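(* Let $m,N\geq1$, $p\geq1$, let $\Omega\subset\mathbb{R}^N$ be a bounded open set with $|\partial\Omega|=0$, and let $W:\mathbb{R}^N\times\mathbb{M}^{m\times N}\to[0,+\infty]$ belong to $\mathcal{A}^p_{\rm per}$. For $\varepsilon>0$ define $I_\varepsilon:W^{1,p}(\Omega;\mathbb{R}^m)\to[0,+\infty]$ by $I_\varepsilon(\phi):=\int_\Omega W(x/\varepsilon,\nabla\phi(x))dx$. Then $I_\varepsilon$ $\Gamma$-converges with respect to the $L^p(\Omega;\mathbb{R}^m)$-convergence as $\varepsilon\to0$ to $I_{\rm hom}(\phi):=\int_\Omega W_{\rm hom}(\nabla\phi(x))dx$, where $W_{\rm hom}(\xi):=\inf_{k\geq1}\frac{1}{k^N}\inf\{\int_{kY}W(x,\xi+\nabla\varphi(x))dx:\varphi\in W^{1,p}_0(kY;\mathbb{R}^m)\}$, $Y:=]0,1[^N$.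
   Context: $\mathbb{M}^{m\times N}$: real $m\times N$ matrices. A normal integrand is a measurable $W$ with $W(x,\cdot)$ lower semicontinuous for each $x$. $\mathcal{Z} W(x,\xi):=\inf\{\int_Y W(x,\xi+\nabla\varphi(y))dy:\varphi\in W^{1,\infty}_0(Y;\mathbb{R}^m)\}$. $\mathcal{A}^p$ is the class of normal integrands $W$ that are $p$-coercive ($W(x,\xi)\geq C|\xi|^p$ for some $C>0$) and satisfy (C$_1$): there is $\omega:[0,+\infty[\to[0,+\infty[$ continuous at $0$ with $\omega(0)=0$ such that $W(x_1,\xi)\leq\omega(|x_1-x_2|)(1+W(x_2,\xi))+W(x_2,\xi)$ for all $x_1,x_2,\xi$; and (C$_2$): $\mathcal{Z} W(x,\xi)\leq c(1+|\xi|^p)$ for all $(x,\xi)$ and some $c>0$. $\mathcal{A}^p_{\rm per}$ is the set of $W\in\mathcal{A}^p$ that are $1$-periodic: $W(x+e_i,\xi)=W(x,\xi)$ for all $x,\xi$ and $i=1,\dots,N$. $\Gamma$-convergence: $I_{\rm hom}=\Gamma\text{-}\lim I_\varepsilon$ means that for every $\phi\in W^{1,p}(\Omega;\mathbb{R}^m)$, $\inf\{\liminf_{\varepsilon\to0}I_\varepsilon(\phi_\varepsilon):\phi_\varepsilon\to\phi\text{ in }L^p\}=\inf\{\limsup_{\varepsilon\to0}I_\varepsilon(\phi_\varepsilon):\phi_\varepsilon\to\phi\text{ in }L^p\}=I_{\rm hom}(\phi)$. *)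

theory Defs
  imports "HOL-Analysis.Analysis"
begin

text \<open>Points of R^N: real^'n; matrices M^{m x N}: real^'n^'m (rows indexed by 'm);
  a map phi : R^N -> R^m is real^'n => real^'m.  The (weak) gradient G x has
  entries (G x) $ i $ j = d phi_i / d x_j.\<close>

fun Ck_fun :: "nat \<Rightarrow> (real^'n \<Rightarrow> real) \<Rightarrow> bool" where
  "Ck_fun 0 f = continuous_on UNIV f"
| "Ck_fun (Suc k) f = ((\<forall>x. f differentiable (at x)) \<and>
      (\<forall>v. Ck_fun k (\<lambda>x. frechet_derivative f (at x) v)))"

definition C_inf :: "(real^'n \<Rightarrow> real) \<Rightarrow> bool" where
  "C_inf f = (\<forall>k. Ck_fun k f)"

definition test_fun :: "(real^'n) set \<Rightarrow> (real^'n \<Rightarrow> real) \<Rightarrow> bool" where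
  "test_fun U \<psi> = (C_inf \<psi> \<and> compact (closure {x. \<psi> x \<noteq> 0}) \<and> closure {x. \<psi> x \<noteq> 0} \<subseteq> U)"

definition test_fun_vec :: "(real^'n) set \<Rightarrow> (real^'n \<Rightarrow> real^'m) \<Rightarrow> bool" where
  "test_fun_vec U \<psi> = (\<forall>i. test_fun U (\<lambda>x. \<psi> x $ i))"

definition Lp :: "real \<Rightarrow> (real^'n) set \<Rightarrow> (real^'n \<Rightarrow> 'b::euclidean_space) \<Rightarrow> bool" where
  "Lp p U f = (f \<in> borel_measurable (restrict_space lebesgue U) \<and>
      (\<integral>\<^sup>+x\<in>U. ennreal (norm (f x) powr p) \<partial>lebesgue) < \<infinity>)"

definition Linf :: "(real^'n) set \<Rightarrow> (real^'n \<Rightarrow> 'b::euclidean_space) \<Rightarrow> bool" where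
  "Linf U f = (f \<in> borel_measurable (restrict_space lebesgue U) \<and>
      (\<exists>B. AE x in lebesgue. x \<in> U \<longrightarrow> norm (f x) \<le> B))"

definition Lp_dist :: "real \<Rightarrow> (real^'n) set \<Rightarrow> (real^'n \<Rightarrow> 'b::euclidean_space) \<Rightarrow> (real^'n \<Rightarrow> 'b) \<Rightarrow> ennreal" where
  "Lp_dist p U f g = (\<integral>\<^sup>+x\<in>U. ennreal (norm (f x - g x) powr p) \<partial>lebesgue)"

definition loc_int :: "(real^'n) set \<Rightarrow> (real^'n \<Rightarrow> 'b::euclidean_space) \<Rightarrow> bool" where
  "loc_int U f = (\<forall>K. compact K \<and> K \<subseteq> U \<longrightarrow> set_integrable lebesgue K f)"

definition is_weak_grad :: "(real^'n) set \<Rightarrow> (real^'n \<Rightarrow> real^'m) \<Rightarrow> (real^'n \<Rightarrow> real^'n^'m) \<Rightarrow> bool" where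
  "is_weak_grad U \<phi> G = (loc_int U \<phi> \<and> loc_int U G \<and>
     (\<forall>\<psi> i j. test_fun U \<psi> \<longrightarrow>
        (LINT x:U|lebesgue. \<phi> x $ i * frechet_derivative \<psi> (at x) (axis j 1))
          = - (LINT x:U|lebesgue. G x $ i $ j * \<psi> x)))"

definition wgrad :: "(real^'n) set \<Rightarrow> (real^'n \<Rightarrow> real^'m) \<Rightarrow> (real^'n \<Rightarrow> real^'n^'m)" where
  "wgrad U \<phi> = (SOME G. is_weak_grad U \<phi> G)"

definition W1p :: "real \<Rightarrow> (real^'n) set \<Rightarrow> (real^'n \<Rightarrow> real^'m) \<Rightarrow> bool" where
  "W1p p U \<phi> = (Lp p U \<phi> \<and> (\<exists>G. is_weak_grad U \<phi> G \<and> Lp p U G))"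

definition W1p0 :: "real \<Rightarrow> (real^'n) set \<Rightarrow> (real^'n \<Rightarrow> real^'m) \<Rightarrow> bool" where
  "W1p0 p U \<phi> = (W1p p U \<phi> \<and>
     (\<exists>\<psi>s :: nat \<Rightarrow> real^'n \<Rightarrow> real^'m. (\<forall>n. test_fun_vec U (\<psi>s n)) \<and>
        (\<lambda>n. Lp_dist p U (\<psi>s n) \<phi>) \<longlonglongrightarrow> 0 \<and>
        (\<lambda>n. Lp_dist p U (wgrad U (\<psi>s n)) (wgrad U \<phi>)) \<longlonglongrightarrow> 0))"

definition W1inf :: "(real^'n) set \<Rightarrow> (real^'n \<Rightarrow> real^'m) \<Rightarrow> bool" where
  "W1inf U \<phi> = (Linf U \<phi> \<and> (\<exists>G. is_weak_grad U \<phi> G \<and> Linf U G))"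

definition W1inf0 :: "(real^'n) set \<Rightarrow> (real^'n \<Rightarrow> real^'m) \<Rightarrow> bool" where
  "W1inf0 U \<phi> = (W1inf U \<phi> \<and> W1p0 1 U \<phi>)"

definition unitcube :: "(real^'n) set" where
  "unitcube = box 0 One"

definition normal_integrand :: "(real^'n \<Rightarrow> real^'n^'m \<Rightarrow> ennreal) \<Rightarrow> bool" where
  "normal_integrand W = ((\<lambda>(x,\<xi>). W x \<xi>) \<in> borel_measurable (lebesgue \<Otimes>\<^sub>M borel) \<and>
     (\<forall>x \<xi>. W x \<xi> \<le> Liminf (at \<xi>) (W x)))"

definition ZW :: "(real^'n \<Rightarrow> real^'n^'m \<Rightarrow> ennreal) \<Rightarrow> real^'n \<Rightarrow> real^'n^'m \<Rightarrow> ennreal" where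
  "ZW W x \<xi> = (INF \<phi>\<in>{\<phi> :: real^'n \<Rightarrow> real^'m. W1inf0 unitcube \<phi>}.
       \<integral>\<^sup>+y\<in>unitcube. W x (\<xi> + wgrad unitcube \<phi> y) \<partial>lebesgue)"

definition class_A :: "real \<Rightarrow> (real^'n \<Rightarrow> real^'n^'m \<Rightarrow> ennreal) \<Rightarrow> bool" where
  "class_A p W = (normal_integrand W \<and>
     (\<exists>C>0. \<forall>x \<xi>. ennreal C * ennreal (norm \<xi> powr p) \<le> W x \<xi>) \<and>
     (\<exists>\<omega>::real \<Rightarrow> real. (\<forall>t\<ge>0. \<omega> t \<ge> 0) \<and> \<omega> 0 = 0 \<and> continuous (at_right 0) \<omega> \<and>
        (\<forall>x1 x2 \<xi>. W x1 \<xi> \<le> ennreal (\<omega> (norm (x1 - x2))) * (1 + W x2 \<xi>) + W x2 \<xi>)) \<and>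
     (\<exists>c>0. \<forall>x \<xi>. ZW W x \<xi> \<le> ennreal (c * (1 + norm \<xi> powr p))))"

definition class_A_per :: "real \<Rightarrow> (real^'n \<Rightarrow> real^'n^'m \<Rightarrow> ennreal) \<Rightarrow> bool" where
  "class_A_per p W = (class_A p W \<and> (\<forall>x \<xi> i. W (x + axis i 1) \<xi> = W x \<xi>))"

definition I_eps :: "real \<Rightarrow> (real^'n) set \<Rightarrow> (real^'n \<Rightarrow> real^'n^'m \<Rightarrow> ennreal) \<Rightarrow> real
    \<Rightarrow> (real^'n \<Rightarrow> real^'m) \<Rightarrow> ennreal" where
  "I_eps p \<Omega> W \<epsilon> \<phi> = (if W1p p \<Omega> \<phi>
      then \<integral>\<^sup>+x\<in>\<Omega>. W ((1/\<epsilon>) *\<^sub>R x) (wgrad \<Omega> \<phi> x) \<partial>lebesgue else \<infinity>)"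

definition W_hom :: "real \<Rightarrow> (real^'n \<Rightarrow> real^'n^'m \<Rightarrow> ennreal) \<Rightarrow> real^'n^'m \<Rightarrow> ennreal" where
  "W_hom p W \<xi> = (INF k\<in>{1::nat..}. ennreal (1 / real k ^ CARD('n)) *
      (INF \<phi>\<in>{\<phi> :: real^'n \<Rightarrow> real^'m. W1p0 p (box 0 (real k *\<^sub>R One)) \<phi>}.
         \<integral>\<^sup>+x\<in>box 0 (real k *\<^sub>R One). W x (\<xi> + wgrad (box 0 (real k *\<^sub>R One)) \<phi> x) \<partial>lebesgue))"

definition I_hom :: "real \<Rightarrow> (real^'n) set \<Rightarrow> (real^'n \<Rightarrow> real^'n^'m \<Rightarrow> ennreal)
    \<Rightarrow> (real^'n \<Rightarrow> real^'m) \<Rightarrow> ennreal" where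
  "I_hom p \<Omega> W \<phi> = (\<integral>\<^sup>+x\<in>\<Omega>. W_hom p W (wgrad \<Omega> \<phi> x) \<partial>lebesgue)"

definition Gamma_conv_Lp :: "real \<Rightarrow> (real^'n) set \<Rightarrow> (real \<Rightarrow> (real^'n \<Rightarrow> real^'m) \<Rightarrow> ennreal)
    \<Rightarrow> ((real^'n \<Rightarrow> real^'m) \<Rightarrow> ennreal) \<Rightarrow> bool" where
  "Gamma_conv_Lp p U I Ih = (\<forall>\<phi>. W1p p U \<phi> \<longrightarrow>
     (let R = {\<phi>s :: real \<Rightarrow> real^'n \<Rightarrow> real^'m. (\<forall>\<epsilon>>0. Lp p U (\<phi>s \<epsilon>)) \<and>
                 ((\<lambda>\<epsilon>. Lp_dist p U (\<phi>s \<epsilon>) \<phi>) \<longlongrightarrow> 0) (at_right 0)}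
      in (INF \<phi>s\<in>R. Liminf (at_right 0) (\<lambda>\<epsilon>. I \<epsilon> (\<phi>s \<epsilon>))) = Ih \<phi> \<and>
         (INF \<phi>s\<in>R. Limsup (at_right 0) (\<lambda>\<epsilon>. I \<epsilon> (\<phi>s \<epsilon>))) = Ih \<phi>))"

end

theory Submission
  imports Defs "HOL-Probability.Probability"
begin

text \<open>
  Condition C2 bounds only the relaxed integrand, so on an affine function \<open>W\<close> itself may be
  infinite. Since the relaxation is an infimum over Lipschitz competitors, patching small copies of
  nearly optimal ones (their oscillation is compared at nearby points by C1) into the pieces of
  a piecewise affine approximation, and iterating on the region not yet treated, replaces every
  Sobolev function by a rough one with the same boundary values, arbitrarily close in \<open>L^p\<close>, of
  energy at most \<open>C0 (|U| + \<integral>|\<nabla>u|^p)\<close>. These rough functions serve as transitions wherever the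
  classical argument would use the growth condition.

  Lower bound: cover \<open>\<Omega>\<close> by small cubes on which the limit is nearly affine. On each cube the
  sequence is glued to the affine function across one of \<open>M\<close> disjoint layers, chosen to carry
  a fraction \<open>1/M\<close> of the energy (De Giorgi). Zero boundary values then allow a comparison with
  the cell formula, after extension to a cube whose side is an integer multiple of \<open>\<epsilon>\<close>.

  Upper bound: approximate the limit by functions affine on cubes, fill each cube with periodic
  copies of a nearly optimal cell function, and use rough competitors on the small remainder.
  The passage from affine pieces to the given gradient uses that \<open>W_hom\<close> is continuous with
  a modulus of \<open>p\<close>-growth, which itself follows from gluing.
\<close>

text \<open>Three features shape the argument. First, the constants \<open>C\<close>,
  \<open>c\<close>, \<open>C0\<close>, \<open>A1\<close> and \<open>A2\<close> are the same for
  every rescaled integrand \<open>W (x / \<epsilon>)\<close>: rescaling changes only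
  \<open>s0\<close>, the distance up to which C1 compares two points, and \<open>s0\<close> limits
  the size of the small cubes without entering a constant. Hence rough competitors cost the same for
  all \<epsilon>. Second, \<open>p = 1\<close> is included, so there is no appeal to weak
  compactness; all limits are quantitative, in terms of the \<open>p\<close>-th power integral
  \<open>Np\<close>, whose triangle inequality carries a factor \<open>2 powr p\<close>. This factor
  explains the powers of 2 in the constants and the ratio \<open>1 / (2 * 2 powr p)\<close> of the
  tolerances in the iteration. Third, a Sobolev function is a pair of a function and its gradient,
  both defined on the whole space: \<open>Wk\<close> on a set, \<open>Sob0\<close> for zero boundary
  values. Extension by zero, pasting and rescaling are then pointwise operations, and the chosen
  gradient \<open>wgrad\<close> enters through a few translation lemmas.\<close>

abbreviation Lmeas :: "('a::euclidean_space \<Rightarrow> 'b::topological_space) \<Rightarrow> bool" where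
  "Lmeas f \<equiv> f \<in> borel_measurable lebesgue"

subsection \<open>Smooth functions and test functions\<close>

lemma frechet_derivative_eqI:
  assumes "(f has_derivative f') (at x)" shows "frechet_derivative f (at x) = f'"
  using frechet_derivative_at[OF assms] by simp

lemma Ck_fun_Suc_D: "Ck_fun (Suc k) f \<Longrightarrow> Ck_fun k f"
proof (induction k arbitrary: f)
  case 0
  then show ?case
    by (auto intro!: continuous_at_imp_continuous_on differentiable_imp_continuous_within)
next
  case (Suc k)
  then show ?case by auto
qed

lemma Ck_fun_const: "Ck_fun k (\<lambda>x. c)"
proof (induction k arbitrary: c)
  case (Suc k)
  have "frechet_derivative (\<lambda>x. c) (at x) = (\<lambda>v. 0)" for x :: "real^'a"
    by (rule frechet_derivative_eqI) auto
  then show ?case using Suc[of 0] by auto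
qed auto

lemma Ck_fun_add: "Ck_fun k f \<Longrightarrow> Ck_fun k g \<Longrightarrow> Ck_fun k (\<lambda>x. f x + g x)"
proof (induction k arbitrary: f g)
  case 0 then show ?case by (auto intro: continuous_intros)
next
  case (Suc k)
  have "frechet_derivative (\<lambda>x. f x + g x) (at x) =
      (\<lambda>v. frechet_derivative f (at x) v + frechet_derivative g (at x) v)" for x
    using Suc.prems by (intro frechet_derivative_eqI has_derivative_add)
      (auto simp: frechet_derivative_works)
  with Suc show ?case by auto
qed

lemma Ck_fun_mult: "Ck_fun k f \<Longrightarrow> Ck_fun k g \<Longrightarrow> Ck_fun k (\<lambda>x. f x * g x)"
proof (induction k arbitrary: f g)
  case 0 then show ?case by (auto intro: continuous_intros)
next
  case (Suc k)
  have "frechet_derivative (\<lambda>x. f x * g x) (at x) =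
      (\<lambda>v. f x * frechet_derivative g (at x) v + frechet_derivative f (at x) v * g x)" for x
    using Suc.prems by (intro frechet_derivative_eqI has_derivative_mult)
      (auto simp: frechet_derivative_works)
  moreover have "Ck_fun k f" "Ck_fun k g" using Suc.prems Ck_fun_Suc_D by blast+
  ultimately show ?case using Suc.prems by (auto intro!: Ck_fun_add Suc.IH)
qed

lemma Ck_fun_affine: "Ck_fun k f \<Longrightarrow> Ck_fun k (\<lambda>x. f (d + c *\<^sub>R x))"
proof (induction k arbitrary: f)
  case 0
  then show ?case
    by (auto intro!: continuous_intros continuous_on_compose2[of UNIV f])
next
  case (Suc k)
  have "((\<lambda>x. f (d + c *\<^sub>R x)) has_derivative
      (\<lambda>v. frechet_derivative f (at (d + c *\<^sub>R x)) (c *\<^sub>R v))) (at x)" for x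
    using Suc.prems
    by (intro has_derivative_compose[of "\<lambda>x. d + c *\<^sub>R x" _ x UNIV f]) (auto intro!: derivative_eq_intros simp: frechet_derivative_works)
  note d = this
  then have "frechet_derivative (\<lambda>x. f (d + c *\<^sub>R x)) (at x) =
      (\<lambda>v. frechet_derivative f (at (d + c *\<^sub>R x)) (c *\<^sub>R v))" for x
    by (intro frechet_derivative_eqI)
  moreover have "Ck_fun k (\<lambda>x. frechet_derivative f (at (d + c *\<^sub>R x)) (c *\<^sub>R v))" for v
    using Suc.IH[of "\<lambda>y. frechet_derivative f (at y) (c *\<^sub>R v)"] Suc.prems by simp
  ultimately show ?case using d by (auto simp: differentiable_def)
qed

lemma Ck_fun_inner: "Ck_fun k (\<lambda>x. x \<bullet> v)"
proof (cases k)
  case (Suc l)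
  have *: "((\<lambda>x. x \<bullet> v) has_derivative (\<lambda>w. w \<bullet> v)) (at x)" for x :: "real^'a"
    by (auto intro!: derivative_eq_intros)
  then have "frechet_derivative (\<lambda>x. x \<bullet> v) (at x) = (\<lambda>w. w \<bullet> v)" for x :: "real^'a"
    by (intro frechet_derivative_eqI)
  with * Suc show ?thesis by (auto simp: differentiable_def Ck_fun_const)
qed (auto intro: continuous_intros)

text \<open>The power of \<open>1/t\<close> makes the family closed under differentiation: the
  derivative of a member is a combination of two other members, so smoothness at 0 is proved for all
  of them by one induction.\<close>

definition flat_exp :: "nat \<Rightarrow> real \<Rightarrow> real" where
  "flat_exp n t = (if t > 0 then (1/t)^n * exp (- (1/t)) else 0)"

lemma flat_exp_tendsto_0: "(flat_exp n \<longlongrightarrow> 0) (at 0)"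
proof (rule filterlim_split_at)
  show "(flat_exp n \<longlongrightarrow> 0) (at_left 0)"
    by (rule tendsto_eventually) (auto simp: eventually_at_filter flat_exp_def)
  have "((\<lambda>t::real. inverse t ^ n / exp (inverse t)) \<longlongrightarrow> 0) (at_right 0)"
    by (rule filterlim_compose[OF tendsto_power_div_exp_0 filterlim_inverse_at_top_right])
  then show "(flat_exp n \<longlongrightarrow> 0) (at_right 0)"
    by (rule Lim_transform_eventually)
       (auto simp: eventually_at_filter flat_exp_def exp_minus field_simps)
qed

lemma flat_exp_has_derivative:
  "(flat_exp n has_real_derivative (flat_exp (n+2) t - real n * flat_exp (n+1) t)) (at t)"
proof -
  consider "t < 0" | "t = 0" | "t > 0" by linarith
  then show ?thesis
  proof cases
    case 1
    have "((\<lambda>x. 0) has_real_derivative 0) (at t)" by simp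
    then have "(flat_exp n has_real_derivative 0) (at t)"
      by (rule DERIV_cong_ev[THEN iffD1, rotated -1])
        (use 1 in \<open>auto simp: flat_exp_def eventually_nhds intro!: exI[of _ "{..<0}"]\<close>)
    then show ?thesis using 1 by (simp add: flat_exp_def)
  next
    case 2
    \<comment> \<open>The difference quotient of \<open>flat_exp n\<close> at 0 is
      \<open>flat_exp (Suc n)\<close>, which tends to 0.\<close>
    have "((\<lambda>h. (flat_exp n (0 + h) - flat_exp n 0) / h) \<longlongrightarrow> 0) (at 0)"
      by (rule Lim_transform_eventually[OF flat_exp_tendsto_0[of "Suc n"]])
        (auto simp: eventually_at_filter flat_exp_def)
    then show ?thesis using 2 by (simp add: DERIV_def flat_exp_def)
  next
    case 3
    have inv: "((\<lambda>t. 1/t) has_real_derivative - ((1/t)^2)) (at t)"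
      using 3 by (auto intro!: derivative_eq_intros simp: field_simps power2_eq_square)
    have "((\<lambda>t. (1/t)^n * exp (- (1/t))) has_real_derivative
        (real n * (- ((1/t)^2) * (1/t)^(n - Suc 0)) * exp (- (1/t)) + exp (- (1/t)) * - (- ((1/t)^2)) * (1/t)^n)) (at t)"
      by (rule DERIV_mult[OF DERIV_power[OF inv] DERIV_fun_exp[OF DERIV_minus[OF inv]]])
    also have "(real n * (- ((1/t)^2) * (1/t)^(n - Suc 0)) * exp (- (1/t)) + exp (- (1/t)) * - (- ((1/t)^2)) * (1/t)^n)
        = flat_exp (n+2) t - real n * flat_exp (n+1) t"
      using 3 by (cases n) (simp_all add: flat_exp_def power_add power2_eq_square algebra_simps)
    finally have "((\<lambda>t. (1/t)^n * exp (- (1/t))) has_real_derivative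
       (flat_exp (n+2) t - real n * flat_exp (n+1) t)) (at t)" .
    then show ?thesis
      by (rule DERIV_cong_ev[THEN iffD1, rotated -1])
        (use 3 in \<open>auto simp: flat_exp_def eventually_nhds intro!: exI[of _ "{0<..}"]\<close>)
  qed
qed

text \<open>This supplies the radial bump function, which vanishes where the squared norm of
  \<open>x\<close> is at least \<open>d\<close>. The induction runs over all \<open>n\<close> at
  once because each derivative raises the exponent.\<close>

lemma Ck_fun_flat_exp: "Ck_fun k (\<lambda>x. flat_exp n (d - x \<bullet> x))"
proof (induction k arbitrary: n)
  case 0
  have "continuous_on UNIV (flat_exp n)"
    by (meson DERIV_isCont continuous_at_imp_continuous_on flat_exp_has_derivative)
  then show ?case
    by (auto intro!: continuous_intros continuous_on_compose2[of UNIV "flat_exp n"])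
next
  case (Suc k)
  let ?D = "\<lambda>x v. (flat_exp (n+2) (d - x \<bullet> x) - real n * flat_exp (n+1) (d - x \<bullet> x)) * (- 2 * (x \<bullet> v))"
  have *: "((\<lambda>x. flat_exp n (d - x \<bullet> x)) has_derivative ?D x) (at x)" for x :: "real^'a"
  proof -
    have 1: "((\<lambda>x. d - x \<bullet> x) has_derivative (\<lambda>v. - 2 * (x \<bullet> v))) (at x)"
      by (auto intro!: derivative_eq_intros simp: inner_commute)
    show ?thesis
      using has_derivative_compose[OF 1 flat_exp_has_derivative[unfolded has_field_derivative_def]] .
  qed
  then have "frechet_derivative (\<lambda>x. flat_exp n (d - x \<bullet> x)) (at x) = ?D x" for x :: "real^'a"
    by (rule frechet_derivative_eqI)
  moreover have "Ck_fun k (\<lambda>x. ?D x v)" for v :: "real^'a"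
  proof -
    have "Ck_fun k (\<lambda>x. (flat_exp (n+2) (d - x \<bullet> x) + (- real n) * flat_exp (n+1) (d - x \<bullet> x)) * (- 2 * (x \<bullet> v)))"
      by (intro Ck_fun_mult Ck_fun_add Ck_fun_const Ck_fun_inner Suc)
    then show ?thesis by simp
  qed
  ultimately show ?case using * by (auto simp: differentiable_def)
qed

section \<open>Partial derivatives and the calculus of test functions\<close>

definition pd :: "'n \<Rightarrow> (real^'n \<Rightarrow> real) \<Rightarrow> real^'n \<Rightarrow> real" where
  "pd j \<psi> x = frechet_derivative \<psi> (at x) (axis j 1)"

definition grad :: "(real^'n \<Rightarrow> real^'m) \<Rightarrow> real^'n \<Rightarrow> real^'n^'m" where
  "grad \<psi> x = (\<chi> i j. pd j (\<lambda>y. \<psi> y $ i) x)"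

lemma test_funI:
  assumes "C_inf \<psi>" "compact K" "K \<subseteq> U" "\<And>x. x \<notin> K \<Longrightarrow> \<psi> x = 0"
  shows "test_fun U \<psi>"
proof -
  have "closure {x. \<psi> x \<noteq> 0} \<subseteq> K"
    using assms by (intro closure_minimal) (auto simp: compact_imp_closed)
  moreover then have "compact (closure {x. \<psi> x \<noteq> 0})"
    using bounded_subset[OF compact_imp_bounded[OF assms(2)], of "{x. \<psi> x \<noteq> 0}"] assms(4)
    by auto
  ultimately show ?thesis using assms by (auto simp: test_fun_def)
qed

lemma test_fun_support:
  assumes "test_fun U \<psi>"
  obtains K where "compact K" "K \<subseteq> U" "\<And>x. x \<notin> K \<Longrightarrow> \<psi> x = 0"
proof (rule that)
  show "compact (closure {x. \<psi> x \<noteq> 0})" "closure {x. \<psi> x \<noteq> 0} \<subseteq> U"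
    using assms by (auto simp: test_fun_def)
  show "\<psi> x = 0" if "x \<notin> closure {x. \<psi> x \<noteq> 0}" for x
    using that closure_subset[of "{x. \<psi> x \<noteq> 0}"] by auto
qed

lemma test_fun_C_inf: "test_fun U \<psi> \<Longrightarrow> C_inf \<psi>"
  by (simp add: test_fun_def)

lemma test_fun_mono: "test_fun U \<psi> \<Longrightarrow> U \<subseteq> V \<Longrightarrow> test_fun V \<psi>"
  by (auto simp: test_fun_def)

lemma C_inf_mult: "C_inf f \<Longrightarrow> C_inf g \<Longrightarrow> C_inf (\<lambda>x. f x * g x)"
  by (auto simp: C_inf_def Ck_fun_mult)

lemma C_inf_add: "C_inf f \<Longrightarrow> C_inf g \<Longrightarrow> C_inf (\<lambda>x. f x + g x)"
  by (auto simp: C_inf_def Ck_fun_add)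

lemma C_inf_const: "C_inf (\<lambda>x. c)"
  by (auto simp: C_inf_def Ck_fun_const)

lemma C_inf_affine: "C_inf f \<Longrightarrow> C_inf (\<lambda>x. f (d + c *\<^sub>R x))"
  by (auto simp: C_inf_def Ck_fun_affine)

lemma C_inf_inner: "C_inf (\<lambda>x. x \<bullet> v)"
  by (auto simp: C_inf_def Ck_fun_inner)

lemma C_inf_differentiable: "C_inf f \<Longrightarrow> f differentiable (at x)"
  by (metis C_inf_def Ck_fun.simps(2))

lemma C_inf_has_derivative: "C_inf f \<Longrightarrow> (f has_derivative frechet_derivative f (at x)) (at x)"
  using C_inf_differentiable frechet_derivative_works by blast

lemma C_inf_deriv: "C_inf f \<Longrightarrow> C_inf (\<lambda>x. frechet_derivative f (at x) v)"
  by (metis C_inf_def Ck_fun.simps(2))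

lemma C_inf_continuous: "C_inf f \<Longrightarrow> continuous_on S f"
  by (metis C_inf_def Ck_fun.simps(1) continuous_on_subset subset_UNIV)

lemma C_inf_pd: "C_inf f \<Longrightarrow> C_inf (pd j f)"
  using C_inf_deriv[of f "axis j 1"] by (simp add: pd_def[abs_def])

lemma pd_mult:
  assumes "C_inf f" "C_inf g"
  shows "pd j (\<lambda>x. f x * g x) x = f x * pd j g x + pd j f x * g x"
  unfolding pd_def
  by (subst frechet_derivative_eqI[OF has_derivative_mult[OF C_inf_has_derivative[OF assms(1)]
        C_inf_has_derivative[OF assms(2)]]]) simp

lemma pd_add:
  assumes "C_inf f" "C_inf g"
  shows "pd j (\<lambda>x. f x + g x) x = pd j f x + pd j g x"
  unfolding pd_def
  by (subst frechet_derivative_eqI[OF has_derivative_add[OF C_inf_has_derivative[OF assms(1)]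
        C_inf_has_derivative[OF assms(2)]]]) simp

lemma C_inf_affine_deriv:
  assumes "C_inf f"
  shows "((\<lambda>x. f (d + c *\<^sub>R x)) has_derivative
      (\<lambda>v. c * frechet_derivative f (at (d + c *\<^sub>R x)) v)) (at x)"
proof -
  let ?D = "frechet_derivative f (at (d + c *\<^sub>R x))"
  have D: "(f has_derivative ?D) (at (d + c *\<^sub>R x))"
    by (rule C_inf_has_derivative[OF assms])
  have "((\<lambda>x. f (d + c *\<^sub>R x)) has_derivative (\<lambda>v. ?D (c *\<^sub>R v))) (at x)"
    by (intro has_derivative_compose[of "\<lambda>x. d + c *\<^sub>R x" _ x UNIV f] D) (auto intro!: derivative_eq_intros)
  moreover have "?D (c *\<^sub>R v) = c * ?D v" for v
    using linear_cmul[OF has_derivative_linear[OF D]] by simp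
  ultimately show ?thesis by simp
qed

lemma pd_affine: "C_inf f \<Longrightarrow> pd j (\<lambda>x. f (d + c *\<^sub>R x)) x = c * pd j f (d + c *\<^sub>R x)"
  unfolding pd_def by (subst frechet_derivative_eqI[OF C_inf_affine_deriv]) auto

lemma frechet_derivative_pd:
  assumes "C_inf f"
  shows "frechet_derivative f (at x) v = (\<Sum>j\<in>UNIV. v $ j * pd j f x)"
proof -
  have lin: "linear (frechet_derivative f (at x))"
    using has_derivative_linear[OF C_inf_has_derivative[OF assms]] .
  have "frechet_derivative f (at x) v = frechet_derivative f (at x) (\<Sum>j\<in>UNIV. v $ j *\<^sub>R axis j 1)"
    using basis_expansion[of v] by (simp add: scalar_mult_eq_scaleR)
  also have "\<dots> = (\<Sum>j\<in>UNIV. v $ j * pd j f x)"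
    by (simp add: linear_sum[OF lin] linear_cmul[OF lin] pd_def)
  finally show ?thesis .
qed

lemma frechet_derivative_0_outside:
  assumes "closed K" "\<And>x. x \<notin> K \<Longrightarrow> \<psi> x = 0" "x \<notin> K"
  shows "frechet_derivative \<psi> (at x) v = 0"
proof -
  have "((\<lambda>x. 0) has_derivative (\<lambda>v. 0)) (at x)" by simp
  then have "(\<psi> has_derivative (\<lambda>v. 0)) (at x)"
    by (rule has_derivative_transform_within_open[of _ _ _ _ "- K"]) (use assms in \<open>auto simp: open_Compl\<close>)
  then show ?thesis by (simp add: frechet_derivative_eqI)
qed

lemma pd_0_outside:
  assumes "closed K" "\<And>x. x \<notin> K \<Longrightarrow> \<psi> x = 0" "x \<notin> K"
  shows "pd j \<psi> x = 0"
  using frechet_derivative_0_outside[OF assms] by (simp add: pd_def)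

lemma test_fun_pd: assumes "test_fun U \<psi>" shows "test_fun U (pd j \<psi>)"
proof -
  from test_fun_support[OF assms] obtain K where K: "compact K" "K \<subseteq> U" "\<And>x. x \<notin> K \<Longrightarrow> \<psi> x = 0"
    by blast
  show ?thesis
    by (rule test_funI[of _ K]) (use K assms in \<open>auto simp: compact_imp_closed intro!: C_inf_pd pd_0_outside[of K] dest: test_fun_C_inf\<close>)
qed

lemma test_fun_mult_left:
  assumes "C_inf f" "test_fun U \<psi>" shows "test_fun U (\<lambda>x. f x * \<psi> x)"
proof -
  from test_fun_support[OF assms(2)] obtain K where K: "compact K" "K \<subseteq> U" "\<And>x. x \<notin> K \<Longrightarrow> \<psi> x = 0"
    by blast
  show ?thesis
    by (rule test_funI[of _ K]) (use K assms in \<open>auto intro!: C_inf_mult dest: test_fun_C_inf\<close>)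
qed

lemma test_fun_mult_right:
  assumes "C_inf f" "test_fun U \<psi>" shows "test_fun U (\<lambda>x. \<psi> x * f x)"
  using test_fun_mult_left[OF assms] by (simp add: mult.commute)

lemma test_fun_0: "test_fun U (\<lambda>x. 0)"
  by (rule test_funI[of _ "{}"]) (auto intro: C_inf_const)

lemma test_fun_add:
  assumes "test_fun U f" "test_fun U g" shows "test_fun U (\<lambda>x. f x + g x)"
proof -
  from test_fun_support[OF assms(1)] obtain K where K: "compact K" "K \<subseteq> U" "\<And>x. x \<notin> K \<Longrightarrow> f x = 0"
    by blast
  from test_fun_support[OF assms(2)] obtain L where L: "compact L" "L \<subseteq> U" "\<And>x. x \<notin> L \<Longrightarrow> g x = 0"
    by blast
  show ?thesis
    by (rule test_funI[of _ "K \<union> L"])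
      (use K L assms in \<open>auto intro!: C_inf_add dest: test_fun_C_inf\<close>)
qed

lemma test_fun_affine:
  assumes "test_fun U \<psi>" "c \<noteq> 0" "\<And>y. y \<in> U \<Longrightarrow> (1/c) *\<^sub>R (y - d) \<in> V"
  shows "test_fun V (\<lambda>x. \<psi> (d + c *\<^sub>R x))"
proof -
  from test_fun_support[OF assms(1)] obtain K where K: "compact K" "K \<subseteq> U" "\<And>x. x \<notin> K \<Longrightarrow> \<psi> x = 0"
    by blast
  let ?L = "(\<lambda>y. (1/c) *\<^sub>R (y - d)) ` K"
  show ?thesis
  proof (rule test_funI[of _ ?L])
    show "compact ?L" by (intro compact_continuous_image continuous_intros K)
    show "?L \<subseteq> V" using K assms by auto
    fix x assume x: "x \<notin> ?L"
    have "x = (1/c) *\<^sub>R ((d + c *\<^sub>R x) - d)" using assms by simp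
    then show "\<psi> (d + c *\<^sub>R x) = 0" using x K(3) by blast
  qed (use assms in \<open>auto intro!: C_inf_affine test_fun_C_inf[OF assms(1)]\<close>)
qed

lemma test_fun_continuous: "test_fun U \<psi> \<Longrightarrow> continuous_on S \<psi>"
  by (simp add: C_inf_continuous test_fun_C_inf)

lemma test_fun_measurable: "test_fun U \<psi> \<Longrightarrow> \<psi> \<in> borel_measurable borel"
  by (simp add: borel_measurable_continuous_onI test_fun_continuous)

lemma continuous_compact_support_bounded:
  fixes f :: "'a::euclidean_space \<Rightarrow> 'b::real_normed_vector"
  assumes "continuous_on UNIV f" "compact K" "\<And>x. x \<notin> K \<Longrightarrow> f x = 0"
  obtains B where "B > 0" "\<And>x. norm (f x) \<le> B"
proof -
  have "bounded (f ` K)"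
    using assms by (intro compact_imp_bounded compact_continuous_image) (auto intro: continuous_on_subset)
  then obtain B where B: "B > 0" "\<And>x. x \<in> K \<Longrightarrow> norm (f x) \<le> B"
    unfolding bounded_pos by auto
  show ?thesis
    by (rule that[OF B(1)]) (metis B assms(3) less_imp_le norm_zero)
qed

lemma continuous_compact_support_integrable:
  fixes f :: "'a::euclidean_space \<Rightarrow> 'b::euclidean_space"
  assumes "continuous_on UNIV f" "compact K" "\<And>x. x \<notin> K \<Longrightarrow> f x = 0"
  shows "integrable lebesgue f"
proof -
  have "integrable lborel (\<lambda>x. indicator K x *\<^sub>R f x)"
    using borel_integrable_compact[of K f] assms continuous_on_subset[OF assms(1)] by (auto simp: set_integrable_def)
  moreover have "(\<lambda>x. indicator K x *\<^sub>R f x) = f"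
    using assms by (auto simp: indicator_def fun_eq_iff)
  ultimately show ?thesis by (simp add: integrable_completion)
qed

lemma test_fun_bounded:
  assumes "test_fun U \<psi>" obtains B where "B > 0" "\<And>x. \<bar>\<psi> x\<bar> \<le> B"
  by (metis assms continuous_compact_support_bounded real_norm_def test_fun_continuous test_fun_support)

lemma test_fun_integrable: "test_fun U \<psi> \<Longrightarrow> integrable lebesgue \<psi>"
  by (metis continuous_compact_support_integrable test_fun_continuous test_fun_support)

lemma uniformly_continuous_compact_support:
  fixes f :: "'a::euclidean_space \<Rightarrow> 'b::real_normed_vector"
  assumes "continuous_on UNIV f" "compact K" "\<And>x. x \<notin> K \<Longrightarrow> f x = 0" "e > 0"
  obtains d where "d > 0" "\<And>x y. dist x y < d \<Longrightarrow> dist (f x) (f y) < e"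
proof -
  \<comment> \<open>If two points are closer than 1 and one of them lies in \<open>K\<close>, both
    lie in this compact enlargement; if neither lies in \<open>K\<close>, both values are 0.\<close>
  define L where "L = {x + y | x y. x \<in> K \<and> y \<in> cball 0 1}"
  have L: "compact L" unfolding L_def by (intro compact_sums assms) auto
  have "uniformly_continuous_on L f"
    by (intro compact_uniformly_continuous L continuous_on_subset[OF assms(1)]) auto
  then obtain d where d: "d > 0" "\<And>x y. x \<in> L \<Longrightarrow> y \<in> L \<Longrightarrow> dist x y < d \<Longrightarrow> dist (f x) (f y) < e"
    using \<open>e > 0\<close> unfolding uniformly_continuous_on_def by (metis dist_commute)
  have KL: "y \<in> L" if "x \<in> K" "dist x y < 1" for x y :: "'a"
  proof -
    have "y = x + (y - x)" "y - x \<in> cball 0 1" using that by (auto simp: dist_norm norm_minus_commute)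
    then show ?thesis unfolding L_def using that(1) by blast
  qed
  show ?thesis
  proof (rule that[of "min d 1"])
    fix x y :: "'a" assume xy: "dist x y < min d 1"
    show "dist (f x) (f y) < e"
    proof (cases "x \<in> K \<or> y \<in> K")
      case True
      then have "x \<in> L" "y \<in> L" using KL[of x y] KL[of y x] KL[of x x] KL[of y y] xy by (auto simp: dist_commute)
      then show ?thesis using d xy by auto
    qed (use assms in auto)
  qed (use d in auto)
qed

subsection \<open>Affine changes of variables\<close>

lemma
  fixes t :: "'a::euclidean_space"
  assumes c: "c \<noteq> 0"
  shows lebesgue_affine_measurable': "(\<lambda>x. t + c *\<^sub>R x) \<in> lebesgue \<rightarrow>\<^sub>M lebesgue"
    and lebesgue_eq_density_affine:
      "lebesgue = density (distr lebesgue lebesgue (\<lambda>x. t + c *\<^sub>R x)) (\<lambda>_. ennreal (\<bar>c\<bar> ^ DIM('a)))"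
proof -
  have *: "(\<lambda>x. t + (\<Sum>j\<in>Basis. (c * (x \<bullet> j)) *\<^sub>R j)) = (\<lambda>x. t + c *\<^sub>R x)"
    unfolding scaleR_scaleR[symmetric] scaleR_sum_right[symmetric] euclidean_representation ..
  show "(\<lambda>x. t + c *\<^sub>R x) \<in> lebesgue \<rightarrow>\<^sub>M lebesgue"
    using lebesgue_affine_measurable[of "\<lambda>_. c" t] c unfolding * by simp
  show "lebesgue = density (distr lebesgue lebesgue (\<lambda>x. t + c *\<^sub>R x)) (\<lambda>_. ennreal (\<bar>c\<bar> ^ DIM('a)))"
    using lebesgue_affine_euclidean[of "\<lambda>_. c" t] c unfolding * by simp
qed

lemma measurable_compose_affine:
  fixes f :: "'a::euclidean_space \<Rightarrow> 'b"
  assumes "f \<in> lebesgue \<rightarrow>\<^sub>M M" "c \<noteq> 0"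
  shows "(\<lambda>x. f (t + c *\<^sub>R x)) \<in> lebesgue \<rightarrow>\<^sub>M M"
  using measurable_compose[OF lebesgue_affine_measurable'[OF assms(2)] assms(1)] by simp

lemma nn_integral_affine:
  fixes f :: "'a::euclidean_space \<Rightarrow> ennreal"
  assumes f: "Lmeas f" and c: "c \<noteq> 0"
  shows "(\<integral>\<^sup>+x. f x \<partial>lebesgue) = ennreal (\<bar>c\<bar> ^ DIM('a)) * (\<integral>\<^sup>+x. f (t + c *\<^sub>R x) \<partial>lebesgue)"
proof -
  note m = lebesgue_affine_measurable'[OF c, of t]
  have "(\<integral>\<^sup>+x. f x \<partial>lebesgue) = (\<integral>\<^sup>+x. f x \<partial>density (distr lebesgue lebesgue (\<lambda>x. t + c *\<^sub>R x)) (\<lambda>_. ennreal (\<bar>c\<bar> ^ DIM('a))))"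
    using lebesgue_eq_density_affine[OF c, of t] by simp
  also have "\<dots> = ennreal (\<bar>c\<bar> ^ DIM('a)) * (\<integral>\<^sup>+x. f (t + c *\<^sub>R x) \<partial>lebesgue)"
    using f m measurable_compose[OF m f]
    by (subst nn_integral_density) (auto simp: nn_integral_cmult nn_integral_distr)
  finally show ?thesis .
qed

lemma AE_affine:
  fixes t :: "'a::euclidean_space"
  assumes P: "AE x in lebesgue. P x" and c: "c \<noteq> 0"
  shows "AE x in lebesgue. P (t + c *\<^sub>R x)"
proof -
  obtain N where N': "\<And>x. x \<in> space lebesgue - N \<Longrightarrow> P x" "N \<in> null_sets lebesgue"
    using AE_E3[OF P] by blast
  then have N: "{x. \<not> P x} \<subseteq> N" "N \<in> null_sets lebesgue" by auto
  let ?T = "\<lambda>x. t + c *\<^sub>R x"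
  have [measurable]: "N \<in> sets lebesgue" using N by auto
  have "0 = (\<integral>\<^sup>+x. indicator N x \<partial>lebesgue)" using N by (simp add: null_sets_def)
  also have "\<dots> = ennreal (\<bar>c\<bar> ^ DIM('a)) * (\<integral>\<^sup>+x. indicator N (?T x) \<partial>lebesgue)"
    by (rule nn_integral_affine[OF _ c]) simp
  finally have "(\<integral>\<^sup>+x. indicator N (?T x) \<partial>lebesgue) = 0" using c by auto
  then have "AE x in lebesgue. (indicator N (?T x) :: ennreal) = 0"
    using measurable_compose_affine[OF borel_measurable_indicator[OF \<open>N \<in> sets lebesgue\<close>] c]
    by (subst (asm) nn_integral_0_iff_AE) auto
  then show ?thesis using N(1) by (auto simp: indicator_def elim!: eventually_mono)
qed

lemma integrable_affine:
  fixes f :: "'a::euclidean_space \<Rightarrow> 'b::euclidean_space"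
  assumes f: "integrable lebesgue f" and c: "c \<noteq> 0"
  shows "integrable lebesgue (\<lambda>x. f (t + c *\<^sub>R x))"
proof (rule integrableI_bounded)
  have m: "Lmeas f" using f by auto
  then show "Lmeas (\<lambda>x. f (t + c *\<^sub>R x))" by (rule measurable_compose_affine[OF _ c])
  have "(\<integral>\<^sup>+x. norm (f x) \<partial>lebesgue) < \<infinity>" using f by (simp add: integrable_iff_bounded)
  then show "(\<integral>\<^sup>+x. norm (f (t + c *\<^sub>R x)) \<partial>lebesgue) < \<infinity>"
    using m c by (subst (asm) nn_integral_affine[OF _ c, of _ t]) (auto simp: ennreal_mult_less_top)
qed

lemma integral_affine:
  fixes f :: "'a::euclidean_space \<Rightarrow> 'b::euclidean_space"
  assumes c: "c \<noteq> 0"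
  shows "(\<integral>x. f x \<partial>lebesgue) = \<bar>c\<bar> ^ DIM('a) *\<^sub>R (\<integral>x. f (t + c *\<^sub>R x) \<partial>lebesgue)"
proof cases
  assume f: "integrable lebesgue f"
  note m = lebesgue_affine_measurable'[OF c, of t]
  have [measurable]: "Lmeas f" using f by auto
  have "(\<integral>x. f x \<partial>lebesgue) = (\<integral>x. f x \<partial>density (distr lebesgue lebesgue (\<lambda>x. t + c *\<^sub>R x)) (\<lambda>_. ennreal (\<bar>c\<bar> ^ DIM('a))))"
    using lebesgue_eq_density_affine[OF c, of t] by simp
  also have "\<dots> = \<bar>c\<bar> ^ DIM('a) *\<^sub>R (\<integral>x. f (t + c *\<^sub>R x) \<partial>lebesgue)"
    using m by (subst integral_density) (auto simp: integral_distr)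
  finally show ?thesis .
next
  assume f: "\<not> integrable lebesgue f"
  \<comment> \<open>Without integrability both integrals are 0 by convention, so it remains to see
    that integrability is not created by the substitution; the inverse map carries it back.\<close>
  have "\<not> integrable lebesgue (\<lambda>x. f (t + c *\<^sub>R x))"
  proof
    assume "integrable lebesgue (\<lambda>x. f (t + c *\<^sub>R x))"
    from integrable_affine[OF this, of "1/c" "- (1/c) *\<^sub>R t"] f c show False
      by (simp add: scaleR_right_diff_distrib)
  qed
  with f show ?thesis by (simp add: not_integrable_integral_eq)
qed

lemma integral_translation:
  fixes f :: "'a::euclidean_space \<Rightarrow> 'b::euclidean_space"
  shows "(\<integral>x. f (t + x) \<partial>lebesgue) = (\<integral>x. f x \<partial>lebesgue)"
  using integral_affine[of 1 f t] by simp

lemma integral_reflection: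
  fixes f :: "'a::euclidean_space \<Rightarrow> 'b::euclidean_space"
  shows "(\<integral>x. f (t - x) \<partial>lebesgue) = (\<integral>x. f x \<partial>lebesgue)"
  using integral_affine[of "-1" f t] by simp

lemma nn_integral_translation:
  fixes f :: "'a::euclidean_space \<Rightarrow> ennreal"
  assumes "Lmeas f"
  shows "(\<integral>\<^sup>+x. f (t + x) \<partial>lebesgue) = (\<integral>\<^sup>+x. f x \<partial>lebesgue)"
  using nn_integral_affine[OF assms, of 1 t] by simp

subsection \<open>Integration by parts for test functions\<close>

text \<open>Translation invariance makes the integral of every difference quotient vanish. The
  quotients converge pointwise and are dominated by a bound for the derivative on the unit
  neighbourhood of the support, so the integral of the limit vanishes too.\<close>

lemma integral_pd_eq_0:
  assumes "test_fun U \<psi>" shows "(\<integral>x. pd j \<psi> x \<partial>lebesgue) = 0"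
proof -
  obtain K where K: "compact K" "K \<subseteq> U" "\<And>x. x \<notin> K \<Longrightarrow> \<psi> x = 0"
    using test_fun_support[OF assms] by blast
  note sm = test_fun_C_inf[OF assms]
  define L where "L = {x + y | x y. x \<in> K \<and> y \<in> cball 0 1}"
  have L: "compact L" unfolding L_def by (intro compact_sums K) auto
  let ?e = "axis j 1 :: real^'a"
  obtain B where B: "B > 0" "\<And>x. \<bar>pd j \<psi> x\<bar> \<le> B" using test_fun_bounded[OF test_fun_pd[OF assms]] by blast
  define t where "t n = 1 / real (Suc n)" for n
  have t0: "t n > 0" "t n \<le> 1" "t n \<noteq> 0" for n by (auto simp: t_def field_simps)
  have tlim: "t \<longlonglongrightarrow> 0" unfolding t_def by (rule LIMSEQ_Suc[OF lim_1_over_n])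
  let ?q = "\<lambda>n x. (\<psi> (t n *\<^sub>R ?e + x) - \<psi> x) / t n"
  have D: "((\<lambda>s. \<psi> (s *\<^sub>R ?e + x)) has_real_derivative pd j \<psi> (s *\<^sub>R ?e + x)) (at s)" for s x
  proof -
    have "((\<lambda>s. \<psi> (s *\<^sub>R ?e + x)) has_derivative (\<lambda>h. frechet_derivative \<psi> (at (s *\<^sub>R ?e + x)) (h *\<^sub>R ?e))) (at s)"
      by (rule has_derivative_compose[of "\<lambda>s. s *\<^sub>R ?e + x" _ s UNIV \<psi>])
        (auto intro!: derivative_eq_intros C_inf_has_derivative sm)
    moreover have "frechet_derivative \<psi> (at (s *\<^sub>R ?e + x)) (h *\<^sub>R ?e) = h * pd j \<psi> (s *\<^sub>R ?e + x)" for h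
      using linear_cmul[OF has_derivative_linear[OF C_inf_has_derivative[OF sm]]] by (simp add: pd_def)
    ultimately show ?thesis by (simp add: has_field_derivative_def mult_commute_abs)
  qed
  have int0: "(\<integral>x. ?q n x \<partial>lebesgue) = 0" for n
  proof -
    have "integrable lebesgue (\<lambda>x. \<psi> (t n *\<^sub>R ?e + x))"
      using integrable_affine[OF test_fun_integrable[OF assms], of 1] by simp
    then show ?thesis
      using test_fun_integrable[OF assms] by (simp add: integral_translation)
  qed
  have lim: "(\<lambda>n. ?q n x) \<longlonglongrightarrow> pd j \<psi> x" for x
  proof -
    have "((\<lambda>h. (\<psi> ((0+h) *\<^sub>R ?e + x) - \<psi> (0 *\<^sub>R ?e + x)) / h) \<longlongrightarrow> pd j \<psi> (0 *\<^sub>R ?e + x)) (at 0)"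
      using D[of x 0] unfolding DERIV_def .
    moreover have "filterlim t (at 0) sequentially"
      using tlim t0 by (auto simp: filterlim_at)
    ultimately have "((\<lambda>n. (\<psi> ((0 + t n) *\<^sub>R ?e + x) - \<psi> (0 *\<^sub>R ?e + x)) / t n) \<longlonglongrightarrow> pd j \<psi> (0 *\<^sub>R ?e + x))"
      by (rule filterlim_compose)
    then show ?thesis by simp
  qed
  have bnd: "\<bar>?q n x\<bar> \<le> B * indicator L x" for n x
  proof (cases "x \<in> L")
    case False
    have "x \<notin> K" using False unfolding L_def by (force intro: exI[of _ 0])
    moreover have "t n *\<^sub>R ?e + x \<notin> K"
    proof
      assume a: "t n *\<^sub>R ?e + x \<in> K"
      have "x = (t n *\<^sub>R ?e + x) + (- t n *\<^sub>R ?e)" "- t n *\<^sub>R ?e \<in> cball 0 1" using t0[of n] by auto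
      with a False show False unfolding L_def by blast
    qed
    ultimately show ?thesis using K False by simp
  next
    case True
    from MVT2[OF t0(1)[of n], of "\<lambda>s. \<psi> (s *\<^sub>R ?e + x)" "\<lambda>s. pd j \<psi> (s *\<^sub>R ?e + x)"] D
    obtain s where "\<psi> (t n *\<^sub>R ?e + x) - \<psi> x = t n * pd j \<psi> (s *\<^sub>R ?e + x)" by auto
    then show ?thesis using t0[of n] B True by simp
  qed
  have mq: "?q n \<in> borel_measurable lebesgue" for n
  proof -
    have [measurable]: "\<psi> \<in> borel_measurable lebesgue" using test_fun_integrable[OF assms] by auto
    have [measurable]: "Lmeas (\<lambda>x. \<psi> (t n *\<^sub>R ?e + x))"
      using measurable_compose_affine[of \<psi> borel 1] by simp
    show ?thesis by measurable
  qed
  have "(\<lambda>n. \<integral>x. ?q n x \<partial>lebesgue) \<longlonglongrightarrow> (\<integral>x. pd j \<psi> x \<partial>lebesgue)"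
  proof (rule integral_dominated_convergence[where w="\<lambda>x. B * indicator L x"])
    show "pd j \<psi> \<in> borel_measurable lebesgue"
      using test_fun_integrable[OF test_fun_pd[OF assms]] by auto
    show "integrable lebesgue (\<lambda>x. B * indicator L x)"
      using fmeasurableD[OF lmeasurable_compact[OF L]] fmeasurableD2[OF lmeasurable_compact[OF L]]
      by (intro integrable_mult_right) (auto intro!: integrable_real_indicator simp: top.not_eq_extremum)
  qed (use mq lim bnd in auto)
  then show ?thesis unfolding int0 by (simp add: LIMSEQ_const_iff)
qed

lemma integration_by_parts:
  assumes "C_inf f" "test_fun U \<psi>"
  shows "(\<integral>x. f x * pd j \<psi> x \<partial>lebesgue) = - (\<integral>x. pd j f x * \<psi> x \<partial>lebesgue)"
proof -
  have "0 = (\<integral>x. pd j (\<lambda>x. f x * \<psi> x) x \<partial>lebesgue)"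
    using integral_pd_eq_0[OF test_fun_mult_left[OF assms]] by simp
  also have "\<dots> = (\<integral>x. f x * pd j \<psi> x + pd j f x * \<psi> x \<partial>lebesgue)"
    by (simp add: pd_mult assms(1) test_fun_C_inf[OF assms(2)])
  also have "\<dots> = (\<integral>x. f x * pd j \<psi> x \<partial>lebesgue) + (\<integral>x. pd j f x * \<psi> x \<partial>lebesgue)"
    by (intro Bochner_Integration.integral_add test_fun_integrable[of U] test_fun_mult_left test_fun_pd assms C_inf_pd)
  finally show ?thesis by simp
qed

subsection \<open>The \<open>p\<close>-th power integral\<close>

text \<open>The \<open>p\<close>-th power of the norm, with no root taken and infinity allowed. It
  is additive over disjoint sets, which suits countable decompositions; the price is the factor
  \<open>2 powr p\<close> in the triangle inequality.\<close>

definition Np :: "real \<Rightarrow> (real^'n) set \<Rightarrow> (real^'n \<Rightarrow> 'b::euclidean_space) \<Rightarrow> ennreal" where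
  "Np p U f = (\<integral>\<^sup>+x\<in>U. ennreal (norm (f x) powr p) \<partial>lebesgue)"

lemma ex_small_factor:
  fixes k \<tau> :: real
  assumes "k \<ge> 0" "\<tau> > 0" obtains e where "e > 0" "e \<le> 1" "k * e \<le> \<tau>"
proof
  let ?e = "min 1 (\<tau> / (k + 1))"
  show "?e > 0" "?e \<le> 1" using assms by auto
  have "k * ?e \<le> k * (\<tau> / (k + 1))" using assms by (intro mult_left_mono) auto
  also have "\<dots> \<le> \<tau>" using assms by (simp add: field_simps)
  finally show "k * ?e \<le> \<tau>" .
qed

lemma powr_add_le:
  fixes a b :: real assumes "0 \<le> a" "0 \<le> b" "0 \<le> p"
  shows "(a + b) powr p \<le> 2 powr p * (a powr p + b powr p)"
proof -
  have "(a + b) powr p \<le> (2 * max a b) powr p" using assms by (intro powr_mono2) auto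
  also have "\<dots> = 2 powr p * max a b powr p" using assms by (simp add: powr_mult)
  also have "\<dots> \<le> 2 powr p * (a powr p + b powr p)"
    by (intro mult_left_mono) (auto simp: max_def)
  finally show ?thesis .
qed

lemma norm_powr_add_le:
  assumes "0 \<le> p"
  shows "norm (a + b) powr p \<le> 2 powr p * (norm a powr p + norm b powr p)"
  using powr_mono2[OF assms norm_ge_zero norm_triangle_ineq[of a b]] powr_add_le[of "norm a" "norm b" p] assms
  by simp

lemma Np_mono:
  assumes "\<And>x. x \<in> U \<Longrightarrow> norm (f x) \<le> norm (g x)" "0 \<le> p" "U \<subseteq> V"
  shows "Np p U f \<le> Np p V g"
  unfolding Np_def using assms by (intro nn_integral_mono) (auto simp: indicator_def intro!: ennreal_leI powr_mono2)

lemma Np_set_mono: "U \<subseteq> V \<Longrightarrow> Np p U f \<le> Np p V f"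
  unfolding Np_def by (intro nn_integral_mono) (auto simp: indicator_def)

lemma Np_cong_AE:
  assumes "AE x in lebesgue. x \<in> U \<longrightarrow> f x = g x" shows "Np p U f = Np p U g"
  unfolding Np_def using assms by (intro nn_integral_cong_AE) (auto simp: indicator_def elim!: eventually_mono)

lemma Np_add:
  fixes f g :: "real^'n \<Rightarrow> 'b::euclidean_space"
  assumes [measurable]: "Lmeas f" "Lmeas g" "U \<in> sets lebesgue" and p: "0 \<le> p"
  shows "Np p U (\<lambda>x. f x + g x) \<le> ennreal (2 powr p) * (Np p U f + Np p U g)"
proof -
  have "Np p U (\<lambda>x. f x + g x) \<le> (\<integral>\<^sup>+x. ennreal (2 powr p) * (ennreal (norm (f x) powr p) * indicator U x + ennreal (norm (g x) powr p) * indicator U x) \<partial>lebesgue)"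
    unfolding Np_def
    by (intro nn_integral_mono)
      (auto simp: indicator_def ennreal_plus[symmetric] ennreal_mult[symmetric] simp del: ennreal_plus intro!: ennreal_leI norm_powr_add_le p)
  also have "\<dots> = ennreal (2 powr p) * (Np p U f + Np p U g)"
    unfolding Np_def by (subst nn_integral_cmult) (auto simp: nn_integral_add)
  finally show ?thesis .
qed

lemma Np_uminus: "Np p U (\<lambda>x. - f x) = Np p U f"
  by (simp add: Np_def)

lemma Np_diff:
  fixes f g :: "real^'n \<Rightarrow> 'b::euclidean_space"
  assumes "Lmeas f" "Lmeas g" "U \<in> sets lebesgue" and p: "0 \<le> p"
  shows "Np p U (\<lambda>x. f x - g x) \<le> ennreal (2 powr p) * (Np p U f + Np p U g)"
  using Np_add[of f "\<lambda>x. - g x" U p] assms by (simp add: Np_uminus)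

lemma Np_triangle:
  fixes f g :: "real^'n \<Rightarrow> 'b::euclidean_space"
  assumes "Lmeas f" "Lmeas g" "Lmeas h" "U \<in> sets lebesgue" and p: "0 \<le> p"
  shows "Np p U (\<lambda>x. f x - g x) \<le> ennreal (2 powr p) * (Np p U (\<lambda>x. f x - h x) + Np p U (\<lambda>x. h x - g x))"
  using Np_add[of "\<lambda>x. f x - h x" "\<lambda>x. h x - g x" U p] assms by simp

lemma Np_commute: "Np p U (\<lambda>x. f x - g x) = Np p U (\<lambda>x. g x - f x)"
  by (simp add: Np_def norm_minus_commute)

lemma Np_zero: "p \<noteq> 0 \<Longrightarrow> Np p U (\<lambda>x. 0) = 0"
  by (simp add: Np_def)

lemma Np_cmult:
  assumes "Lmeas f" "U \<in> sets lebesgue"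
  shows "Np p U (\<lambda>x. c *\<^sub>R f x) = ennreal (\<bar>c\<bar> powr p) * Np p U f"
  unfolding Np_def using assms
  by (subst nn_integral_cmult[symmetric]) (auto simp: powr_mult ennreal_mult mult_ac intro!: nn_integral_cong)

lemma Np_UNIV_supp:
  assumes "\<And>x. x \<notin> U \<Longrightarrow> f x = 0" "p \<noteq> 0"
  shows "Np p UNIV f = Np p U f"
  unfolding Np_def using assms by (intro nn_integral_cong) (auto simp: indicator_def)

lemma Np_disjoint_UN:
  fixes Q :: "nat \<Rightarrow> (real^'n) set"
  assumes "Lmeas f" "\<And>n. Q n \<in> sets lebesgue" "disjoint_family Q"
  shows "Np p (\<Union>n. Q n) f = (\<Sum>n. Np p (Q n) f)"
  unfolding Np_def using assms by (intro nn_integral_disjoint_family) auto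

lemma Np_tendsto_0_dominated:
  fixes f :: "nat \<Rightarrow> real^'n \<Rightarrow> 'b::euclidean_space"
  assumes [measurable]: "\<And>n. f n \<in> borel_measurable lebesgue" and p: "p > 0"
    and lim: "AE x in lebesgue. (\<lambda>n. f n x) \<longlonglongrightarrow> 0"
    and dom: "\<And>n x. ennreal (norm (f n x) powr p) \<le> w x" and [measurable]: "Lmeas w"
    and fin: "(\<integral>\<^sup>+x. w x \<partial>lebesgue) < \<infinity>"
  shows "(\<lambda>n. Np p UNIV (f n)) \<longlonglongrightarrow> 0"
proof -
  have "(\<lambda>n. (\<integral>\<^sup>+x. ennreal (norm (f n x) powr p) \<partial>lebesgue)) \<longlonglongrightarrow> (\<integral>\<^sup>+x. 0 \<partial>(lebesgue :: (real^'n) measure))"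
  proof (rule nn_integral_dominated_convergence[where w=w and u'="\<lambda>x. 0"
        and u="\<lambda>n x. ennreal (norm (f n x) powr p)"])
    show "(\<integral>\<^sup>+x. w x \<partial>lebesgue) < \<infinity>" by (rule fin)
    show "AE x in lebesgue. (\<lambda>n. ennreal (norm (f n x) powr p)) \<longlonglongrightarrow> 0"
      using lim
    proof eventually_elim
      case (elim x)
      have "(\<lambda>n. norm (f n x) powr p) \<longlonglongrightarrow> 0"
        using tendsto_norm[OF elim] p by (auto intro!: tendsto_eq_intros tendsto_zero_powrI)
      then show ?case using tendsto_ennrealI[of _ 0] by force
    qed
  qed (use dom in auto)
  then show ?thesis by (simp add: Np_def)
qed

subsection \<open>Density of continuous functions and continuity of translations\<close>

lemma lebesgue_measurable_ident: "(\<lambda>x. x) \<in> borel_measurable (lebesgue :: 'a::euclidean_space measure)"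
  by (intro measurable_completion) simp

lemma continuous_imp_lebesgue_measurable:
  fixes f :: "'a::euclidean_space \<Rightarrow> 'b::euclidean_space"
  shows "continuous_on UNIV f \<Longrightarrow> f \<in> borel_measurable lebesgue"
  by (intro measurable_completion) (simp add: borel_measurable_continuous_onI)

lemma compact_support_dominated_finite:
  fixes R :: real
  shows "(\<integral>\<^sup>+x. ennreal c * indicator (cball 0 R) x \<partial>(lebesgue :: (real^'n) measure)) < \<infinity>"
proof -
  have "emeasure lebesgue (cball (0::real^'n) R) < \<infinity>"
    using fmeasurableD2[OF lmeasurable_cball] by (simp add: top.not_eq_extremum)
  then show ?thesis by (simp add: nn_integral_cmult_indicator ennreal_mult_less_top)
qed

lemma Np_dense_bounded:
  fixes f :: "real^'n \<Rightarrow> 'b::euclidean_space"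
  assumes [measurable]: "Lmeas f" and p: "p > 0" and e: "e > 0" and b: "b > 0"
    and fb: "\<And>x. norm (f x) \<le> b" and fs: "\<And>x. norm x > b \<Longrightarrow> f x = 0"
  obtains g where "continuous_on UNIV g" "\<And>x. norm x > b + 1 \<Longrightarrow> g x = 0" "Np p UNIV (\<lambda>x. f x - g x) \<le> ennreal e"
proof -
  have "f measurable_on UNIV" by (simp add: measurable_on_iff_borel_measurable)
  then obtain N h where N: "negligible N" and h: "\<And>n. continuous_on UNIV (h n)" "\<And>x. x \<notin> N \<Longrightarrow> (\<lambda>n. h n x) \<longlonglongrightarrow> f x"
    unfolding measurable_on_def by auto
  let ?C = "cball (0::'b) b"
  have C: "convex ?C" "closed ?C" "?C \<noteq> {}" using b by auto
  \<comment> \<open>The projection onto the ball of radius \<open>b\<close> keeps the approximants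
    bounded and the tent function gives them bounded support. Neither changes the limit, since
    \<open>f\<close> already obeys both bounds.\<close>
  define g where "g n x = max 0 (min 1 (b + 1 - norm x)) *\<^sub>R closest_point ?C (h n x)" for n x
  have cont: "continuous_on UNIV (g n)" for n
    unfolding g_def
    by (intro continuous_intros continuous_on_compose2[OF continuous_on_closest_point[OF C, of UNIV] h(1)]) auto
  have [measurable]: "Lmeas (g n)" for n
    using cont by (rule continuous_imp_lebesgue_measurable)
  have gb: "norm (g n x) \<le> b" for n x
  proof -
    have "closest_point ?C (h n x) \<in> ?C" by (rule closest_point_in_set[OF C(2,3)])
    then have *: "norm (closest_point ?C (h n x)) \<le> b" by simp
    have "\<bar>max 0 (min 1 (b + 1 - norm x))\<bar> * norm (closest_point ?C (h n x)) \<le> 1 * b"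
      using * by (intro mult_mono) auto
    then show ?thesis unfolding g_def by simp
  qed
  have gs: "g n x = 0" if "norm x > b + 1" for n x using that by (simp add: g_def)
  have lim: "(\<lambda>n. f x - g n x) \<longlonglongrightarrow> 0" if "x \<notin> N" for x
  proof -
    have "isCont (closest_point ?C) (f x)"
      using continuous_on_closest_point[OF C, of UNIV] by (simp add: continuous_on_eq_continuous_at)
    then have "(\<lambda>n. closest_point ?C (h n x)) \<longlonglongrightarrow> closest_point ?C (f x)"
      using h(2)[OF that] isCont_tendsto_compose by blast
    moreover have "closest_point ?C (f x) = f x" using fb[of x] by (intro closest_point_self) simp
    ultimately have "(\<lambda>n. g n x) \<longlonglongrightarrow> max 0 (min 1 (b + 1 - norm x)) *\<^sub>R f x"
      unfolding g_def by (intro tendsto_intros) simp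
    moreover have "max 0 (min 1 (b + 1 - norm x)) *\<^sub>R f x = f x"
      using fs[of x] by (cases "norm x > b") auto
    ultimately show ?thesis using tendsto_diff[OF tendsto_const[of "f x"]] by fastforce
  qed
  have "(\<lambda>n. Np p UNIV (\<lambda>x. f x - g n x)) \<longlonglongrightarrow> 0"
  proof (rule Np_tendsto_0_dominated[OF _ p])
    show "AE x in lebesgue. (\<lambda>n. f x - g n x) \<longlonglongrightarrow> 0"
      using lim AE_not_in[OF N[unfolded negligible_iff_null_sets]] by (auto elim: eventually_mono)
    show "ennreal (norm (f x - g n x) powr p) \<le> ennreal ((2 * b) powr p) * indicator (cball 0 (b+1)) x" for n x
    proof (cases "norm x \<le> b + 1")
      case True
      have "norm (f x - g n x) \<le> 2 * b" using fb[of x] gb[of n x] norm_triangle_ineq4[of "f x" "g n x"] by linarith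
      then show ?thesis using True p by (auto intro!: ennreal_leI powr_mono2)
    next
      case False
      then show ?thesis using fs[of x] gs[of x n] by simp
    qed
    show "(\<integral>\<^sup>+x. ennreal ((2 * b) powr p) * indicator (cball 0 (b+1)) x \<partial>(lebesgue :: (real^'n) measure)) < \<infinity>"
      by (rule compact_support_dominated_finite)
    show "Lmeas (\<lambda>x. f x - g n x)" for n by measurable
    show "(\<lambda>x. ennreal ((2 * b) powr p) * indicator (cball 0 (b+1)) x) \<in> borel_measurable (lebesgue :: (real^'n) measure)"
      by (intro borel_measurable_times_ennreal borel_measurable_indicator fmeasurableD[OF lmeasurable_cball] borel_measurable_const)
  qed
  then have "eventually (\<lambda>n. Np p UNIV (\<lambda>x. f x - g n x) < ennreal e) sequentially"
    using e by (intro order_tendstoD) auto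
  then obtain n where "Np p UNIV (\<lambda>x. f x - g n x) < ennreal e" by (auto simp: eventually_sequentially)
  then show ?thesis using that[of "g n"] cont gs by (auto intro: less_imp_le)
qed

lemma Np_dense:
  fixes f :: "real^'n \<Rightarrow> 'b::euclidean_space"
  assumes [measurable]: "Lmeas f" and p: "p > 0" and e: "e > 0"
    and fin: "Np p UNIV f < \<infinity>"
  obtains g R where "continuous_on UNIV g" "\<And>x. norm x > R \<Longrightarrow> g x = 0" "Np p UNIV (\<lambda>x. f x - g x) \<le> ennreal e"
proof -
  define F where "F n x = (if norm x \<le> real n + 1 \<and> norm (f x) \<le> real n + 1 then f x else 0)" for n x
  have [measurable]: "Lmeas (F n)" for n
  proof -
    note [measurable] = lebesgue_measurable_ident
    show ?thesis unfolding F_def by measurable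
  qed
  have "(\<lambda>n. Np p UNIV (\<lambda>x. f x - F n x)) \<longlonglongrightarrow> 0"
  proof (rule Np_tendsto_0_dominated[OF _ p])
    show "AE x in lebesgue. (\<lambda>n. f x - F n x) \<longlonglongrightarrow> 0"
    proof (rule AE_I2)
      fix x
      obtain k where k: "real k \<ge> max (norm x) (norm (f x))" using real_arch_simple by blast
      have "f x - F n x = 0" if "n \<ge> k" for n
      proof -
        have "real n \<ge> real k" using that by simp
        then show ?thesis using k by (simp add: F_def)
      qed
      then show "(\<lambda>n. f x - F n x) \<longlonglongrightarrow> 0"
        by (intro tendsto_eventually) (auto simp: eventually_sequentially)
    qed
    show "ennreal (norm (f x - F n x) powr p) \<le> ennreal (norm (f x) powr p)" for n x
      by (simp add: F_def)
    show "(\<integral>\<^sup>+x. ennreal (norm (f x) powr p) \<partial>lebesgue) < \<infinity>" using fin by (simp add: Np_def)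
    show "Lmeas (\<lambda>x. f x - F n x)" for n by measurable
    show "Lmeas (\<lambda>x. ennreal (norm (f x) powr p))" by measurable
  qed
  moreover define e' where "e' = e / (2 * 2 powr p)"
  moreover have e': "e' > 0" using e by (simp add: e'_def)
  ultimately have "eventually (\<lambda>n. Np p UNIV (\<lambda>x. f x - F n x) < ennreal e') sequentially"
    by (intro order_tendstoD) auto
  then obtain n where n: "Np p UNIV (\<lambda>x. f x - F n x) < ennreal e'" by (auto simp: eventually_sequentially)
  obtain g where g: "continuous_on UNIV g" "\<And>x. norm x > (real n + 1) + 1 \<Longrightarrow> g x = 0" "Np p UNIV (\<lambda>x. F n x - g x) \<le> ennreal e'"
    by (rule Np_dense_bounded[of "F n" p e' "real n + 1"]) (use p e' in \<open>auto simp: F_def\<close>)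
  have [measurable]: "Lmeas g"
    using g(1) by (rule continuous_imp_lebesgue_measurable)
  have "Np p UNIV (\<lambda>x. f x - g x) \<le> ennreal (2 powr p) * (Np p UNIV (\<lambda>x. f x - F n x) + Np p UNIV (\<lambda>x. F n x - g x))"
    using p by (intro Np_triangle) auto
  also have "\<dots> \<le> ennreal (2 powr p) * (ennreal e' + ennreal e')"
    using n g by (intro mult_left_mono add_mono) auto
  also have "\<dots> = ennreal e"
    using e e' by (simp add: ennreal_plus[symmetric] ennreal_mult[symmetric] e'_def del: ennreal_plus)
  finally show ?thesis using that g by blast
qed

lemma Np_translation:
  fixes f :: "real^'n \<Rightarrow> 'b::euclidean_space"
  assumes "Lmeas f"
  shows "Np p UNIV (\<lambda>x. f (z + x)) = Np p UNIV f"
  using nn_integral_translation[of "\<lambda>x. ennreal (norm (f x) powr p)" z] assms by (simp add: Np_def)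

lemma Np_translation_continuous:
  fixes f :: "real^'n \<Rightarrow> 'b::euclidean_space"
  assumes [measurable]: "Lmeas f" and p: "p > 0" and e: "e > 0"
    and fin: "Np p UNIV f < \<infinity>"
  obtains d where "d > 0" "\<And>z. norm z < d \<Longrightarrow> Np p UNIV (\<lambda>x. f (z + x) - f x) \<le> ennreal e"
proof -
  define c where "c = 2 powr p"
  have c: "c > 0" by (simp add: c_def)
  \<comment> \<open>Two nested triangle inequalities compare the translate of \<open>f\<close> with
    the translate of \<open>g\<close>, that with \<open>g\<close>, and \<open>g\<close> with
    \<open>f\<close>; each of the three terms is allowed the tolerance \<open>e'\<close>.\<close>
  obtain e' where e': "e' > 0" "c * (e' + c * (e' + e')) \<le> e"
  proof -
    obtain e' where "e' > 0" "(c + 2 * c * c) * e' \<le> e" using ex_small_factor[OF _ e, of "c + 2 * c * c"] c by auto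
    then show thesis by (intro that[of e']) (auto simp: algebra_simps)
  qed
  obtain g R where g: "continuous_on UNIV g" "\<And>x. norm x > R \<Longrightarrow> g x = 0" "Np p UNIV (\<lambda>x. f x - g x) \<le> ennreal e'"
    using Np_dense[OF assms(1) p e'(1) fin] by metis
  have [measurable]: "Lmeas g"
    using g(1) by (rule continuous_imp_lebesgue_measurable)
  have g0: "g x = 0" if "x \<notin> cball 0 R" for x using g(2)[of x] that by auto
  define V where "V = measure lebesgue (cball (0::real^'n) (R + 1)) + 1"
  have V: "V > 0" by (simp add: V_def add_nonneg_pos)
  have eV: "emeasure lebesgue (cball (0::real^'n) (R + 1)) \<le> ennreal V"
    using emeasure_eq_measure2[OF lmeasurable_cball[of "0::real^'n" "R+1"]] by (simp add: V_def ennreal_leI)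
  \<comment> \<open>With this oscillation the integral over a ball of volume at most
    \<open>V\<close> is at most \<open>s powr p * V = e'\<close>.\<close>
  define s where "s = (e' / V) powr (1/p)"
  have s: "s > 0" "s powr p = e' / V" using e' V p by (auto simp: s_def powr_powr)
  obtain d where d: "d > 0" "\<And>x y. dist x y < d \<Longrightarrow> dist (g x) (g y) < s"
    using uniformly_continuous_compact_support[OF g(1) compact_cball g0 s(1)] by metis
  show ?thesis
  proof (rule that[of "min d 1"])
    show "min d 1 > 0" using d by simp
    fix z :: "real^'n" assume z: "norm z < min d 1"
    have [measurable]: "Lmeas (\<lambda>x. f (z + x))" "Lmeas (\<lambda>x. g (z + x))"
      using measurable_compose_affine[of f borel 1 z] measurable_compose_affine[of g borel 1 z] by simp_all
    have "Np p UNIV (\<lambda>x. g (z + x) - g x) \<le> (\<integral>\<^sup>+x. ennreal (e' / V) * indicator (cball (0::real^'n) (R + 1)) x \<partial>lebesgue)"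
      unfolding Np_def
    proof (rule nn_integral_mono)
      fix x
      show "ennreal (norm (g (z + x) - g x) powr p) * indicator UNIV x \<le> ennreal (e' / V) * indicator (cball 0 (R + 1)) x"
      proof (cases "norm x \<le> R + 1")
        case True
        have "dist (g (z + x)) (g x) < s" using z by (intro d(2)) (simp add: dist_norm)
        then have "norm (g (z + x) - g x) powr p \<le> s powr p" using p by (intro powr_mono2) (auto simp: dist_norm)
        then show ?thesis using True s by (simp add: ennreal_leI)
      next
        case False
        have "norm x \<le> norm (z + x) + norm z" by (metis add_diff_cancel_left' norm_triangle_ineq4 )
        then have "norm (z + x) > R" using False z by simp
        then show ?thesis using False g(2) by simp
      qed
    qed
    also have "\<dots> = ennreal (e' / V) * emeasure lebesgue (cball (0::real^'n) (R + 1))"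
      by (simp add: nn_integral_cmult_indicator)
    also have "\<dots> \<le> ennreal (e' / V) * ennreal V" using eV by (intro mult_left_mono) auto
    also have "\<dots> = ennreal e'" using V e' by (simp add: ennreal_mult[symmetric])
    finally have 1: "Np p UNIV (\<lambda>x. g (z + x) - g x) \<le> ennreal e'" .
    have 2: "Np p UNIV (\<lambda>x. f (z + x) - g (z + x)) \<le> ennreal e'"
      using Np_translation[of "\<lambda>x. f x - g x" p z] g(3) by simp
    have "Np p UNIV (\<lambda>x. f (z + x) - f x) \<le> ennreal c * (Np p UNIV (\<lambda>x. f (z + x) - g (z + x)) + Np p UNIV (\<lambda>x. g (z + x) - f x))"
      unfolding c_def using p by (intro Np_triangle) auto
    also have "\<dots> \<le> ennreal c * (ennreal e' + ennreal c * (Np p UNIV (\<lambda>x. g (z + x) - g x) + Np p UNIV (\<lambda>x. g x - f x)))"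
      using p 2 by (intro mult_left_mono add_mono Np_triangle[of _ _ _ _ p, folded c_def]) auto
    also have "\<dots> \<le> ennreal c * (ennreal e' + ennreal c * (ennreal e' + ennreal e'))"
      using 1 g(3) by (intro mult_left_mono add_mono) (auto simp: Np_commute[of p UNIV g])
    also have "\<dots> = ennreal (c * (e' + c * (e' + e')))"
      using c e' by (simp add: ennreal_plus[symmetric] ennreal_mult[symmetric] del: ennreal_plus)
    also have "\<dots> \<le> ennreal e" using e'(2) by (rule ennreal_leI)
    finally show "Np p UNIV (\<lambda>x. f (z + x) - f x) \<le> ennreal e" .
  qed
qed

subsection \<open>Jensen's inequality for powers\<close>

text \<open>The supporting line of a convex function. The boundary point \<open>t = 0\<close> is
  computed by hand, since the tangent lemma is applied on the open half-line.\<close>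

lemma powr_tangent:
  fixes p m t :: real
  assumes "p \<ge> 1" "m > 0" "t \<ge> 0"
  shows "m powr p + p * m powr (p - 1) * (t - m) \<le> t powr p"
proof (cases "t = 0")
  case True
  have "m powr p = m powr (p - 1) * m" using assms powr_add[of m "p - 1" 1] by simp
  then have "m powr p + p * m powr (p - 1) * (t - m) = (1 - p) * (m powr (p-1) * m)"
    using True by (simp add: algebra_simps)
  also have "\<dots> \<le> 0" using assms by (intro mult_nonpos_nonneg) auto
  finally show ?thesis using True by simp
next
  case False
  have "((\<lambda>x. x powr p) has_real_derivative p * m powr (p - 1)) (at m within {0<..})"
    using assms by (auto intro!: derivative_eq_intros)
  from convex_on_imp_above_tangent[OF powr_convex[OF assms(1)] _ _ _ this, of t] False assms
  show ?thesis by (simp add: interior_open)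
qed

text \<open>The tangent inequality at the mean is integrated; the linear term drops out. The
  right-hand side is an extended integral, so integrability of the power is a case distinction and
  not a hypothesis.\<close>

lemma (in prob_space) jensen_powr:
  assumes X: "integrable M X" "\<And>x. X x \<ge> 0" and p: "p \<ge> (1::real)"
  shows "ennreal ((\<integral>x. X x \<partial>M) powr p) \<le> (\<integral>\<^sup>+x. ennreal (X x powr p) \<partial>M)"
proof (cases "(\<integral>\<^sup>+x. ennreal (X x powr p) \<partial>M) = \<infinity>")
  case False
  have [measurable]: "X \<in> borel_measurable M" using X by auto
  let ?m = "\<integral>x. X x \<partial>M"
  have int: "integrable M (\<lambda>x. X x powr p)"
    using False by (intro integrableI_nonneg) (auto simp: top.not_eq_extremum)
  show ?thesis
  proof (cases "?m > 0")
    case True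
    have "?m powr p = (\<integral>x. ?m powr p + p * ?m powr (p - 1) * (X x - ?m) \<partial>M)"
      using X by (simp add: prob_space)
    also have "\<dots> \<le> (\<integral>x. X x powr p \<partial>M)"
      using X p True by (intro integral_mono int powr_tangent) auto
    finally have "ennreal (?m powr p) \<le> ennreal (\<integral>x. X x powr p \<partial>M)" by (rule ennreal_leI)
    also have "\<dots> = (\<integral>\<^sup>+x. ennreal (X x powr p) \<partial>M)"
      by (rule nn_integral_eq_integral[symmetric, OF int]) auto
    finally show ?thesis .
  next
    case False
    then have "?m = 0" using Bochner_Integration.integral_nonneg_AE[where f=X and M=M] X(2) by (simp add: antisym_conv)
    then show ?thesis by simp
  qed
qed simp

subsection \<open>Mollification\<close>

definition conv :: "(real^'n \<Rightarrow> real) \<Rightarrow> (real^'n \<Rightarrow> 'b::euclidean_space) \<Rightarrow> real^'n \<Rightarrow> 'b" where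
  "conv \<eta> v x = (\<integral>y. \<eta> (x - y) *\<^sub>R v y \<partial>lebesgue)"

lemma conv_integrable:
  fixes v :: "real^'n \<Rightarrow> 'b::euclidean_space"
  assumes "test_fun U \<eta>" "integrable lebesgue v"
  shows "integrable lebesgue (\<lambda>y. \<eta> (x - y) *\<^sub>R v y)"
proof -
  obtain B where B: "B > 0" "\<And>x. \<bar>\<eta> x\<bar> \<le> B" using test_fun_bounded[OF assms(1)] by blast
  have [measurable]: "Lmeas (\<lambda>y. \<eta> (x - y))"
    by (rule continuous_imp_lebesgue_measurable)
      (auto intro!: continuous_on_compose2[OF test_fun_continuous[OF assms(1), of UNIV]] continuous_intros)
  have [measurable]: "Lmeas v" using assms(2) by auto
  show ?thesis
  proof (rule Bochner_Integration.integrable_bound)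
    show "integrable lebesgue (\<lambda>y. B * norm (v y))" using assms(2) by auto
    show "AE y in lebesgue. norm (\<eta> (x - y) *\<^sub>R v y) \<le> norm (B * norm (v y))"
      using B by (intro AE_I2) (auto simp: intro!: mult_right_mono)
  qed measurable
qed

lemma test_fun_deriv: assumes "test_fun U \<psi>" shows "test_fun U (\<lambda>x. frechet_derivative \<psi> (at x) v)"
proof -
  from test_fun_support[OF assms] obtain K where K: "compact K" "K \<subseteq> U" "\<And>x. x \<notin> K \<Longrightarrow> \<psi> x = 0"
    by blast
  show ?thesis
    by (rule test_funI[of _ K])
      (use K assms in \<open>auto simp: compact_imp_closed intro!: C_inf_deriv frechet_derivative_0_outside[of K] dest: test_fun_C_inf\<close>)
qed

text \<open>The gradient of a test function is uniformly continuous, so the first-order remainder is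
  small uniformly in the base point. This is what allows differentiation of a convolution with a
  function that is only integrable.\<close>

lemma test_fun_uniform_linearization:
  fixes \<eta> :: "real^'n \<Rightarrow> real"
  assumes "test_fun U \<eta>" "e > 0"
  obtains d where "d > 0" "\<And>z h. norm h < d \<Longrightarrow> \<bar>\<eta> (z + h) - \<eta> z - frechet_derivative \<eta> (at z) h\<bar> \<le> e * norm h"
proof -
  define g :: "real^'n \<Rightarrow> real^'n" where "g x = (\<chi> j. pd j \<eta> x)" for x
  note sm = test_fun_C_inf[OF assms(1)]
  have fd: "frechet_derivative \<eta> (at x) v = v \<bullet> g x" for x v
    by (simp add: frechet_derivative_pd[OF sm] g_def inner_vec_def)
  obtain K where K: "compact K" "K \<subseteq> U" "\<And>x. x \<notin> K \<Longrightarrow> \<eta> x = 0"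
    using test_fun_support[OF assms(1)] by blast
  have gc: "continuous_on UNIV g"
    unfolding g_def by (intro continuous_on_vec_lambda test_fun_continuous[of U] test_fun_pd assms)
  have g0: "g x = 0" if "x \<notin> K" for x
    using pd_0_outside[OF compact_imp_closed[OF K(1)] K(3) that] by (simp add: g_def vec_eq_iff)
  obtain d where d: "d > 0" "\<And>x y. dist x y < d \<Longrightarrow> dist (g x) (g y) < e"
    using uniformly_continuous_compact_support[OF gc K(1) g0 assms(2)] by metis
  show ?thesis
  proof (rule that[OF d(1)])
    fix z h :: "real^'n" assume h: "norm h < d"
    have "norm (\<eta> (z + h) - \<eta> z - frechet_derivative \<eta> (at z) ((z + h) - z)) \<le> norm ((z + h) - z) * e"
    proof (rule differentiable_bound_linearization[of _ _ "ball z d"])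
      show "z + t *\<^sub>R (z + h - z) \<in> ball z d" if "t \<in> {0..1}" for t
      proof -
        have "\<bar>t\<bar> * norm h \<le> 1 * norm h" using that by (intro mult_right_mono) auto
        then show ?thesis using h by (simp add: dist_norm)
      qed
      show "(\<eta> has_derivative frechet_derivative \<eta> (at x)) (at x within ball z d)" for x
        by (rule has_derivative_at_withinI[OF C_inf_has_derivative[OF sm]])
      show "onorm (frechet_derivative \<eta> (at x) - frechet_derivative \<eta> (at z)) \<le> e" if "x \<in> ball z d" for x
      proof (rule onorm_le)
        fix v :: "real^'n"
        have "norm (g x - g z) < e" using d(2)[of x z] that by (simp add: dist_norm norm_minus_commute)
        then have "norm v * norm (g x - g z) \<le> norm v * e" by (intro mult_left_mono) auto
        moreover have "\<bar>v \<bullet> (g x - g z)\<bar> \<le> norm v * norm (g x - g z)" by (rule Cauchy_Schwarz_ineq2)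
        ultimately show "norm ((frechet_derivative \<eta> (at x) - frechet_derivative \<eta> (at z)) v) \<le> e * norm v"
          by (simp add: fd inner_diff_right mult.commute)
      qed
    qed (use d in auto)
    then show "\<bar>\<eta> (z + h) - \<eta> z - frechet_derivative \<eta> (at z) h\<bar> \<le> e * norm h" by (simp add: mult.commute)
  qed
qed

lemma conv_has_derivative:
  fixes v :: "real^'n \<Rightarrow> real"
  assumes \<eta>: "test_fun U \<eta>" and v: "integrable lebesgue v"
  shows "(conv \<eta> v has_derivative (\<lambda>h. conv (\<lambda>z. frechet_derivative \<eta> (at z) h) v x)) (at x)"
  unfolding has_derivative_within_alt
proof (intro conjI allI impI)
  let ?L = "\<lambda>h. conv (\<lambda>z. frechet_derivative \<eta> (at z) h) v x"
  note sm = test_fun_C_inf[OF \<eta>]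
  have L: "?L h = (\<Sum>j\<in>UNIV. h $ j * conv (pd j \<eta>) v x)" for h
    unfolding conv_def frechet_derivative_pd[OF sm] sum_distrib_right scaleR_sum_left
    using conv_integrable[OF test_fun_pd[OF \<eta>] v]
    by (subst Bochner_Integration.integral_sum) (auto simp: mult.assoc)
  show "bounded_linear ?L"
    unfolding L by (intro bounded_linear_sum bounded_linear_mult_const bounded_linear_vec_nth)
  fix e :: real assume e: "e > 0"
  \<comment> \<open>The summand 1 keeps the divisor positive when \<open>v\<close> vanishes almost
    everywhere.\<close>
  define V where "V = (\<integral>y. \<bar>v y\<bar> \<partial>lebesgue) + 1"
  have V: "V > 0" by (simp add: V_def add_nonneg_pos)
  obtain d where d: "d > 0" "\<And>z h. norm h < d \<Longrightarrow> \<bar>\<eta> (z + h) - \<eta> z - frechet_derivative \<eta> (at z) h\<bar> \<le> e / V * norm h"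
    using test_fun_uniform_linearization[OF \<eta>, of "e / V"] e V by auto
  show "\<exists>d>0. \<forall>y\<in>UNIV. norm (y - x) < d \<longrightarrow> norm (conv \<eta> v y - conv \<eta> v x - ?L (y - x)) \<le> e * norm (y - x)"
  proof (intro exI[of _ d] conjI ballI impI d(1))
    fix y assume y: "norm (y - x) < d"
    let ?h = "y - x"
    let ?r = "\<lambda>t. \<eta> (y - t) - \<eta> (x - t) - frechet_derivative \<eta> (at (x - t)) ?h"
    have r: "\<bar>?r t\<bar> \<le> e / V * norm ?h" for t
      using d(2)[OF y, of "x - t"] by (simp add: algebra_simps)
    have i1: "integrable lebesgue (\<lambda>t. \<eta> (z - t) * v t)" for z using conv_integrable[OF \<eta> v] by simp
    have i2: "integrable lebesgue (\<lambda>t. frechet_derivative \<eta> (at (x - t)) ?h * v t)"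
      using conv_integrable[OF test_fun_deriv[OF \<eta>] v] by simp
    have i3: "integrable lebesgue (\<lambda>t. ?r t * v t)"
      using i1 i2 by (simp add: left_diff_distrib)
    have "conv \<eta> v y - conv \<eta> v x - ?L ?h = (\<integral>t. ?r t * v t \<partial>lebesgue)"
      unfolding conv_def using i1 i2 by (simp add: left_diff_distrib)
    then have "norm (conv \<eta> v y - conv \<eta> v x - ?L ?h) = norm (\<integral>t. ?r t * v t \<partial>lebesgue)" by simp
    also have "\<dots> \<le> (\<integral>t. norm (?r t * v t) \<partial>lebesgue)" by (rule integral_norm_bound)
    also have "\<dots> \<le> (\<integral>t. e / V * norm ?h * \<bar>v t\<bar> \<partial>lebesgue)"
    proof (rule integral_mono)
      show "integrable lebesgue (\<lambda>t. norm (?r t * v t))" using i3 by (rule integrable_norm)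
      show "integrable lebesgue (\<lambda>t. e / V * norm ?h * \<bar>v t\<bar>)" using v by auto
      show "norm (?r t * v t) \<le> e / V * norm ?h * \<bar>v t\<bar>" for t
        using r[of t] by (simp only: real_norm_def abs_mult) (rule mult_right_mono, auto)
    qed
    also have "\<dots> = e / V * norm ?h * (V - 1)" by (simp add: V_def)
    also have "\<dots> \<le> e / V * norm ?h * V" using e V by (intro mult_left_mono) auto
    also have "\<dots> = e * norm ?h" using V by simp
    finally show "norm (conv \<eta> v y - conv \<eta> v x - ?L ?h) \<le> e * norm ?h" .
  qed
qed

text \<open>A directional derivative of a convolution is the convolution with the derivative of the
  kernel, which is again a test function; hence the induction over all kernels.\<close>

lemma conv_Ck_fun:
  fixes v :: "real^'n \<Rightarrow> real"
  assumes "test_fun U \<eta>" "integrable lebesgue v"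
  shows "Ck_fun k (conv \<eta> v)"
  using assms(1)
proof (induction k arbitrary: \<eta>)
  case 0
  then show ?case using conv_has_derivative[OF 0 assms(2)]
    by (auto intro!: continuous_at_imp_continuous_on has_derivative_continuous)
next
  case (Suc k)
  have "frechet_derivative (conv \<eta> v) (at x) = (\<lambda>h. conv (\<lambda>z. frechet_derivative \<eta> (at z) h) v x)" for x
    by (rule frechet_derivative_eqI[OF conv_has_derivative[OF Suc.prems assms(2)]])
  moreover have "Ck_fun k (\<lambda>x. conv (\<lambda>z. frechet_derivative \<eta> (at z) h) v x)" for h
    using Suc.IH[OF test_fun_deriv[OF Suc.prems], of h] by simp
  ultimately show ?case
    using conv_has_derivative[OF Suc.prems assms(2)] by (auto simp: differentiable_def)
qed

lemma pd_conv:
  fixes v :: "real^'n \<Rightarrow> real"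
  assumes "test_fun U \<eta>" "integrable lebesgue v"
  shows "pd j (conv \<eta> v) x = conv (pd j \<eta>) v x"
  unfolding pd_def frechet_derivative_eqI[OF conv_has_derivative[OF assms]] by (simp add: pd_def[abs_def])

lemma conv_eq_0_outside:
  assumes "\<And>z. norm z \<ge> d \<Longrightarrow> \<eta> z = 0" "\<And>x. x \<notin> K \<Longrightarrow> v x = 0" "x \<notin> {x + y | x y. x \<in> K \<and> y \<in> cball 0 d}"
  shows "conv \<eta> v x = 0"
proof -
  have "\<eta> (x - y) *\<^sub>R v y = 0" for y
  proof (rule ccontr)
    assume a: "\<eta> (x - y) *\<^sub>R v y \<noteq> 0"
    then have "y \<in> K" "norm (x - y) < d" using assms(1)[of "x - y"] assms(2)[of y] by (auto simp: not_le[symmetric])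
    moreover have "x = y + (x - y)" by simp
    ultimately have "x \<in> {x + y | x y. x \<in> K \<and> y \<in> cball 0 d}" by (metis (mono_tags, lifting) mem_Collect_eq mem_cball_0 less_imp_le)
    with assms(3) show False by blast
  qed
  then have "(\<lambda>y. \<eta> (x - y) *\<^sub>R v y) = (\<lambda>y. 0)" by (intro ext)
  then show ?thesis unfolding conv_def by simp
qed

lemma conv_test_fun:
  fixes v :: "real^'n \<Rightarrow> real"
  assumes "test_fun V \<eta>" "integrable lebesgue v" "\<And>z. norm z \<ge> d \<Longrightarrow> \<eta> z = 0"
    "compact K" "\<And>x. x \<notin> K \<Longrightarrow> v x = 0" "(\<Union>x\<in>K. cball x d) \<subseteq> U"
  shows "test_fun U (conv \<eta> v)"
proof (rule test_funI[of _ "{x + y | x y. x \<in> K \<and> y \<in> cball 0 d}"])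
  show "C_inf (conv \<eta> v)" using conv_Ck_fun[OF assms(1,2)] by (auto simp: C_inf_def)
  show "compact {x + y | x y. x \<in> K \<and> y \<in> cball 0 d}" by (intro compact_sums assms) auto
  show "{x + y | x y. x \<in> K \<and> y \<in> cball 0 d} \<subseteq> U" using assms(6) by (force simp: dist_norm)
  show "conv \<eta> v x = 0" if "x \<notin> {x + y | x y. x \<in> K \<and> y \<in> cball 0 d}" for x
    using conv_eq_0_outside[OF assms(3,5) that] .
qed

lemma conv_vec_nth:
  fixes v :: "real^'n \<Rightarrow> ('b::euclidean_space)^'m"
  assumes "test_fun V \<eta>" "integrable lebesgue v"
  shows "conv \<eta> v x $ i = conv \<eta> (\<lambda>y. v y $ i) x"
  using integral_bounded_linear[OF bounded_linear_vec_nth[of i] conv_integrable[OF assms, of x]]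
  by (simp add: conv_def)

lemma lebesgue_ex_borel:
  fixes f :: "'a::euclidean_space \<Rightarrow> 'b::euclidean_space"
  assumes "Lmeas f"
  obtains g where "g \<in> borel_measurable borel" "AE x in lebesgue. f x = g x"
proof -
  have "\<forall>b\<in>Basis. \<exists>g. g \<in> borel_measurable borel \<and> (AE x in lebesgue. f x \<bullet> b = g x)"
  proof
    fix b :: 'b assume "b \<in> Basis"
    have "Lmeas (\<lambda>x. f x \<bullet> b)" using assms by auto
    from completion_ex_borel_measurable_real[OF this] show "\<exists>g. g \<in> borel_measurable borel \<and> (AE x in lebesgue. f x \<bullet> b = g x)"
      by (auto intro: AE_completion)
  qed
  then obtain g where g: "\<And>b. b \<in> Basis \<Longrightarrow> g b \<in> borel_measurable borel"
      "\<And>b. b \<in> Basis \<Longrightarrow> AE x in lebesgue. f x \<bullet> b = g b x"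
    by metis
  show ?thesis
  proof (rule that[of "\<lambda>x. \<Sum>b\<in>Basis. g b x *\<^sub>R b"])
    show "(\<lambda>x. \<Sum>b\<in>Basis. g b x *\<^sub>R b) \<in> borel_measurable borel" using g(1) by auto
    have "AE x in lebesgue. \<forall>b\<in>Basis. f x \<bullet> b = g b x"
      using g(2) by (intro AE_finite_allI) auto
    then show "AE x in lebesgue. f x = (\<Sum>b\<in>Basis. g b x *\<^sub>R b)"
    proof eventually_elim
      case (elim x)
      have "f x = (\<Sum>b\<in>Basis. (f x \<bullet> b) *\<^sub>R b)" by (simp add: euclidean_representation)
      also have "\<dots> = (\<Sum>b\<in>Basis. g b x *\<^sub>R b)" using elim by (intro sum.cong) auto
      finally show ?case .
    qed
  qed
qed

lemma conv_cong_AE: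
  assumes "AE x in lebesgue. v x = w x"
    and "Lmeas v" "Lmeas w" "test_fun U \<eta>"
  shows "conv \<eta> v x = conv \<eta> w x"
proof -
  have [measurable]: "Lmeas (\<lambda>y. \<eta> (x - y))"
    by (rule continuous_imp_lebesgue_measurable)
      (auto intro!: continuous_on_compose2[OF test_fun_continuous[OF assms(4), of UNIV]] continuous_intros)
  show ?thesis
    unfolding conv_def using assms(2,3)
    by (intro integral_cong_AE) (use assms(1) in \<open>auto elim!: eventually_mono\<close>)
qed

text \<open>Passing to a Borel representative makes \<open>(x, z) \<mapsto> v (x - z)\<close> jointly measurable,
  which fails in general for functions that are only Lebesgue measurable.\<close>

lemma conv_approx:
  fixes v :: "real^'n \<Rightarrow> 'b::euclidean_space"
  assumes \<eta>: "test_fun U \<eta>" "\<And>z. \<eta> z \<ge> 0" "(\<integral>z. \<eta> z \<partial>lebesgue) = 1" "\<And>z. norm z \<ge> d \<Longrightarrow> \<eta> z = 0"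
    and v: "integrable lebesgue v" and p: "p \<ge> 1"
    and tr: "\<And>z. norm z < d \<Longrightarrow> Np p UNIV (\<lambda>x. v (z + x) - v x) \<le> e"
  shows "Np p UNIV (\<lambda>x. conv \<eta> v x - v x) \<le> e"
proof -
  have vm: "Lmeas v" using v by auto
  obtain w where w: "w \<in> borel_measurable borel" and vw: "AE x in lebesgue. v x = w x"
    using lebesgue_ex_borel[OF vm] by blast
  note [measurable] = w
  have wl: "Lmeas w" by (rule measurable_completion) simp
  have wi: "integrable lebesgue w" using v vw integrable_cong_AE[OF vm wl] by blast
  have [measurable]: "\<eta> \<in> borel_measurable borel" by (rule test_fun_measurable[OF \<eta>(1)])
  have cw: "conv \<eta> v = conv \<eta> w" using conv_cong_AE[OF vw vm wl \<eta>(1)] by auto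
  \<comment> \<open>The kernel is read as a probability density, so that the power of the averaged
    difference is bounded by Jensen's inequality.\<close>
  define M where "M = density lborel (\<lambda>z. ennreal (\<eta> z))"
  have \<eta>1: "(\<integral>\<^sup>+z. ennreal (\<eta> z) \<partial>lborel) = 1"
    using nn_integral_eq_integral[OF test_fun_integrable[OF \<eta>(1)]] \<eta>(2,3) by (simp add: nn_integral_completion)
  interpret M: prob_space M
    by (rule prob_spaceI) (simp add: M_def emeasure_density \<eta>1)
  have jen: "ennreal (norm (conv \<eta> w x - w x) powr p) \<le> (\<integral>\<^sup>+z. ennreal (\<eta> z) * ennreal (norm (w (x - z) - w x) powr p) \<partial>lborel)" for x
  proof -
    have ci: "integrable lebesgue (\<lambda>z. \<eta> z *\<^sub>R w (x - z))"
      using integrable_affine[OF conv_integrable[OF \<eta>(1) wi, of x], of "-1" x] by simp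
    have ci2: "integrable lebesgue (\<lambda>z. \<eta> z *\<^sub>R w x)"
      using test_fun_integrable[OF \<eta>(1)] by auto
    have "conv \<eta> w x = (\<integral>z. \<eta> z *\<^sub>R w (x - z) \<partial>lebesgue)"
      using integral_reflection[of "\<lambda>y. \<eta> (x - y) *\<^sub>R w y" x] by (simp add: conv_def)
    moreover have "w x = (\<integral>z. \<eta> z *\<^sub>R w x \<partial>lebesgue)" using \<eta>(3) test_fun_integrable[OF \<eta>(1)] by simp
    ultimately have "conv \<eta> w x - w x = (\<integral>z. \<eta> z *\<^sub>R (w (x - z) - w x) \<partial>lebesgue)"
      using ci ci2 by (simp add: scaleR_diff_right)
    then have "norm (conv \<eta> w x - w x) \<le> (\<integral>z. norm (\<eta> z *\<^sub>R (w (x - z) - w x)) \<partial>lebesgue)"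
      using integral_norm_bound[of lebesgue "\<lambda>z. \<eta> z *\<^sub>R (w (x - z) - w x)"] by simp
    also have "\<dots> = (\<integral>z. \<eta> z * norm (w (x - z) - w x) \<partial>lebesgue)" using \<eta>(2) by simp
    also have "\<dots> = (\<integral>z. \<eta> z * norm (w (x - z) - w x) \<partial>lborel)" by (rule integral_completion) measurable
    also have "\<dots> = (\<integral>z. norm (w (x - z) - w x) \<partial>M)"
      unfolding M_def using \<eta>(2) by (subst integral_density) auto
    finally have 1: "norm (conv \<eta> w x - w x) \<le> (\<integral>z. norm (w (x - z) - w x) \<partial>M)" .
    have "integrable lebesgue (\<lambda>z. norm (\<eta> z *\<^sub>R (w (x - z) - w x)))"
      using Bochner_Integration.integrable_diff[OF ci ci2] by (intro integrable_norm) (simp add: scaleR_diff_right)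
    then have "integrable lebesgue (\<lambda>z. \<eta> z * norm (w (x - z) - w x))" using \<eta>(2) by simp
    then have "integrable lborel (\<lambda>z. \<eta> z * norm (w (x - z) - w x))"
      by (subst (asm) integrable_completion) auto
    then have 2: "integrable M (\<lambda>z. norm (w (x - z) - w x))"
      unfolding M_def using \<eta>(2) by (subst integrable_density) auto
    have "ennreal (norm (conv \<eta> w x - w x) powr p) \<le> ennreal ((\<integral>z. norm (w (x - z) - w x) \<partial>M) powr p)"
      using 1 p by (intro ennreal_leI powr_mono2) auto
    also have "\<dots> \<le> (\<integral>\<^sup>+z. ennreal (norm (w (x - z) - w x) powr p) \<partial>M)"
      by (rule M.jensen_powr[OF 2]) (use p in auto)
    also have "\<dots> = (\<integral>\<^sup>+z. ennreal (\<eta> z) * ennreal (norm (w (x - z) - w x) powr p) \<partial>lborel)"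
      unfolding M_def by (subst nn_integral_density) auto
    finally show ?thesis .
  qed
  have tw: "(\<integral>\<^sup>+x. ennreal (norm (w (x - z) - w x) powr p) \<partial>lborel) \<le> e" if "norm z < d" for z
  proof -
    have "AE x in lebesgue. v (-z + x) = w (- z + x)" using AE_affine[OF vw, of 1 "-z"] by simp
    then have "AE x in lebesgue. v (-z + x) - v x = w (- z + x) - w x" using vw by eventually_elim simp
    then have "Np p UNIV (\<lambda>x. v (-z + x) - v x) = Np p UNIV (\<lambda>x. w (- z + x) - w x)" by (intro Np_cong_AE) auto
    with tr[of "-z"] that have "Np p UNIV (\<lambda>x. w (- z + x) - w x) \<le> e" by simp
    then show ?thesis by (simp add: Np_def nn_integral_completion)
  qed
  have "Np p UNIV (\<lambda>x. conv \<eta> v x - v x) = Np p UNIV (\<lambda>x. conv \<eta> w x - w x)"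
    unfolding cw using vw by (intro Np_cong_AE) (auto elim: eventually_mono)
  also have "\<dots> = (\<integral>\<^sup>+x. ennreal (norm (conv \<eta> w x - w x) powr p) \<partial>lborel)" by (simp add: Np_def nn_integral_completion)
  also have "\<dots> \<le> (\<integral>\<^sup>+x. (\<integral>\<^sup>+z. ennreal (\<eta> z) * ennreal (norm (w (x - z) - w x) powr p) \<partial>lborel) \<partial>lborel)"
    by (intro nn_integral_mono jen)
  \<comment> \<open>After exchanging the integrals, the inner one is the translation error for the
    shift by \<open>z\<close>; shifts of norm at least \<open>d\<close> carry no weight.\<close>
  also have "\<dots> = (\<integral>\<^sup>+z. (\<integral>\<^sup>+x. ennreal (\<eta> z) * ennreal (norm (w (x - z) - w x) powr p) \<partial>lborel) \<partial>lborel)"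
    by (rule lborel_pair.Fubini') measurable
  also have "\<dots> = (\<integral>\<^sup>+z. ennreal (\<eta> z) * (\<integral>\<^sup>+x. ennreal (norm (w (x - z) - w x) powr p) \<partial>lborel) \<partial>lborel)"
    by (intro nn_integral_cong nn_integral_cmult) measurable
  also have "\<dots> \<le> (\<integral>\<^sup>+z. ennreal (\<eta> z) * e \<partial>lborel)"
  proof (rule nn_integral_mono)
    fix z
    show "ennreal (\<eta> z) * (\<integral>\<^sup>+x. ennreal (norm (w (x - z) - w x) powr p) \<partial>lborel) \<le> ennreal (\<eta> z) * e"
      using tw[of z] \<eta>(4)[of z] by (cases "norm z < d") (auto intro: mult_left_mono)
  qed
  also have "\<dots> = e" using \<eta>1 by (simp add: nn_integral_multc)
  finally show ?thesis .
qed

section \<open>Mollifiers and cutoff functions\<close>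

lemma ex_mollifier:
  assumes "d > 0"
  obtains \<eta> :: "real^'n \<Rightarrow> real" where "test_fun UNIV \<eta>" "\<And>z. \<eta> z \<ge> 0" "(\<integral>z. \<eta> z \<partial>lebesgue) = 1" "\<And>z. norm z \<ge> d \<Longrightarrow> \<eta> z = 0"
proof -
  define f where "f x = flat_exp 0 (d^2 - x \<bullet> x)" for x :: "real^'n"
  have f0: "f z = 0" if "norm z \<ge> d" for z
    using that assms power_mono[OF that, of 2] by (simp add: f_def flat_exp_def power2_norm_eq_inner)
  have fpos: "f z > 0" if "norm z < d" for z
    using that assms power_strict_mono[OF that, of 2] by (simp add: f_def flat_exp_def power2_norm_eq_inner)
  have fnn: "f z \<ge> 0" for z by (simp add: f_def flat_exp_def)
  have ft: "test_fun UNIV f"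
    by (rule test_funI[of _ "cball 0 d"]) (use f0 Ck_fun_flat_exp in \<open>auto simp: C_inf_def f_def[abs_def]\<close>)
  define c where "c = (\<integral>z. f z \<partial>lebesgue)"
  have "c \<noteq> 0"
  proof
    assume "c = 0"
    then have "AE z in lebesgue. f z = 0"
      unfolding c_def using integral_nonneg_eq_0_iff_AE[OF test_fun_integrable[OF ft]] fnn by auto
    then have "AE z in lebesgue. z \<notin> ball (0::real^'n) d" by eventually_elim (metis fpos less_irrefl mem_ball_0)
    then have "ball (0::real^'n) d \<in> null_sets lebesgue" by (subst (asm) AE_iff_null_sets[symmetric]) auto
    then have "negligible (ball (0::real^'n) d)" by (simp add: negligible_iff_null_sets)
    then show False using assms open_not_negligible[of "ball (0::real^'n) d"] by auto
  qed
  moreover have "c \<ge> 0" unfolding c_def using fnn by simp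
  ultimately have c: "c > 0" by simp
  show ?thesis
  proof (rule that[of "\<lambda>x. (1/c) * f x"])
    show "test_fun UNIV (\<lambda>x. (1/c) * f x)" by (intro test_fun_mult_left C_inf_const ft)
    show "(\<integral>z. (1/c) * f z \<partial>lebesgue) = 1" using c by (simp add: c_def[symmetric])
  qed (use fnn f0 c in auto)
qed

text \<open>The cutoff is the mollified indicator of the closed \<open>d\<close>-neighbourhood of
  \<open>K\<close>. At a point of \<open>K\<close> the kernel sees only the value 1, and mollifying
  enlarges the support by at most another \<open>d\<close>, so twice \<open>d\<close> is the
  available room \<open>e\<close>.\<close>

lemma ex_cutoff:
  fixes K :: "(real^'n) set"
  assumes "compact K" "open U" "K \<subseteq> U"
  obtains \<theta> where "test_fun U \<theta>" "\<And>x. 0 \<le> \<theta> x" "\<And>x. \<theta> x \<le> 1" "\<And>x. x \<in> K \<Longrightarrow> \<theta> x = 1"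
proof -
  obtain e where e: "e > 0" "(\<Union>x\<in>K. cball x e) \<subseteq> U"
    using compact_subset_open_imp_cball_epsilon_subset[OF assms] by blast
  define d where "d = e / 2"
  have d: "d > 0" using e by (simp add: d_def)
  obtain \<eta> :: "real^'n \<Rightarrow> real" where \<eta>: "test_fun UNIV \<eta>" "\<And>z. \<eta> z \<ge> 0" "(\<integral>z. \<eta> z \<partial>lebesgue) = 1" "\<And>z. norm z \<ge> d \<Longrightarrow> \<eta> z = 0"
    using ex_mollifier[OF d] by blast
  define L where "L = {x + y | x y. x \<in> K \<and> y \<in> cball 0 d}"
  have L: "compact L" unfolding L_def by (intro compact_sums assms) auto
  have Li: "integrable lebesgue (indicator L :: _ \<Rightarrow> real)"
    using fmeasurableD[OF lmeasurable_compact[OF L]] fmeasurableD2[OF lmeasurable_compact[OF L]]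
    by (auto intro!: integrable_real_indicator simp: top.not_eq_extremum)
  let ?\<theta> = "conv \<eta> (indicator L :: _ \<Rightarrow> real)"
  have bnd: "0 \<le> \<eta> (x - y) * indicator L y" "\<eta> (x - y) * indicator L y \<le> \<eta> (x - y)" for x y
    using \<eta>(2) by (auto simp: indicator_def)
  have \<eta>i: "integrable lebesgue (\<lambda>y. \<eta> (x - y))" "(\<integral>y. \<eta> (x - y) \<partial>lebesgue) = 1" for x
    using integrable_affine[OF test_fun_integrable[OF \<eta>(1)], of "-1" x] integral_reflection[of \<eta> x] \<eta>(3) by auto
  show ?thesis
  proof (rule that)
    show "test_fun U ?\<theta>"
    proof (rule conv_test_fun[OF \<eta>(1) Li \<eta>(4) L])
      show "(\<Union>x\<in>L. cball x d) \<subseteq> U"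
      proof
        fix z assume "z \<in> (\<Union>x\<in>L. cball x d)"
        then obtain x y where xy: "x \<in> K" "norm y \<le> d" "dist (x + y) z \<le> d" unfolding L_def by auto
        have "dist x z \<le> dist x (x + y) + dist (x + y) z" by (rule dist_triangle)
        also have "\<dots> \<le> e" using xy by (simp add: d_def dist_norm)
        finally have "z \<in> cball x e" by simp
        then show "z \<in> U" using e(2) xy(1) by blast
      qed
    qed auto
    show "0 \<le> ?\<theta> x" for x unfolding conv_def using bnd by simp
    show "?\<theta> x \<le> 1" for x
    proof -
      have "?\<theta> x \<le> (\<integral>y. \<eta> (x - y) \<partial>lebesgue)"
        unfolding conv_def using bnd conv_integrable[OF \<eta>(1) Li, of x] by (intro integral_mono \<eta>i) auto
      then show ?thesis using \<eta>i by simp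
    qed
    show "?\<theta> x = 1" if "x \<in> K" for x
    proof -
      have "\<eta> (x - y) * indicator L y = \<eta> (x - y)" for y
      proof (cases "norm (x - y) \<ge> d")
        case False
        have "y = x + (y - x)" "y - x \<in> cball 0 d" using False by (auto simp: norm_minus_commute)
        then have "y \<in> L" unfolding L_def using that by blast
        then show ?thesis by simp
      qed (use \<eta>(4) in auto)
      then have "(\<lambda>y. \<eta> (x - y) *\<^sub>R indicator L y) = (\<lambda>y. \<eta> (x - y))" by (intro ext) simp
      then show ?thesis unfolding conv_def using \<eta>i by simp
    qed
  qed
qed

subsection \<open>Sobolev functions with zero boundary values\<close>

text \<open>The closure of the test functions in the norm of function and gradient together. Both
  members of the pair live on the whole space and vanish off \<open>U\<close>, so extension by zero
  is built in and enlarging \<open>U\<close> changes nothing.\<close>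

definition Sob0 :: "real \<Rightarrow> (real^'n) set \<Rightarrow> (real^'n \<Rightarrow> real^'m) \<Rightarrow> (real^'n \<Rightarrow> real^'n^'m) \<Rightarrow> bool" where
  "Sob0 p U v H \<longleftrightarrow> v \<in> borel_measurable lebesgue \<and> H \<in> borel_measurable lebesgue \<and>
     (\<forall>x. x \<notin> U \<longrightarrow> v x = 0 \<and> H x = 0) \<and>
     (\<forall>e>0. \<exists>\<psi>. test_fun_vec U \<psi> \<and> Np p UNIV (\<lambda>x. \<psi> x - v x) \<le> ennreal e \<and>
        Np p UNIV (\<lambda>x. grad \<psi> x - H x) \<le> ennreal e)"

lemma test_fun_vec_nth: "test_fun_vec U \<psi> \<Longrightarrow> test_fun U (\<lambda>x. \<psi> x $ i)"
  by (simp add: test_fun_vec_def)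

lemma test_fun_vec_support:
  assumes "test_fun_vec U \<psi>"
  obtains K where "compact K" "K \<subseteq> U" "\<And>x. x \<notin> K \<Longrightarrow> \<psi> x = 0" "\<And>x. x \<notin> K \<Longrightarrow> grad \<psi> x = 0"
proof -
  have "\<forall>i. \<exists>K. compact K \<and> K \<subseteq> U \<and> (\<forall>x. x \<notin> K \<longrightarrow> \<psi> x $ i = 0)"
    using test_fun_support[OF test_fun_vec_nth[OF assms]] by metis
  then obtain K where K: "\<And>i. compact (K i)" "\<And>i. K i \<subseteq> U" "\<And>i x. x \<notin> K i \<Longrightarrow> \<psi> x $ i = 0" by metis
  show ?thesis
  proof (rule that[of "\<Union>i\<in>UNIV. K i"])
    show "compact (\<Union>i\<in>UNIV. K i)" using K by (intro compact_UN) auto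
    show "grad \<psi> x = 0" if "x \<notin> (\<Union>i\<in>UNIV. K i)" for x
    proof -
      have "pd j (\<lambda>y. \<psi> y $ i) x = 0" for i j
        by (rule pd_0_outside[OF compact_imp_closed[OF K(1)[of i]]]) (use that K(3) in auto)
      then show ?thesis by (simp add: grad_def vec_eq_iff)
    qed
  qed (use K in \<open>auto simp: vec_eq_iff\<close>)
qed

lemma test_fun_vec_continuous: "test_fun_vec U \<psi> \<Longrightarrow> continuous_on UNIV \<psi>"
  using test_fun_continuous[OF test_fun_vec_nth, of U \<psi>] continuous_on_vec_lambda[of UNIV "\<lambda>i x. \<psi> x $ i"] by simp

lemma grad_continuous: "test_fun_vec U \<psi> \<Longrightarrow> continuous_on UNIV (grad \<psi>)"
  unfolding grad_def
  by (intro continuous_on_vec_lambda test_fun_continuous[of U] test_fun_pd test_fun_vec_nth)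

lemma test_fun_vec_measurable:
  assumes "test_fun_vec U \<psi>"
  shows "\<psi> \<in> borel_measurable lebesgue" "grad \<psi> \<in> borel_measurable lebesgue"
  using test_fun_vec_continuous[OF assms] grad_continuous[OF assms]
  by (auto intro: continuous_imp_lebesgue_measurable)

lemma continuous_compact_support_Np_finite:
  fixes f :: "real^'n \<Rightarrow> 'b::euclidean_space"
  assumes "continuous_on UNIV f" "compact K" "\<And>x. x \<notin> K \<Longrightarrow> f x = 0" "p \<ge> 0"
  shows "Np p UNIV f < \<infinity>"
proof -
  obtain B where B: "B > 0" "\<And>x. norm (f x) \<le> B"
    using continuous_compact_support_bounded[OF assms(1-3)] by metis
  have "Np p UNIV f \<le> (\<integral>\<^sup>+x. ennreal (B powr p) * indicator K x \<partial>lebesgue)"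
    unfolding Np_def
  proof (rule nn_integral_mono)
    show "ennreal (norm (f x) powr p) * indicator UNIV x \<le> ennreal (B powr p) * indicator K x" for x
      using B assms(3)[of x] assms(4) by (cases "x \<in> K") (auto intro!: ennreal_leI powr_mono2)
  qed
  also have "\<dots> < \<infinity>"
    using fmeasurableD[OF lmeasurable_compact[OF assms(2)]] fmeasurableD2[OF lmeasurable_compact[OF assms(2)]]
    by (auto simp: nn_integral_cmult_indicator ennreal_mult_less_top top.not_eq_extremum)
  finally show ?thesis .
qed

lemma test_fun_vec_Np_finite:
  assumes "test_fun_vec U \<psi>" "p \<ge> 0"
  shows "Np p UNIV \<psi> < \<infinity>" "Np p UNIV (grad \<psi>) < \<infinity>"
  using test_fun_vec_support[OF assms(1)] test_fun_vec_continuous[OF assms(1)] grad_continuous[OF assms(1)] assms(2)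
  by (metis continuous_compact_support_Np_finite)+

lemma test_fun_vec_add: "test_fun_vec U f \<Longrightarrow> test_fun_vec U g \<Longrightarrow> test_fun_vec U (\<lambda>x. f x + g x)"
  by (simp add: test_fun_vec_def test_fun_add)

lemma grad_add:
  "test_fun_vec U f \<Longrightarrow> test_fun_vec U g \<Longrightarrow> grad (\<lambda>x. f x + g x) x = grad f x + grad g x"
  by (simp add: grad_def vec_eq_iff pd_add test_fun_C_inf[OF test_fun_vec_nth])

lemma Sob0_measurable: "Sob0 p U v H \<Longrightarrow> v \<in> borel_measurable lebesgue" "Sob0 p U v H \<Longrightarrow> H \<in> borel_measurable lebesgue"
  by (auto simp: Sob0_def)

lemma Sob0_outside: "Sob0 p U v H \<Longrightarrow> x \<notin> U \<Longrightarrow> v x = 0" "Sob0 p U v H \<Longrightarrow> x \<notin> U \<Longrightarrow> H x = 0"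
  by (auto simp: Sob0_def)

lemma Sob0_approx:
  assumes "Sob0 p U v H" "e > 0"
  obtains \<psi> where "test_fun_vec U \<psi>" "Np p UNIV (\<lambda>x. \<psi> x - v x) \<le> ennreal e" "Np p UNIV (\<lambda>x. grad \<psi> x - H x) \<le> ennreal e"
  using assms unfolding Sob0_def by meson

lemma Np_finite_from_approx:
  fixes v f :: "real^'n \<Rightarrow> 'b::euclidean_space"
  assumes "Lmeas v" "Lmeas f" "p \<ge> 0"
    "Np p UNIV f < \<infinity>" "Np p UNIV (\<lambda>x. f x - v x) < \<infinity>"
  shows "Np p UNIV v < \<infinity>"
proof -
  have "Np p UNIV (\<lambda>x. f x - (f x - v x)) \<le> ennreal (2 powr p) * (Np p UNIV f + Np p UNIV (\<lambda>x. f x - v x))"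
    using assms by (intro Np_diff) auto
  also have "\<dots> < \<infinity>" using assms(4,5) by (auto simp: ennreal_mult_less_top)
  finally show ?thesis by simp
qed

lemma Sob0_finite:
  assumes "Sob0 p U v H" "p \<ge> 0"
  shows "Np p UNIV v < \<infinity>" "Np p UNIV H < \<infinity>"
proof -
  have one: "N < \<infinity>" if "N \<le> ennreal 1" for N using that by (metis ennreal_less_top infinity_ennreal_def le_less_trans)
  obtain \<psi> where \<psi>: "test_fun_vec U \<psi>" "Np p UNIV (\<lambda>x. \<psi> x - v x) \<le> ennreal 1" "Np p UNIV (\<lambda>x. grad \<psi> x - H x) \<le> ennreal 1"
    using Sob0_approx[OF assms(1), of 1] by auto
  show "Np p UNIV v < \<infinity>"
    using Np_finite_from_approx[OF Sob0_measurable(1)[OF assms(1)] test_fun_vec_measurable(1)[OF \<psi>(1)] assms(2) test_fun_vec_Np_finite(1)[OF \<psi>(1) assms(2)] one[OF \<psi>(2)]] .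
  show "Np p UNIV H < \<infinity>"
    using Np_finite_from_approx[OF Sob0_measurable(2)[OF assms(1)] test_fun_vec_measurable(2)[OF \<psi>(1)] assms(2) test_fun_vec_Np_finite(2)[OF \<psi>(1) assms(2)] one[OF \<psi>(3)]] .
qed

lemma Sob0_closed:
  assumes v: "Lmeas v" and H: "Lmeas H"
    and out: "\<And>x. x \<notin> U \<Longrightarrow> v x = 0" "\<And>x. x \<notin> U \<Longrightarrow> H x = 0" and p: "p \<ge> 0"
    and ex: "\<And>e. e > 0 \<Longrightarrow> \<exists>v' H'. Sob0 p U v' H' \<and> Np p UNIV (\<lambda>x. v' x - v x) \<le> ennreal e \<and> Np p UNIV (\<lambda>x. H' x - H x) \<le> ennreal e"
  shows "Sob0 p U v H"
  unfolding Sob0_def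
proof (intro conjI allI impI v H)
  fix e :: real assume e: "e > 0"
  define e' where "e' = e / (2 * 2 powr p)"
  have e': "e' > 0" using e by (simp add: e'_def)
  have ee: "ennreal (2 powr p) * (ennreal e' + ennreal e') = ennreal e"
    using e e' by (simp add: ennreal_plus[symmetric] ennreal_mult[symmetric] e'_def del: ennreal_plus)
  obtain v' H' where 1: "Sob0 p U v' H'" "Np p UNIV (\<lambda>x. v' x - v x) \<le> ennreal e'" "Np p UNIV (\<lambda>x. H' x - H x) \<le> ennreal e'"
    using ex[OF e'] by blast
  obtain \<psi> where 2: "test_fun_vec U \<psi>" "Np p UNIV (\<lambda>x. \<psi> x - v' x) \<le> ennreal e'" "Np p UNIV (\<lambda>x. grad \<psi> x - H' x) \<le> ennreal e'"
    using Sob0_approx[OF 1(1) e'] by blast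
  note m = test_fun_vec_measurable[OF 2(1)] Sob0_measurable[OF 1(1)] v H
  have "Np p UNIV (\<lambda>x. \<psi> x - v x) \<le> ennreal (2 powr p) * (Np p UNIV (\<lambda>x. \<psi> x - v' x) + Np p UNIV (\<lambda>x. v' x - v x))"
    using m p by (intro Np_triangle) auto
  also have "\<dots> \<le> ennreal (2 powr p) * (ennreal e' + ennreal e')" using 1 2 by (intro mult_left_mono add_mono) auto
  finally have A: "Np p UNIV (\<lambda>x. \<psi> x - v x) \<le> ennreal e" unfolding ee .
  have "Np p UNIV (\<lambda>x. grad \<psi> x - H x) \<le> ennreal (2 powr p) * (Np p UNIV (\<lambda>x. grad \<psi> x - H' x) + Np p UNIV (\<lambda>x. H' x - H x))"
    using m p by (intro Np_triangle) auto
  also have "\<dots> \<le> ennreal (2 powr p) * (ennreal e' + ennreal e')" using 1 2 by (intro mult_left_mono add_mono) auto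
  finally have "Np p UNIV (\<lambda>x. grad \<psi> x - H x) \<le> ennreal e" unfolding ee .
  with A 2(1) show "\<exists>\<psi>. test_fun_vec U \<psi> \<and> Np p UNIV (\<lambda>x. \<psi> x - v x) \<le> ennreal e \<and> Np p UNIV (\<lambda>x. grad \<psi> x - H x) \<le> ennreal e"
    by blast
qed (use out in auto)

lemma Sob0_test_fun:
  assumes "test_fun_vec U \<psi>" "p > 0" shows "Sob0 p U \<psi> (grad \<psi>)"
proof -
  obtain K where K: "compact K" "K \<subseteq> U" "\<And>x. x \<notin> K \<Longrightarrow> \<psi> x = 0" "\<And>x. x \<notin> K \<Longrightarrow> grad \<psi> x = 0"
    using test_fun_vec_support[OF assms(1)] by metis
  have "\<psi> x = 0 \<and> grad \<psi> x = 0" if "x \<notin> U" for x using that K by (meson subsetD)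
  moreover have "Np p UNIV (\<lambda>x. \<psi> x - \<psi> x) \<le> ennreal e" "Np p UNIV (\<lambda>x. grad \<psi> x - grad \<psi> x) \<le> ennreal e" for e
    using assms(2) by (simp_all add: Np_zero)
  ultimately show ?thesis
    unfolding Sob0_def using assms(1) test_fun_vec_measurable[OF assms(1)]
    by (intro conjI allI impI exI[of _ \<psi>]) auto
qed

lemma grad_const_0: "grad (\<lambda>x::real^'n. 0 :: real^'m) x = 0"
proof -
  have "pd j (\<lambda>y::real^'n. 0) x = 0" for j and x :: "real^'n"
    by (rule pd_0_outside[of "{}"]) auto
  then show ?thesis by (simp add: grad_def vec_eq_iff)
qed

lemma Sob0_zero: "p > 0 \<Longrightarrow> Sob0 p U (\<lambda>x. 0) (\<lambda>x. 0)"
  using Sob0_test_fun[of U "\<lambda>x. 0" p] grad_const_0 by (simp add: test_fun_vec_def test_fun_0 grad_const_0[abs_def])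

lemma Sob0_mono: "Sob0 p U v H \<Longrightarrow> U \<subseteq> V \<Longrightarrow> Sob0 p V v H"
  unfolding Sob0_def test_fun_vec_def by (meson subsetD test_fun_mono)

lemma Sob0_add:
  assumes 1: "Sob0 p U v H" and 2: "Sob0 p U v' H'" and p: "p \<ge> 0"
  shows "Sob0 p U (\<lambda>x. v x + v' x) (\<lambda>x. H x + H' x)"
  unfolding Sob0_def
proof (intro conjI allI impI)
  note m = Sob0_measurable[OF 1] Sob0_measurable[OF 2]
  show "Lmeas (\<lambda>x. v x + v' x)" "Lmeas (\<lambda>x. H x + H' x)" using m by auto
  show "v x + v' x = 0" "H x + H' x = 0" if "x \<notin> U" for x using Sob0_outside[OF 1 that] Sob0_outside[OF 2 that] by auto
  fix e :: real assume e: "e > 0"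
  define e' where "e' = e / (2 * 2 powr p)"
  have e': "e' > 0" using e by (simp add: e'_def)
  have ee: "ennreal (2 powr p) * (ennreal e' + ennreal e') = ennreal e"
    using e e' by (simp add: ennreal_plus[symmetric] ennreal_mult[symmetric] e'_def del: ennreal_plus)
  obtain f where f: "test_fun_vec U f" "Np p UNIV (\<lambda>x. f x - v x) \<le> ennreal e'" "Np p UNIV (\<lambda>x. grad f x - H x) \<le> ennreal e'"
    using Sob0_approx[OF 1 e'] by blast
  obtain g where g: "test_fun_vec U g" "Np p UNIV (\<lambda>x. g x - v' x) \<le> ennreal e'" "Np p UNIV (\<lambda>x. grad g x - H' x) \<le> ennreal e'"
    using Sob0_approx[OF 2 e'] by blast
  note m' = test_fun_vec_measurable[OF f(1)] test_fun_vec_measurable[OF g(1)]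
  have "Np p UNIV (\<lambda>x. (f x - v x) + (g x - v' x)) \<le> ennreal (2 powr p) * (Np p UNIV (\<lambda>x. f x - v x) + Np p UNIV (\<lambda>x. g x - v' x))"
    using m m' p by (intro Np_add) auto
  also have "\<dots> \<le> ennreal (2 powr p) * (ennreal e' + ennreal e')" using f g by (intro mult_left_mono add_mono) auto
  finally have A: "Np p UNIV (\<lambda>x. (f x + g x) - (v x + v' x)) \<le> ennreal e" unfolding ee by (simp add: algebra_simps)
  have "Np p UNIV (\<lambda>x. (grad f x - H x) + (grad g x - H' x)) \<le> ennreal (2 powr p) * (Np p UNIV (\<lambda>x. grad f x - H x) + Np p UNIV (\<lambda>x. grad g x - H' x))"
    using m m' p by (intro Np_add) auto
  also have "\<dots> \<le> ennreal (2 powr p) * (ennreal e' + ennreal e')" using f g by (intro mult_left_mono add_mono) auto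
  finally have "Np p UNIV (\<lambda>x. grad (\<lambda>x. f x + g x) x - (H x + H' x)) \<le> ennreal e"
    unfolding ee by (simp add: algebra_simps grad_add[OF f(1) g(1)])
  with A show "\<exists>\<psi>. test_fun_vec U \<psi> \<and> Np p UNIV (\<lambda>x. \<psi> x - (v x + v' x)) \<le> ennreal e \<and> Np p UNIV (\<lambda>x. grad \<psi> x - (H x + H' x)) \<le> ennreal e"
    using test_fun_vec_add[OF f(1) g(1)] by blast
qed

lemma Sob0_sum:
  assumes "\<And>i::nat. Sob0 p U (v i) (H i)" "p > 0"
  shows "Sob0 p U (\<lambda>x. \<Sum>i<n. v i x) (\<lambda>x. \<Sum>i<n. H i x)"
  by (induction n) (use assms in \<open>auto intro!: Sob0_zero Sob0_add\<close>)

lemma disjoint_family_eqI: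
  assumes "disjoint_family Q" "x \<in> Q i" "x \<in> Q j" shows "i = j"
  using assms unfolding disjoint_family_on_def by blast

text \<open>Countable pasting. A partial sum of the pieces agrees with the pasted function on the
  first sets and is 0 elsewhere; dominated convergence, with the pasted function itself as majorant,
  gives convergence in \<open>Np\<close>, and the space is closed. The summability hypotheses are
  exactly the finiteness of that majorant.\<close>

lemma Sob0_patch:
  fixes v :: "nat \<Rightarrow> real^'n \<Rightarrow> real^'m"
  assumes S: "\<And>i. Sob0 p U (v i) (H i)" and p: "p > 0" and Q: "disjoint_family Q" "\<And>i. Q i \<in> sets lebesgue" "\<And>i. Q i \<subseteq> U"
    and out: "\<And>i x. x \<notin> Q i \<Longrightarrow> v i x = 0 \<and> H i x = 0"
    and fin: "(\<Sum>i. Np p UNIV (v i)) < \<infinity>" "(\<Sum>i. Np p UNIV (H i)) < \<infinity>"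
  obtains V G where "Sob0 p U V G" "\<And>i x. x \<in> Q i \<Longrightarrow> G x = H i x" "\<And>x. x \<notin> (\<Union>i. Q i) \<Longrightarrow> G x = 0"
    "Np p UNIV V = (\<Sum>i. Np p UNIV (v i))" "Np p UNIV G = (\<Sum>i. Np p UNIV (H i))"
proof -
  \<comment> \<open>Stated for an arbitrary sequence of functions because it is applied once to the
    functions and once to their gradients.\<close>
  have *: "\<exists>f. f \<in> borel_measurable lebesgue \<and> (\<forall>i. \<forall>x\<in>Q i. f x = w i x) \<and> (\<forall>x. x \<notin> (\<Union>i. Q i) \<longrightarrow> f x = 0) \<and>
      Np p UNIV f = (\<Sum>i. Np p UNIV (w i)) \<and> (\<lambda>n. Np p UNIV (\<lambda>x. (\<Sum>i<n. w i x) - f x)) \<longlonglongrightarrow> 0"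
    if w: "\<And>i. w i \<in> borel_measurable lebesgue" "\<And>i x. x \<notin> Q i \<Longrightarrow> w i x = 0" "(\<Sum>i. Np p UNIV (w i)) < \<infinity>"
    for w :: "nat \<Rightarrow> real^'n \<Rightarrow> 'c::euclidean_space"
  proof -
    define f where "f x = (if \<exists>i. x \<in> Q i then w (SOME i. x \<in> Q i) x else 0)" for x
    have "(SOME i. x \<in> Q i) = i" if "x \<in> Q i" for x i
      using that by (intro some_equality disjoint_family_eqI[OF Q(1)])
    then have f: "f x = w i x" if "x \<in> Q i" for x i using that by (auto simp: f_def)
    have f0: "f x = 0" if "x \<notin> (\<Union>i. Q i)" for x using that by (auto simp: f_def)
    have eq: "(\<Sum>i<n. w i x) = (if x \<in> (\<Union>i<n. Q i) then f x else 0)" for n x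
    proof (cases "x \<in> (\<Union>i<n. Q i)")
      case True
      then obtain k where k: "k < n" "x \<in> Q k" by auto
      have "(\<Sum>i<n. w i x) = (\<Sum>i<n. if i = k then w k x else 0)"
        using w(2)[of x] disjoint_family_eqI[OF Q(1) k(2)] by (intro sum.cong) (simp, metis)
      then show ?thesis using True k f by simp
    qed (use w(2) in \<open>auto intro!: sum.neutral\<close>)
    have lim: "(\<lambda>n. \<Sum>i<n. w i x) \<longlonglongrightarrow> f x" for x
    proof (cases "x \<in> (\<Union>i. Q i)")
      case True
      then obtain k where "x \<in> Q k" by auto
      then have "(\<Sum>i<n. w i x) = f x" if "n \<ge> Suc k" for n using that by (auto simp: eq)
      then show ?thesis by (intro tendsto_eventually) (auto simp: eventually_sequentially intro!: exI[of _ "Suc k"])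
    qed (auto simp: eq f0)
    note [measurable] = w(1)
    have fm[measurable]: "Lmeas f"
      by (rule borel_measurable_LIMSEQ_metric[of "\<lambda>n x. \<Sum>i<n. w i x"]) (use lim in auto)
    have "Np p UNIV f = Np p (\<Union>i. Q i) f" using f0 p by (intro Np_UNIV_supp) auto
    also have "\<dots> = (\<Sum>i. Np p (Q i) f)" by (rule Np_disjoint_UN[OF fm Q(2,1)])
    also have "\<dots> = (\<Sum>i. Np p UNIV (w i))"
      using f Np_UNIV_supp[of "Q i" "w i" p for i] w(2) p by (intro arg_cong[where f=suminf] ext) (auto intro!: Np_cong_AE)
    finally have N: "Np p UNIV f = (\<Sum>i. Np p UNIV (w i))" .
    have "(\<lambda>n. Np p UNIV (\<lambda>x. (\<Sum>i<n. w i x) - f x)) \<longlonglongrightarrow> 0"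
    proof (rule Np_tendsto_0_dominated[OF _ p])
      show "AE x in lebesgue. (\<lambda>n. (\<Sum>i<n. w i x) - f x) \<longlonglongrightarrow> 0"
        using LIM_zero[OF lim] by (intro AE_I2)
      show "ennreal (norm ((\<Sum>i<n. w i x) - f x) powr p) \<le> ennreal (norm (f x) powr p)" for n x
        unfolding eq by (auto simp: p)
      show "(\<integral>\<^sup>+x. ennreal (norm (f x) powr p) \<partial>lebesgue) < \<infinity>" using N w(3) by (simp add: Np_def)
    qed measurable
    with fm f f0 N show ?thesis by blast
  qed
  obtain V where V: "Lmeas V" "\<forall>x. x \<notin> (\<Union>i. Q i) \<longrightarrow> V x = 0" "Np p UNIV V = (\<Sum>i. Np p UNIV (v i))"
     "(\<lambda>n. Np p UNIV (\<lambda>x. (\<Sum>i<n. v i x) - V x)) \<longlonglongrightarrow> 0"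
    using *[OF Sob0_measurable(1)[OF S] _ fin(1)] out by blast
  obtain G where G: "Lmeas G" "\<forall>i. \<forall>x\<in>Q i. G x = H i x" "\<forall>x. x \<notin> (\<Union>i. Q i) \<longrightarrow> G x = 0"
     "Np p UNIV G = (\<Sum>i. Np p UNIV (H i))" "(\<lambda>n. Np p UNIV (\<lambda>x. (\<Sum>i<n. H i x) - G x)) \<longlonglongrightarrow> 0"
    using *[OF Sob0_measurable(2)[OF S] _ fin(2)] out by blast
  have "Sob0 p U V G"
  proof (rule Sob0_closed)
    show "V x = 0" "G x = 0" if "x \<notin> U" for x using V(2) G(3) Q(3) that by blast+
    fix e :: real assume e: "e > 0"
    have "eventually (\<lambda>n. Np p UNIV (\<lambda>x. (\<Sum>i<n. v i x) - V x) < ennreal e \<and> Np p UNIV (\<lambda>x. (\<Sum>i<n. H i x) - G x) < ennreal e) sequentially"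
      using V(4) G(5) e by (intro eventually_conj order_tendstoD(2)[of _ 0]) auto
    then obtain n where "Np p UNIV (\<lambda>x. (\<Sum>i<n. v i x) - V x) < ennreal e" "Np p UNIV (\<lambda>x. (\<Sum>i<n. H i x) - G x) < ennreal e"
      by (auto simp: eventually_sequentially)
    with Sob0_sum[where v=v and H=H and n=n, OF S p] show "\<exists>v' H'. Sob0 p U v' H' \<and> Np p UNIV (\<lambda>x. v' x - V x) \<le> ennreal e \<and> Np p UNIV (\<lambda>x. H' x - G x) \<le> ennreal e"
      by (intro exI conjI less_imp_le)
  qed (use V G p in auto)
  with V G that show thesis by blast
qed

lemma Np_affine:
  fixes f :: "real^'n \<Rightarrow> 'b::euclidean_space"
  assumes "Lmeas f" "c \<noteq> 0"
  shows "Np p UNIV f = ennreal (\<bar>c\<bar> ^ CARD('n)) * Np p UNIV (\<lambda>x. f (t + c *\<^sub>R x))"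
  using nn_integral_affine[of "\<lambda>x. ennreal (norm (f x) powr p)" c t] assms by (simp add: Np_def)

lemma grad_affine:
  assumes "test_fun_vec U f"
  shows "grad (\<lambda>x. s *\<^sub>R f (d + c *\<^sub>R x)) x = (s * c) *\<^sub>R grad f (d + c *\<^sub>R x)"
proof -
  have "pd j (\<lambda>y. s * f (d + c *\<^sub>R y) $ i) x = s * c * pd j (\<lambda>y. f y $ i) (d + c *\<^sub>R x)" for i j
  proof -
    note C = test_fun_C_inf[OF test_fun_vec_nth[OF assms, of i]]
    have "pd j (\<lambda>y. s * f (d + c *\<^sub>R y) $ i) x = s * pd j (\<lambda>y. f (d + c *\<^sub>R y) $ i) x + pd j (\<lambda>x. s) x * f (d + c *\<^sub>R x) $ i"
      using pd_mult[OF C_inf_const C_inf_affine[OF C]] by simp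
    also have "pd j (\<lambda>x. s) x = 0" unfolding pd_def by (subst frechet_derivative_eqI[of _ "\<lambda>_. 0"]) auto
    finally show ?thesis using pd_affine[OF C, of j d c x] by simp
  qed
  then show ?thesis by (simp add: grad_def vec_eq_iff)
qed

text \<open>Multiplying by \<open>s\<close> makes the gradient scale-free: the shrunken copy takes
  the same gradient values as the original. Thus the gradient integral scales like the volume, while
  the function itself gains the factor \<open>s powr p\<close>.\<close>

lemma Sob0_scale:
  fixes v :: "real^'n \<Rightarrow> real^'m"
  assumes S: "Sob0 p U v H" and s: "s > 0" and UV: "\<And>y. y \<in> U \<Longrightarrow> a + s *\<^sub>R y \<in> V" and p: "p \<ge> 0"
  shows "Sob0 p V (\<lambda>x. s *\<^sub>R v ((1/s) *\<^sub>R (x - a))) (\<lambda>x. H ((1/s) *\<^sub>R (x - a)))"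
    and "Np p UNIV (\<lambda>x. s *\<^sub>R v ((1/s) *\<^sub>R (x - a))) = ennreal (s powr p * s ^ CARD('n)) * Np p UNIV v"
    and "Np p UNIV (\<lambda>x. H ((1/s) *\<^sub>R (x - a))) = ennreal (s ^ CARD('n)) * Np p UNIV H"
proof -
  define d where "d = - (1/s) *\<^sub>R a"
  have aff: "(1/s) *\<^sub>R (x - a) = d + (1/s) *\<^sub>R x" for x by (simp add: d_def scaleR_diff_right)
  have s1: "1 / s \<noteq> 0" using s by simp
  have Nps: "Np p UNIV (\<lambda>x. f (d + (1/s) *\<^sub>R x)) = ennreal (s ^ CARD('n)) * Np p UNIV f"
    if f: "Lmeas f" for f :: "real^'n \<Rightarrow> 'c::euclidean_space"
  proof -
    have "ennreal (s ^ CARD('n)) * Np p UNIV f = ennreal (s ^ CARD('n)) * (ennreal (\<bar>1/s\<bar> ^ CARD('n)) * Np p UNIV (\<lambda>x. f (d + (1/s) *\<^sub>R x)))"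
      using Np_affine[OF f s1, of p d] by simp
    also have "\<dots> = ennreal (s ^ CARD('n) * \<bar>1/s\<bar> ^ CARD('n)) * Np p UNIV (\<lambda>x. f (d + (1/s) *\<^sub>R x))"
      using s by (simp add: ennreal_mult mult.assoc)
    also have "s ^ CARD('n) * \<bar>1/s\<bar> ^ CARD('n) = 1" using s by (simp add: power_mult_distrib[symmetric])
    finally show ?thesis by simp
  qed
  note m = Sob0_measurable[OF S]
  have mc: "Lmeas (\<lambda>x. f (d + (1/s) *\<^sub>R x))"
    if "Lmeas f" for f :: "real^'n \<Rightarrow> 'c::euclidean_space"
    using measurable_compose_affine[OF that s1] .
  have Npv: "Np p UNIV (\<lambda>x. s *\<^sub>R f (d + (1/s) *\<^sub>R x)) = ennreal (s powr p * s ^ CARD('n)) * Np p UNIV f"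
    if f: "Lmeas f" for f :: "real^'n \<Rightarrow> 'c::euclidean_space"
    using s by (subst Np_cmult[OF mc[OF f]]) (auto simp: Nps[OF f] ennreal_mult mult.assoc)
  show "Np p UNIV (\<lambda>x. s *\<^sub>R v ((1/s) *\<^sub>R (x - a))) = ennreal (s powr p * s ^ CARD('n)) * Np p UNIV v"
    "Np p UNIV (\<lambda>x. H ((1/s) *\<^sub>R (x - a))) = ennreal (s ^ CARD('n)) * Np p UNIV H"
    unfolding aff using Npv[OF m(1)] Nps[OF m(2)] by auto
  show "Sob0 p V (\<lambda>x. s *\<^sub>R v ((1/s) *\<^sub>R (x - a))) (\<lambda>x. H ((1/s) *\<^sub>R (x - a)))"
    unfolding aff Sob0_def
  proof (intro conjI allI impI)
    show "Lmeas (\<lambda>x. s *\<^sub>R v (d + (1/s) *\<^sub>R x))" "Lmeas (\<lambda>x. H (d + (1/s) *\<^sub>R x))"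
      using mc[OF m(1)] mc[OF m(2)] by auto
    show "s *\<^sub>R v (d + (1/s) *\<^sub>R x) = 0" "H (d + (1/s) *\<^sub>R x) = 0" if "x \<notin> V" for x
    proof -
      have "x = a + s *\<^sub>R (d + (1/s) *\<^sub>R x)" using s by (simp add: d_def scaleR_add_right scaleR_diff_right)
      then have "d + (1/s) *\<^sub>R x \<notin> U" using UV that by metis
      then show "s *\<^sub>R v (d + (1/s) *\<^sub>R x) = 0" "H (d + (1/s) *\<^sub>R x) = 0" using Sob0_outside[OF S] by auto
    qed
    fix e :: real assume e: "e > 0"
    define c where "c = max (s powr p * s ^ CARD('n)) (s ^ CARD('n))"
    have c: "c > 0" "s powr p * s ^ CARD('n) \<le> c" "s ^ CARD('n) \<le> c" using s by (auto simp: c_def less_max_iff_disj)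
    obtain \<psi> where \<psi>: "test_fun_vec U \<psi>" "Np p UNIV (\<lambda>x. \<psi> x - v x) \<le> ennreal (e/c)" "Np p UNIV (\<lambda>x. grad \<psi> x - H x) \<le> ennreal (e/c)"
      using Sob0_approx[OF S, of "e/c"] e c by auto
    note m' = test_fun_vec_measurable[OF \<psi>(1)]
    let ?\<psi> = "\<lambda>x. s *\<^sub>R \<psi> (d + (1/s) *\<^sub>R x)"
    have le: "ennreal k * N \<le> ennreal e" if "k \<le> c" "N \<le> ennreal (e/c)" "k \<ge> 0" for k N
    proof -
      have "ennreal k * N \<le> ennreal c * ennreal (e/c)" using that by (intro mult_mono ennreal_leI) auto
      also have "\<dots> = ennreal e" using c e by (simp add: ennreal_mult[symmetric])
      finally show ?thesis .
    qed
    have "test_fun_vec V ?\<psi>"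
      unfolding test_fun_vec_def
    proof
      fix i
      have "test_fun V (\<lambda>x. \<psi> (d + (1/s) *\<^sub>R x) $ i)"
        by (rule test_fun_affine[OF test_fun_vec_nth[OF \<psi>(1)]])
          (use s UV in \<open>auto simp: d_def algebra_simps\<close>)
      then show "test_fun V (\<lambda>x. (s *\<^sub>R \<psi> (d + (1/s) *\<^sub>R x)) $ i)"
        using test_fun_mult_left[OF C_inf_const] by simp
    qed
    moreover have "Np p UNIV (\<lambda>x. ?\<psi> x - s *\<^sub>R v (d + (1/s) *\<^sub>R x)) \<le> ennreal e"
      using Npv[of "\<lambda>x. \<psi> x - v x"] m m' le[OF c(2) \<psi>(2)] s by (simp add: scaleR_diff_right)
    moreover have "Np p UNIV (\<lambda>x. grad ?\<psi> x - H (d + (1/s) *\<^sub>R x)) \<le> ennreal e"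
      using Nps[of "\<lambda>x. grad \<psi> x - H x"] m m' le[OF c(3) \<psi>(3)] s by (simp add: grad_affine[OF \<psi>(1)])
    ultimately show "\<exists>\<psi>. test_fun_vec V \<psi> \<and> Np p UNIV (\<lambda>x. \<psi> x - s *\<^sub>R v (d + (1/s) *\<^sub>R x)) \<le> ennreal e \<and> Np p UNIV (\<lambda>x. grad \<psi> x - H (d + (1/s) *\<^sub>R x)) \<le> ennreal e"
      by blast
  qed
qed

subsection \<open>Weak gradients\<close>

text \<open>A substitute for Hoelder's inequality that also covers \<open>p = 1\<close>. A value is
  either at most \<delta>, or bounded by \<open>\<delta> powr (1 - p)\<close> times its
  \<open>p\<close>-th power; \<delta> remains free for balancing the two terms.\<close>

lemma Np_imp_L1:
  fixes f :: "real^'n \<Rightarrow> 'b::euclidean_space"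
  assumes [measurable]: "Lmeas f" "K \<in> sets lebesgue" and p: "p \<ge> 1" and d: "\<delta> > 0"
  shows "(\<integral>\<^sup>+x\<in>K. ennreal (norm (f x)) \<partial>lebesgue) \<le> ennreal \<delta> * emeasure lebesgue K + ennreal (\<delta> powr (1 - p)) * Np p K f"
proof -
  have *: "t \<le> \<delta> + \<delta> powr (1 - p) * t powr p" if "t \<ge> 0" for t :: real
  proof (cases "t \<le> \<delta>")
    case False
    then have "t = t powr (1 - p) * t powr p" using d by (simp add: powr_add[symmetric])
    also have "\<dots> \<le> \<delta> powr (1 - p) * t powr p" using False d p by (intro mult_right_mono powr_mono2') auto
    finally show ?thesis using d by simp
  qed (simp add: add_increasing2)
  have "(\<integral>\<^sup>+x\<in>K. ennreal (norm (f x)) \<partial>lebesgue) \<le>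
      (\<integral>\<^sup>+x. ennreal \<delta> * indicator K x + ennreal (\<delta> powr (1 - p)) * (ennreal (norm (f x) powr p) * indicator K x) \<partial>lebesgue)"
    using * d by (intro nn_integral_mono)
      (auto simp: indicator_def ennreal_plus[symmetric] ennreal_mult[symmetric] simp del: ennreal_plus intro!: ennreal_leI)
  also have "\<dots> = ennreal \<delta> * emeasure lebesgue K + ennreal (\<delta> powr (1 - p)) * Np p K f"
    by (simp add: nn_integral_add nn_integral_cmult Np_def)
  finally show ?thesis .
qed

lemma emeasure_compact_lt_top: "compact (K :: (real^'n) set) \<Longrightarrow> emeasure lebesgue K < \<infinity>"
  using fmeasurableD2[OF lmeasurable_compact] by (simp add: top.not_eq_extremum)

lemma compact_sets_lebesgue: "compact (K :: (real^'n) set) \<Longrightarrow> K \<in> sets lebesgue"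
  by (rule fmeasurableD[OF lmeasurable_compact])

lemma Np_set_integrable:
  fixes f :: "real^'n \<Rightarrow> 'b::euclidean_space"
  assumes f: "Lmeas f" and K: "K \<in> sets lebesgue" "emeasure lebesgue K < \<infinity>" and p: "p \<ge> 1" and fin: "Np p K f < \<infinity>"
  shows "set_integrable lebesgue K f"
  unfolding set_integrable_def
proof (rule integrableI_bounded)
  show "Lmeas (\<lambda>x. indicator K x *\<^sub>R f x)" using f K by auto
  have "(\<integral>\<^sup>+x. ennreal (norm (indicator K x *\<^sub>R f x)) \<partial>lebesgue) = (\<integral>\<^sup>+x\<in>K. ennreal (norm (f x)) \<partial>lebesgue)"
    by (intro nn_integral_cong) (auto simp: indicator_def)
  also have "\<dots> \<le> ennreal 1 * emeasure lebesgue K + ennreal (1 powr (1 - p)) * Np p K f"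
    by (rule Np_imp_L1[OF f K(1) p]) simp
  also have "\<dots> < \<infinity>" using K fin by simp
  finally show "(\<integral>\<^sup>+x. ennreal (norm (indicator K x *\<^sub>R f x)) \<partial>lebesgue) < \<infinity>" .
qed

lemma Np_weighted_integrable:
  fixes f :: "real^'n \<Rightarrow> 'b::euclidean_space"
  assumes f: "Lmeas f" and p: "p \<ge> 1" and fin: "Np p U f < \<infinity>"
    and g: "test_fun U g"
  shows "integrable lebesgue (\<lambda>x. g x *\<^sub>R f x)"
proof -
  obtain K where K: "compact K" "K \<subseteq> U" "\<And>x. x \<notin> K \<Longrightarrow> g x = 0" using test_fun_support[OF g] by blast
  obtain B where B: "B > 0" "\<And>x. \<bar>g x\<bar> \<le> B" using test_fun_bounded[OF g] by blast
  have "Np p K f < \<infinity>" using Np_set_mono[OF K(2), of p f] fin by (rule le_less_trans)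
  then have "integrable lebesgue (\<lambda>x. indicator K x *\<^sub>R f x)"
    using Np_set_integrable[OF f compact_sets_lebesgue[OF K(1)] emeasure_compact_lt_top[OF K(1)] p] by (simp add: set_integrable_def)
  then have i: "integrable lebesgue (\<lambda>x. B *\<^sub>R (indicator K x *\<^sub>R f x))" by (rule integrable_scaleR_right)
  have [measurable]: "Lmeas g" using test_fun_integrable[OF g] by auto
  show ?thesis
  proof (rule Bochner_Integration.integrable_bound[OF i])
    show "Lmeas (\<lambda>x. g x *\<^sub>R f x)" using f by measurable
    show "AE x in lebesgue. norm (g x *\<^sub>R f x) \<le> norm (B *\<^sub>R indicator K x *\<^sub>R f x)"
      using B K(3) by (intro AE_I2) (auto simp: indicator_def intro!: mult_right_mono)
  qed
qed

lemma Np_weighted_integral_le: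
  fixes f :: "real^'n \<Rightarrow> 'b::euclidean_space"
  assumes f: "Lmeas f" and p: "p \<ge> 1"
    and g: "\<And>x. \<bar>g x\<bar> \<le> B" "\<And>x. x \<notin> K \<Longrightarrow> g x = 0" "K \<in> sets lebesgue" and B: "B \<ge> 0" and d: "\<delta> > 0"
    and gf: "integrable lebesgue (\<lambda>x. g x *\<^sub>R f x)"
  shows "ennreal (norm (\<integral>x. g x *\<^sub>R f x \<partial>lebesgue)) \<le> ennreal B * (ennreal \<delta> * emeasure lebesgue K + ennreal (\<delta> powr (1 - p)) * Np p K f)"
proof -
  have "ennreal (norm (\<integral>x. g x *\<^sub>R f x \<partial>lebesgue)) \<le> (\<integral>\<^sup>+x. ennreal (norm (g x *\<^sub>R f x)) \<partial>lebesgue)"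
    by (rule integral_norm_bound_ennreal[OF gf])
  also have "\<dots> \<le> (\<integral>\<^sup>+x. ennreal B * (ennreal (norm (f x)) * indicator K x) \<partial>lebesgue)"
    using g B by (intro nn_integral_mono) (auto simp: indicator_def ennreal_mult[symmetric] intro!: ennreal_leI mult_right_mono)
  also have "\<dots> = ennreal B * (\<integral>\<^sup>+x\<in>K. ennreal (norm (f x)) \<partial>lebesgue)"
    using f g(3) by (subst nn_integral_cmult) auto
  also have "\<dots> \<le> ennreal B * (ennreal \<delta> * emeasure lebesgue K + ennreal (\<delta> powr (1 - p)) * Np p K f)"
    by (intro mult_left_mono Np_imp_L1 f g(3) p d) auto
  finally show ?thesis .
qed

lemma vec_nth_measurable [simp, measurable (raw)]:
  fixes f :: "'a \<Rightarrow> ('b::euclidean_space)^'m"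
  shows "f \<in> borel_measurable M \<Longrightarrow> (\<lambda>x. f x $ i) \<in> borel_measurable M"
  by (rule borel_measurable_continuous_on[of "\<lambda>x. x $ i"]) (auto intro!: continuous_intros)

lemma Np_vec_nth_le: "p \<ge> 0 \<Longrightarrow> Np p U (\<lambda>x. f x $ i) \<le> Np p U f"
  by (intro Np_mono Finite_Cartesian_Product.norm_nth_le) auto

text \<open>The Sobolev space on \<open>U\<close> with its gradient carried along. Since test
  functions are supported in \<open>U\<close>, the identity may integrate over the whole space;
  values off \<open>U\<close> are only required to be measurable.\<close>

definition Wk :: "real \<Rightarrow> (real^'n) set \<Rightarrow> (real^'n \<Rightarrow> real^'m) \<Rightarrow> (real^'n \<Rightarrow> real^'n^'m) \<Rightarrow> bool" where
  "Wk p U u G \<longleftrightarrow> u \<in> borel_measurable lebesgue \<and> G \<in> borel_measurable lebesgue \<and>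
     Np p U u < \<infinity> \<and> Np p U G < \<infinity> \<and>
     (\<forall>\<psi> i j. test_fun U \<psi> \<longrightarrow> (\<integral>x. u x $ i * pd j \<psi> x \<partial>lebesgue) = - (\<integral>x. G x $ i $ j * \<psi> x \<partial>lebesgue))"

lemma WkD:
  assumes "Wk p U u G"
  shows "Lmeas u" "Lmeas G" "Np p U u < \<infinity>" "Np p U G < \<infinity>"
    "test_fun U \<psi> \<Longrightarrow> (\<integral>x. u x $ i * pd j \<psi> x \<partial>lebesgue) = - (\<integral>x. G x $ i $ j * \<psi> x \<partial>lebesgue)"
  using assms by (auto simp: Wk_def)

lemma Np_weighted_nth_integrable:
  fixes u :: "real^'n \<Rightarrow> real^'m" and G :: "real^'n \<Rightarrow> real^'n^'m"
  assumes p: "p \<ge> 1" and g: "test_fun U g"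
  shows "u \<in> borel_measurable lebesgue \<Longrightarrow> Np p U u < \<infinity> \<Longrightarrow> integrable lebesgue (\<lambda>x. u x $ i * g x)"
    and "G \<in> borel_measurable lebesgue \<Longrightarrow> Np p U G < \<infinity> \<Longrightarrow> integrable lebesgue (\<lambda>x. G x $ i $ j * g x)"
proof -
  have p0: "p \<ge> 0" using p by simp
  show "integrable lebesgue (\<lambda>x. u x $ i * g x)" if "Lmeas u" "Np p U u < \<infinity>"
    using Np_weighted_integrable[of "\<lambda>x. u x $ i", OF _ p _ g] that le_less_trans[OF Np_vec_nth_le[OF p0]]
    by (auto simp: mult.commute)
  show "integrable lebesgue (\<lambda>x. G x $ i $ j * g x)" if "Lmeas G" "Np p U G < \<infinity>"
    using Np_weighted_integrable[of "\<lambda>x. G x $ i $ j", OF _ p _ g] that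
      le_less_trans[OF order_trans[OF Np_vec_nth_le[OF p0, of _ "\<lambda>x. G x $ i"] Np_vec_nth_le[OF p0]]]
    by (auto simp: mult.commute)
qed

lemma Wk_integrable:
  assumes "Wk p U u G" "p \<ge> 1" "test_fun U g"
  shows "integrable lebesgue (\<lambda>x. u x $ i * g x)" "integrable lebesgue (\<lambda>x. G x $ i $ j * g x)"
  using Np_weighted_nth_integrable[OF assms(2,3)] WkD[OF assms(1)] by blast+

lemma Wk_mono:
  assumes "Wk p U u G" "V \<subseteq> U" shows "Wk p V u G"
  unfolding Wk_def
proof (intro conjI allI impI)
  show "Np p V u < \<infinity>" "Np p V G < \<infinity>"
    using WkD(3,4)[OF assms(1)] Np_set_mono[OF assms(2)] by (meson le_less_trans)+
  show "(\<integral>x. u x $ i * pd j \<psi> x \<partial>lebesgue) = - (\<integral>x. G x $ i $ j * \<psi> x \<partial>lebesgue)" if "test_fun V \<psi>" for \<psi> i j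
    by (rule WkD(5)[OF assms(1) test_fun_mono[OF that assms(2)]])
qed (use WkD[OF assms(1)] in auto)

lemma Np_add_finite:
  fixes f g :: "real^'n \<Rightarrow> 'b::euclidean_space"
  assumes "Lmeas f" "Lmeas g" "U \<in> sets lebesgue" "0 \<le> p"
    "Np p U f < \<infinity>" "Np p U g < \<infinity>"
  shows "Np p U (\<lambda>x. f x + g x) < \<infinity>"
  using Np_add[OF assms(1-4)] assms(5,6) by (auto simp: ennreal_mult_less_top intro: le_less_trans)

lemma Wk_add:
  assumes 1: "Wk p U u G" and 2: "Wk p U u' G'" and p: "p \<ge> 1" and U: "U \<in> sets lebesgue"
  shows "Wk p U (\<lambda>x. u x + u' x) (\<lambda>x. G x + G' x)"
  unfolding Wk_def
proof (intro conjI allI impI)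
  show "Np p U (\<lambda>x. u x + u' x) < \<infinity>" "Np p U (\<lambda>x. G x + G' x) < \<infinity>"
    using p by (auto intro!: Np_add_finite WkD(1-4)[OF 1] WkD(1-4)[OF 2] U simp del: infinity_ennreal_def)
  show "(\<integral>x. (u x + u' x) $ i * pd j \<psi> x \<partial>lebesgue) = - (\<integral>x. (G x + G' x) $ i $ j * \<psi> x \<partial>lebesgue)"
    if t: "test_fun U \<psi>" for \<psi> i j
    using Wk_integrable[OF 1 p t] Wk_integrable[OF 2 p t] Wk_integrable[OF 1 p test_fun_pd[OF t]]
      Wk_integrable[OF 2 p test_fun_pd[OF t]] WkD(5)[OF 1 t] WkD(5)[OF 2 t]
    by (simp add: distrib_right)
qed (use WkD[OF 1] WkD[OF 2] in auto)

lemma Wk_uminus: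
  assumes 1: "Wk p U u G"
  shows "Wk p U (\<lambda>x. - u x) (\<lambda>x. - G x)"
  using assms by (auto simp: Wk_def Np_uminus)

lemma Wk_diff:
  assumes 1: "Wk p U u G" and 2: "Wk p U u' G'" and p: "p \<ge> 1" and U: "U \<in> sets lebesgue"
  shows "Wk p U (\<lambda>x. u x - u' x) (\<lambda>x. G x - G' x)"
  using Wk_add[OF 1 Wk_uminus[OF 2] p U] by simp

text \<open>The set \<open>V\<close> is unrelated to \<open>U\<close>: the approximating test
  functions satisfy integration by parts against every test function on the whole space, and this
  passes to the limit. So extension by zero has a weak gradient across the boundary of
  \<open>U\<close>.\<close>

lemma Sob0_Wk:
  fixes v :: "real^'n \<Rightarrow> real^'m"
  assumes S: "Sob0 p U v H" and p: "p \<ge> 1"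
  shows "Wk p V v H"
proof -
  have p0: "p \<ge> 0" using p by simp
  note m = Sob0_measurable[OF S]
  have "(\<integral>x. v x $ i * pd j \<psi> x \<partial>lebesgue) = - (\<integral>x. H x $ i $ j * \<psi> x \<partial>lebesgue)" if t: "test_fun UNIV \<psi>" for \<psi> i j
  proof -
    let ?D = "(\<integral>x. v x $ i * pd j \<psi> x \<partial>lebesgue) + (\<integral>x. H x $ i $ j * \<psi> x \<partial>lebesgue)"
    note t' = test_fun_pd[OF t, of j]
    obtain B1 where B1: "B1 > 0" "\<And>x. \<bar>\<psi> x\<bar> \<le> B1" using test_fun_bounded[OF t] by blast
    obtain B2 where B2: "B2 > 0" "\<And>x. \<bar>pd j \<psi> x\<bar> \<le> B2" using test_fun_bounded[OF t'] by blast
    obtain K where K: "compact K" "\<And>x. x \<notin> K \<Longrightarrow> \<psi> x = 0" using test_fun_support[OF t] by metis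
    have K': "pd j \<psi> x = 0" if "x \<notin> K" for x using pd_0_outside[OF compact_imp_closed[OF K(1)] K(2) that] .
    define B where "B = max B1 B2"
    have B: "B > 0" "\<And>x. \<bar>\<psi> x\<bar> \<le> B" "\<And>x. \<bar>pd j \<psi> x\<bar> \<le> B"
      using B1 B2 by (auto simp: B_def le_max_iff_disj)
    define k where "k = measure lebesgue K + 1"
    have k: "k > 0" by (simp add: k_def add_nonneg_pos)
    have ek: "emeasure lebesgue K \<le> ennreal k"
      using emeasure_eq_measure2[OF lmeasurable_compact[OF K(1)]] by (simp add: k_def ennreal_leI)
    have "\<bar>?D\<bar> \<le> \<eta>" if \<eta>: "\<eta> > 0" for \<eta>
    proof -
      \<comment> \<open>Here \<delta> and \<open>e\<close> are chosen so that the two terms in the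
        bound of a weighted integral contribute \<eta>/4 each; two integrals have to be
        controlled.\<close>
      define \<delta> where "\<delta> = \<eta> / (4 * B * k)"
      have \<delta>: "\<delta> > 0" using \<eta> B k by (simp add: \<delta>_def)
      define e where "e = \<eta> / (4 * B * \<delta> powr (1 - p))"
      have e: "e > 0" using \<eta> B \<delta> by (simp add: e_def)
      obtain \<phi> where \<phi>: "test_fun_vec U \<phi>" "Np p UNIV (\<lambda>x. \<phi> x - v x) \<le> ennreal e" "Np p UNIV (\<lambda>x. grad \<phi> x - H x) \<le> ennreal e"
        using Sob0_approx[OF S e] by blast
      note m\<phi> = test_fun_vec_measurable[OF \<phi>(1)]
      have est: "\<bar>\<integral>x. g x *\<^sub>R f x \<partial>lebesgue\<bar> \<le> \<eta> / 2"
        if f: "Lmeas f" "Np p UNIV f \<le> ennreal e" and g: "\<And>x. \<bar>g x\<bar> \<le> B" "\<And>x. x \<notin> K \<Longrightarrow> g x = 0"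
          and gf: "integrable lebesgue (\<lambda>x. g x *\<^sub>R f x)"
        for f g :: "real^'n \<Rightarrow> real"
      proof -
        have "ennreal (norm (\<integral>x. g x *\<^sub>R f x \<partial>lebesgue)) \<le> ennreal B * (ennreal \<delta> * emeasure lebesgue K + ennreal (\<delta> powr (1 - p)) * Np p K f)"
          using B by (intro Np_weighted_integral_le f p g compact_sets_lebesgue K \<delta> gf) auto
        also have "\<dots> \<le> ennreal B * (ennreal \<delta> * ennreal k + ennreal (\<delta> powr (1 - p)) * ennreal e)"
          using ek order_trans[OF Np_set_mono f(2), of K] by (intro mult_left_mono add_mono) auto
        also have "\<dots> = ennreal (B * (\<delta> * k + \<delta> powr (1 - p) * e))"
          using B \<delta> k e by (simp add: ennreal_plus[symmetric] ennreal_mult[symmetric] del: ennreal_plus)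
        also have "B * (\<delta> * k + \<delta> powr (1 - p) * e) = \<eta> / 2"
        proof -
          have "B * (\<delta> * k) = \<eta> / 4" using B k by (simp add: \<delta>_def)
          moreover have "B * (\<delta> powr (1 - p) * e) = \<eta> / 4" using B \<delta> by (simp add: e_def)
          ultimately show ?thesis by (simp add: distrib_left)
        qed
        finally show ?thesis using \<eta> by (simp add: ennreal_le_iff)
      qed
      have fin: "Np p UNIV \<phi> < \<infinity>" "Np p UNIV (grad \<phi>) < \<infinity>" "Np p UNIV v < \<infinity>" "Np p UNIV H < \<infinity>"
        using test_fun_vec_Np_finite[OF \<phi>(1) p0] Sob0_finite[OF S p0] by auto
      note i1 = Np_weighted_nth_integrable(1)[OF p t' m\<phi>(1) fin(1), of i] Np_weighted_nth_integrable(1)[OF p t' m(1) fin(3), of i]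
      note i2 = Np_weighted_nth_integrable(2)[OF p t m\<phi>(2) fin(2), of i j] Np_weighted_nth_integrable(2)[OF p t m(2) fin(4), of i j]
      have ibp: "(\<integral>x. \<phi> x $ i * pd j \<psi> x \<partial>lebesgue) = - (\<integral>x. grad \<phi> x $ i $ j * \<psi> x \<partial>lebesgue)"
        using integration_by_parts[OF test_fun_C_inf[OF test_fun_vec_nth[OF \<phi>(1), of i]] t, of j] by (simp add: grad_def)
      have e1: "(\<integral>x. pd j \<psi> x *\<^sub>R (\<phi> x - v x) $ i \<partial>lebesgue) = (\<integral>x. \<phi> x $ i * pd j \<psi> x \<partial>lebesgue) - (\<integral>x. v x $ i * pd j \<psi> x \<partial>lebesgue)"
        using i1 by (simp add: algebra_simps)
      have e2: "(\<integral>x. \<psi> x *\<^sub>R (grad \<phi> x - H x) $ i $ j \<partial>lebesgue) = (\<integral>x. grad \<phi> x $ i $ j * \<psi> x \<partial>lebesgue) - (\<integral>x. H x $ i $ j * \<psi> x \<partial>lebesgue)"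
        using i2 by (simp add: algebra_simps)
      have "\<bar>\<integral>x. pd j \<psi> x *\<^sub>R (\<phi> x - v x) $ i \<partial>lebesgue\<bar> \<le> \<eta> / 2"
      proof (rule est)
        show "Np p UNIV (\<lambda>x. (\<phi> x - v x) $ i) \<le> ennreal e" using Np_vec_nth_le[OF p0] \<phi>(2) by (rule order_trans)
        show "integrable lebesgue (\<lambda>x. pd j \<psi> x *\<^sub>R (\<phi> x - v x) $ i)" using Bochner_Integration.integrable_diff[OF i1] by (simp add: algebra_simps)
      qed (use B K' m m\<phi> in auto)
      moreover have "\<bar>\<integral>x. \<psi> x *\<^sub>R (grad \<phi> x - H x) $ i $ j \<partial>lebesgue\<bar> \<le> \<eta> / 2"
      proof (rule est)
        show "Np p UNIV (\<lambda>x. (grad \<phi> x - H x) $ i $ j) \<le> ennreal e"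
          using order_trans[OF Np_vec_nth_le[OF p0] Np_vec_nth_le[OF p0]] \<phi>(3) by (rule order_trans)
        show "integrable lebesgue (\<lambda>x. \<psi> x *\<^sub>R (grad \<phi> x - H x) $ i $ j)" using Bochner_Integration.integrable_diff[OF i2] by (simp add: algebra_simps)
      qed (use B K m m\<phi> in auto)
      ultimately show ?thesis using e1 e2 ibp by linarith
    qed
    then have "\<bar>?D\<bar> \<le> 0" by (rule dense_ge)
    then show ?thesis by simp
  qed
  then have "Wk p UNIV v H" using Sob0_finite[OF S p0] m by (auto simp: Wk_def)
  then show ?thesis by (rule Wk_mono) simp
qed

text \<open>The tensor product of two vectors, the second term of the product rule: the gradient of
  \<open>\<theta> *\<^sub>R u\<close> is \<open>\<theta> *\<^sub>R G\<close> plus the tensor product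
  of \<open>u\<close> with the gradient of \<theta>.\<close>

definition outer :: "real^'m \<Rightarrow> real^'n \<Rightarrow> real^'n^'m" where
  "outer a b = (\<chi> i j. a $ i * b $ j)"

definition gvec :: "(real^'n \<Rightarrow> real) \<Rightarrow> real^'n \<Rightarrow> real^'n" where
  "gvec \<theta> x = (\<chi> j. pd j \<theta> x)"

lemma outer_nth [simp]: "outer a b $ i $ j = a $ i * b $ j"
  by (simp add: outer_def)

lemma gvec_nth [simp]: "gvec \<theta> x $ j = pd j \<theta> x"
  by (simp add: gvec_def)

lemma norm_outer: "norm (outer a b) = norm a * norm b"
proof -
  have "outer a b $ i = a $ i *\<^sub>R b" for i by (simp add: vec_eq_iff)
  then have "norm (outer a b) = L2_set (\<lambda>i. norm (a $ i) * norm b) UNIV"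
    unfolding norm_vec_def[of "outer a b"] by simp
  also have "\<dots> = norm a * norm b" by (simp add: L2_set_left_distrib norm_vec_def[of a])
  finally show ?thesis .
qed

lemma gvec_continuous: "test_fun U \<theta> \<Longrightarrow> continuous_on UNIV (gvec \<theta>)"
  unfolding gvec_def by (intro continuous_on_vec_lambda test_fun_continuous[of U] test_fun_pd)

lemma gvec_bounded:
  assumes "test_fun U \<theta>" obtains B where "B > 0" "\<And>x. norm (gvec \<theta> x) \<le> B"
proof -
  obtain K where K: "compact K" "\<And>x. x \<notin> K \<Longrightarrow> \<theta> x = 0" using test_fun_support[OF assms] by metis
  have "gvec \<theta> x = 0" if "x \<notin> K" for x
    using pd_0_outside[OF compact_imp_closed[OF K(1)] K(2) that] by (simp add: vec_eq_iff)
  from continuous_compact_support_bounded[OF gvec_continuous[OF assms] K(1) this] that show ?thesis by metis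
qed

lemma outer_measurable:
  fixes u :: "real^'n \<Rightarrow> real^'m"
  assumes "Lmeas u" "test_fun U \<theta>"
  shows "Lmeas (\<lambda>x. outer (u x) (gvec \<theta> x))"
proof -
  have [measurable]: "pd j \<theta> \<in> borel_measurable lebesgue" for j
    using test_fun_integrable[OF test_fun_pd[OF assms(2)]] by auto
  note [measurable] = assms(1)
  have "Lmeas (\<lambda>x. outer (u x) (gvec \<theta> x) \<bullet> b)" if b: "b \<in> Basis" for b
  proof -
    obtain i and w :: "real^'n" where "b = axis i w" "w \<in> Basis" using b unfolding Basis_vec_def[where ?'b="'m"] by blast
    moreover then obtain j where "w = axis j 1" unfolding Basis_vec_def by auto
    ultimately have "b = axis i (axis j 1)" by simp
    then have "outer (u x) (gvec \<theta> x) \<bullet> b = u x $ i * pd j \<theta> x" for x by (simp add: inner_axis)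
    then show ?thesis by simp
  qed
  then show ?thesis by (subst borel_measurable_euclidean_space) auto
qed

text \<open>The product rule comes from testing the identity for \<open>u\<close> with the product
  of \<theta> and \<psi>. As \<theta> has compact support in \<open>U\<close>, the result is a
  Sobolev function on the whole space.\<close>

lemma Wk_mult_test_fun:
  fixes u :: "real^'n \<Rightarrow> real^'m"
  assumes W: "Wk p U u G" and \<theta>: "test_fun U \<theta>" and p: "p \<ge> 1"
  shows "Wk p UNIV (\<lambda>x. \<theta> x *\<^sub>R u x) (\<lambda>x. \<theta> x *\<^sub>R G x + outer (u x) (gvec \<theta> x))"
  unfolding Wk_def
proof (intro conjI allI impI)
  note m[measurable] = WkD(1,2)[OF W]
  have p0: "p \<ge> 0" "p \<noteq> 0" using p by auto
  obtain K where K: "compact K" "K \<subseteq> U" "\<And>x. x \<notin> K \<Longrightarrow> \<theta> x = 0" using test_fun_support[OF \<theta>] by blast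
  obtain B where B: "B > 0" "\<And>x. \<bar>\<theta> x\<bar> \<le> B" using test_fun_bounded[OF \<theta>] by blast
  obtain B' where B': "B' > 0" "\<And>x. norm (gvec \<theta> x) \<le> B'" using gvec_bounded[OF \<theta>] by blast
  have g0: "gvec \<theta> x = 0" if "x \<notin> K" for x
    using pd_0_outside[OF compact_imp_closed[OF K(1)] K(3) that] by (simp add: vec_eq_iff)
  have [measurable]: "\<theta> \<in> borel_measurable lebesgue" using test_fun_integrable[OF \<theta>] by auto
  note om[measurable] = outer_measurable[OF m(1) \<theta>]
  have Ks[measurable]: "K \<in> sets lebesgue" by (rule compact_sets_lebesgue[OF K(1)])
  have fin: "Np p K u < \<infinity>" "Np p K G < \<infinity>" using Wk_mono[OF W K(2)] WkD(3,4) by blast+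
  \<comment> \<open>A function supported in \<open>K\<close> and dominated by a multiple of
    \<open>g\<close> only needs \<open>g\<close> over \<open>K\<close>; off \<open>U\<close> nothing
    is known about \<open>u\<close> and \<open>G\<close>.\<close>
  have bd: "Np p UNIV f < \<infinity>" if f: "\<And>x. norm (f x) \<le> c * norm (g x)" "\<And>x. x \<notin> K \<Longrightarrow> f x = 0" "Np p K g < \<infinity>" "c \<ge> 0" "Lmeas g"
    for f :: "real^'n \<Rightarrow> 'c::euclidean_space" and g :: "real^'n \<Rightarrow> 'd::euclidean_space" and c
  proof -
    have "Np p UNIV f = Np p K f" using f(2) p0 by (intro Np_UNIV_supp)
    also have "\<dots> \<le> Np p K (\<lambda>x. c *\<^sub>R g x)" using f(1,4) p0 by (intro Np_mono) auto
    also have "\<dots> = ennreal (\<bar>c\<bar> powr p) * Np p K g" by (rule Np_cmult[OF f(5) Ks])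
    also have "\<dots> < \<infinity>" using f(3) by (simp add: ennreal_mult_less_top)
    finally show ?thesis .
  qed
  show "Np p UNIV (\<lambda>x. \<theta> x *\<^sub>R u x) < \<infinity>"
    by (rule bd[of _ B u]) (use B K(3) fin in \<open>auto intro: mult_right_mono\<close>)
  have 1: "Np p UNIV (\<lambda>x. \<theta> x *\<^sub>R G x) < \<infinity>"
    by (rule bd[of _ B G]) (use B K(3) fin in \<open>auto intro: mult_right_mono\<close>)
  have 2: "Np p UNIV (\<lambda>x. outer (u x) (gvec \<theta> x)) < \<infinity>"
  proof (rule bd[of _ B' u])
    show "norm (outer (u x) (gvec \<theta> x)) \<le> B' * norm (u x)" for x
      unfolding norm_outer using B'(2)[of x] mult_right_mono[of "norm (gvec \<theta> x)" B' "norm (u x)"] by (simp add: mult.commute)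
    show "outer (u x) (gvec \<theta> x) = 0" if "x \<notin> K" for x using g0[OF that] by (simp add: vec_eq_iff)
  qed (use B' fin in auto)
  show "Np p UNIV (\<lambda>x. \<theta> x *\<^sub>R G x + outer (u x) (gvec \<theta> x)) < \<infinity>"
    using 1 2 p0 by (intro Np_add_finite) auto
  show "Lmeas (\<lambda>x. \<theta> x *\<^sub>R u x)" "Lmeas (\<lambda>x. \<theta> x *\<^sub>R G x + outer (u x) (gvec \<theta> x))"
    by measurable
  fix \<psi> :: "real^'n \<Rightarrow> real" and i j assume t: "test_fun UNIV \<psi>"
  note C = test_fun_C_inf[OF t] and C\<theta> = test_fun_C_inf[OF \<theta>]
  have t1: "test_fun U (\<lambda>x. \<theta> x * \<psi> x)" by (rule test_fun_mult_right[OF C \<theta>])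
  have t2: "test_fun U (\<lambda>x. \<theta> x * pd j \<psi> x)" by (rule test_fun_mult_right[OF C_inf_pd[OF C] \<theta>])
  have t3: "test_fun U (\<lambda>x. pd j \<theta> x * \<psi> x)" by (rule test_fun_mult_right[OF C test_fun_pd[OF \<theta>]])
  have "(\<integral>x. u x $ i * (\<theta> x * pd j \<psi> x) \<partial>lebesgue) + (\<integral>x. u x $ i * (pd j \<theta> x * \<psi> x) \<partial>lebesgue) = (\<integral>x. u x $ i * pd j (\<lambda>x. \<theta> x * \<psi> x) x \<partial>lebesgue)"
    using Wk_integrable(1)[OF W p t2] Wk_integrable(1)[OF W p t3] by (simp add: pd_mult[OF C\<theta> C] distrib_left)
  also have "\<dots> = - (\<integral>x. G x $ i $ j * (\<theta> x * \<psi> x) \<partial>lebesgue)" by (rule WkD(5)[OF W t1])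
  finally show "(\<integral>x. (\<theta> x *\<^sub>R u x) $ i * pd j \<psi> x \<partial>lebesgue) = - (\<integral>x. (\<theta> x *\<^sub>R G x + outer (u x) (gvec \<theta> x)) $ i $ j * \<psi> x \<partial>lebesgue)"
    using Wk_integrable(2)[OF W p t1] Wk_integrable(1)[OF W p t3]
    by (simp add: distrib_right mult.assoc mult.left_commute algebra_simps)
qed

text \<open>Mollification at a scale below the distance from \<open>K\<close> to the complement of
  \<open>U\<close>. The classical gradient of the mollified function is the mollification of
  \<open>G\<close>, so both approximations follow from continuity of translations.\<close>

lemma Wk_compact_support_Sob0:
  assumes W: "Wk p UNIV v G" and p: "p \<ge> 1" and K: "compact K" "K \<subseteq> U" "\<And>x. x \<notin> K \<Longrightarrow> v x = 0" "\<And>x. x \<notin> K \<Longrightarrow> G x = 0"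
    and U: "open U"
  shows "Sob0 p U v G"
  unfolding Sob0_def
proof (intro conjI allI impI)
  note m[measurable] = WkD(1,2)[OF W]
  show "v x = 0" "G x = 0" if "x \<notin> U" for x using that K by blast+
  fix e :: real assume e: "e > 0"
  have p0: "p > 0" using p by simp
  have int: "integrable lebesgue f" if f: "Lmeas f" "Np p UNIV f < \<infinity>" "\<And>x. x \<notin> K \<Longrightarrow> f x = 0" for f :: "real^'a \<Rightarrow> 'c::euclidean_space"
  proof -
    have "Np p K f < \<infinity>" using Np_set_mono[of K UNIV p f] f(2) by (auto intro: le_less_trans)
    from Np_set_integrable[OF f(1) compact_sets_lebesgue[OF K(1)] emeasure_compact_lt_top[OF K(1)] p this]
    have "integrable lebesgue (\<lambda>x. indicator K x *\<^sub>R f x)" by (simp add: set_integrable_def)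
    moreover have "(\<lambda>x. indicator K x *\<^sub>R f x) = f" using f(3) by (auto simp: indicator_def fun_eq_iff)
    ultimately show ?thesis by simp
  qed
  have vi: "integrable lebesgue v" using int[OF m(1) WkD(3)[OF W] K(3)] .
  have Gi: "integrable lebesgue G" using int[OF m(2) WkD(4)[OF W] K(4)] .
  obtain d1 where d1: "d1 > 0" "\<And>z. norm z < d1 \<Longrightarrow> Np p UNIV (\<lambda>x. v (z + x) - v x) \<le> ennreal e"
    using Np_translation_continuous[OF m(1) p0 e WkD(3)[OF W]] by blast
  obtain d2 where d2: "d2 > 0" "\<And>z. norm z < d2 \<Longrightarrow> Np p UNIV (\<lambda>x. G (z + x) - G x) \<le> ennreal e"
    using Np_translation_continuous[OF m(2) p0 e WkD(4)[OF W]] by blast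
  obtain d3 where d3: "d3 > 0" "(\<Union>x\<in>K. cball x d3) \<subseteq> U"
    using compact_subset_open_imp_cball_epsilon_subset[OF K(1) U K(2)] by blast
  define d where "d = min d1 (min d2 d3)"
  have d: "d > 0" "d \<le> d1" "d \<le> d2" "d \<le> d3" using d1 d2 d3 by (auto simp: d_def)
  obtain \<eta> :: "real^'a \<Rightarrow> real" where \<eta>: "test_fun UNIV \<eta>" "\<And>z. \<eta> z \<ge> 0" "(\<integral>z. \<eta> z \<partial>lebesgue) = 1" "\<And>z. norm z \<ge> d \<Longrightarrow> \<eta> z = 0"
    using ex_mollifier[OF d(1)] by blast
  have vii: "integrable lebesgue (\<lambda>x. v x $ i)" for i
    using integrable_bounded_linear[OF bounded_linear_vec_nth vi] .
  have Gii: "integrable lebesgue (\<lambda>x. G x $ i)" for i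
    using integrable_bounded_linear[OF bounded_linear_vec_nth Gi] .
  have cn: "conv \<eta> v x $ i = conv \<eta> (\<lambda>y. v y $ i) x" for x i by (rule conv_vec_nth[OF \<eta>(1) vi])
  have cn2: "conv \<eta> G x $ i $ j = conv \<eta> (\<lambda>y. G y $ i $ j) x" for x i j
    using conv_vec_nth[OF \<eta>(1) Gi] conv_vec_nth[OF \<eta>(1) Gii] by simp
  have sub: "(\<Union>x\<in>K. cball x d) \<subseteq> U" using d3(2) d(4) by force
  have T: "test_fun_vec U (conv \<eta> v)"
    unfolding test_fun_vec_def cn
  proof
    fix i
    show "test_fun U (conv \<eta> (\<lambda>y. v y $ i))"
      by (rule conv_test_fun[OF \<eta>(1) vii \<eta>(4) K(1) _ sub]) (use K in auto)
  qed
  have gr: "grad (conv \<eta> v) x = conv \<eta> G x" for x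
  proof -
    have "pd j (conv \<eta> (\<lambda>y. v y $ i)) x = conv \<eta> (\<lambda>y. G y $ i $ j) x" for i j
    proof -
      \<comment> \<open>The reflected kernel centred at \<open>x\<close> is a test function;
        inserting it into the weak identity moves the derivative from the kernel to
        \<open>v\<close>.\<close>
      define \<zeta> where "\<zeta> y = \<eta> (x + (-1) *\<^sub>R y)" for y
      have tz: "test_fun UNIV \<zeta>" unfolding \<zeta>_def by (rule test_fun_affine[OF \<eta>(1)]) auto
      have pz: "pd j \<zeta> y = - pd j \<eta> (x - y)" for y
        unfolding \<zeta>_def using pd_affine[OF test_fun_C_inf[OF \<eta>(1)], of j x "-1" y] by simp
      have "pd j (conv \<eta> (\<lambda>y. v y $ i)) x = conv (pd j \<eta>) (\<lambda>y. v y $ i) x" by (rule pd_conv[OF \<eta>(1) vii])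
      also have "\<dots> = - (\<integral>y. v y $ i * pd j \<zeta> y \<partial>lebesgue)" by (simp add: conv_def pz mult.commute)
      also have "\<dots> = (\<integral>y. G y $ i $ j * \<zeta> y \<partial>lebesgue)" using WkD(5)[OF W tz] by simp
      also have "\<dots> = conv \<eta> (\<lambda>y. G y $ i $ j) x" by (simp add: conv_def \<zeta>_def mult.commute)
      finally show ?thesis .
    qed
    then show ?thesis by (simp add: grad_def vec_eq_iff cn cn2)
  qed
  have "Np p UNIV (\<lambda>x. conv \<eta> v x - v x) \<le> ennreal e"
    by (rule conv_approx[OF \<eta> vi p]) (use d1 d in auto)
  moreover have "Np p UNIV (\<lambda>x. grad (conv \<eta> v) x - G x) \<le> ennreal e"
    unfolding gr by (rule conv_approx[OF \<eta> Gi p]) (use d2 d in auto)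
  ultimately show "\<exists>\<psi>. test_fun_vec U \<psi> \<and> Np p UNIV (\<lambda>x. \<psi> x - v x) \<le> ennreal e \<and> Np p UNIV (\<lambda>x. grad \<psi> x - G x) \<le> ennreal e"
    using T by blast
qed (use WkD[OF W] in auto)

lemma Sob0_mult_test_fun:
  assumes W: "Wk p U u G" and \<theta>: "test_fun U \<theta>" and p: "p \<ge> 1" and U: "open U"
  shows "Sob0 p U (\<lambda>x. \<theta> x *\<^sub>R u x) (\<lambda>x. \<theta> x *\<^sub>R G x + outer (u x) (gvec \<theta> x))"
proof -
  obtain K where K: "compact K" "K \<subseteq> U" "\<And>x. x \<notin> K \<Longrightarrow> \<theta> x = 0" using test_fun_support[OF \<theta>] by blast
  have g0: "gvec \<theta> x = 0" if "x \<notin> K" for x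
    using pd_0_outside[OF compact_imp_closed[OF K(1)] K(3) that] by (simp add: vec_eq_iff)
  show ?thesis
    by (rule Wk_compact_support_Sob0[OF Wk_mult_test_fun[OF W \<theta> p] p K(1,2) _ _ U])
      (use K g0 in \<open>auto simp: vec_eq_iff\<close>)
qed

lemma Np_bounded_finite:
  fixes f :: "real^'n \<Rightarrow> 'b::euclidean_space"
  assumes "AE x in lebesgue. x \<in> U \<longrightarrow> norm (f x) \<le> B" "U \<in> sets lebesgue" "bounded U" "p \<ge> 0" "B \<ge> 0"
  shows "Np p U f < \<infinity>"
proof -
  have "Np p U f \<le> (\<integral>\<^sup>+x. ennreal (B powr p) * indicator U x \<partial>lebesgue)"
    unfolding Np_def
  proof (rule nn_integral_mono_AE)
    show "AE x in lebesgue. ennreal (norm (f x) powr p) * indicator U x \<le> ennreal (B powr p) * indicator U x"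
      using assms(1)
    proof eventually_elim
      case (elim x)
      then show ?case using assms(4,5) by (cases "x \<in> U") (auto intro!: ennreal_leI powr_mono2)
    qed
  qed
  also have "\<dots> = ennreal (B powr p) * emeasure lebesgue U" using assms(2) by (rule nn_integral_cmult_indicator)
  also have "\<dots> < \<infinity>"
    using fmeasurableD2[OF bounded_set_imp_lmeasurable[OF assms(3,2)]] by (simp add: ennreal_mult_less_top top.not_eq_extremum)
  finally show ?thesis .
qed

lemma Wk_affine:
  assumes U: "bounded U" "p \<ge> 0"
  shows "Wk p U (\<lambda>x. b + \<xi> *v x) (\<lambda>x. \<xi>)"
  unfolding Wk_def
proof (intro conjI allI impI)
  have c: "continuous_on UNIV (\<lambda>x. b + \<xi> *v x)"
    by (intro continuous_intros linear_continuous_on) (simp add: matrix_vector_mul_bounded_linear)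
  then show "Lmeas (\<lambda>x. b + \<xi> *v x)" by (rule continuous_imp_lebesgue_measurable)
  have fin: "Np p V f < \<infinity>" if f: "continuous_on UNIV f" "bounded V" for f :: "real^'a \<Rightarrow> 'c::euclidean_space" and V
  proof -
    obtain R where R: "V \<subseteq> cball 0 R" using f(2) by (auto simp: bounded_iff subset_iff)
    have "bounded (f ` cball 0 R)"
      by (intro compact_imp_bounded compact_continuous_image continuous_on_subset[OF f(1)]) auto
    then obtain B where B: "B > 0" "\<And>x. x \<in> cball 0 R \<Longrightarrow> norm (f x) \<le> B" unfolding bounded_pos by auto
    have "Np p (cball 0 R) f < \<infinity>" by (rule Np_bounded_finite[of _ _ B]) (use B U in auto)
    then show ?thesis using Np_set_mono[OF R, of p f] by (rule le_less_trans[rotated])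
  qed
  show "Np p U (\<lambda>x. b + \<xi> *v x) < \<infinity>" by (rule fin[OF c U(1)])
  show "Np p U (\<lambda>x. \<xi>) < \<infinity>" by (rule fin) (use U in auto)
  fix \<psi> i j assume t: "test_fun U \<psi>"
  let ?f = "\<lambda>x. b $ i + x \<bullet> (\<xi> $ i)"
  have f: "(b + \<xi> *v x) $ i = ?f x" for x
    by (simp add: matrix_vector_mult_def inner_vec_def mult.commute)
  have "pd j ?f x = \<xi> $ i $ j" for x
    unfolding pd_def
    by (subst frechet_derivative_eqI[of _ "\<lambda>v. v \<bullet> (\<xi> $ i)"]) (auto intro!: derivative_eq_intros simp: inner_axis' )
  then show "(\<integral>x. (b + \<xi> *v x) $ i * pd j \<psi> x \<partial>lebesgue) = - (\<integral>x. \<xi> $ i $ j * \<psi> x \<partial>lebesgue)"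
    using integration_by_parts[OF C_inf_add[OF C_inf_const C_inf_inner] t, of "b $ i" "\<xi> $ i" j] unfolding f by simp
qed auto

subsection \<open>Comparison with the Sobolev spaces of the statement\<close>

lemma set_integral_test_fun_eq:
  assumes "test_fun U g"
  shows "(LINT x:U|lebesgue. f x * g x) = (\<integral>x. f x * g x \<partial>lebesgue)"
proof -
  obtain K where K: "compact K" "K \<subseteq> U" "\<And>x. x \<notin> K \<Longrightarrow> g x = 0" using test_fun_support[OF assms] by blast
  have "(\<lambda>x. indicator U x *\<^sub>R (f x * g x)) = (\<lambda>x. f x * g x)"
  proof
    show "indicator U x *\<^sub>R (f x * g x) = f x * g x" for x using K(2,3) by (cases "x \<in> U") auto
  qed
  then show ?thesis unfolding set_lebesgue_integral_def by simp
qed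

text \<open>Localized by a cutoff \<theta>, the difference of two weak gradients is integrable. Its
  mollification at \<open>x\<close> is the pairing of the difference with the test function
  \<open>\<eta> (x - y) * \<theta> y\<close>, hence 0; letting the scale shrink shows that the
  difference vanishes where \<theta> is 1.\<close>

lemma is_weak_grad_unique:
  fixes G1 G2 :: "real^'n \<Rightarrow> real^'n^'m"
  assumes 1: "is_weak_grad U \<phi> G1" and 2: "is_weak_grad U \<phi> G2" and U: "open U"
  shows "AE x in lebesgue. x \<in> U \<longrightarrow> G1 x = G2 x"
proof -
  obtain C :: "nat \<Rightarrow> (real^'n) set" where C: "\<And>n. compact (C n)" "\<And>n. C n \<subseteq> U" "\<Union>(range C) = U"
    by (rule open_Union_compact_subsets[OF U]) (rule that; assumption)
  have "AE x in lebesgue. x \<in> C n \<longrightarrow> G1 x $ i $ j = G2 x $ i $ j" for n :: nat and i j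
  proof -
    obtain \<theta> where \<theta>: "test_fun U \<theta>" "\<And>x. x \<in> C n \<Longrightarrow> \<theta> x = 1"
      using ex_cutoff[OF C(1) U C(2)] by metis
    obtain K where K: "compact K" "K \<subseteq> U" "\<And>x. x \<notin> K \<Longrightarrow> \<theta> x = 0" using test_fun_support[OF \<theta>(1)] by blast
    obtain B where B: "B > 0" "\<And>x. \<bar>\<theta> x\<bar> \<le> B" using test_fun_bounded[OF \<theta>(1)] by blast
    have nth: "integrable lebesgue (\<lambda>x. indicator L x * G x $ i $ j)" if "is_weak_grad U \<phi> G" "compact L" "L \<subseteq> U" for G L
    proof -
      have "integrable lebesgue (\<lambda>x. indicator L x *\<^sub>R G x)"
        using that by (auto simp: is_weak_grad_def loc_int_def set_integrable_def)
      from integrable_bounded_linear[OF bounded_linear_vec_nth[of j] integrable_bounded_linear[OF bounded_linear_vec_nth[of i] this]]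
      show ?thesis by simp
    qed
    have wint: "integrable lebesgue (\<lambda>x. g x * G x $ i $ j)" if G: "is_weak_grad U \<phi> G" and g: "test_fun U g" for G g
    proof -
      obtain L where L: "compact L" "L \<subseteq> U" "\<And>x. x \<notin> L \<Longrightarrow> g x = 0" using test_fun_support[OF g] by blast
      obtain B where B: "B > 0" "\<And>x. \<bar>g x\<bar> \<le> B" using test_fun_bounded[OF g] by blast
      note iL = nth[OF G L(1,2)]
      have [measurable]: "Lmeas g" using test_fun_integrable[OF g] by auto
      have eq: "g x * G x $ i $ j = g x * (indicator L x * G x $ i $ j)" for x using L(3)[of x] by (auto simp: indicator_def)
      show ?thesis unfolding eq
      proof (rule Bochner_Integration.integrable_bound[OF integrable_mult_right[OF iL, of B]])
        show "Lmeas (\<lambda>x. g x * (indicator L x * G x $ i $ j))"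
          using iL by measurable
        show "AE x in lebesgue. norm (g x * (indicator L x * G x $ i $ j)) \<le> norm (B * (indicator L x * G x $ i $ j))"
          using B by (intro AE_I2) (auto simp: abs_mult intro!: mult_right_mono)
      qed
    qed
    define f where "f x = \<theta> x * (G1 x $ i $ j - G2 x $ i $ j)" for x
    have fi: "integrable lebesgue f"
      unfolding f_def right_diff_distrib using wint[OF 1 \<theta>(1)] wint[OF 2 \<theta>(1)] by simp
    have zero: "(\<integral>x. g x * (G1 x $ i $ j - G2 x $ i $ j) \<partial>lebesgue) = 0" if g: "test_fun U g" for g
    proof -
      have "(LINT x:U|lebesgue. G1 x $ i $ j * g x) = (LINT x:U|lebesgue. G2 x $ i $ j * g x)"
        using 1 2 g unfolding is_weak_grad_def by (metis (no_types) neg_equal_iff_equal)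
      then have "(\<integral>x. g x * G1 x $ i $ j \<partial>lebesgue) = (\<integral>x. g x * G2 x $ i $ j \<partial>lebesgue)"
        unfolding set_integral_test_fun_eq[OF g] by (simp add: mult.commute)
      then show ?thesis unfolding right_diff_distrib using wint[OF 1 g] wint[OF 2 g] by simp
    qed
    have Nf: "Np 1 UNIV f < \<infinity>" using fi by (simp add: Np_def integrable_iff_bounded)
    have fm[measurable]: "Lmeas f" using fi by auto
    have small: "Np 1 UNIV f \<le> ennreal e" if e: "e > 0" for e
    proof -
      obtain d where d: "d > 0" "\<And>z. norm z < d \<Longrightarrow> Np 1 UNIV (\<lambda>x. f (z + x) - f x) \<le> ennreal e"
        using Np_translation_continuous[OF fm _ e Nf] by auto
      obtain \<eta> :: "real^'n \<Rightarrow> real" where \<eta>: "test_fun UNIV \<eta>" "\<And>z. \<eta> z \<ge> 0" "(\<integral>z. \<eta> z \<partial>lebesgue) = 1" "\<And>z. norm z \<ge> d \<Longrightarrow> \<eta> z = 0"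
        using ex_mollifier[OF d(1)] by blast
      have "conv \<eta> f x = 0" for x
      proof -
        have "test_fun U (\<lambda>y. \<eta> (x + (-1) *\<^sub>R y) * \<theta> y)"
          by (rule test_fun_mult_left[OF C_inf_affine[OF test_fun_C_inf[OF \<eta>(1)]] \<theta>(1)])
        from zero[OF this] show ?thesis by (simp add: conv_def f_def mult.assoc)
      qed
      moreover have "Np 1 UNIV (\<lambda>x. conv \<eta> f x - f x) \<le> ennreal e"
        by (rule conv_approx[OF \<eta> fi]) (use d in auto)
      ultimately show ?thesis by (simp add: Np_uminus)
    qed
    have "Np 1 UNIV f \<le> 0"
    proof (rule ennreal_le_epsilon)
      show "Np 1 UNIV f \<le> 0 + ennreal e" if "0 < e" for e using small[OF that] by simp
    qed
    then have "AE x in lebesgue. f x = 0" unfolding Np_def by (simp add: nn_integral_0_iff_AE)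
    then show ?thesis
      by eventually_elim (auto simp: f_def \<theta>(2))
  qed
  then have "AE x in lebesgue. \<forall>n i j. x \<in> C n \<longrightarrow> G1 x $ i $ j = G2 x $ i $ j"
    unfolding AE_all_countable by (intro allI)
  then show ?thesis
  proof eventually_elim
    case (elim x)
    show ?case
    proof
      assume "x \<in> U"
      then obtain n where "x \<in> C n" using C(3) by blast
      then have "G1 x $ i $ j = G2 x $ i $ j" for i j using elim by blast
      then show "G1 x = G2 x" by (simp add: vec_eq_iff)
    qed
  qed
qed

lemma measurable_restrict_indicator:
  fixes f :: "real^'n \<Rightarrow> 'b::euclidean_space"
  assumes "open U" "f \<in> borel_measurable (restrict_space lebesgue U)"
  shows "Lmeas (\<lambda>x. indicator U x *\<^sub>R f x)"
  using borel_measurable_restrict_space_iff[of U lebesgue f] assms by simp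

lemma Wk_is_weak_grad:
  assumes W: "Wk p U u G" and U: "open U" and p: "p \<ge> 1"
  shows "is_weak_grad U u G"
  unfolding is_weak_grad_def
proof (intro conjI allI impI)
  have loc: "loc_int U f" if "Lmeas f" "Np p U f < \<infinity>" for f :: "real^'a \<Rightarrow> 'c::euclidean_space"
    unfolding loc_int_def
  proof (intro allI impI)
    fix K assume K: "compact K \<and> K \<subseteq> U"
    then have "Np p K f < \<infinity>" using Np_set_mono[of K U p f] that(2) by (auto intro: le_less_trans)
    then show "set_integrable lebesgue K f"
      using K by (intro Np_set_integrable[OF that(1) _ _ p] compact_sets_lebesgue emeasure_compact_lt_top) auto
  qed
  show "loc_int U u" "loc_int U G" using loc WkD[OF W] by blast+
  fix \<psi> i j assume t: "test_fun U \<psi>"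
  show "(LINT x:U|lebesgue. u x $ i * frechet_derivative \<psi> (at x) (axis j 1)) = - (LINT x:U|lebesgue. G x $ i $ j * \<psi> x)"
    unfolding set_integral_test_fun_eq[OF t] set_integral_test_fun_eq[OF test_fun_pd[OF t, unfolded pd_def[abs_def]]]
    using WkD(5)[OF W t] by (simp add: pd_def)
qed

lemma wgrad_AE_eq:
  assumes "is_weak_grad U u G" "open U"
  shows "AE x in lebesgue. x \<in> U \<longrightarrow> wgrad U u x = G x"
proof -
  have "is_weak_grad U u (wgrad U u)" unfolding wgrad_def by (rule someI[of "is_weak_grad U u", OF assms(1)])
  then show ?thesis using is_weak_grad_unique assms by blast
qed

lemma Lp_indicator:
  assumes "open U" "Lp p U f" "p > 0"
  shows "Lmeas (\<lambda>x. indicator U x *\<^sub>R f x)" "Np p UNIV (\<lambda>x. indicator U x *\<^sub>R f x) < \<infinity>"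
proof -
  show "Lmeas (\<lambda>x. indicator U x *\<^sub>R f x)"
    using assms by (intro measurable_restrict_indicator) (auto simp: Lp_def)
  have "Np p UNIV (\<lambda>x. indicator U x *\<^sub>R f x) = (\<integral>\<^sup>+x\<in>U. ennreal (norm (f x) powr p) \<partial>lebesgue)"
    unfolding Np_def using assms(3) by (intro nn_integral_cong) (auto simp: indicator_def)
  then show "Np p UNIV (\<lambda>x. indicator U x *\<^sub>R f x) < \<infinity>" using assms(2) by (simp add: Lp_def)
qed

lemma Np_LpI:
  assumes "Lmeas f" "Np p U f < \<infinity>"
  shows "Lp p U f"
  using assms by (auto simp: Lp_def Np_def measurable_restrict_space1)

lemma Wk_W1p:
  assumes "Wk p U u G" "open U" "p \<ge> 1"
  shows "W1p p U u" "AE x in lebesgue. x \<in> U \<longrightarrow> wgrad U u x = G x"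
proof -
  note w = Wk_is_weak_grad[OF assms]
  show "AE x in lebesgue. x \<in> U \<longrightarrow> wgrad U u x = G x" by (rule wgrad_AE_eq[OF w assms(2)])
  show "W1p p U u" unfolding W1p_def
    using w Np_LpI[OF WkD(1,3)[OF assms(1)]] Np_LpI[OF WkD(2,4)[OF assms(1)]] by blast
qed

text \<open>A member of \<open>W1p\<close> is measurable only on \<open>U\<close>, so it is cut off
  by the indicator. The choice in \<open>wgrad\<close> is harmless because it agrees almost
  everywhere with the gradient whose integrability is known.\<close>

lemma W1p_Wk:
  assumes W: "W1p p U \<phi>" and U: "open U" and p: "p \<ge> 1"
  shows "Wk p U (\<lambda>x. indicator U x *\<^sub>R \<phi> x) (\<lambda>x. indicator U x *\<^sub>R wgrad U \<phi> x)"
proof -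
  obtain G where G: "is_weak_grad U \<phi> G" "Lp p U G" and \<phi>: "Lp p U \<phi>" using W by (auto simp: W1p_def)
  have p0: "p > 0" "p \<ge> 0" using p by auto
  have eq: "AE x in lebesgue. x \<in> U \<longrightarrow> wgrad U \<phi> x = G x" by (rule wgrad_AE_eq[OF G(1) U])
  then have eq': "AE x in lebesgue. indicator U x *\<^sub>R G x = indicator U x *\<^sub>R wgrad U \<phi> x"
    by eventually_elim (auto simp: indicator_def)
  note mu = Lp_indicator[OF U \<phi> p0(1)] and mG = Lp_indicator[OF U G(2) p0(1)]
  have mG': "Lmeas (\<lambda>x. indicator U x *\<^sub>R wgrad U \<phi> x)"
    using borel_measurable_AE[OF mG(1) eq'] by simp
  have wg: "is_weak_grad U \<phi> (wgrad U \<phi>)" unfolding wgrad_def by (rule someI[of "is_weak_grad U \<phi>", OF G(1)])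
  have "(\<integral>x. (indicator U x *\<^sub>R \<phi> x) $ i * pd j \<psi> x \<partial>lebesgue) = - (\<integral>x. (indicator U x *\<^sub>R wgrad U \<phi> x) $ i $ j * \<psi> x \<partial>lebesgue)"
    if "test_fun U \<psi>" for \<psi> i j
    using wg that unfolding is_weak_grad_def set_lebesgue_integral_def by (simp add: pd_def mult.assoc)
  moreover have "Np p UNIV (\<lambda>x. indicator U x *\<^sub>R wgrad U \<phi> x) < \<infinity>"
    using Np_cong_AE[of UNIV "\<lambda>x. indicator U x *\<^sub>R G x" "\<lambda>x. indicator U x *\<^sub>R wgrad U \<phi> x" p] eq' mG(2) by (auto elim: eventually_mono)
  ultimately show ?thesis
    unfolding Wk_def using mu mG' by (intro conjI allI impI le_less_trans[OF Np_set_mono[of U UNIV p]]) simp_all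
qed

lemma Lp_dist_Np: "Lp_dist p U f g = Np p U (\<lambda>x. f x - g x)"
  by (simp add: Lp_dist_def Np_def)

lemma test_fun_vec_wgrad:
  assumes "test_fun_vec U \<psi>" "open U"
  shows "AE x in lebesgue. x \<in> U \<longrightarrow> wgrad U \<psi> x = grad \<psi> x"
  using Wk_W1p(2)[OF Sob0_Wk[OF Sob0_test_fun[OF assms(1), of 1]] assms(2)] by simp

lemma W1p0_Sob0:
  assumes W: "W1p0 p U \<phi>" and U: "open U" and p: "p \<ge> 1"
  shows "Sob0 p U (\<lambda>x. indicator U x *\<^sub>R \<phi> x) (\<lambda>x. indicator U x *\<^sub>R wgrad U \<phi> x)"
  unfolding Sob0_def
proof (intro conjI allI impI)
  have p0: "p \<noteq> 0" using p by simp
  have W1: "W1p p U \<phi>" using W by (simp add: W1p0_def)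
  note Wk = W1p_Wk[OF W1 U p]
  show "Lmeas (\<lambda>x. indicator U x *\<^sub>R \<phi> x)" "Lmeas (\<lambda>x. indicator U x *\<^sub>R wgrad U \<phi> x)"
    using WkD(1,2)[OF Wk] .
  fix e :: real assume e: "e > 0"
  obtain \<psi> where \<psi>: "\<And>n. test_fun_vec U (\<psi> n)" "(\<lambda>n. Lp_dist p U (\<psi> n) \<phi>) \<longlonglongrightarrow> 0"
        "(\<lambda>n. Lp_dist p U (wgrad U (\<psi> n)) (wgrad U \<phi>)) \<longlonglongrightarrow> 0"
    using W by (auto simp: W1p0_def)
  have "eventually (\<lambda>n. Lp_dist p U (\<psi> n) \<phi> < ennreal e \<and> Lp_dist p U (wgrad U (\<psi> n)) (wgrad U \<phi>) < ennreal e) sequentially"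
    using \<psi> e by (intro eventually_conj order_tendstoD(2)[of _ 0]) auto
  then obtain n where n: "Lp_dist p U (\<psi> n) \<phi> < ennreal e" "Lp_dist p U (wgrad U (\<psi> n)) (wgrad U \<phi>) < ennreal e"
    by (auto simp: eventually_sequentially)
  obtain K where K: "K \<subseteq> U" "\<And>x. x \<notin> K \<Longrightarrow> \<psi> n x = 0" "\<And>x. x \<notin> K \<Longrightarrow> grad (\<psi> n) x = 0"
    using test_fun_vec_support[OF \<psi>(1)[of n]] by metis
  have "Np p UNIV (\<lambda>x. \<psi> n x - indicator U x *\<^sub>R \<phi> x) = Np p U (\<lambda>x. \<psi> n x - indicator U x *\<^sub>R \<phi> x)"
    by (intro Np_UNIV_supp p0) (use K in auto)
  also have "\<dots> = Lp_dist p U (\<psi> n) \<phi>" unfolding Lp_dist_Np by (intro Np_cong_AE) auto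
  finally have 1: "Np p UNIV (\<lambda>x. \<psi> n x - indicator U x *\<^sub>R \<phi> x) \<le> ennreal e" using n by simp
  have "Np p UNIV (\<lambda>x. grad (\<psi> n) x - indicator U x *\<^sub>R wgrad U \<phi> x) = Np p U (\<lambda>x. grad (\<psi> n) x - indicator U x *\<^sub>R wgrad U \<phi> x)"
    by (intro Np_UNIV_supp p0) (use K in auto)
  also have "\<dots> = Lp_dist p U (wgrad U (\<psi> n)) (wgrad U \<phi>)"
    unfolding Lp_dist_Np using test_fun_vec_wgrad[OF \<psi>(1)[of n] U] by (intro Np_cong_AE) (auto elim: eventually_mono)
  finally have "Np p UNIV (\<lambda>x. grad (\<psi> n) x - indicator U x *\<^sub>R wgrad U \<phi> x) \<le> ennreal e" using n by simp
  with 1 show "\<exists>\<psi>. test_fun_vec U \<psi> \<and> Np p UNIV (\<lambda>x. \<psi> x - indicator U x *\<^sub>R \<phi> x) \<le> ennreal e \<and>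
      Np p UNIV (\<lambda>x. grad \<psi> x - indicator U x *\<^sub>R wgrad U \<phi> x) \<le> ennreal e"
    using \<psi>(1) by blast
qed auto

lemma Sob0_W1p0:
  assumes S: "Sob0 p U v H" and U: "open U" and p: "p \<ge> 1"
  shows "W1p0 p U v" "AE x in lebesgue. x \<in> U \<longrightarrow> wgrad U v x = H x"
proof -
  note W = Wk_W1p[OF Sob0_Wk[OF S p] U p]
  show eq: "AE x in lebesgue. x \<in> U \<longrightarrow> wgrad U v x = H x" by (rule W(2))
  have "\<forall>n. \<exists>\<psi>. test_fun_vec U \<psi> \<and> Np p UNIV (\<lambda>x. \<psi> x - v x) \<le> ennreal (1 / Suc n) \<and> Np p UNIV (\<lambda>x. grad \<psi> x - H x) \<le> ennreal (1 / Suc n)"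
  proof
    fix n :: nat
    have "(0::real) < 1 / Suc n" by simp
    then show "\<exists>\<psi>. test_fun_vec U \<psi> \<and> Np p UNIV (\<lambda>x. \<psi> x - v x) \<le> ennreal (1 / Suc n) \<and> Np p UNIV (\<lambda>x. grad \<psi> x - H x) \<le> ennreal (1 / Suc n)"
      by (rule Sob0_approx[OF S]) (intro exI conjI)
  qed
  from choice[OF this] obtain \<psi> where h: "\<forall>n. test_fun_vec U (\<psi> n) \<and> Np p UNIV (\<lambda>x. \<psi> n x - v x) \<le> ennreal (1 / Suc n) \<and> Np p UNIV (\<lambda>x. grad (\<psi> n) x - H x) \<le> ennreal (1 / Suc n)" ..
  note \<psi> = h[rule_format, THEN conjunct1] h[rule_format, THEN conjunct2, THEN conjunct1] h[rule_format, THEN conjunct2, THEN conjunct2]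
  have z: "(\<lambda>n. ennreal (1 / Suc n)) \<longlonglongrightarrow> 0"
    using tendsto_ennrealI[OF LIMSEQ_Suc[OF lim_1_over_n]] by simp
  have 1: "(\<lambda>n. Lp_dist p U (\<psi> n) v) \<longlonglongrightarrow> 0"
  proof (rule tendsto_sandwich[OF _ _ tendsto_const z])
    show "eventually (\<lambda>n. Lp_dist p U (\<psi> n) v \<le> ennreal (1 / Suc n)) sequentially"
      unfolding Lp_dist_Np by (intro always_eventually allI order_trans[OF Np_set_mono \<psi>(2)]) simp
  qed simp
  have "Lp_dist p U (wgrad U (\<psi> n)) (wgrad U v) = Np p U (\<lambda>x. grad (\<psi> n) x - H x)" for n
    unfolding Lp_dist_Np
  proof (rule Np_cong_AE)
    show "AE x in lebesgue. x \<in> U \<longrightarrow> wgrad U (\<psi> n) x - wgrad U v x = grad (\<psi> n) x - H x"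
      using test_fun_vec_wgrad[OF \<psi>(1)[of n] U] eq by eventually_elim auto
  qed
  then have 2: "(\<lambda>n. Lp_dist p U (wgrad U (\<psi> n)) (wgrad U v)) \<longlonglongrightarrow> 0"
  proof (intro tendsto_sandwich[OF _ _ tendsto_const z])
    assume eq: "\<And>n. Lp_dist p U (wgrad U (\<psi> n)) (wgrad U v) = Np p U (\<lambda>x. grad (\<psi> n) x - H x)"
    show "eventually (\<lambda>n. Lp_dist p U (wgrad U (\<psi> n)) (wgrad U v) \<le> ennreal (1 / Suc n)) sequentially"
      unfolding eq by (intro always_eventually allI order_trans[OF Np_set_mono \<psi>(3)]) simp
  qed simp
  show "W1p0 p U v" unfolding W1p0_def using W(1) \<psi>(1) 1 2 by blast
qed

text \<open>Zero boundary values in \<open>W1inf0\<close> are expressed with exponent 1. That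
  already gives the weak identity on the whole space; boundedness of function and gradient on the
  cube then upgrades the integrability to every \<open>p\<close>.\<close>

lemma W1inf0_Wk:
  fixes \<phi> :: "real^'n \<Rightarrow> real^'m"
  assumes W: "W1inf0 unitcube \<phi>" and p: "p \<ge> 1"
  shows "Wk p UNIV (\<lambda>x. indicator unitcube x *\<^sub>R \<phi> x) (\<lambda>x. indicator unitcube x *\<^sub>R wgrad unitcube \<phi> x)"
proof -
  let ?Y = "unitcube :: (real^'n) set"
  have Y: "open ?Y" "bounded ?Y" "?Y \<in> sets lebesgue" by (auto simp: unitcube_def)
  have W1: "W1p0 1 ?Y \<phi>" and Wi: "W1inf ?Y \<phi>" using W by (auto simp: W1inf0_def)
  have S: "Sob0 1 ?Y (\<lambda>x. indicator ?Y x *\<^sub>R \<phi> x) (\<lambda>x. indicator ?Y x *\<^sub>R wgrad ?Y \<phi> x)"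
    by (rule W1p0_Sob0[OF W1 Y(1)]) simp
  have W': "Wk 1 UNIV (\<lambda>x. indicator ?Y x *\<^sub>R \<phi> x) (\<lambda>x. indicator ?Y x *\<^sub>R wgrad ?Y \<phi> x)"
    by (rule Sob0_Wk[OF S]) simp
  have fin: "Np p UNIV (\<lambda>x. indicator ?Y x *\<^sub>R f x) < \<infinity>" if f: "AE x in lebesgue. x \<in> ?Y \<longrightarrow> norm (f x) \<le> B" for f :: "real^'n \<Rightarrow> 'c::euclidean_space" and B
  proof -
    have "Np p UNIV (\<lambda>x. indicator ?Y x *\<^sub>R f x) = Np p ?Y (\<lambda>x. indicator ?Y x *\<^sub>R f x)"
      using p by (intro Np_UNIV_supp) auto
    also have "\<dots> < \<infinity>"
      by (rule Np_bounded_finite[of _ _ "max 0 B"]) (use f Y p in \<open>auto elim!: eventually_mono\<close>)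
    finally show ?thesis .
  qed
  obtain B where B: "AE x in lebesgue. x \<in> ?Y \<longrightarrow> norm (\<phi> x) \<le> B"
    using Wi by (auto simp: W1inf_def Linf_def)
  obtain G B' where G: "is_weak_grad ?Y \<phi> G" and B': "AE x in lebesgue. x \<in> ?Y \<longrightarrow> norm (G x) \<le> B'"
    using Wi by (auto simp: W1inf_def Linf_def)
  have "AE x in lebesgue. x \<in> ?Y \<longrightarrow> norm (wgrad ?Y \<phi> x) \<le> B'"
    using wgrad_AE_eq[OF G Y(1)] B' by eventually_elim auto
  from fin[OF this] fin[OF B] show ?thesis using W' unfolding Wk_def by blast
qed

subsection \<open>Difference quotients, the inequalities of Poincare and Friedrichs\<close>

text \<open>Carries an inequality between a function and its gradient from a smooth approximation
  \<psi>, \<Psi> to \<open>u\<close>, \<open>G\<close>. The factor \<open>4 powr p\<close> stems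
  from two triangle inequalities, one for each side.\<close>

lemma Np_transfer:
  fixes u \<psi> :: "real^'n \<Rightarrow> 'b::euclidean_space" and G \<Psi> :: "real^'n \<Rightarrow> 'c::euclidean_space"
  assumes m: "Lmeas u" "Lmeas \<psi>" "Lmeas G" "Lmeas \<Psi>" "Q \<in> sets lebesgue" and p: "0 \<le> p" and A: "A \<ge> 0" and e: "e \<ge> 0"
    and le: "Np p Q (\<lambda>x. u x - \<psi> x) \<le> ennreal e" "Np p Q (\<lambda>x. \<Psi> x - G x) \<le> ennreal e" "Np p Q \<psi> \<le> ennreal A * Np p Q \<Psi> + ennreal e"
  shows "Np p Q u \<le> ennreal (4 powr p * A) * Np p Q G + ennreal (2 powr p * (2 + A * 2 powr p) * e)"
proof -
  define c where "c = 2 powr p"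
  have c: "c \<ge> 0" "4 powr p = c * c" by (simp_all add: c_def powr_mult[symmetric])
  have 1: "Np p Q u \<le> ennreal c * (Np p Q (\<lambda>x. u x - \<psi> x) + Np p Q \<psi>)"
    using Np_add[of "\<lambda>x. u x - \<psi> x" \<psi> Q p] m p by (simp add: c_def)
  have 2: "Np p Q \<Psi> \<le> ennreal c * (Np p Q (\<lambda>x. \<Psi> x - G x) + Np p Q G)"
    using Np_add[of "\<lambda>x. \<Psi> x - G x" G Q p] m p by (simp add: c_def)
  have "Np p Q u \<le> ennreal c * (ennreal e + (ennreal A * (ennreal c * (ennreal e + Np p Q G)) + ennreal e))"
    by (intro order_trans[OF 1] mult_left_mono add_mono le(1) order_trans[OF le(3)] order_trans[OF 2] le(2)) auto
  also have "\<dots> = ennreal c * ennreal c * ennreal A * Np p Q G + ennreal c * (ennreal e + (ennreal A * (ennreal c * ennreal e) + ennreal e))"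
    by (simp only: distrib_left mult.assoc mult.left_commute add.assoc add.left_commute add.commute)
  also have "\<dots> = ennreal (4 powr p * A) * Np p Q G + ennreal (2 powr p * (2 + A * 2 powr p) * e)"
    using c A e unfolding c_def[symmetric]
    by (simp add: ennreal_mult[symmetric] ennreal_plus[symmetric] del: ennreal_plus) (simp add: algebra_simps)
  finally show ?thesis .
qed

lemma norm_matrix_vector_le: "norm ((A::real^'n^'m) *v h) \<le> norm A * norm h"
proof -
  have *: "norm ((A *v h) $ i) \<le> norm (A $ i) * norm h" for i
    using Cauchy_Schwarz_ineq2[of "A $ i" h] by (simp add: matrix_vector_mult_def inner_vec_def)
  have "norm (A *v h) = L2_set (\<lambda>i. norm ((A *v h) $ i)) UNIV" by (simp add: norm_vec_def)
  also have "\<dots> \<le> L2_set (\<lambda>i. norm (A $ i) * norm h) UNIV" by (rule L2_set_mono) (use * in auto)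
  also have "\<dots> = norm A * norm h" by (simp add: L2_set_left_distrib norm_vec_def[of A])
  finally show ?thesis .
qed

text \<open>The fundamental theorem of calculus along the segment from \<open>x\<close> to
  \<open>x + h\<close>, followed by Jensen's inequality for the uniform measure on the unit
  interval. To stay with a scalar integrand, the path is paired with its own total increment
  \<open>?a\<close>, which is divided out at the end.\<close>

lemma difference_powr_le:
  fixes \<psi> :: "real^'n \<Rightarrow> real^'m"
  assumes \<psi>: "test_fun_vec U \<psi>" and p: "p \<ge> 1"
  shows "ennreal (norm ((\<psi> (x + h) - \<xi> *v (x + h)) - (\<psi> x - \<xi> *v x)) powr p) \<le>
    ennreal (norm h powr p) * (\<integral>\<^sup>+t\<in>{0..1}. ennreal (norm (grad \<psi> (x + t *\<^sub>R h) - \<xi>) powr p) \<partial>lborel)"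
proof -
  define w where "w y = \<psi> y - \<xi> *v y" for y
  define D where "D t = grad \<psi> (x + t *\<^sub>R h) - \<xi>" for t :: real
  have Dc: "continuous_on UNIV D"
    unfolding D_def
    by (intro continuous_intros continuous_on_compose2[OF grad_continuous[OF \<psi>]]) auto
  have [measurable]: "D \<in> borel_measurable borel" by (rule borel_measurable_continuous_onI[OF Dc])
  let ?a = "w (x + h) - w x"
  define I where "I = (\<lambda>t. indicator {0..1::real} t :: real)"
  define M where "M = density lborel (\<lambda>t::real. ennreal (I t))"
  interpret M: prob_space M
    by (rule prob_spaceI) (simp add: M_def I_def emeasure_density ennreal_indicator)
  have ND: "integrable lborel (\<lambda>t. I t * norm (D t))"
    using borel_integrable_compact[of "{0..1::real}" "\<lambda>t. norm (D t)"] continuous_on_norm[OF continuous_on_subset[OF Dc]]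
    by (simp add: set_integrable_def I_def)
  have cmp: "((\<lambda>t. ?a \<bullet> w (x + t *\<^sub>R h)) has_vector_derivative ?a \<bullet> (D t *v h)) (at t)" for t
  proof -
    have 1: "((\<lambda>t. \<psi> (x + t *\<^sub>R h) $ i) has_real_derivative (grad \<psi> (x + t *\<^sub>R h) *v h) $ i) (at t)" for i
    proof -
      note C = test_fun_C_inf[OF test_fun_vec_nth[OF \<psi>, of i]]
      let ?F = "frechet_derivative (\<lambda>x. \<psi> x $ i) (at (x + t *\<^sub>R h))"
      have "((\<lambda>t. \<psi> (x + t *\<^sub>R h) $ i) has_derivative (\<lambda>s. ?F (s *\<^sub>R h))) (at t)"
        by (rule has_derivative_compose[of "\<lambda>t. x + t *\<^sub>R h" _ t UNIV "\<lambda>x. \<psi> x $ i"])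
          (auto intro!: derivative_eq_intros C_inf_has_derivative C)
      moreover have "?F (s *\<^sub>R h) = (grad \<psi> (x + t *\<^sub>R h) *v h) $ i * s" for s
        by (simp add: frechet_derivative_pd[OF C] grad_def matrix_vector_mult_def sum_distrib_left sum_distrib_right mult_ac)
      ultimately show ?thesis by (simp add: has_field_derivative_def)
    qed
    have 2: "((\<lambda>t. (\<xi> *v (x + t *\<^sub>R h)) $ i) has_real_derivative (\<xi> *v h) $ i) (at t)" for i
    proof -
      have "(\<xi> *v (x + t *\<^sub>R h)) $ i = (\<xi> *v x) $ i + t * (\<xi> *v h) $ i" for t
        by (simp add: matrix_vector_right_distrib matrix_vector_mult_scaleR)
      then show ?thesis by (auto intro!: derivative_eq_intros)
    qed
    have "((\<lambda>t. \<Sum>i\<in>UNIV. ?a $ i * (\<psi> (x + t *\<^sub>R h) $ i - (\<xi> *v (x + t *\<^sub>R h)) $ i)) has_real_derivative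
        (\<Sum>i\<in>UNIV. ?a $ i * ((grad \<psi> (x + t *\<^sub>R h) *v h) $ i - (\<xi> *v h) $ i))) (at t)"
      by (intro DERIV_sum DERIV_cmult DERIV_diff 1 2)
    then show ?thesis
      by (simp add: has_real_derivative_iff_has_vector_derivative inner_vec_def w_def D_def matrix_vector_mult_diff_rdistrib)
  qed
  have "norm ?a \<le> norm h * (\<integral>t. norm (D t) \<partial>M)"
  proof (cases "?a = 0")
    case True
    then show ?thesis by (simp add: M_def)
  next
    case False
    have "(\<integral>t. indicator {0..1} t *\<^sub>R (?a \<bullet> (D t *v h)) \<partial>lborel) = ?a \<bullet> w (x + 1 *\<^sub>R h) - ?a \<bullet> w (x + 0 *\<^sub>R h)"
    proof (rule integral_FTC_atLeastAtMost)
      show "continuous_on {0..1} (\<lambda>t. ?a \<bullet> (D t *v h))"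
        by (intro continuous_intros continuous_on_inner) (auto simp: matrix_vector_mult_def intro!: continuous_intros continuous_on_subset[OF Dc])
    qed (use cmp in \<open>auto intro: has_vector_derivative_at_within\<close>)
    then have "norm ?a * norm ?a = (\<integral>t. I t * (?a \<bullet> (D t *v h)) \<partial>lborel)"
      by (simp add: I_def inner_diff_right[symmetric] power2_norm_eq_inner[symmetric] power2_eq_square)
    also have "\<dots> \<le> (\<integral>t. norm ?a * norm h * (I t * norm (D t)) \<partial>lborel)"
    proof (rule integral_mono')
      show "integrable lborel (\<lambda>t. norm ?a * norm h * (I t * norm (D t)))" using ND by (rule integrable_mult_right)
      fix t
      have "?a \<bullet> (D t *v h) \<le> norm ?a * norm (D t *v h)" by (rule norm_cauchy_schwarz)
      also have "\<dots> \<le> norm ?a * (norm (D t) * norm h)" by (intro mult_left_mono norm_matrix_vector_le) auto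
      finally show "I t * (?a \<bullet> (D t *v h)) \<le> norm ?a * norm h * (I t * norm (D t))"
        by (auto simp: I_def indicator_def mult_ac)
      show "0 \<le> norm ?a * norm h * (I t * norm (D t))" by (simp add: I_def)
    qed
    also have "\<dots> = norm ?a * (norm h * (\<integral>t. norm (D t) \<partial>M))"
      unfolding M_def by (subst integral_density) (auto simp: I_def mult.assoc)
    finally show ?thesis using False by (simp add: mult_le_cancel_left)
  qed
  then have "ennreal (norm ?a powr p) \<le> ennreal ((norm h * (\<integral>t. norm (D t) \<partial>M)) powr p)"
    using p by (intro ennreal_leI powr_mono2) auto
  also have "\<dots> = ennreal (norm h powr p) * ennreal ((\<integral>t. norm (D t) \<partial>M) powr p)"
    by (simp add: powr_mult ennreal_mult)
  also have "\<dots> \<le> ennreal (norm h powr p) * (\<integral>\<^sup>+t. ennreal (norm (D t) powr p) \<partial>M)"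
  proof (intro mult_left_mono M.jensen_powr p)
    show "integrable M (\<lambda>t. norm (D t))"
      unfolding M_def using ND by (subst integrable_density) (auto simp: I_def)
  qed auto
  also have "(\<integral>\<^sup>+t. ennreal (norm (D t) powr p) \<partial>M) = (\<integral>\<^sup>+t\<in>{0..1}. ennreal (norm (D t) powr p) \<partial>lborel)"
    unfolding M_def by (subst nn_integral_density) (auto simp: I_def mult.commute ennreal_indicator)
  finally show ?thesis unfolding w_def D_def .
qed

lemma nn_integral_lborel_translation:
  fixes f :: "'a::euclidean_space \<Rightarrow> ennreal"
  assumes "f \<in> borel_measurable borel"
  shows "(\<integral>\<^sup>+x. f (t + x) \<partial>lborel) = (\<integral>\<^sup>+x. f x \<partial>lborel)"
  using nn_integral_translation[of f t] assms by (simp add: nn_integral_completion measurable_completion)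

text \<open>The pointwise estimate is integrated over \<open>A\<close> and the integrals are
  exchanged: for each fixed \<open>t\<close> the translated gradient integral over \<open>A\<close>
  is at most the one over \<open>B\<close>, since \<open>A\<close> shifted by
  \<open>t *\<^sub>R h\<close> stays in \<open>B\<close>.\<close>

lemma difference_Np_le:
  fixes \<psi> :: "real^'n \<Rightarrow> real^'m"
  assumes \<psi>: "test_fun_vec U \<psi>" and p: "p \<ge> 1" and A: "A \<in> sets borel" and B: "B \<in> sets borel"
    and AB: "\<And>x t. x \<in> A \<Longrightarrow> 0 \<le> t \<Longrightarrow> t \<le> 1 \<Longrightarrow> x + t *\<^sub>R h \<in> B"
  shows "(\<integral>\<^sup>+x\<in>A. ennreal (norm ((\<psi> (x + h) - \<xi> *v (x + h)) - (\<psi> x - \<xi> *v x)) powr p) \<partial>lborel)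
    \<le> ennreal (norm h powr p) * Np p B (\<lambda>x. grad \<psi> x - \<xi>)"
proof -
  define F where "F x = ennreal (norm (grad \<psi> x - \<xi>) powr p)" for x
  have [measurable]: "grad \<psi> \<in> borel_measurable borel" by (rule borel_measurable_continuous_onI[OF grad_continuous[OF \<psi>]])
  have [measurable]: "F \<in> borel_measurable borel" unfolding F_def by measurable
  note [measurable] = A B
  have F2: "(\<lambda>(x, t). F (x + t *\<^sub>R h) * indicator {0..1::real} t * indicator A x) \<in> borel_measurable (lborel \<Otimes>\<^sub>M lborel)"
    by measurable
  have "(\<integral>\<^sup>+x. (\<integral>\<^sup>+t. F (x + t *\<^sub>R h) * indicator {0..1::real} t * indicator A x \<partial>lborel) \<partial>lborel)
     = (\<integral>\<^sup>+t. (\<integral>\<^sup>+x. F (x + t *\<^sub>R h) * indicator {0..1::real} t * indicator A x \<partial>lborel) \<partial>lborel)"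
    by (rule lborel_pair.Fubini'[symmetric, OF F2])
  also have "\<dots> \<le> (\<integral>\<^sup>+t. Np p B (\<lambda>x. grad \<psi> x - \<xi>) * indicator {0..1::real} t \<partial>lborel)"
  proof (rule nn_integral_mono)
    fix t :: real
    show "(\<integral>\<^sup>+x. F (x + t *\<^sub>R h) * indicator {0..1} t * indicator A x \<partial>lborel) \<le> Np p B (\<lambda>x. grad \<psi> x - \<xi>) * indicator {0..1} t"
    proof (cases "t \<in> {0..1}")
      case True
      have "(\<integral>\<^sup>+x. F (x + t *\<^sub>R h) * indicator {0..1} t * indicator A x \<partial>lborel) \<le> (\<integral>\<^sup>+x. (\<lambda>y. F y * indicator B y) (t *\<^sub>R h + x) \<partial>lborel)"
        using AB True by (intro nn_integral_mono) (auto simp: indicator_def add.commute)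
      also have "\<dots> = (\<integral>\<^sup>+y. F y * indicator B y \<partial>lborel)"
        by (rule nn_integral_lborel_translation) measurable
      also have "\<dots> = Np p B (\<lambda>x. grad \<psi> x - \<xi>)" by (simp add: Np_def F_def nn_integral_completion)
      finally show ?thesis using True by simp
    qed simp
  qed
  also have "\<dots> = Np p B (\<lambda>x. grad \<psi> x - \<xi>)" by (simp add: nn_integral_cmult)
  finally have I: "(\<integral>\<^sup>+x. (\<integral>\<^sup>+t. F (x + t *\<^sub>R h) * indicator {0..1::real} t * indicator A x \<partial>lborel) \<partial>lborel) \<le> Np p B (\<lambda>x. grad \<psi> x - \<xi>)" .
  have "(\<integral>\<^sup>+x\<in>A. ennreal (norm ((\<psi> (x + h) - \<xi> *v (x + h)) - (\<psi> x - \<xi> *v x)) powr p) \<partial>lborel)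
     \<le> (\<integral>\<^sup>+x. ennreal (norm h powr p) * (\<integral>\<^sup>+t. F (x + t *\<^sub>R h) * indicator {0..1::real} t * indicator A x \<partial>lborel) \<partial>lborel)"
  proof (rule nn_integral_mono)
    fix x
    show "ennreal (norm ((\<psi> (x + h) - \<xi> *v (x + h)) - (\<psi> x - \<xi> *v x)) powr p) * indicator A x
      \<le> ennreal (norm h powr p) * (\<integral>\<^sup>+t. F (x + t *\<^sub>R h) * indicator {0..1::real} t * indicator A x \<partial>lborel)"
      using difference_powr_le[OF \<psi> p, of x h \<xi>] by (cases "x \<in> A") (auto simp: F_def)
  qed
  also have "\<dots> = ennreal (norm h powr p) * (\<integral>\<^sup>+x. (\<integral>\<^sup>+t. F (x + t *\<^sub>R h) * indicator {0..1::real} t * indicator A x \<partial>lborel) \<partial>lborel)"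
    using F2 by (intro nn_integral_cmult lborel.borel_measurable_nn_integral)
  also have "\<dots> \<le> ennreal (norm h powr p) * Np p B (\<lambda>x. grad \<psi> x - \<xi>)" by (intro mult_left_mono I) auto
  finally show ?thesis .
qed

section \<open>Cubes given by their lower corner and side\<close>

definition cube :: "real^'n \<Rightarrow> real \<Rightarrow> (real^'n) set" where
  "cube a r = box a (a + (\<chi> i. r))"

definition ccube :: "real^'n \<Rightarrow> real \<Rightarrow> (real^'n) set" where
  "ccube a r = cbox a (a + (\<chi> i. r))"

lemma One_eq: "(One :: real^'n) = (\<chi> i. 1)"
proof -
  have "(One :: real^'n) \<bullet> axis i 1 = 1" for i
    using inner_sum_left_Basis[of "axis i 1 :: real^'n" "\<lambda>_. 1"] by simp
  then have "(One :: real^'n) $ i = 1" for i unfolding cart_eq_inner_axis .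
  then show ?thesis unfolding vec_eq_iff by simp
qed

lemma mem_cube: "x \<in> cube a r \<longleftrightarrow> (\<forall>i. a $ i < x $ i \<and> x $ i < a $ i + r)"
  by (simp add: cube_def mem_box_cart)

lemma mem_ccube: "x \<in> ccube a r \<longleftrightarrow> (\<forall>i. a $ i \<le> x $ i \<and> x $ i \<le> a $ i + r)"
  by (simp add: ccube_def mem_box_cart)

lemma box_eq_cube: "box 0 (r *\<^sub>R One) = cube 0 r"
  by (simp only: One_eq) (auto simp: mem_cube mem_box_cart)

lemma unitcube_eq_cube: "unitcube = cube 0 1"
  using box_eq_cube[of 1] by (simp add: unitcube_def)

lemma cube_subset_ccube: "cube a r \<subseteq> ccube a r"
  by (auto simp: mem_cube mem_ccube less_imp_le)

lemma cube_subset_cube: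
  assumes "\<And>i. b $ i \<le> a $ i \<and> a $ i + r \<le> b $ i + s" shows "cube a r \<subseteq> cube b s"
  using assms by (simp add: subset_iff mem_cube) (smt (verit))

lemma ccube_subset_cube:
  assumes "\<And>i. b $ i < a $ i \<and> a $ i + r < b $ i + s" shows "ccube a r \<subseteq> cube b s"
  using assms by (simp add: subset_iff mem_cube mem_ccube) (smt (verit))

lemma ccube_subset_ccube:
  assumes "\<And>i. b $ i \<le> a $ i \<and> a $ i + r \<le> b $ i + s" shows "ccube a r \<subseteq> ccube b s"
  using assms by (simp add: subset_iff mem_ccube) (smt (verit))

lemma scaled_in_cube:
  assumes "r > 0"
  shows "(1/r) *\<^sub>R (x - a) \<in> cube b R \<longleftrightarrow> x \<in> cube (a + r *\<^sub>R b) (r * R)"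
    "(1/r) *\<^sub>R (x - a) \<in> ccube b R \<longleftrightarrow> x \<in> ccube (a + r *\<^sub>R b) (r * R)"
  using assms by (auto simp: mem_cube mem_ccube field_simps)

lemma cube_basic [simp, intro]: "open (cube a r)" "compact (ccube a r)" "bounded (cube a r)" "cube a r \<in> sets borel" "cube a r \<in> sets lebesgue"
    "ccube a r \<in> sets lebesgue" "convex (cube a r)"
  by (auto simp: cube_def ccube_def)

lemma cube_empty: "r \<le> 0 \<Longrightarrow> cube a r = {}"
proof -
  assume r: "r \<le> 0"
  have False if "x \<in> cube a r" for x
  proof -
    have "a $ undefined < x $ undefined" "x $ undefined < a $ undefined + r" using that by (auto simp: mem_cube)
    with r show False by linarith
  qed
  then show ?thesis by blast
qed

lemma emeasure_cube:
  fixes a :: "real^'n"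
  assumes "r \<ge> 0"
  shows "emeasure lebesgue (cube a r) = ennreal (r ^ CARD('n))" "emeasure lebesgue (ccube a r) = ennreal (r ^ CARD('n))"
proof -
  have b: "(\<chi> i. r) \<bullet> b = r" if bB: "b \<in> Basis" for b :: "real^'n"
  proof -
    obtain i where "b = axis i 1" using bB by (auto simp: Basis_vec_def)
    then show ?thesis by (simp add: inner_axis)
  qed
  have pr: "(\<Prod>b\<in>(Basis :: (real^'n) set). (\<chi> i. r) \<bullet> b) = r ^ CARD('n)" by (simp add: b)
  have "emeasure lborel (cube a r) = ennreal (\<Prod>b\<in>Basis. ((\<chi> i. r) :: real^'n) \<bullet> b)"
    unfolding cube_def using assms by (subst emeasure_lborel_box) (auto simp: inner_add_left b)
  then show "emeasure lebesgue (cube a r) = ennreal (r ^ CARD('n))" by (simp add: pr)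
  have "emeasure lborel (ccube a r) = ennreal (\<Prod>b\<in>Basis. ((\<chi> i. r) :: real^'n) \<bullet> b)"
    unfolding ccube_def using assms by (subst emeasure_lborel_cbox) (auto simp: inner_add_left b)
  then show "emeasure lebesgue (ccube a r) = ennreal (r ^ CARD('n))" by (simp add: pr ccube_def)
qed

lemma null_ccube_diff_cube: "ccube a r - cube a r \<in> null_sets lebesgue"
proof -
  have "negligible (cbox a (a + (\<chi> i. r)) - box a (a + (\<chi> i. r)))" by (rule negligible_frontier_interval)
  then show ?thesis by (simp add: cube_def ccube_def negligible_iff_null_sets)
qed

lemma norm_le_card: "(\<And>i. \<bar>(h::real^'n) $ i\<bar> \<le> r) \<Longrightarrow> norm h \<le> real CARD('n) * r"
  by (rule order_trans[OF norm_le_l1_cart]) (rule sum_bounded_above)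

text \<open>In place of the mean value, the constant is the value of \<open>w\<close> at a well
  chosen point \<open>y\<close>. The differences \<open>w x - w y\<close> are averaged over all
  \<open>y\<close>, with \<open>x = y + h\<close>: the increment \<open>h\<close> ranges over a cube
  of side \<open>2 * r\<close>, which gives the factor \<open>2 ^ CARD('n)\<close>, and has norm at
  most \<open>CARD('n) * r\<close>. Some \<open>y\<close> must do at least as well as the average,
  up to \<tau>.\<close>

lemma poincare_test_fun:
  fixes \<psi> :: "real^'n \<Rightarrow> real^'m"
  assumes \<psi>: "test_fun_vec U \<psi>" and p: "p \<ge> 1" and r: "r > 0" and \<tau>: "\<tau> > 0"
  shows "\<exists>b. Np p (cube a r) (\<lambda>x. \<psi> x - (b + \<xi> *v x)) \<le>
    ennreal (2 ^ CARD('n) * (real CARD('n) * r) powr p) * Np p (cube a r) (\<lambda>x. grad \<psi> x - \<xi>) + ennreal \<tau>"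
proof -
  let ?Q = "cube a r" and ?R = "cube ((\<chi> i. - r) :: real^'n) (2 * r)" and ?n = "CARD('n)"
  define w where "w y = \<psi> y - \<xi> *v y" for y
  define X where "X = Np p ?Q (\<lambda>x. grad \<psi> x - \<xi>)"
  have wc: "continuous_on UNIV w"
    unfolding w_def by (intro continuous_intros test_fun_vec_continuous[OF \<psi>] linear_continuous_on) (simp add: matrix_vector_mul_bounded_linear)
  have [measurable]: "w \<in> borel_measurable borel" by (rule borel_measurable_continuous_onI[OF wc])
  define K where "K = ennreal (2 ^ ?n * (real ?n * r) powr p) * X + ennreal \<tau>"
  define F where "F y = (\<integral>\<^sup>+x. ennreal (norm (w x - w y) powr p) * indicator ?Q x \<partial>lborel)" for y
  have "\<exists>y\<in>?Q. F y \<le> K"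
  proof (rule ccontr)
    assume "\<not> (\<exists>y\<in>?Q. F y \<le> K)"
    then have big: "F y \<ge> K" if "y \<in> ?Q" for y using that by (meson le_cases)
    have [measurable]: "?Q \<in> sets borel" by simp
    have meas: "(\<lambda>(x, h). ennreal (norm (w (h + x) - w x) powr p) * indicator ?Q (h + x) * indicator ?Q x) \<in> borel_measurable (lborel \<Otimes>\<^sub>M lborel)"
      by measurable
    have "K * ennreal (r ^ ?n) = (\<integral>\<^sup>+y. K * indicator ?Q y \<partial>lborel)"
      using emeasure_cube(1)[of r a] r by (simp add: nn_integral_cmult_indicator)
    also have "\<dots> \<le> (\<integral>\<^sup>+y. F y * indicator ?Q y \<partial>lborel)"
      using big by (intro nn_integral_mono) (auto simp: indicator_def)
    also have "\<dots> = (\<integral>\<^sup>+y. (\<integral>\<^sup>+h. ennreal (norm (w (h + y) - w y) powr p) * indicator ?Q (h + y) * indicator ?Q y \<partial>lborel) \<partial>lborel)"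
    proof (intro nn_integral_cong)
      fix y :: "real^'n"
      have "F y = (\<integral>\<^sup>+x. (\<lambda>z. ennreal (norm (w z - w y) powr p) * indicator ?Q z) (y + x) \<partial>lborel)"
        unfolding F_def by (rule nn_integral_lborel_translation[symmetric]) measurable
      then show "F y * indicator ?Q y = (\<integral>\<^sup>+h. ennreal (norm (w (h + y) - w y) powr p) * indicator ?Q (h + y) * indicator ?Q y \<partial>lborel)"
        by (cases "y \<in> ?Q") (auto simp: add.commute)
    qed
    also have "\<dots> = (\<integral>\<^sup>+h. (\<integral>\<^sup>+y. ennreal (norm (w (h + y) - w y) powr p) * indicator ?Q (h + y) * indicator ?Q y \<partial>lborel) \<partial>lborel)"
      by (rule lborel_pair.Fubini'[symmetric, OF meas])
    also have "\<dots> \<le> (\<integral>\<^sup>+h. ennreal ((real ?n * r) powr p) * X * indicator ?R h \<partial>lborel)"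
    proof (rule nn_integral_mono)
      fix h :: "real^'n"
      let ?A = "?Q \<inter> (\<lambda>x. h + x) -` ?Q"
      have A: "?A \<in> sets borel" by measurable
      show "(\<integral>\<^sup>+y. ennreal (norm (w (h + y) - w y) powr p) * indicator ?Q (h + y) * indicator ?Q y \<partial>lborel) \<le> ennreal ((real ?n * r) powr p) * X * indicator ?R h"
      proof (cases "h \<in> ?R")
        case True
        have "\<bar>h $ i\<bar> \<le> r" for i
        proof -
          have "- r < h $ i \<and> h $ i < r" using True by (simp add: mem_cube)
          then show ?thesis by linarith
        qed
        then have hn: "norm h \<le> real ?n * r" by (rule norm_le_card)
        have "(\<integral>\<^sup>+y. ennreal (norm (w (h + y) - w y) powr p) * indicator ?Q (h + y) * indicator ?Q y \<partial>lborel)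
          = (\<integral>\<^sup>+y\<in>?A. ennreal (norm ((\<psi> (y + h) - \<xi> *v (y + h)) - (\<psi> y - \<xi> *v y)) powr p) \<partial>lborel)"
          by (intro nn_integral_cong) (auto simp: indicator_def w_def add.commute)
        also have "\<dots> \<le> ennreal (norm h powr p) * X"
          unfolding X_def
        proof (rule difference_Np_le[OF \<psi> p A])
          fix x and t :: real assume x: "x \<in> ?A" and t: "0 \<le> t" "t \<le> 1"
          have "x + t *\<^sub>R h = (1 - t) *\<^sub>R x + t *\<^sub>R (h + x)" by (simp add: algebra_simps)
          also have "\<dots> \<in> ?Q" using x t by (intro convexD[OF cube_basic(7)]) auto
          finally show "x + t *\<^sub>R h \<in> ?Q" .
        qed simp
        also have "\<dots> \<le> ennreal ((real ?n * r) powr p) * X"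
          using hn p by (intro mult_right_mono ennreal_leI powr_mono2) auto
        finally show ?thesis using True by simp
      next
        case False
        have "indicator ?Q (h + y) * indicator ?Q y = (0::ennreal)" for y
        proof (rule ccontr)
          assume "indicator ?Q (h + y) * indicator ?Q y \<noteq> (0::ennreal)"
          then have "h + y \<in> ?Q" "y \<in> ?Q" by (auto simp: indicator_def split: if_splits)
          then have "h \<in> ?R" unfolding mem_cube
            by (auto simp: add_less_cancel_left) (smt (verit, ccfv_SIG))+
          with False show False by simp
        qed
        then have "(\<integral>\<^sup>+y. ennreal (norm (w (h + y) - w y) powr p) * indicator ?Q (h + y) * indicator ?Q y \<partial>lborel) = (\<integral>\<^sup>+y. 0 \<partial>(lborel :: (real^'n) measure))"
          by (intro nn_integral_cong) (simp only: mult.assoc mult_zero_right)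
        then show ?thesis by simp
      qed
    qed
    also have "\<dots> = ennreal ((real ?n * r) powr p) * X * ennreal ((2 * r) ^ ?n)"
      using emeasure_cube(1)[of "2 * r" "(\<chi> i. - r) :: real^'n"] r by (simp add: nn_integral_cmult_indicator)
    finally have le: "K * ennreal (r ^ ?n) \<le> ennreal ((real ?n * r) powr p) * X * ennreal ((2 * r) ^ ?n)" .
    \<comment> \<open>Finiteness of \<open>X\<close> lets it cancel from both sides; what is left
      bounds a positive multiple of \<tau> by 0.\<close>
    have "X < \<infinity>"
      unfolding X_def using WkD(4)[OF Wk_diff[OF Sob0_Wk[OF Sob0_test_fun[OF \<psi>]] Wk_affine]] p by auto
    then obtain y where y: "X = ennreal y" "y \<ge> 0" by (cases X) auto
    define c where "c = (real ?n * r) powr p"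
    have c0: "c \<ge> 0" by (simp add: c_def)
    have "ennreal ((2 ^ ?n * c * y + \<tau>) * r ^ ?n) \<le> ennreal (c * y * (2 * r) ^ ?n)"
      using le y c0 r \<tau> unfolding K_def c_def[symmetric]
      by (simp add: ennreal_plus[symmetric] ennreal_mult[symmetric] del: ennreal_plus)
    then have "(2 ^ ?n * c * y + \<tau>) * r ^ ?n \<le> c * y * (2 * r) ^ ?n"
      using y c0 r by (subst (asm) ennreal_le_iff) auto
    then have "\<tau> * r ^ ?n \<le> 0" by (simp add: power_mult_distrib algebra_simps)
    moreover have "0 < \<tau> * r ^ ?n" using \<tau> r by simp
    ultimately show False by linarith
  qed
  then obtain y where y: "F y \<le> K" by blast
  have "Np p ?Q (\<lambda>x. \<psi> x - (w y + \<xi> *v x)) = F y"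
    unfolding Np_def F_def nn_integral_completion by (intro nn_integral_cong) (simp add: w_def algebra_simps)
  with y show ?thesis unfolding K_def X_def by (intro exI[of _ "w y"]) simp
qed

lemma pd_cong_open:
  assumes "open S" "x \<in> S" "\<And>y. y \<in> S \<Longrightarrow> f y = g y"
  shows "pd j f x = pd j g x"
proof -
  have "(f has_derivative D) (at x) \<longleftrightarrow> (g has_derivative D) (at x)" for D
    using has_derivative_transform_within_open[of f D x UNIV S g] has_derivative_transform_within_open[of g D x UNIV S f] assms by auto
  then show ?thesis by (simp add: pd_def frechet_derivative_def)
qed

lemma gvec_eq_0_on_open:
  assumes "open S" "x \<in> S" "\<And>y. y \<in> S \<Longrightarrow> \<theta> y = c"
  shows "gvec \<theta> x = 0"
proof -
  have "pd j \<theta> x = pd j (\<lambda>_. c) x" for j by (rule pd_cong_open[OF assms])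
  moreover have "pd j (\<lambda>_. c) x = 0" for j
    unfolding pd_def by (subst frechet_derivative_eqI[of _ "\<lambda>_. 0"]) auto
  ultimately show ?thesis by (simp add: vec_eq_iff)
qed

text \<open>A cutoff equal to 1 on the closed cube turns \<open>u\<close> into a function with zero
  boundary values without changing it on the cube; its smooth approximations satisfy the inequality,
  and \<open>Np_transfer\<close> carries it over. This is why the closed cube has to lie in
  \<open>U\<close>.\<close>

lemma poincare:
  fixes u :: "real^'n \<Rightarrow> real^'m"
  assumes W: "Wk p U u G" and U: "open U" and p: "p \<ge> 1" and r: "r > 0" and \<tau>: "\<tau> > 0" and sub: "ccube a r \<subseteq> U"
  shows "\<exists>b. Np p (cube a r) (\<lambda>x. u x - (b + \<xi> *v x)) \<le>
    ennreal (4 powr p * (2 ^ CARD('n) * (real CARD('n) * r) powr p)) * Np p (cube a r) (\<lambda>x. G x - \<xi>) + ennreal \<tau>"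
proof -
  let ?Q = "cube a r"
  have p0: "p \<ge> 0" using p by simp
  define A where "A = 2 ^ CARD('n) * (real CARD('n) * r) powr p"
  have A0: "A \<ge> 0" by (simp add: A_def)
  obtain e where e: "e > 0" "2 powr p * (2 + A * 2 powr p) * e \<le> \<tau>"
    using ex_small_factor[OF _ \<tau>, of "2 powr p * (2 + A * 2 powr p)"] A0 by auto
  obtain \<theta> where \<theta>: "test_fun U \<theta>" "\<And>x. x \<in> ccube a r \<Longrightarrow> \<theta> x = 1"
    using ex_cutoff[OF cube_basic(2) U sub] by metis
  have \<theta>1: "\<theta> x = 1" "gvec \<theta> x = 0" if "x \<in> ?Q" for x
  proof -
    show "\<theta> x = 1" using \<theta>(2) that cube_subset_ccube by blast
    show "gvec \<theta> x = 0" by (rule gvec_eq_0_on_open[OF cube_basic(1) that, of _ 1]) (use \<theta>(2) cube_subset_ccube in blast)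
  qed
  note S = Sob0_mult_test_fun[OF W \<theta>(1) p U]
  obtain \<psi> where \<psi>: "test_fun_vec U \<psi>" "Np p UNIV (\<lambda>x. \<psi> x - \<theta> x *\<^sub>R u x) \<le> ennreal e"
      "Np p UNIV (\<lambda>x. grad \<psi> x - (\<theta> x *\<^sub>R G x + outer (u x) (gvec \<theta> x))) \<le> ennreal e"
    using Sob0_approx[OF S e(1)] by blast
  note m[measurable] = test_fun_vec_measurable[OF \<psi>(1)] WkD(1,2)[OF W]
  have 1: "Np p ?Q (\<lambda>x. u x - \<psi> x) \<le> ennreal e"
  proof -
    have "Np p ?Q (\<lambda>x. u x - \<psi> x) = Np p ?Q (\<lambda>x. \<psi> x - \<theta> x *\<^sub>R u x)"
      unfolding Np_commute[of p ?Q u] by (intro Np_cong_AE) (use \<theta>1 in auto)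
    also have "\<dots> \<le> ennreal e" by (rule order_trans[OF Np_set_mono \<psi>(2)]) simp
    finally show ?thesis .
  qed
  have 2: "Np p ?Q (\<lambda>x. grad \<psi> x - G x) \<le> ennreal e"
  proof -
    have "outer (u x) 0 = (0 :: real^'n^'m)" for x by (simp add: vec_eq_iff)
    then have "Np p ?Q (\<lambda>x. grad \<psi> x - G x) = Np p ?Q (\<lambda>x. grad \<psi> x - (\<theta> x *\<^sub>R G x + outer (u x) (gvec \<theta> x)))"
      by (intro Np_cong_AE) (use \<theta>1 in auto)
    also have "\<dots> \<le> ennreal e" by (rule order_trans[OF Np_set_mono \<psi>(3)]) simp
    finally show ?thesis .
  qed
  obtain b where b: "Np p ?Q (\<lambda>x. \<psi> x - (b + \<xi> *v x)) \<le> ennreal A * Np p ?Q (\<lambda>x. grad \<psi> x - \<xi>) + ennreal e"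
    using poincare_test_fun[OF \<psi>(1) p r e(1), of a \<xi>] unfolding A_def by blast
  have [measurable]: "Lmeas (\<lambda>x. b + \<xi> *v x)"
    by (rule WkD(1)[OF Wk_affine[OF bounded_empty p0]])
  have "Np p ?Q (\<lambda>x. u x - (b + \<xi> *v x)) \<le> ennreal (4 powr p * A) * Np p ?Q (\<lambda>x. G x - \<xi>) + ennreal (2 powr p * (2 + A * 2 powr p) * e)"
    by (rule Np_transfer[OF _ _ _ _ _ p0 A0 less_imp_le[OF e(1)] _ _ b]) (use 1 2 in auto)
  also have "\<dots> \<le> ennreal (4 powr p * A) * Np p ?Q (\<lambda>x. G x - \<xi>) + ennreal \<tau>"
    using e(2) by (intro add_left_mono ennreal_leI)
  finally show ?thesis unfolding A_def by blast
qed

text \<open>A shift by the full side of the cube in one coordinate moves the cube off itself, so for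
  \<open>x\<close> in the cube the difference of the two values is just the value at
  \<open>x\<close>, and the difference estimate applies.\<close>

lemma friedrichs:
  fixes v :: "real^'n \<Rightarrow> real^'m"
  assumes S: "Sob0 p (cube a r) v H" and p: "p \<ge> 1" and r: "r > 0"
  shows "Np p UNIV v \<le> ennreal (4 powr p * r powr p) * Np p UNIV H"
proof (rule ennreal_le_epsilon)
  fix \<tau> :: real assume \<tau>: "\<tau> > 0"
  define A where "A = r powr p"
  have A: "A \<ge> 0" by (simp add: A_def)
  obtain e where e: "e > 0" "2 powr p * (2 + A * 2 powr p) * e \<le> \<tau>"
    using ex_small_factor[OF _ \<tau>, of "2 powr p * (2 + A * 2 powr p)"] A by auto
  obtain \<psi> where \<psi>: "test_fun_vec (cube a r) \<psi>" "Np p UNIV (\<lambda>x. \<psi> x - v x) \<le> ennreal e" "Np p UNIV (\<lambda>x. grad \<psi> x - H x) \<le> ennreal e"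
    using Sob0_approx[OF S e(1)] by blast
  note m[measurable] = test_fun_vec_measurable[OF \<psi>(1)] Sob0_measurable[OF S]
  obtain K where K: "K \<subseteq> cube a r" "\<And>x. x \<notin> K \<Longrightarrow> \<psi> x = 0" using test_fun_vec_support[OF \<psi>(1)] by metis
  obtain i :: 'n where True by simp
  define h :: "real^'n" where "h = r *\<^sub>R axis i 1"
  have hn: "norm h = r" using r by (simp add: h_def)
  have z: "\<psi> x = 0" if "x \<notin> cube a r" for x using K that by blast
  have out: "\<psi> (x + h) = 0" if "x \<in> cube a r" for x
  proof (rule z)
    have "(x + h) $ i = x $ i + r" by (simp add: h_def)
    moreover have "a $ i < x $ i" using that by (simp add: mem_cube)
    ultimately have "\<not> (x + h) $ i < a $ i + r" by linarith
    then show "x + h \<notin> cube a r" unfolding mem_cube by blast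
  qed
  have "Np p UNIV \<psi> = (\<integral>\<^sup>+x\<in>cube a r. ennreal (norm ((\<psi> (x + h) - 0 *v (x + h)) - (\<psi> x - 0 *v x)) powr p) \<partial>lborel)"
    unfolding Np_def nn_integral_completion using z out p by (intro nn_integral_cong) (auto simp: indicator_def)
  also have "\<dots> \<le> ennreal (norm h powr p) * Np p UNIV (\<lambda>x. grad \<psi> x - 0)"
    by (rule difference_Np_le[OF \<psi>(1) p]) auto
  also have "\<dots> = ennreal A * Np p UNIV (grad \<psi>)" by (simp add: hn A_def)
  finally have t: "Np p UNIV \<psi> \<le> ennreal A * Np p UNIV (grad \<psi>) + ennreal e" by (rule order_trans) simp
  have "Np p UNIV v \<le> ennreal (4 powr p * A) * Np p UNIV H + ennreal (2 powr p * (2 + A * 2 powr p) * e)"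
    by (rule Np_transfer[OF _ _ _ _ _ _ A less_imp_le[OF e(1)] _ \<psi>(3) t]) (use \<psi>(2) p in \<open>auto simp: Np_commute[of p UNIV v]\<close>)
  also have "\<dots> \<le> ennreal (4 powr p * A) * Np p UNIV H + ennreal \<tau>"
    using e(2) by (intro add_left_mono ennreal_leI)
  finally show "Np p UNIV v \<le> ennreal (4 powr p * r powr p) * Np p UNIV H + ennreal \<tau>" unfolding A_def .
qed

subsection \<open>Covering by small cubes\<close>

lemma dist_ccube_le:
  fixes x y :: "real^'n"
  assumes "x \<in> ccube a r" "y \<in> ccube a r"
  shows "dist x y \<le> real CARD('n) * r"
proof -
  have "\<bar>(x - y) $ i\<bar> \<le> r" for i
  proof -
    have "a $ i \<le> x $ i \<and> x $ i \<le> a $ i + r" "a $ i \<le> y $ i \<and> y $ i \<le> a $ i + r"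
      using assms by (simp_all add: mem_ccube)
    then show ?thesis by (simp add: abs_le_iff)
  qed
  then show ?thesis unfolding dist_norm by (rule norm_le_card)
qed

declare cube_basic(4,5) [measurable]

definition cube_cover :: "(real^'n) set \<Rightarrow> real \<Rightarrow> (nat \<Rightarrow> real^'n) \<Rightarrow> (nat \<Rightarrow> real) \<Rightarrow> bool" where
  "cube_cover U d a r \<longleftrightarrow> (\<forall>i. 0 \<le> r i \<and> r i \<le> d) \<and> (\<forall>i. r i > 0 \<longrightarrow> ccube (a i) (r i) \<subseteq> U) \<and>
     disjoint_family (\<lambda>i. cube (a i) (r i)) \<and> (AE x in lebesgue. x \<in> U \<longrightarrow> x \<in> (\<Union>i. cube (a i) (r i)))"

lemma cube_coverD:
  assumes "cube_cover U d a r"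
  shows "0 \<le> r i" "r i \<le> d" "r i > 0 \<Longrightarrow> ccube (a i) (r i) \<subseteq> U" "cube (a i) (r i) \<subseteq> U"
    "disjoint_family (\<lambda>i. cube (a i) (r i))" "AE x in lebesgue. x \<in> U \<longrightarrow> x \<in> (\<Union>i. cube (a i) (r i))"
proof -
  note * = assms[unfolded cube_cover_def]
  show "0 \<le> r i" "r i \<le> d" "r i > 0 \<Longrightarrow> ccube (a i) (r i) \<subseteq> U"
    "disjoint_family (\<lambda>i. cube (a i) (r i))" "AE x in lebesgue. x \<in> U \<longrightarrow> x \<in> (\<Union>i. cube (a i) (r i))"
    using * by blast+
  show "cube (a i) (r i) \<subseteq> U"
  proof (cases "r i > 0")
    case True
    then show ?thesis using * cube_subset_ccube by blast
  next
    case False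
    then show ?thesis using cube_empty[of "r i" "a i"] by simp
  qed
qed

lemma cover_integral:
  fixes h :: "real^'n \<Rightarrow> ennreal"
  assumes cv: "cube_cover U d a r" and h: "Lmeas h"
  shows "(\<integral>\<^sup>+x\<in>U. h x \<partial>lebesgue) = (\<Sum>i. \<integral>\<^sup>+x\<in>cube (a i) (r i). h x \<partial>lebesgue)"
proof -
  have "(\<integral>\<^sup>+x\<in>U. h x \<partial>lebesgue) = (\<integral>\<^sup>+x\<in>(\<Union>i. cube (a i) (r i)). h x \<partial>lebesgue)"
  proof (rule nn_integral_cong_AE)
    show "AE x in lebesgue. h x * indicator U x = h x * indicator (\<Union>i. cube (a i) (r i)) x"
      using cube_coverD(6)[OF cv]
    proof eventually_elim
      case (elim x)
      then have "x \<in> U \<longleftrightarrow> x \<in> (\<Union>i. cube (a i) (r i))" using cube_coverD(4)[OF cv] by blast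
      then show ?case by (simp add: indicator_def)
    qed
  qed
  also have "\<dots> = (\<Sum>i. \<integral>\<^sup>+x\<in>cube (a i) (r i). h x \<partial>lebesgue)"
    by (rule nn_integral_disjoint_family) (use cube_coverD(5)[OF cv] h in auto)
  finally show ?thesis .
qed

lemma ex_step:
  fixes \<xi> :: "nat \<Rightarrow> 'b::euclidean_space"
  assumes cv: "cube_cover U d a r"
  obtains Z where "Lmeas Z" "\<And>i x. x \<in> cube (a i) (r i) \<Longrightarrow> Z x = \<xi> i"
proof
  \<comment> \<open>Off the cubes the least index is unspecified; inside \<open>U\<close> this
    concerns only a null set.\<close>
  show "Lmeas (\<lambda>x. \<xi> (LEAST i. x \<in> cube (a i) (r i)))"
    by (rule measurable_compose[where N="count_space UNIV"]) measurable
  show "\<xi> (LEAST i. x \<in> cube (a i) (r i)) = \<xi> i" if "x \<in> cube (a i) (r i)" for i x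
    using LeastI[of "\<lambda>i. x \<in> cube (a i) (r i)", OF that] disjoint_family_eqI[OF cube_coverD(5)[OF cv] that] by auto
qed

lemma step_integral:
  fixes g :: "'b::euclidean_space \<Rightarrow> ennreal" and U :: "(real^'n) set"
  assumes cv: "cube_cover U d a r" and Z: "Lmeas Z" "\<And>i x. x \<in> cube (a i) (r i) \<Longrightarrow> Z x = \<xi> i"
    and g: "g \<in> borel_measurable borel"
  shows "(\<integral>\<^sup>+x\<in>U. g (Z x) \<partial>lebesgue) = (\<Sum>i. ennreal (r i ^ CARD('n)) * g (\<xi> i))"
  unfolding cover_integral[OF cv measurable_compose[OF Z(1) g]]
proof (intro arg_cong[where f=suminf] ext)
  fix i
  have "(\<integral>\<^sup>+x\<in>cube (a i) (r i). g (Z x) \<partial>lebesgue) = (\<integral>\<^sup>+x\<in>cube (a i) (r i). g (\<xi> i) \<partial>lebesgue)"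
    using Z(2) by (intro nn_integral_cong) (auto simp: indicator_def)
  then show "(\<integral>\<^sup>+x\<in>cube (a i) (r i). g (Z x) \<partial>lebesgue) = ennreal (r i ^ CARD('n)) * g (\<xi> i)"
    using emeasure_cube(1)[OF cube_coverD(1)[OF cv], of "a i" i] by (simp add: nn_integral_cmult_indicator mult.commute)
qed

lemma ex_cube_cover:
  fixes U :: "(real^'n) set"
  assumes U: "open U" "bounded U" and d: "d > 0"
  shows "\<exists>a r. cube_cover U d a r"
proof -
  obtain L where L: "L > 0" "\<forall>x\<in>U. norm x \<le> L" using U(2) by (auto simp: bounded_pos)
  \<comment> \<open>The bounding box is a cube, so the dyadic subdivision in the covering lemma
    yields cubes and not merely boxes.\<close>
  let ?a = "(\<chi> i. - L) :: real^'n" and ?b = "(\<chi> i. L) :: real^'n"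
  have sub: "U \<subseteq> cbox ?a ?b"
  proof
    fix x assume "x \<in> U"
    then have "\<bar>x $ i\<bar> \<le> L" for i using L(2) component_le_norm_cart[of x i] by fastforce
    then show "x \<in> cbox ?a ?b" by (simp add: mem_box_cart abs_le_iff minus_le_iff)
  qed
  have "0 \<in> box ?a ?b" using L by (simp add: mem_box_cart)
  then have ne: "box ?a ?b \<noteq> {}" by blast
  have "\<forall>x\<in>U. \<exists>e>0. ball x e \<subseteq> U" using U(1) by (simp add: open_contains_ball)
  then obtain \<epsilon> where \<epsilon>: "\<And>x. x \<in> U \<Longrightarrow> \<epsilon> x > 0" "\<And>x. x \<in> U \<Longrightarrow> ball x (\<epsilon> x) \<subseteq> U" by metis
  \<comment> \<open>The gauge forces each piece into a ball around a point of \<open>U\<close>: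
    radius \<epsilon> keeps the piece inside \<open>U\<close>, and radius \<open>d/2\<close> bounds
    its side by \<open>d\<close>.\<close>
  define g where "g x = (if x \<in> U then ball x (min (d/2) (\<epsilon> x)) else ball x 1)" for x
  have g: "gauge g" unfolding gauge_def g_def using \<epsilon>(1) d by auto
  obtain D where D: "countable D" "\<Union>D \<subseteq> cbox ?a ?b"
    "\<And>K. K \<in> D \<Longrightarrow> interior K \<noteq> {} \<and> (\<exists>c d. K = cbox c d)"
    "pairwise (\<lambda>A B. interior A \<inter> interior B = {}) D"
    "\<And>K. K \<in> D \<Longrightarrow> \<exists>x \<in> U \<inter> K. K \<subseteq> g x"
    "\<And>u v. cbox u v \<in> D \<Longrightarrow> \<exists>n. \<forall>i \<in> Basis. v \<bullet> i - u \<bullet> i = (?b \<bullet> i - ?a \<bullet> i) / 2^n"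
    "U \<subseteq> \<Union>D"
    using covering_lemma[OF sub ne g] by blast
  have "\<exists>c \<rho>. K = ccube c \<rho> \<and> \<rho> > 0" if K: "K \<in> D" for K
  proof -
    obtain u v where uv: "K = cbox u v" using D(3)[OF K] by blast
    then obtain n where n: "\<forall>i \<in> Basis. v \<bullet> i - u \<bullet> i = (?b \<bullet> i - ?a \<bullet> i) / 2^n" using D(6) K by blast
    have "v $ i - u $ i = 2 * L / 2^n" for i
      using n[rule_format, of "axis i 1"] by (simp add: inner_axis)
    then have "v = u + (\<chi> i. 2 * L / 2^n)" by (simp add: vec_eq_iff algebra_simps)
    then have "K = ccube u (2 * L / 2^n)" unfolding ccube_def uv by simp
    then show ?thesis using L(1) by (intro exI[of _ u] exI[of _ "2 * L / 2^n"]) simp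
  qed
  then obtain c \<rho> where c: "\<And>K. K \<in> D \<Longrightarrow> K = ccube (c K) (\<rho> K)" "\<And>K. K \<in> D \<Longrightarrow> \<rho> K > 0" by metis
  \<comment> \<open>Only indices that code a member of \<open>D\<close> carry a cube; all others get
    side 0, which also handles a finite \<open>D\<close>.\<close>
  define I where "I = to_nat_on D ` D"
  define a where "a n = c (from_nat_into D n)" for n
  define r where "r n = (if n \<in> I then \<rho> (from_nat_into D n) else 0)" for n
  have inD: "from_nat_into D n \<in> D" if "n \<in> I" for n using that D(1) unfolding I_def by auto
  have inj: "n = m" if "n \<in> I" "m \<in> I" "from_nat_into D n = from_nat_into D m" for n m
    using that D(1) unfolding I_def by auto
  have int: "interior K = cube (c K) (\<rho> K)" if "K \<in> D" for K
    using c(1)[OF that] by (metis ccube_def cube_def interior_cbox)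
  show ?thesis
  proof (intro exI)
    show "cube_cover U d a r"
      unfolding cube_cover_def
    proof (intro conjI allI impI)
      show "0 \<le> r i" for i using c(2)[OF inD] by (auto simp: r_def less_imp_le)
      have Kin: "\<exists>x\<in>U. ccube (a i) (r i) \<subseteq> ball x (min (d/2) (\<epsilon> x))" if "r i > 0" for i
      proof -
        have i: "i \<in> I" using that by (auto simp: r_def split: if_splits)
        obtain x where "x \<in> U" "from_nat_into D i \<subseteq> g x" using D(5)[OF inD[OF i]] by blast
        then show ?thesis using c(1)[OF inD[OF i]] i by (auto simp: g_def a_def r_def)
      qed
      show "ccube (a i) (r i) \<subseteq> U" if ri: "r i > 0" for i
      proof -
        obtain x where x: "x \<in> U" "ccube (a i) (r i) \<subseteq> ball x (min (d/2) (\<epsilon> x))" using Kin[OF ri] by blast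
        have "ball x (min (d/2) (\<epsilon> x)) \<subseteq> ball x (\<epsilon> x)" by (intro subset_ball) simp
        then show ?thesis using x \<epsilon>(2)[OF x(1)] by blast
      qed
      show "r i \<le> d" for i
      proof (cases "r i > 0")
        case True
        obtain x where x: "ccube (a i) (r i) \<subseteq> ball x (min (d/2) (\<epsilon> x))" using Kin[OF True] by blast
        \<comment> \<open>Two points of the closed cube along one coordinate axis have distance
          equal to the side, and both are within \<open>d/2\<close> of the centre of the gauge
          ball.\<close>
        obtain j :: 'n where True by simp
        have 1: "a i \<in> ccube (a i) (r i)" "a i + r i *\<^sub>R axis j 1 \<in> ccube (a i) (r i)"
          using True by (auto simp: mem_ccube axis_def)
        then have "dist x (a i) < d/2" "dist x (a i + r i *\<^sub>R axis j 1) < d/2" using x by auto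
        moreover have "dist (a i) (a i + r i *\<^sub>R axis j 1) = r i" using True by (simp add: dist_norm)
        ultimately show ?thesis using dist_triangle3[of "a i" "a i + r i *\<^sub>R axis j 1" x] by linarith
      qed (use d in simp)
      show "disjoint_family (\<lambda>i. cube (a i) (r i))"
        unfolding disjoint_family_on_def
      proof (intro ballI impI)
        fix m n :: nat assume mn: "m \<noteq> n"
        show "cube (a m) (r m) \<inter> cube (a n) (r n) = {}"
        proof (cases "m \<in> I \<and> n \<in> I")
          case True
          then have "from_nat_into D m \<noteq> from_nat_into D n" using inj mn by blast
          then have "interior (from_nat_into D m) \<inter> interior (from_nat_into D n) = {}"
            using D(4) inD True unfolding pairwise_def by blast
          then show ?thesis using int inD True by (simp add: a_def r_def)
        next
          case False
          then have "r m = 0 \<or> r n = 0" by (auto simp: r_def)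
          then show ?thesis by (elim disjE) (simp_all add: cube_empty)
        qed
      qed
      define N where "N = (\<Union>i. ccube (a i) (r i) - cube (a i) (r i))"
      have N: "N \<in> null_sets lebesgue" unfolding N_def by (intro null_sets_UN null_ccube_diff_cube)
      have "x \<in> (\<Union>i. cube (a i) (r i))" if xU: "x \<in> U" "x \<notin> N" for x
      proof -
        obtain K where K: "K \<in> D" "x \<in> K" using D(7) xU(1) by blast
        define n where "n = to_nat_on D K"
        have "n \<in> I" "from_nat_into D n = K" using K D(1) by (auto simp: n_def I_def)
        then have "x \<in> ccube (a n) (r n)" using K c(1)[OF K(1)] by (simp add: a_def r_def)
        then show ?thesis using xU(2) unfolding N_def by blast
      qed
      then show "AE x in lebesgue. x \<in> U \<longrightarrow> x \<in> (\<Union>i. cube (a i) (r i))"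
        using AE_not_in[OF N] by (auto elim!: eventually_mono)
    qed
  qed
qed

lemma suminf_half_ennreal:
  assumes "e \<ge> 0" shows "(\<Sum>i. ennreal (e * (1/2) ^ Suc i)) = ennreal e"
proof -
  have "(\<lambda>i. e * (1/2) ^ Suc i) sums (e * 1)" by (intro sums_mult power_half_series)
  then show ?thesis using assms by (intro suminf_ennreal_eq) auto
qed

text \<open>The gradient is approximated in \<open>Np\<close> by a continuous function of compact
  support, which is nearly constant on small cubes, and \<xi> samples it at the corners; Poincare's
  inequality then supplies \<open>b\<close>. The weight \<open>r powr (- p)\<close> is the cost of a
  cutoff whose gradient has size \<open>1/r\<close>, and it exactly cancels the dependence of the
  Poincare constant on the side.\<close>

lemma affine_cover:
  fixes u :: "real^'n \<Rightarrow> real^'m"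
  assumes W: "Wk p U u G" and U: "open U" "bounded U" and p: "p \<ge> 1" and d: "d > 0" and \<eta>: "\<eta> > 0"
  shows "\<exists>a r \<xi> b. cube_cover U d a r \<and>
     (\<Sum>i. Np p (cube (a i) (r i)) (\<lambda>x. G x - \<xi> i)) \<le> ennreal \<eta> \<and>
     (\<Sum>i. ennreal (r i powr (- p)) * Np p (cube (a i) (r i)) (\<lambda>x. u x - (b i + \<xi> i *v x))) \<le> ennreal \<eta>"
proof -
  have p0: "p > 0" "p \<ge> 0" using p by auto
  have Us[measurable]: "U \<in> sets lebesgue" using U(1) by simp
  \<comment> \<open>The Poincare constant for side 1.\<close>
  define C where "C = 4 powr p * (2 ^ CARD('n) * real CARD('n) powr p)"
  have C: "C \<ge> 0" by (simp add: C_def)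
  obtain \<eta>1 where \<eta>1: "\<eta>1 > 0" "\<eta>1 \<le> \<eta>" "C * \<eta>1 \<le> \<eta> / 2"
  proof -
    obtain \<eta>1 where "\<eta>1 > 0" "(1 + 2 * C) * \<eta>1 \<le> \<eta>" using ex_small_factor[OF _ \<eta>, of "1 + 2 * C"] C by auto
    moreover have "0 \<le> C * \<eta>1" using C \<open>\<eta>1 > 0\<close> by simp
    ultimately show thesis by (intro that[of \<eta>1]) (auto simp: algebra_simps)
  qed
  define c where "c = 2 powr p"
  have c: "c > 0" by (simp add: c_def)
  define V where "V = measure lebesgue U + 1"
  have V: "V > 0" by (simp add: V_def add_nonneg_pos)
  have eV: "emeasure lebesgue U \<le> ennreal V"
    using emeasure_eq_measure2[OF bounded_set_imp_lmeasurable[OF U(2) Us]] by (simp add: V_def ennreal_leI)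
  define e where "e = \<eta>1 / (2 * c)"
  have e: "e > 0" using \<eta>1 c by (simp add: e_def)
  \<comment> \<open>The oscillation of \<open>g\<close> over one cube; integrated over
    \<open>U\<close> it contributes half of the tolerance \<eta>1 after the factor \<open>c\<close>,
    the other half being the error \<open>e\<close> of the approximation by
    \<open>g\<close>.\<close>
  define \<sigma> where "\<sigma> = (\<eta>1 / (2 * c * V)) powr (1/p)"
  have \<sigma>: "\<sigma> > 0" "\<sigma> powr p = \<eta>1 / (2 * c * V)"
    using \<eta>1 c V p0 by (auto simp: \<sigma>_def powr_powr)
  note m[measurable] = WkD(1,2)[OF W]
  have "Np p UNIV (\<lambda>x. indicator U x *\<^sub>R G x) = Np p U (\<lambda>x. indicator U x *\<^sub>R G x)" using p0 by (intro Np_UNIV_supp) auto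
  also have "\<dots> = Np p U G" by (intro Np_cong_AE) auto
  finally have "Np p UNIV (\<lambda>x. indicator U x *\<^sub>R G x) < \<infinity>" using WkD(4)[OF W] by simp
  then obtain g R where g: "continuous_on UNIV g" "\<And>x. norm x > R \<Longrightarrow> g x = 0"
      "Np p UNIV (\<lambda>x. indicator U x *\<^sub>R G x - g x) \<le> ennreal e"
    using Np_dense[OF _ p0(1) e, of "\<lambda>x. indicator U x *\<^sub>R G x"] by auto
  have g0: "g x = 0" if "x \<notin> cball 0 R" for x using g(2)[of x] that by auto
  have [measurable]: "Lmeas g" by (rule continuous_imp_lebesgue_measurable[OF g(1)])
  obtain d1 where d1: "d1 > 0" "\<And>x y. dist x y < d1 \<Longrightarrow> dist (g x) (g y) < \<sigma>"
    using uniformly_continuous_compact_support[OF g(1) compact_cball g0 \<sigma>(1)] by metis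
  define d2 where "d2 = min d (d1 / (2 * real CARD('n)))"
  have d2: "d2 > 0" "d2 \<le> d" "real CARD('n) * d2 < d1"
  proof -
    have N: "real CARD('n) > 0" by simp
    show "d2 > 0" "d2 \<le> d" using d d1 N by (auto simp: d2_def)
    have "real CARD('n) * d2 \<le> real CARD('n) * (d1 / (2 * real CARD('n)))" by (intro mult_left_mono) (auto simp: d2_def)
    also have "\<dots> = d1 / 2" using N by (simp add: field_simps)
    finally show "real CARD('n) * d2 < d1" using d1 by linarith
  qed
  obtain a r where ar: "cube_cover U d2 a r" using ex_cube_cover[OF U d2(1)] by blast
  note ar' = cube_coverD[OF ar]
  have ar_d: "cube_cover U d a r" using ar d2(2) unfolding cube_cover_def by (meson order_trans)
  let ?Q = "\<lambda>i. cube (a i) (r i)"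
  define \<xi> where "\<xi> i = g (a i)" for i
  have Qi: "Np p (?Q i) (\<lambda>x. G x - \<xi> i) \<le> ennreal c * (Np p (?Q i) (\<lambda>x. indicator U x *\<^sub>R G x - g x) + ennreal (\<sigma> powr p) * emeasure lebesgue (?Q i))" for i
  proof -
    have "Np p (?Q i) (\<lambda>x. G x - \<xi> i) = Np p (?Q i) (\<lambda>x. indicator U x *\<^sub>R G x - \<xi> i)"
      by (intro Np_cong_AE AE_I2) (use ar'(4)[of i] in auto)
    also have "\<dots> \<le> ennreal c * (Np p (?Q i) (\<lambda>x. indicator U x *\<^sub>R G x - g x) + Np p (?Q i) (\<lambda>x. g x - \<xi> i))"
      unfolding c_def using p0 by (intro Np_triangle) auto
    also have "Np p (?Q i) (\<lambda>x. g x - \<xi> i) \<le> (\<integral>\<^sup>+x. ennreal (\<sigma> powr p) * indicator (?Q i) x \<partial>lebesgue)"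
      unfolding Np_def
    proof (rule nn_integral_mono)
      fix x
      show "ennreal (norm (g x - \<xi> i) powr p) * indicator (?Q i) x \<le> ennreal (\<sigma> powr p) * indicator (?Q i) x"
      proof (cases "x \<in> ?Q i")
        case True
        then have "x \<in> ccube (a i) (r i)" using cube_subset_ccube by blast
        moreover have "a i \<in> ccube (a i) (r i)" using ar'(1)[of i] by (simp add: mem_ccube)
        ultimately have "dist x (a i) \<le> real CARD('n) * r i" by (rule dist_ccube_le)
        also have "\<dots> \<le> real CARD('n) * d2" using ar'(2)[of i] by (intro mult_left_mono) auto
        finally have "dist x (a i) < d1" using d2 by linarith
        then have "norm (g x - \<xi> i) < \<sigma>" using d1(2) by (simp add: dist_norm \<xi>_def)
        then show ?thesis using p0 by (intro mult_right_mono ennreal_leI powr_mono2) auto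
      qed simp
    qed
    also have "\<dots> = ennreal (\<sigma> powr p) * emeasure lebesgue (?Q i)" by (rule nn_integral_cmult_indicator) simp
    finally show ?thesis by (simp add: add_left_mono mult_left_mono)
  qed
  have "(\<Sum>i. Np p (?Q i) (\<lambda>x. G x - \<xi> i)) \<le> (\<Sum>i. ennreal c * (Np p (?Q i) (\<lambda>x. indicator U x *\<^sub>R G x - g x) + ennreal (\<sigma> powr p) * emeasure lebesgue (?Q i)))"
    by (intro suminf_le Qi) auto
  also have "\<dots> = ennreal c * ((\<Sum>i. Np p (?Q i) (\<lambda>x. indicator U x *\<^sub>R G x - g x)) + ennreal (\<sigma> powr p) * (\<Sum>i. emeasure lebesgue (?Q i)))"
    by (simp add: suminf_add[symmetric])
  also have "(\<Sum>i. Np p (?Q i) (\<lambda>x. indicator U x *\<^sub>R G x - g x)) = Np p (\<Union>i. ?Q i) (\<lambda>x. indicator U x *\<^sub>R G x - g x)"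
    by (rule Np_disjoint_UN[symmetric]) (use ar'(5) in auto)
  also have "(\<Sum>i. emeasure lebesgue (?Q i)) = emeasure lebesgue (\<Union>i. ?Q i)"
    by (rule suminf_emeasure) (use ar'(5) in auto)
  also have "ennreal c * (Np p (\<Union>i. ?Q i) (\<lambda>x. indicator U x *\<^sub>R G x - g x) + ennreal (\<sigma> powr p) * emeasure lebesgue (\<Union>i. ?Q i))
      \<le> ennreal c * (ennreal e + ennreal (\<sigma> powr p) * ennreal V)"
  proof (intro mult_left_mono add_mono)
    show "Np p (\<Union>i. ?Q i) (\<lambda>x. indicator U x *\<^sub>R G x - g x) \<le> ennreal e" by (rule order_trans[OF Np_set_mono g(3)]) simp
    have "emeasure lebesgue (\<Union>i. ?Q i) \<le> emeasure lebesgue U" using ar'(4) by (intro emeasure_mono) auto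
    then show "emeasure lebesgue (\<Union>i. ?Q i) \<le> ennreal V" using eV by (rule order_trans)
  qed auto
  also have "\<dots> = ennreal (c * (e + \<sigma> powr p * V))"
    using c e V by (simp add: ennreal_plus[symmetric] ennreal_mult[symmetric] del: ennreal_plus)
  also have "c * (e + \<sigma> powr p * V) = \<eta>1" using c V by (simp add: \<sigma>(2) e_def field_simps)
  finally have S1: "(\<Sum>i. Np p (?Q i) (\<lambda>x. G x - \<xi> i)) \<le> ennreal \<eta>1" .
  have ex: "\<exists>b. ennreal (r i powr (- p)) * Np p (?Q i) (\<lambda>x. u x - (b + \<xi> i *v x)) \<le> ennreal C * Np p (?Q i) (\<lambda>x. G x - \<xi> i) + ennreal (\<eta>/2 * (1/2) ^ Suc i)" for i
  proof (cases "r i > 0")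
    case True
    \<comment> \<open>A geometric share of \<eta>/2, premultiplied by \<open>r i powr p\<close>
      because the estimate is divided by this power afterwards.\<close>
    define \<tau> where "\<tau> = r i powr p * (\<eta>/2 * (1/2) ^ Suc i)"
    have \<tau>: "\<tau> > 0" using True \<eta> by (simp add: \<tau>_def)
    obtain b where b: "Np p (?Q i) (\<lambda>x. u x - (b + \<xi> i *v x)) \<le>
        ennreal (4 powr p * (2 ^ CARD('n) * (real CARD('n) * r i) powr p)) * Np p (?Q i) (\<lambda>x. G x - \<xi> i) + ennreal \<tau>"
      using poincare[OF W U(1) p True \<tau> ar'(3)[OF True]] by blast
    have ri: "r i powr (-p) * r i powr p = 1" using True by (simp add: powr_minus)
    have "ennreal (r i powr (- p)) * Np p (?Q i) (\<lambda>x. u x - (b + \<xi> i *v x)) \<le> ennreal (r i powr (- p)) *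
       (ennreal (4 powr p * (2 ^ CARD('n) * (real CARD('n) * r i) powr p)) * Np p (?Q i) (\<lambda>x. G x - \<xi> i) + ennreal \<tau>)"
      by (rule mult_left_mono[OF b]) simp
    also have "\<dots> = ennreal (r i powr (- p) * (4 powr p * (2 ^ CARD('n) * (real CARD('n) * r i) powr p))) * Np p (?Q i) (\<lambda>x. G x - \<xi> i) + ennreal (r i powr (- p) * \<tau>)"
      using \<tau> by (simp add: distrib_left ennreal_mult mult.assoc)
    also have "r i powr (- p) * (4 powr p * (2 ^ CARD('n) * (real CARD('n) * r i) powr p)) = C"
    proof -
      have "r i powr (- p) * (4 powr p * (2 ^ CARD('n) * (real CARD('n) * r i) powr p)) = (r i powr (-p) * r i powr p) * C"
        using True by (simp add: C_def powr_mult mult_ac)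
      then show ?thesis by (simp add: ri)
    qed
    also have "r i powr (- p) * \<tau> = \<eta>/2 * (1/2) ^ Suc i"
      unfolding \<tau>_def mult.assoc[symmetric] ri by simp
    finally show ?thesis by blast
  next
    case False
    then have "?Q i = {}" by (intro cube_empty) simp
    then show ?thesis by (simp add: Np_def)
  qed
  from choice[OF allI[OF ex]] obtain b where
    "\<forall>i. ennreal (r i powr (- p)) * Np p (?Q i) (\<lambda>x. u x - (b i + \<xi> i *v x)) \<le> ennreal C * Np p (?Q i) (\<lambda>x. G x - \<xi> i) + ennreal (\<eta>/2 * (1/2) ^ Suc i)" ..
  note b = this[rule_format]
  have "(\<Sum>i. ennreal (r i powr (- p)) * Np p (?Q i) (\<lambda>x. u x - (b i + \<xi> i *v x))) \<le> (\<Sum>i. ennreal C * Np p (?Q i) (\<lambda>x. G x - \<xi> i) + ennreal (\<eta>/2 * (1/2) ^ Suc i))"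
    by (intro suminf_le b) auto
  also have "\<dots> = ennreal C * (\<Sum>i. Np p (?Q i) (\<lambda>x. G x - \<xi> i)) + (\<Sum>i. ennreal (\<eta>/2 * (1/2) ^ Suc i))"
    by (subst suminf_add[symmetric]) auto
  also have "\<dots> \<le> ennreal C * ennreal \<eta>1 + ennreal (\<eta>/2)"
  proof (intro add_mono mult_left_mono S1)
    show "(\<Sum>i. ennreal (\<eta>/2 * (1/2) ^ Suc i)) \<le> ennreal (\<eta>/2)" using \<eta> by (subst suminf_half_ennreal) simp_all
  qed simp
  also have "\<dots> = ennreal (C * \<eta>1 + \<eta>/2)" using C \<eta>1 \<eta> by (simp add: ennreal_plus[symmetric] ennreal_mult[symmetric] del: ennreal_plus)
  also have "\<dots> \<le> ennreal \<eta>" using \<eta>1 by (intro ennreal_leI) simp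
  finally have S2: "(\<Sum>i. ennreal (r i powr (- p)) * Np p (?Q i) (\<lambda>x. u x - (b i + \<xi> i *v x))) \<le> ennreal \<eta>" .
  have "(\<Sum>i. Np p (?Q i) (\<lambda>x. G x - \<xi> i)) \<le> ennreal \<eta>" using S1 \<eta>1(2) ennreal_leI order_trans by blast
  with S2 ar_d show ?thesis by blast
qed

lemma scaled_cutoff:
  fixes \<Theta> :: "real^'n \<Rightarrow> real" and a :: "real^'n" and r :: real
  assumes \<Theta>: "test_fun (cube 0 1) \<Theta>" and r: "r > 0"
  defines "\<theta> \<equiv> \<lambda>x. \<Theta> ((1/r) *\<^sub>R (x - a))"
  shows "test_fun (cube a r) \<theta>" "gvec \<theta> x = (1/r) *\<^sub>R gvec \<Theta> ((1/r) *\<^sub>R (x - a))"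
proof -
  have eq: "\<theta> = (\<lambda>x. \<Theta> (- (1/r) *\<^sub>R a + (1/r) *\<^sub>R x))"
    by (auto simp: \<theta>_def scaleR_diff_right)
  show "test_fun (cube a r) \<theta>"
    unfolding eq
  proof (rule test_fun_affine[OF \<Theta>])
    show "(1/(1/r)) *\<^sub>R (y - - (1/r) *\<^sub>R a) \<in> cube a r" if "y \<in> cube 0 1" for y
    proof -
      have "0 < y $ i" "y $ i < 1" for i using that by (simp_all add: mem_cube)
      then show ?thesis using r by (simp add: mem_cube algebra_simps)
    qed
  qed (use r in simp)
  have "pd j \<theta> x = (1/r) * pd j \<Theta> (- (1/r) *\<^sub>R a + (1/r) *\<^sub>R x)" for j
    unfolding eq by (rule pd_affine[OF test_fun_C_inf[OF \<Theta>]])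
  then show "gvec \<theta> x = (1/r) *\<^sub>R gvec \<Theta> ((1/r) *\<^sub>R (x - a))"
    by (simp add: vec_eq_iff scaleR_diff_right)
qed

lemma Np_cutoff_le:
  fixes w :: "real^'n \<Rightarrow> real^'m" and D :: "real^'n \<Rightarrow> real^'n^'m"
  assumes m: "Lmeas w" "Lmeas D" and p: "p \<ge> 1" and Q: "Q \<in> sets lebesgue"
    and \<theta>: "\<And>x. \<bar>\<theta> x\<bar> \<le> 1" "test_fun Q \<theta>" and B: "\<And>x. norm (gvec \<theta> x) \<le> B" "B \<ge> 0"
  shows "Np p UNIV (\<lambda>x. \<theta> x *\<^sub>R w x) \<le> Np p Q w"
    and "Np p UNIV (\<lambda>x. \<theta> x *\<^sub>R D x + outer (w x) (gvec \<theta> x)) \<le> ennreal (2 powr p) * (Np p Q D + ennreal (B powr p) * Np p Q w)"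
proof -
  have p0: "p \<ge> 0" "p \<noteq> 0" using p by auto
  obtain K where K: "compact K" "K \<subseteq> Q" "\<And>x. x \<notin> K \<Longrightarrow> \<theta> x = 0" using test_fun_support[OF \<theta>(2)] by blast
  have z: "\<theta> x = 0" "gvec \<theta> x = 0" if "x \<notin> Q" for x
  proof -
    have x: "x \<notin> K" using that K(2) by blast
    show "\<theta> x = 0" using x K(3) by blast
    show "gvec \<theta> x = 0" unfolding vec_eq_iff gvec_nth using pd_0_outside[OF compact_imp_closed[OF K(1)] K(3) x] by simp
  qed
  have o0: "outer (w x) 0 = (0 :: real^'n^'m)" for x by (simp add: vec_eq_iff)
  have [measurable]: "\<theta> \<in> borel_measurable lebesgue" using test_fun_integrable[OF \<theta>(2)] by auto
  note [measurable] = m Q outer_measurable[OF m(1) \<theta>(2)]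
  have le1: "\<bar>\<theta> x\<bar> * norm y \<le> norm y" for x and y :: "'z::real_normed_vector"
    using mult_right_mono[OF \<theta>(1)[of x], of "norm y"] by simp
  have "Np p UNIV (\<lambda>x. \<theta> x *\<^sub>R w x) = Np p Q (\<lambda>x. \<theta> x *\<^sub>R w x)" using z p0 by (intro Np_UNIV_supp) auto
  also have "\<dots> \<le> Np p Q w" using p0 le1 by (intro Np_mono) auto
  finally show "Np p UNIV (\<lambda>x. \<theta> x *\<^sub>R w x) \<le> Np p Q w" .
  have "Np p UNIV (\<lambda>x. \<theta> x *\<^sub>R D x + outer (w x) (gvec \<theta> x)) = Np p Q (\<lambda>x. \<theta> x *\<^sub>R D x + outer (w x) (gvec \<theta> x))"
    using z o0 p0 by (intro Np_UNIV_supp) auto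
  also have "\<dots> \<le> ennreal (2 powr p) * (Np p Q (\<lambda>x. \<theta> x *\<^sub>R D x) + Np p Q (\<lambda>x. outer (w x) (gvec \<theta> x)))"
    using p0 by (intro Np_add) auto
  also have "\<dots> \<le> ennreal (2 powr p) * (Np p Q D + ennreal (B powr p) * Np p Q w)"
  proof (intro mult_left_mono add_mono)
    show "Np p Q (\<lambda>x. \<theta> x *\<^sub>R D x) \<le> Np p Q D" using p0 le1 by (intro Np_mono) auto
    have "Np p Q (\<lambda>x. outer (w x) (gvec \<theta> x)) \<le> Np p Q (\<lambda>x. B *\<^sub>R w x)"
    proof (rule Np_mono)
      show "norm (outer (w x) (gvec \<theta> x)) \<le> norm (B *\<^sub>R w x)" for x
        using mult_left_mono[OF B(1)[of x], of "norm (w x)"] B(2) by (simp add: norm_outer mult.commute)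
    qed (use p0 in auto)
    also have "\<dots> = ennreal (B powr p) * Np p Q w" using B(2) by (simp add: Np_cmult[OF m(1) Q])
    finally show "Np p Q (\<lambda>x. outer (w x) (gvec \<theta> x)) \<le> ennreal (B powr p) * Np p Q w" .
  qed auto
  finally show "Np p UNIV (\<lambda>x. \<theta> x *\<^sub>R D x + outer (w x) (gvec \<theta> x)) \<le> ennreal (2 powr p) * (Np p Q D + ennreal (B powr p) * Np p Q w)" .
qed

subsection \<open>Piecewise affine approximation\<close>

text \<open>On the inner cubes of side \<open>r i\<close> the modified function is affine; the part of \<open>U\<close> where this
  is not yet the case is the open set \<open>V\<close>, which misses a fixed fraction of \<open>U\<close>.\<close>

definition affine_on_cubes :: "real \<Rightarrow> (real^'n) set \<Rightarrow> (real^'n) set \<Rightarrow> (real^'n \<Rightarrow> 'b::real_vector) \<Rightarrow>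
    (nat \<Rightarrow> real^'n) \<Rightarrow> (nat \<Rightarrow> real) \<Rightarrow> (nat \<Rightarrow> 'b) \<Rightarrow> bool" where
  "affine_on_cubes d U V F a r \<xi> \<longleftrightarrow> (\<forall>i. 0 \<le> r i \<and> r i \<le> d) \<and> (\<forall>i. r i > 0 \<longrightarrow> ccube (a i) (r i) \<subseteq> U) \<and>
     disjoint_family (\<lambda>i. cube (a i) (r i)) \<and> (\<forall>i. cube (a i) (r i) \<subseteq> U - V) \<and>
     (AE x in lebesgue. x \<in> U \<longrightarrow> x \<in> V \<or> x \<in> (\<Union>i. cube (a i) (r i))) \<and> (\<forall>i. \<forall>x\<in>cube (a i) (r i). F x = \<xi> i)"

text \<open>On every covering cube a cutoff times the difference between the affine approximation
  and \<open>u\<close> is added. Where the cutoff is 1, on the concentric cube of half the side, the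
  function becomes affine; there the fraction \<open>(1/2) ^ CARD('n)\<close> of the volume is
  settled, and \<open>V\<close> consists of what remains of the covering cubes.\<close>

lemma affine_step:
  fixes u :: "real^'n \<Rightarrow> real^'m"
  assumes W: "Wk p U u G" and U: "open U" "bounded U" and p: "p \<ge> 1" and \<eta>: "\<eta> > 0" and s0: "s0 > 0"
  shows "\<exists>v H V a r \<xi>. Sob0 p U v H \<and> Np p UNIV v \<le> ennreal \<eta> \<and> Np p UNIV H \<le> ennreal \<eta> \<and>
     open V \<and> V \<subseteq> U \<and> emeasure lebesgue V \<le> ennreal (1 - (1/2) ^ CARD('n)) * emeasure lebesgue U \<and>
     affine_on_cubes s0 U V (\<lambda>x. G x + H x) a r \<xi>"
proof -
  have p0: "p > 0" "p \<ge> 0" using p by auto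
  define a0 :: "real^'n" where "a0 = (\<chi> i. 1/4)"
  have in0: "ccube a0 (1/2) \<subseteq> cube 0 1"
    by (rule ccube_subset_cube) (simp add: a0_def)
  obtain \<Theta> where \<Theta>: "test_fun (cube 0 1) \<Theta>" "\<And>x. 0 \<le> \<Theta> x" "\<And>x. \<Theta> x \<le> 1" "\<And>x. x \<in> ccube a0 (1/2) \<Longrightarrow> \<Theta> x = 1"
    using ex_cutoff[OF cube_basic(2) cube_basic(1) in0] by metis
  obtain B where B: "B > 0" "\<And>x. norm (gvec \<Theta> x) \<le> B" using gvec_bounded[OF \<Theta>(1)] by blast
  obtain \<eta>' where \<eta>': "\<eta>' > 0" "\<eta>' \<le> \<eta>" "2 powr p * (1 + B powr p) * \<eta>' \<le> \<eta>"
  proof -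
    obtain \<eta>' where "\<eta>' > 0" "(1 + 2 powr p * (1 + B powr p)) * \<eta>' \<le> \<eta>" using ex_small_factor[OF _ \<eta>, of "1 + 2 powr p * (1 + B powr p)"] by auto
    then have "\<eta>' > 0" "\<eta>' + 2 powr p * (1 + B powr p) * \<eta>' \<le> \<eta>" "0 \<le> 2 powr p * (1 + B powr p) * \<eta>'" by (simp_all add: distrib_right)
    then show thesis by (intro that[of \<eta>']) linarith+
  qed
  \<comment> \<open>Sides of at most 1 make the weight \<open>R i powr (- p)\<close> at least 1, so
    the weighted sum also controls the added function and not only its gradient.\<close>
  define d where "d = min s0 1"
  have d: "d > 0" using s0 by (simp add: d_def)
  obtain A R \<xi> b where cov: "cube_cover U d A R" and
     s1: "(\<Sum>i. Np p (cube (A i) (R i)) (\<lambda>x. G x - \<xi> i)) \<le> ennreal \<eta>'" and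
     s2: "(\<Sum>i. ennreal (R i powr (- p)) * Np p (cube (A i) (R i)) (\<lambda>x. u x - (b i + \<xi> i *v x))) \<le> ennreal \<eta>'"
    using affine_cover[OF W U p d \<eta>'(1)] by blast
  note cv = cube_coverD[OF cov]
  let ?Q = "\<lambda>i. cube (A i) (R i)"
  define \<theta> where "\<theta> i x = (if R i > 0 then \<Theta> ((1/R i) *\<^sub>R (x - A i)) else 0)" for i x
  have \<theta>t: "test_fun (?Q i) (\<theta> i)" for i
    using scaled_cutoff(1)[OF \<Theta>(1), of "R i" "A i"] test_fun_0 by (cases "R i > 0") (simp_all add: \<theta>_def[abs_def])
  have \<theta>g: "gvec (\<theta> i) x = (1/R i) *\<^sub>R gvec \<Theta> ((1/R i) *\<^sub>R (x - A i))" if "R i > 0" for i x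
    using scaled_cutoff(2)[OF \<Theta>(1), of "R i" "A i" x] that by (simp add: \<theta>_def[abs_def])
  have \<theta>b: "\<bar>\<theta> i x\<bar> \<le> 1" for i x using \<Theta>(2,3) by (simp add: \<theta>_def)
  define w where "w i x = (b i + \<xi> i *v x) - u x" for i x
  define D where "D i x = \<xi> i - G x" for i x
  have Ww: "Wk p (?Q i) (w i) (D i)" for i
    unfolding w_def D_def by (intro Wk_diff Wk_affine Wk_mono[OF W] cv p p0) auto
  define v where "v i x = \<theta> i x *\<^sub>R w i x" for i x
  define H where "H i x = \<theta> i x *\<^sub>R D i x + outer (w i x) (gvec (\<theta> i) x)" for i x
  have S: "Sob0 p (?Q i) (v i) (H i)" for i
    unfolding v_def H_def by (rule Sob0_mult_test_fun[OF Ww \<theta>t p]) simp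
  have Nw: "Np p (?Q i) (w i) = Np p (?Q i) (\<lambda>x. u x - (b i + \<xi> i *v x))" for i
    unfolding w_def by (rule Np_commute)
  have ND: "Np p (?Q i) (D i) = Np p (?Q i) (\<lambda>x. G x - \<xi> i)" for i
    unfolding D_def by (rule Np_commute)
  let ?P = "\<lambda>i. ennreal (R i powr (- p)) * Np p (?Q i) (\<lambda>x. u x - (b i + \<xi> i *v x))"
  have Nv: "Np p UNIV (v i) \<le> ?P i" for i
  proof (cases "R i > 0")
    case True
    have "Np p UNIV (v i) \<le> Np p (?Q i) (w i)"
      unfolding v_def by (rule Np_cutoff_le(1)[OF WkD(1,2)[OF Ww] p _ \<theta>b \<theta>t, of i "B / R i"])
        (use B True in \<open>auto simp: \<theta>g divide_right_mono\<close>)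
    also have "\<dots> = ennreal 1 * Np p (?Q i) (\<lambda>x. u x - (b i + \<xi> i *v x))" by (simp add: Nw)
    also have "\<dots> \<le> ?P i"
    proof (intro mult_right_mono ennreal_leI)
      have "R i \<le> 1" using cv(2)[of i] by (simp add: d_def)
      then have "1 powr (-p) \<le> R i powr (- p)" using True p0 by (intro powr_mono2') auto
      then show "1 \<le> R i powr (- p)" by simp
    qed simp
    finally show ?thesis .
  next
    case False
    then have "v i = (\<lambda>x. 0)" by (simp add: v_def \<theta>_def fun_eq_iff)
    then show ?thesis using p0 by (simp add: Np_zero)
  qed
  have NH: "Np p UNIV (H i) \<le> ennreal (2 powr p) * (Np p (?Q i) (\<lambda>x. G x - \<xi> i) + ennreal (B powr p) * ?P i)" for i
  proof (cases "R i > 0")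
    case True
    have "Np p UNIV (H i) \<le> ennreal (2 powr p) * (Np p (?Q i) (D i) + ennreal ((B / R i) powr p) * Np p (?Q i) (w i))"
      unfolding H_def by (rule Np_cutoff_le(2)[OF WkD(1,2)[OF Ww] p _ \<theta>b \<theta>t, of i "B / R i"])
        (use B True in \<open>auto simp: \<theta>g divide_right_mono\<close>)
    also have "(B / R i) powr p = B powr p * R i powr (- p)" using B True by (simp add: powr_divide powr_minus field_simps)
    finally show ?thesis by (simp add: Nw ND ennreal_mult mult.assoc)
  next
    case False
    have z: "\<theta> i x = 0" for x using False by (simp add: \<theta>_def)
    have "gvec (\<theta> i) x = 0" for x by (rule gvec_eq_0_on_open[of UNIV _ _ 0]) (auto simp: z)
    moreover have "outer a 0 = (0 :: real^'n^'m)" for a by (simp add: vec_eq_iff)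
    ultimately have "H i = (\<lambda>x. 0)" by (simp add: H_def fun_eq_iff z)
    then show ?thesis using p0 by (simp add: Np_zero)
  qed
  have sv: "(\<Sum>i. Np p UNIV (v i)) \<le> ennreal \<eta>"
  proof -
    have "(\<Sum>i. Np p UNIV (v i)) \<le> (\<Sum>i. ?P i)" by (intro suminf_le Nv) auto
    also have "\<dots> \<le> ennreal \<eta>" using s2 \<eta>'(2) by (meson ennreal_leI order_trans)
    finally show ?thesis .
  qed
  have "(\<Sum>i. Np p UNIV (H i)) \<le> (\<Sum>i. ennreal (2 powr p) * (Np p (?Q i) (\<lambda>x. G x - \<xi> i) + ennreal (B powr p) * ?P i))"
    by (intro suminf_le NH) auto
  also have "\<dots> = ennreal (2 powr p) * ((\<Sum>i. Np p (?Q i) (\<lambda>x. G x - \<xi> i)) + ennreal (B powr p) * (\<Sum>i. ?P i))"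
    by (simp add: suminf_add[symmetric])
  also have "\<dots> \<le> ennreal (2 powr p) * (ennreal \<eta>' + ennreal (B powr p) * ennreal \<eta>')"
    using s1 s2 by (intro mult_left_mono add_mono) auto
  also have "\<dots> = ennreal (2 powr p * (1 + B powr p) * \<eta>')"
    using \<eta>'(1) by (simp add: ennreal_plus[symmetric] ennreal_mult[symmetric] del: ennreal_plus) (simp add: algebra_simps)
  also have "\<dots> \<le> ennreal \<eta>" using \<eta>'(3) by (rule ennreal_leI)
  finally have sH: "(\<Sum>i. Np p UNIV (H i)) \<le> ennreal \<eta>" .
  have top: "ennreal \<eta> < \<infinity>" by simp
  have outQ: "x \<notin> ?Q i \<Longrightarrow> v i x = 0 \<and> H i x = 0" for i x using Sob0_outside[OF S] by blast
  obtain vv HH where J: "Sob0 p U vv HH" "\<And>i x. x \<in> ?Q i \<Longrightarrow> HH x = H i x"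
    "Np p UNIV vv = (\<Sum>i. Np p UNIV (v i))" "Np p UNIV HH = (\<Sum>i. Np p UNIV (H i))"
    by (rule Sob0_patch[OF Sob0_mono[OF S cv(4)] p0(1) cv(5) cube_basic(5) cv(4) outQ le_less_trans[OF sv top] le_less_trans[OF sH top]])
      (use that in blast)+
  define a where "a i = A i + (R i) *\<^sub>R a0" for i
  define r where "r i = R i / 2" for i
  have r0: "0 \<le> r i" for i using cv(1)[of i] by (simp add: r_def)
  have inn: "ccube (a i) (r i) \<subseteq> ?Q i" if "R i > 0" for i
    using that by (intro ccube_subset_cube) (simp add: a_def a0_def r_def)
  have inn': "cube (a i) (r i) \<subseteq> ?Q i" for i
  proof (cases "R i > 0")
    case True
    then show ?thesis using inn cube_subset_ccube by blast
  next
    case False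
    then show ?thesis by (simp add: r_def cube_empty)
  qed
  define V where "V = (\<Union>i. ?Q i - ccube (a i) (r i))"
  have Vo: "open V" unfolding V_def by (intro open_UN open_Diff ballI) (auto simp: compact_imp_closed)
  have VU: "V \<subseteq> U" unfolding V_def using cv(4) by blast
  have Vem: "emeasure lebesgue V \<le> ennreal (1 - (1/2) ^ CARD('n)) * emeasure lebesgue U"
  proof -
    let ?q = "1 - (1/2) ^ CARD('n) :: real"
    have q: "?q \<ge> 0" by (simp add: power_le_one)
    have e: "emeasure lebesgue (?Q i - ccube (a i) (r i)) = ennreal ?q * emeasure lebesgue (?Q i)" for i
    proof (cases "R i > 0")
      case True
      have "emeasure lebesgue (?Q i - ccube (a i) (r i)) = emeasure lebesgue (?Q i) - emeasure lebesgue (ccube (a i) (r i))"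
        using inn[OF True] emeasure_cube(2)[OF r0, of "a i" i] by (intro emeasure_Diff) auto
      also have "\<dots> = ennreal (R i ^ CARD('n)) - ennreal (r i ^ CARD('n))"
        using emeasure_cube(2)[OF r0, of "a i" i] emeasure_cube(1)[of "R i" "A i"] True by simp
      also have "\<dots> = ennreal (R i ^ CARD('n) - r i ^ CARD('n))" using r0 by (intro ennreal_minus) simp
      also have "R i ^ CARD('n) - r i ^ CARD('n) = ?q * R i ^ CARD('n)" by (simp add: r_def power_divide left_diff_distrib)
      also have "ennreal (?q * R i ^ CARD('n)) = ennreal ?q * emeasure lebesgue (?Q i)"
        using emeasure_cube(1)[of "R i" "A i"] True q by (simp add: ennreal_mult)
      finally show ?thesis .
    next
      case False
      then show ?thesis by (simp add: cube_empty)
    qed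
    have dj: "disjoint_family (\<lambda>i. ?Q i - ccube (a i) (r i))"
      by (rule disjoint_family_subset[OF cv(5)]) auto
    have "emeasure lebesgue V = (\<Sum>i. emeasure lebesgue (?Q i - ccube (a i) (r i)))"
      unfolding V_def by (rule suminf_emeasure[symmetric]) (use dj in auto)
    also have "\<dots> = ennreal ?q * (\<Sum>i. emeasure lebesgue (?Q i))" unfolding e by simp
    also have "(\<Sum>i. emeasure lebesgue (?Q i)) = emeasure lebesgue (\<Union>i. ?Q i)"
      by (rule suminf_emeasure) (use cv(5) in auto)
    also have "ennreal ?q * \<dots> \<le> ennreal ?q * emeasure lebesgue U"
      using cv(4) U(1) by (intro mult_left_mono emeasure_mono) auto
    finally show ?thesis .
  qed
  have dj: "disjoint_family (\<lambda>i. cube (a i) (r i))" by (rule disjoint_family_subset[OF cv(5) inn'])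
  have off: "cube (a i) (r i) \<subseteq> U - V" for i
  proof
    fix x assume x: "x \<in> cube (a i) (r i)"
    then have xQ: "x \<in> ?Q i" using inn' by blast
    have "x \<notin> V"
    proof
      assume "x \<in> V"
      then obtain j where j: "x \<in> ?Q j" "x \<notin> ccube (a j) (r j)" unfolding V_def by blast
      then have "i = j" using disjoint_family_eqI[OF cv(5) xQ] by simp
      then show False using j x cube_subset_ccube by blast
    qed
    then show "x \<in> U - V" using xQ cv(4) by blast
  qed
  define N where "N = (\<Union>i. ccube (a i) (r i) - cube (a i) (r i))"
  have N: "N \<in> null_sets lebesgue" unfolding N_def by (intro null_sets_UN null_ccube_diff_cube)
  have AEc: "AE x in lebesgue. x \<in> U \<longrightarrow> x \<in> V \<or> x \<in> (\<Union>i. cube (a i) (r i))"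
    using cv(6) AE_not_in[OF N]
  proof eventually_elim
    case (elim x)
    then show ?case unfolding V_def N_def by blast
  qed
  have af: "G x + HH x = \<xi> i" if x: "x \<in> cube (a i) (r i)" for x i
  proof -
    have R: "R i > 0" using x cube_empty[of "r i" "a i"] cv(1)[of i] by (cases "R i > 0") (auto simp: r_def)
    have th1: "\<theta> i y = 1" if "y \<in> cube (a i) (r i)" for y
    proof -
      have "(1/R i) *\<^sub>R (y - A i) \<in> ccube a0 (1/2)"
        unfolding scaled_in_cube[OF R] using that cube_subset_ccube by (auto simp: a_def r_def)
      then show ?thesis using \<Theta>(4) R by (simp add: \<theta>_def)
    qed
    have "gvec (\<theta> i) x = 0" by (rule gvec_eq_0_on_open[OF cube_basic(1) x]) (use th1 in auto)
    then have "outer (w i x) (gvec (\<theta> i) x) = 0" by (simp add: vec_eq_iff)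
    then have "H i x = D i x" using th1[OF x] by (simp add: H_def)
    moreover have "HH x = H i x" using J(2) x inn' by blast
    ultimately show ?thesis by (simp add: D_def)
  qed
  have rs: "r i \<le> s0" for i using cv(1,2)[of i] by (simp add: r_def d_def)
  have cU: "ccube (a i) (r i) \<subseteq> U" if "r i > 0" for i
    using inn[of i] that cv(4)[of i] by (auto simp: r_def)
  have "affine_on_cubes s0 U V (\<lambda>x. G x + HH x) a r \<xi>"
    unfolding affine_on_cubes_def using r0 rs cU dj off AEc af by simp
  then show ?thesis using J(1) sv[folded J(3)] sH[folded J(4)] Vo VU Vem by blast
qed

text \<open>Fatou's lemma for a limit that is reached after finitely many steps at almost every
  point, the mode of convergence of the iteration in \<open>piecewise_affine\<close>.\<close>

lemma Np_fatou_le: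
  fixes f :: "nat \<Rightarrow> real^'n \<Rightarrow> 'b::euclidean_space"
  assumes [measurable]: "\<And>n. f n \<in> borel_measurable lebesgue"
    and ev: "AE x in lebesgue. \<exists>k. \<forall>n\<ge>k. f n x = g x" and le: "\<And>n. Np p UNIV (f n) \<le> K"
  shows "Np p UNIV g \<le> K"
proof -
  have "Np p UNIV g \<le> (\<integral>\<^sup>+x. liminf (\<lambda>n. ennreal (norm (f n x) powr p)) \<partial>lebesgue)"
    unfolding Np_def
  proof (rule nn_integral_mono_AE)
    show "AE x in lebesgue. ennreal (norm (g x) powr p) * indicator UNIV x \<le> liminf (\<lambda>n. ennreal (norm (f n x) powr p))"
      using ev
    proof eventually_elim
      case (elim x)
      then obtain k where k: "\<And>n. n \<ge> k \<Longrightarrow> f n x = g x" by blast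
      have "(\<lambda>n. ennreal (norm (f n x) powr p)) \<longlonglongrightarrow> ennreal (norm (g x) powr p)"
        by (rule tendsto_eventually) (use k in \<open>auto simp: eventually_sequentially intro!: exI[of _ k]\<close>)
      then show ?case using lim_imp_Liminf[OF sequentially_bot] by fastforce
    qed
  qed
  also have "\<dots> \<le> liminf (\<lambda>n. \<integral>\<^sup>+x. ennreal (norm (f n x) powr p) \<partial>lebesgue)"
    by (rule nn_integral_liminf) measurable
  also have "\<dots> \<le> liminf (\<lambda>n. K)" using le by (intro Liminf_mono always_eventually) (simp add: Np_def)
  also have "\<dots> = K" by (simp add: Liminf_const)
  finally show ?thesis .
qed

text \<open>The ratio of the step sizes is half the inverse of the triangle factor: adding one more
  step and the inductive bound for the rest costs \<open>2 powr p\<close> times twice the step size,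
  which is exactly the previous member of the geometric sequence.\<close>

lemma Np_chain_le:
  fixes V :: "nat \<Rightarrow> real^'n \<Rightarrow> 'b::euclidean_space"
  assumes m: "\<And>n. V n \<in> borel_measurable lebesgue" and p: "p > 0" and \<eta>: "\<eta> > 0"
    and st: "\<And>n. Np p UNIV (\<lambda>x. V (Suc n) x - V n x) \<le> ennreal (\<eta> * (1 / (2 * 2 powr p)) ^ Suc n)"
  shows "Np p UNIV (\<lambda>x. V (n + j) x - V n x) \<le> ennreal (\<eta> * (1 / (2 * 2 powr p)) ^ n)"
proof (induction j arbitrary: n)
  case 0
  then show ?case using p by (simp add: Np_zero)
next
  case (Suc j)
  define c where "c = 2 powr p"
  have c: "c > 0" by (simp add: c_def)
  let ?e = "\<eta> * (1 / (2 * c)) ^ Suc n"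
  have e: "?e \<ge> 0" using c \<eta> by simp
  have "Np p UNIV (\<lambda>x. V (n + Suc j) x - V n x) \<le> ennreal c * (Np p UNIV (\<lambda>x. V (n + Suc j) x - V (Suc n) x) + Np p UNIV (\<lambda>x. V (Suc n) x - V n x))"
    unfolding c_def using m p by (intro Np_triangle) auto
  also have "\<dots> \<le> ennreal c * (ennreal ?e + ennreal ?e)"
    using Suc[of "Suc n"] st[of n] by (intro mult_left_mono add_mono) (auto simp: c_def)
  also have "\<dots> = ennreal (c * (?e + ?e))"
    using c e by (simp only: ennreal_plus ennreal_mult less_imp_le add_nonneg_nonneg)
  also have "c * (?e + ?e) = \<eta> * (1 / (2 * c)) ^ n" using c by simp
  finally show ?case unfolding c_def .
qed

text \<open>\<open>affine_step\<close> is repeated on the set not yet treated, whose measure decays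
  geometrically. Almost every point leaves that set after finitely many steps and is never modified
  again, so the limit is pointwise stationary and inherits affinity on each cube from the step that
  created the cube.\<close>

lemma piecewise_affine:
  fixes u :: "real^'n \<Rightarrow> real^'m"
  assumes W: "Wk p U u G" and U: "open U" "bounded U" and p: "p \<ge> 1" and \<eta>: "\<eta> > 0" and s0: "s0 > 0"
  shows "\<exists>v H a r \<xi>. Sob0 p U v H \<and> Np p UNIV v \<le> ennreal \<eta> \<and> Np p UNIV H \<le> ennreal \<eta> \<and>
     cube_cover U s0 a r \<and> (\<forall>i. \<forall>x\<in>cube (a i) (r i). G x + H x = \<xi> i)"
proof -
  have p0: "p > 0" "p \<ge> 0" using p by auto
  define c where "c = 2 powr p"
  have c: "c \<ge> 1" using p0 by (simp add: c_def ge_one_powr_ge_zero)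
  define \<delta> where "\<delta> n = \<eta> * (1 / (2 * c)) ^ Suc n" for n
  have \<delta>: "\<delta> n > 0" for n using c \<eta> by (simp add: \<delta>_def)
  define q where "q = (1 - (1/2) ^ CARD('n) :: real)"
  have q: "0 \<le> q" "q < 1" by (auto simp: q_def power_le_one)
  define P where "P = (\<lambda>(n::nat) (V, v :: real^'n \<Rightarrow> real^'m, H :: real^'n \<Rightarrow> real^'n^'m).
     open V \<and> V \<subseteq> U \<and> Sob0 p U v H \<and> (n = 0 \<longrightarrow> V = U \<and> v = (\<lambda>_. 0) \<and> H = (\<lambda>_. 0)))"
  define R where "R = (\<lambda>(n::nat) (V, v :: real^'n \<Rightarrow> real^'m, H :: real^'n \<Rightarrow> real^'n^'m) (V', v' :: real^'n \<Rightarrow> real^'m, H' :: real^'n \<Rightarrow> real^'n^'m).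
     V' \<subseteq> V \<and> emeasure lebesgue V' \<le> ennreal q * emeasure lebesgue V \<and>
     (\<forall>x. x \<notin> V \<longrightarrow> v' x = v x \<and> H' x = H x) \<and>
     Np p UNIV (\<lambda>x. v' x - v x) \<le> ennreal (\<delta> n) \<and> Np p UNIV (\<lambda>x. H' x - H x) \<le> ennreal (\<delta> n) \<and>
     (\<exists>a r \<xi>. affine_on_cubes s0 V V' (\<lambda>x. G x + H' x) a r \<xi>))"
  have "\<exists>f. \<forall>n. P n (f n) \<and> R n (f n) (f (Suc n))"
  proof (rule dependent_nat_choice)
    show "\<exists>x. P 0 x"
      by (rule exI[of _ "(U, \<lambda>_. 0, \<lambda>_. 0)"]) (simp add: P_def U Sob0_zero p0)
    fix x n assume Px: "P n x"
    obtain V v H where x: "x = (V, v, H)" by (cases x)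
    have V: "open V" "V \<subseteq> U" and S: "Sob0 p U v H" using Px by (auto simp: P_def x)
    have W': "Wk p V (\<lambda>x. u x + v x) (\<lambda>x. G x + H x)"
      by (rule Wk_add[OF Wk_mono[OF W V(2)] Sob0_Wk[OF S p] p]) (use V in simp)
    obtain w K V' a r \<xi> where *: "Sob0 p V w K" "Np p UNIV w \<le> ennreal (\<delta> n)" "Np p UNIV K \<le> ennreal (\<delta> n)"
      "open V'" "V' \<subseteq> V" "emeasure lebesgue V' \<le> ennreal q * emeasure lebesgue V"
      "affine_on_cubes s0 V V' (\<lambda>x. (G x + H x) + K x) a r \<xi>"
      using affine_step[OF W' V(1) bounded_subset[OF U(2) V(2)] p \<delta>[of n] s0, folded q_def] by blast
    let ?y = "(V', \<lambda>x. v x + w x, \<lambda>x. H x + K x)"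
    have "P (Suc n) ?y"
      using *(4,5) V(2) Sob0_add[OF S Sob0_mono[OF *(1) V(2)] p0(2)] by (auto simp: P_def)
    moreover have "R n x ?y"
      unfolding R_def x
    proof (simp only: prod.case, intro conjI exI[of _ a] exI[of _ r] exI[of _ \<xi>])
      show "\<forall>x. x \<notin> V \<longrightarrow> v x + w x = v x \<and> H x + K x = H x" using Sob0_outside[OF *(1)] by simp
      show "Np p UNIV (\<lambda>x. v x + w x - v x) \<le> ennreal (\<delta> n)" "Np p UNIV (\<lambda>x. H x + K x - H x) \<le> ennreal (\<delta> n)"
        using *(2,3) by simp_all
      show "affine_on_cubes s0 V V' (\<lambda>x. G x + (H x + K x)) a r \<xi>"
        using *(7) by (simp add: add.assoc)
    qed (use * in auto)
    ultimately show "\<exists>y. P (Suc n) y \<and> R n x y" by blast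
  qed
  then obtain f where "\<forall>n. P n (f n) \<and> R n (f n) (f (Suc n))" ..
  note f = this[rule_format, THEN conjunct1] this[rule_format, THEN conjunct2]
  define Vs where "Vs n = fst (f n)" for n
  define vs where "vs n = fst (snd (f n))" for n
  define Hs where "Hs n = snd (snd (f n))" for n
  have fe: "f n = (Vs n, vs n, Hs n)" for n by (simp add: Vs_def vs_def Hs_def)
  have VU: "open (Vs n)" "Vs n \<subseteq> U" and S: "Sob0 p U (vs n) (Hs n)" for n using f(1)[of n] by (auto simp: P_def fe)
  have init: "Vs 0 = U" "vs 0 = (\<lambda>_. 0)" "Hs 0 = (\<lambda>_. 0)" using f(1)[of 0] by (auto simp: P_def fe)
  have st: "Vs (Suc n) \<subseteq> Vs n" "emeasure lebesgue (Vs (Suc n)) \<le> ennreal q * emeasure lebesgue (Vs n)"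
     "\<And>x. x \<notin> Vs n \<Longrightarrow> vs (Suc n) x = vs n x" "\<And>x. x \<notin> Vs n \<Longrightarrow> Hs (Suc n) x = Hs n x"
     "Np p UNIV (\<lambda>x. vs (Suc n) x - vs n x) \<le> ennreal (\<delta> n)" "Np p UNIV (\<lambda>x. Hs (Suc n) x - Hs n x) \<le> ennreal (\<delta> n)"
     "\<exists>a r \<xi>. affine_on_cubes s0 (Vs n) (Vs (Suc n)) (\<lambda>x. G x + Hs (Suc n) x) a r \<xi>" for n
    using f(2)[of n] by (auto simp: R_def fe)
  have anti: "Vs m \<subseteq> Vs n" if "n \<le> m" for n m using that by (induction rule: dec_induct) (use st(1) in auto)
  have stab: "vs m x = vs n x" "Hs m x = Hs n x" if "x \<notin> Vs n" "n \<le> m" for x n m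
  proof -
    have "vs m x = vs n x \<and> Hs m x = Hs n x" using that(2)
    proof (induction rule: dec_induct)
      case (step k)
      have "x \<notin> Vs k" using that(1) anti[OF step.hyps(1)] by blast
      then show ?case using st(3,4) step.IH by simp
    qed simp
    then show "vs m x = vs n x" "Hs m x = Hs n x" by auto
  qed
  define N where "N = (\<Inter>n. Vs n)"
  have N: "N \<in> null_sets lebesgue"
  proof -
    have "emeasure lebesgue (Vs n) \<le> ennreal (q ^ n) * emeasure lebesgue U" for n
    proof (induction n)
      case 0
      then show ?case by (simp add: init)
    next
      case (Suc n)
      have "emeasure lebesgue (Vs (Suc n)) \<le> ennreal q * (ennreal (q ^ n) * emeasure lebesgue U)"
        by (rule order_trans[OF st(2) mult_left_mono[OF Suc]]) simp
      then show ?case using q by (simp add: ennreal_mult mult.assoc)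
    qed
    note le = this
    have Us: "U \<in> sets lebesgue" using U(1) by simp
    define mU where "mU = measure lebesgue U"
    have eU: "emeasure lebesgue U = ennreal mU"
      unfolding mU_def by (rule emeasure_eq_measure2[OF bounded_set_imp_lmeasurable[OF U(2) Us]])
    have Ns: "N \<in> sets lebesgue" unfolding N_def using VU(1) by (intro sets.countable_INT) auto
    have "emeasure lebesgue N \<le> ennreal (q ^ n * mU)" for n
    proof -
      have "emeasure lebesgue N \<le> emeasure lebesgue (Vs n)" using VU(1)[of n] by (intro emeasure_mono) (auto simp: N_def)
      also have "\<dots> \<le> ennreal (q ^ n * mU)" using le[of n] q by (simp add: eU ennreal_mult')
      finally show ?thesis .
    qed
    moreover have "(\<lambda>n. ennreal (q ^ n * mU)) \<longlonglongrightarrow> ennreal (0 * mU)"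
      using q by (intro tendsto_ennrealI tendsto_mult LIMSEQ_power_zero tendsto_const) auto
    ultimately have "emeasure lebesgue N \<le> ennreal (0 * mU)" by (intro LIMSEQ_le_const) auto
    then show ?thesis using Ns by (simp add: null_sets_def)
  qed
  \<comment> \<open>The first index at which \<open>x\<close> has left the remaining sets. On the
    exceptional null set the limit is set to 0.\<close>
  define k where "k x = (LEAST n. x \<notin> Vs n)" for x
  define vv where "vv x = (if x \<in> N then 0 else vs (k x) x)" for x
  define HH where "HH x = (if x \<in> N then 0 else Hs (k x) x)" for x
  have lim: "vv x = vs n x" "HH x = Hs n x" if "x \<notin> Vs n" for x n
  proof -
    have xN: "x \<notin> N" using that by (auto simp: N_def)
    have 1: "x \<notin> Vs (k x)" unfolding k_def using that by (rule LeastI)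
    have 2: "k x \<le> n" unfolding k_def using that by (rule Least_le)
    show "vv x = vs n x" "HH x = Hs n x" using stab[OF 1 2] xN by (auto simp: vv_def HH_def)
  qed
  have lim_ev: "AE x in lebesgue. \<exists>k. \<forall>n\<ge>k. vs n x = vv x \<and> Hs n x = HH x"
    using AE_not_in[OF N]
  proof eventually_elim
    case (elim x)
    then obtain k where "x \<notin> Vs k" by (auto simp: N_def)
    then have "\<forall>n\<ge>k. x \<notin> Vs n" using anti by blast
    then show ?case using lim by metis
  qed
  note ms = Sob0_measurable[OF S]
  have mlim: "Lmeas g" if m: "\<And>n. gs n \<in> borel_measurable lebesgue" and g: "\<And>x n. x \<notin> Vs n \<Longrightarrow> g x = gs n x" "\<And>x. x \<in> N \<Longrightarrow> g x = 0"
    for gs :: "nat \<Rightarrow> real^'n \<Rightarrow> 'c::euclidean_space" and g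
  proof (rule borel_measurable_LIMSEQ_metric)
    show "Lmeas (\<lambda>x. indicator (- Vs n) x *\<^sub>R gs n x)" for n
      using m[of n] VU(1)[of n] by (intro borel_measurable_scaleR borel_measurable_indicator) auto
    fix x
    show "(\<lambda>n. indicator (- Vs n) x *\<^sub>R gs n x) \<longlonglongrightarrow> g x"
    proof (cases "x \<in> N")
      case False
      then obtain k where "x \<notin> Vs k" by (auto simp: N_def)
      then have "\<forall>n\<ge>k. x \<notin> Vs n" using anti by blast
      then show ?thesis using g(1)[of x, symmetric] by (intro tendsto_eventually) (auto simp: eventually_sequentially intro!: exI[of _ k])
    qed (auto simp: g(2) N_def)
  qed
  have vm: "Lmeas vv" by (rule mlim[OF ms(1) lim(1)]) (auto simp: vv_def)
  have Hm: "Lmeas HH" by (rule mlim[OF ms(2) lim(2)]) (auto simp: HH_def)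
  have ch: "Np p UNIV (\<lambda>x. g x - gs n x) \<le> ennreal (\<eta> * (1 / (2 * c)) ^ n)"
    if gm: "\<And>n. gs n \<in> borel_measurable lebesgue" and gl: "AE x in lebesgue. \<exists>k. \<forall>n\<ge>k. gs n x = g x"
      and gd: "\<And>n. Np p UNIV (\<lambda>x. gs (Suc n) x - gs n x) \<le> ennreal (\<delta> n)"
    for gs :: "nat \<Rightarrow> real^'n \<Rightarrow> 'c::euclidean_space" and g n
  proof (rule Np_fatou_le[of "\<lambda>j x. gs (n + j) x - gs n x"])
    show "Lmeas (\<lambda>x. gs (n + j) x - gs n x)" for j using gm by auto
    show "Np p UNIV (\<lambda>x. gs (n + j) x - gs n x) \<le> ennreal (\<eta> * (1 / (2 * c)) ^ n)" for j
      unfolding c_def by (rule Np_chain_le[OF gm p0(1) \<eta>]) (use gd in \<open>simp add: \<delta>_def c_def\<close>)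
    show "AE x in lebesgue. \<exists>k. \<forall>j\<ge>k. gs (n + j) x - gs n x = g x - gs n x"
      using gl
    proof eventually_elim
      case (elim x)
      then obtain k where "\<forall>n\<ge>k. gs n x = g x" by blast
      then show ?case by (intro exI[of _ k]) auto
    qed
  qed
  have vl: "Np p UNIV (\<lambda>x. vv x - vs n x) \<le> ennreal (\<eta> * (1 / (2 * c)) ^ n)" for n
    by (rule ch[OF ms(1) _ st(5)]) (use lim_ev in \<open>auto elim!: eventually_mono\<close>)
  have Hl: "Np p UNIV (\<lambda>x. HH x - Hs n x) \<le> ennreal (\<eta> * (1 / (2 * c)) ^ n)" for n
    by (rule ch[OF ms(2) _ st(6)]) (use lim_ev in \<open>auto elim!: eventually_mono\<close>)
  have SS: "Sob0 p U vv HH"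
  proof (rule Sob0_closed[OF vm Hm _ _ p0(2)])
    show "vv x = 0" "HH x = 0" if "x \<notin> U" for x
      using lim[of x 0] that init by auto
    fix e :: real assume e: "e > 0"
    have "(\<lambda>n. \<eta> * (1 / (2 * c)) ^ n) \<longlonglongrightarrow> \<eta> * 0"
      using c by (intro tendsto_mult tendsto_const LIMSEQ_power_zero) auto
    then have "eventually (\<lambda>n. \<eta> * (1 / (2 * c)) ^ n < e) sequentially" using e by (intro order_tendstoD) auto
    then obtain n where "\<eta> * (1 / (2 * c)) ^ n < e" by (auto simp: eventually_sequentially)
    then have le: "ennreal (\<eta> * (1 / (2 * c)) ^ n) \<le> ennreal e" by (intro ennreal_leI) simp
    show "\<exists>v' H'. Sob0 p U v' H' \<and> Np p UNIV (\<lambda>x. v' x - vv x) \<le> ennreal e \<and> Np p UNIV (\<lambda>x. H' x - HH x) \<le> ennreal e"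
      using S[of n] order_trans[OF vl le] order_trans[OF Hl le]
      unfolding Np_commute[of p UNIV vv] Np_commute[of p UNIV HH] by (intro exI conjI)
  qed
  from choice[OF allI[OF st(7)]] obtain as where "\<forall>n. \<exists>r \<xi>. affine_on_cubes s0 (Vs n) (Vs (Suc n)) (\<lambda>x. G x + Hs (Suc n) x) (as n) r \<xi>" ..
  from choice[OF this] obtain rs where "\<forall>n. \<exists>\<xi>. affine_on_cubes s0 (Vs n) (Vs (Suc n)) (\<lambda>x. G x + Hs (Suc n) x) (as n) (rs n) \<xi>" ..
  from choice[OF this] obtain \<xi>s where "\<forall>n. affine_on_cubes s0 (Vs n) (Vs (Suc n)) (\<lambda>x. G x + Hs (Suc n) x) (as n) (rs n) (\<xi>s n)" ..
  then have cb: "0 \<le> rs n i" "rs n i \<le> s0" "rs n i > 0 \<Longrightarrow> ccube (as n i) (rs n i) \<subseteq> Vs n"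
     "disjoint_family (\<lambda>i. cube (as n i) (rs n i))" "cube (as n i) (rs n i) \<subseteq> Vs n - Vs (Suc n)"
     "AE x in lebesgue. x \<in> Vs n \<longrightarrow> x \<in> Vs (Suc n) \<or> x \<in> (\<Union>i. cube (as n i) (rs n i))"
     "x \<in> cube (as n i) (rs n i) \<Longrightarrow> G x + Hs (Suc n) x = \<xi>s n i" for n i x
    unfolding affine_on_cubes_def by blast+
  \<comment> \<open>The cubes of all steps are merged into one sequence by the pairing of step
    number and index within the step.\<close>
  define a where "a j = as (fst (prod_decode j)) (snd (prod_decode j))" for j
  define r where "r j = rs (fst (prod_decode j)) (snd (prod_decode j))" for j
  define \<xi> where "\<xi> j = \<xi>s (fst (prod_decode j)) (snd (prod_decode j))" for j
  have disj: "disjoint_family (\<lambda>j. cube (a j) (r j))"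
    unfolding disjoint_family_on_def
  proof (intro ballI impI)
    fix m n :: nat assume mn: "m \<noteq> n"
    obtain m1 m2 n1 n2 where e: "prod_decode m = (m1, m2)" "prod_decode n = (n1, n2)" by (metis surj_pair)
    have ne: "(m1, m2) \<noteq> (n1, n2)" using mn e by (metis prod_decode_inverse)
    show "cube (a m) (r m) \<inter> cube (a n) (r n) = {}"
    proof (cases "m1 = n1")
      case True
      then have "m2 \<noteq> n2" using ne by simp
      then show ?thesis using cb(4)[of n1] True by (auto simp: a_def r_def e disjoint_family_on_def)
    next
      case False
      have "cube (as k i) (rs k i) \<inter> cube (as l j) (rs l j) = {}" if "k < l" for k l i j
      proof -
        have "Vs l \<subseteq> Vs (Suc k)" using that by (intro anti) simp
        then show ?thesis using cb(5)[of k i] cb(5)[of l j] by blast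
      qed
      then show ?thesis using False unfolding a_def r_def e fst_conv snd_conv by (metis Int_commute linorder_neqE_nat)
    qed
  qed
  have "AE x in lebesgue. \<forall>n. x \<in> Vs n \<longrightarrow> x \<in> Vs (Suc n) \<or> x \<in> (\<Union>i. cube (as n i) (rs n i))"
    using cb(6) by (simp add: AE_all_countable)
  then have cover: "AE x in lebesgue. x \<in> U \<longrightarrow> x \<in> (\<Union>j. cube (a j) (r j))"
    using AE_not_in[OF N]
  proof eventually_elim
    case (elim x)
    show ?case
    proof
      assume xU: "x \<in> U"
      obtain n where n: "x \<notin> Vs n" using elim(2) by (auto simp: N_def)
      have "\<exists>k. x \<in> Vs k \<and> x \<notin> Vs (Suc k)"
      proof (rule ccontr)
        assume "\<not> ?thesis"
        then have "x \<in> Vs k" for k by (induction k) (use xU init in auto)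
        with n show False by blast
      qed
      then obtain k i where "x \<in> cube (as k i) (rs k i)" using elim(1) by blast
      then show "x \<in> (\<Union>j. cube (a j) (r j))"
        by (intro UN_I[of "prod_encode (k, i)"]) (auto simp: a_def r_def)
    qed
  qed
  have aff: "G x + HH x = \<xi> j" if x: "x \<in> cube (a j) (r j)" for x j
  proof -
    let ?n = "fst (prod_decode j)"
    have "x \<notin> Vs (Suc ?n)" using x cb(5)[of ?n "snd (prod_decode j)"] by (auto simp: a_def r_def)
    then show ?thesis using lim(2) cb(7)[of x ?n "snd (prod_decode j)"] x by (simp add: a_def r_def \<xi>_def)
  qed
  have cc: "cube_cover U s0 a r"
    unfolding cube_cover_def
  proof (intro conjI allI impI disj cover)
    show "0 \<le> r j" "r j \<le> s0" for j using cb(1,2) by (auto simp: r_def)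
    show "ccube (a j) (r j) \<subseteq> U" if "r j > 0" for j
      using cb(3)[of "fst (prod_decode j)" "snd (prod_decode j)"] that VU(2) unfolding a_def r_def by blast
  qed
  have "Np p UNIV vv \<le> ennreal \<eta>" "Np p UNIV HH \<le> ennreal \<eta>" using vl[of 0] Hl[of 0] by (auto simp: init)
  with SS cc aff show ?thesis by blast
qed

subsection \<open>Competitors with controlled energy\<close>

abbreviation energy :: "('a::euclidean_space \<Rightarrow> 'b \<Rightarrow> ennreal) \<Rightarrow> 'a set \<Rightarrow> ('a \<Rightarrow> 'b) \<Rightarrow> ennreal" where
  "energy f U G \<equiv> \<integral>\<^sup>+x\<in>U. f x (G x) \<partial>lebesgue"

text \<open>The hypotheses with named constants. \<open>osc\<close> is C1 restricted to distances at
  which its modulus is at most 1. Keeping the constants as locale parameters makes it visible that a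
  rescaled integrand is an instance with the same \<open>p\<close>, \<open>C\<close> and
  \<open>c\<close>.\<close>

locale integrand =
  fixes f :: "real^'n \<Rightarrow> real^'n^'m \<Rightarrow> ennreal" and p C s0 c :: real
  assumes p: "p \<ge> 1" and C: "C > 0" and s0: "s0 > 0" and c: "c > 0"
    and meas: "(\<lambda>(x, \<xi>). f x \<xi>) \<in> borel_measurable (lebesgue \<Otimes>\<^sub>M borel)"
    and coercive: "ennreal C * ennreal (norm \<xi> powr p) \<le> f x \<xi>"
    and osc: "norm (x1 - x2) \<le> s0 \<Longrightarrow> f x1 \<xi> \<le> 1 + 2 * f x2 \<xi>"
    and ZW_le: "ZW f x \<xi> \<le> ennreal (c * (1 + norm \<xi> powr p))"
begin

lemma p0: "p > 0" "p \<ge> 0" "p \<noteq> 0"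
  using p by auto

lemma meas_comp [measurable (raw)]:
  assumes "Lmeas G"
  shows "Lmeas (\<lambda>x. f x (G x))"
proof -
  have "(\<lambda>x. (x, G x)) \<in> lebesgue \<rightarrow>\<^sub>M lebesgue \<Otimes>\<^sub>M borel"
    using assms by (intro measurable_Pair) auto
  from measurable_compose[OF this meas] show ?thesis by simp
qed

lemma energy_coercive:
  assumes "Lmeas G" "U \<in> sets lebesgue"
  shows "ennreal C * Np p U G \<le> energy f U G"
proof -
  have "ennreal C * Np p U G = (\<integral>\<^sup>+x. ennreal C * (ennreal (norm (G x) powr p) * indicator U x) \<partial>lebesgue)"
    unfolding Np_def using assms by (subst nn_integral_cmult) auto
  also have "\<dots> \<le> energy f U G"
    using coercive by (intro nn_integral_mono) (auto simp: indicator_def)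
  finally show ?thesis .
qed

text \<open>The summand 1 is slack that guarantees a competitor below the bound, as the infimum in
  \<open>ZW\<close> need not be attained. The competitor is extended by zero to the whole
  space.\<close>

lemma ex_cell_function:
  obtains \<phi> K where "Wk p UNIV \<phi> K" "\<And>y. y \<notin> cube 0 1 \<Longrightarrow> \<phi> y = 0" "\<And>y. y \<notin> cube 0 1 \<Longrightarrow> K y = 0"
    "(\<integral>\<^sup>+y\<in>cube 0 1. f x (\<xi> + K y) \<partial>lebesgue) \<le> ennreal (c * (1 + norm \<xi> powr p) + 1)"
proof -
  have "ZW f x \<xi> < ennreal (c * (1 + norm \<xi> powr p) + 1)"
    using ZW_le[of x \<xi>] c by (intro le_less_trans[OF ZW_le] ennreal_lessI) (auto intro: add_nonneg_pos)
  then obtain \<phi> :: "real^'n \<Rightarrow> real^'m" where \<phi>: "W1inf0 unitcube \<phi>"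
    "(\<integral>\<^sup>+y\<in>unitcube. f x (\<xi> + wgrad unitcube \<phi> y) \<partial>lebesgue) < ennreal (c * (1 + norm \<xi> powr p) + 1)"
    unfolding ZW_def INF_less_iff by auto
  let ?Y = "unitcube :: (real^'n) set"
  show ?thesis
  proof (rule that[OF W1inf0_Wk[OF \<phi>(1) p]])
    have "(\<integral>\<^sup>+y\<in>cube 0 1. f x (\<xi> + indicator ?Y y *\<^sub>R wgrad ?Y \<phi> y) \<partial>lebesgue) = (\<integral>\<^sup>+y\<in>?Y. f x (\<xi> + wgrad ?Y \<phi> y) \<partial>lebesgue)"
      unfolding unitcube_eq_cube by (intro nn_integral_cong) (auto simp: indicator_def)
    then show "(\<integral>\<^sup>+y\<in>cube 0 1. f x (\<xi> + indicator ?Y y *\<^sub>R wgrad ?Y \<phi> y) \<partial>lebesgue) \<le> ennreal (c * (1 + norm \<xi> powr p) + 1)"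
      using \<phi>(2) by simp
  qed (simp_all add: unitcube_eq_cube)
qed

lemma nn_integral_cube_scale:
  fixes g :: "real^'n \<Rightarrow> ennreal"
  assumes g: "Lmeas g" and r: "r > 0"
  shows "(\<integral>\<^sup>+x\<in>cube a (r * R). g ((1/r) *\<^sub>R (x - a)) \<partial>lebesgue) = ennreal (r ^ CARD('n)) * (\<integral>\<^sup>+y\<in>cube 0 R. g y \<partial>lebesgue)"
proof -
  have m: "Lmeas (\<lambda>y. g y * indicator (cube 0 R) y)" using g by measurable
  have eq: "(\<integral>\<^sup>+x\<in>cube a (r * R). g ((1/r) *\<^sub>R (x - a)) \<partial>lebesgue) = (\<integral>\<^sup>+x. (\<lambda>y. g y * indicator (cube 0 R) y) (- (1/r) *\<^sub>R a + (1/r) *\<^sub>R x) \<partial>lebesgue)"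
  proof (intro nn_integral_cong)
    fix x
    have "- (1/r) *\<^sub>R a + (1/r) *\<^sub>R x = (1/r) *\<^sub>R (x - a)" by (simp add: scaleR_diff_right)
    then show "g ((1/r) *\<^sub>R (x - a)) * indicator (cube a (r * R)) x = (\<lambda>y. g y * indicator (cube 0 R) y) (- (1/r) *\<^sub>R a + (1/r) *\<^sub>R x)"
      using scaled_in_cube(1)[OF r, of x a 0 R] by (simp add: indicator_def)
  qed
  have "ennreal (r ^ CARD('n)) * (\<integral>\<^sup>+y\<in>cube 0 R. g y \<partial>lebesgue)
     = ennreal (r ^ CARD('n)) * (ennreal (\<bar>1/r\<bar> ^ CARD('n)) * (\<integral>\<^sup>+x\<in>cube a (r * R). g ((1/r) *\<^sub>R (x - a)) \<partial>lebesgue))"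
    unfolding eq using nn_integral_affine[OF m, of "1/r" "- (1/r) *\<^sub>R a"] r by simp
  also have "\<dots> = ennreal (r ^ CARD('n) * \<bar>1/r\<bar> ^ CARD('n)) * (\<integral>\<^sup>+x\<in>cube a (r * R). g ((1/r) *\<^sub>R (x - a)) \<partial>lebesgue)"
    using r by (simp add: ennreal_mult mult.assoc)
  also have "r ^ CARD('n) * \<bar>1/r\<bar> ^ CARD('n) = 1" using r by (simp add: power_mult_distrib[symmetric])
  finally show ?thesis by simp
qed

lemma cell_on_cube:
  assumes r: "r > 0" "real CARD('n) * r \<le> s0" and U: "open U" "ccube a r \<subseteq> U"
  obtains v H where "Sob0 p U v H" "\<And>y. y \<notin> cube a r \<Longrightarrow> v y = 0" "\<And>y. y \<notin> cube a r \<Longrightarrow> H y = 0"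
    "Np p UNIV v \<le> ennreal (4 powr p * (2 * r) powr p) * Np p UNIV H"
    "energy f (cube a r) (\<lambda>x. \<xi> + H x) \<le> ennreal (r ^ CARD('n) * ((3 + 2 * c) * (1 + norm \<xi> powr p)))"
proof -
  obtain \<phi> K where W: "Wk p UNIV \<phi> K" and out: "\<And>y. y \<notin> cube 0 1 \<Longrightarrow> \<phi> y = 0" "\<And>y. y \<notin> cube 0 1 \<Longrightarrow> K y = 0"
    and en: "(\<integral>\<^sup>+y\<in>cube 0 1. f a (\<xi> + K y) \<partial>lebesgue) \<le> ennreal (c * (1 + norm \<xi> powr p) + 1)"
    using ex_cell_function[of a \<xi>] by blast
  have out': "\<phi> y = 0" "K y = 0" if "y \<notin> ccube 0 1" for y
    using that out[of y] cube_subset_ccube[of 0 1] by blast+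
  define v where "v x = r *\<^sub>R \<phi> ((1/r) *\<^sub>R (x - a))" for x
  define H where "H x = K ((1/r) *\<^sub>R (x - a))" for x
  have sob: "Sob0 p V v H" if V: "open V" "ccube a r \<subseteq> V" for V
  proof -
    define V' where "V' = (\<lambda>y. a + r *\<^sub>R y) -` V"
    have "open V'" unfolding V'_def by (intro continuous_open_vimage V(1) continuous_intros)
    moreover have "ccube 0 1 \<subseteq> V'"
    proof
      fix y :: "real^'n" assume y: "y \<in> ccube 0 1"
      have "a + r *\<^sub>R y \<in> ccube a r" unfolding mem_ccube
      proof
        fix i
        have y': "0 \<le> y $ i" "y $ i \<le> 1" using y by (auto simp: mem_ccube)
        then have "r * y $ i \<le> r * 1" using r(1) by (intro mult_left_mono) auto
        then show "a $ i \<le> (a + r *\<^sub>R y) $ i \<and> (a + r *\<^sub>R y) $ i \<le> a $ i + r" using y' r(1) by simp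
      qed
      then show "y \<in> V'" using V(2) by (auto simp: V'_def)
    qed
    ultimately have "Sob0 p V' \<phi> K"
      using Wk_compact_support_Sob0[OF W p cube_basic(2), of 0 1 V'] out' by blast
    then show ?thesis
      unfolding v_def H_def by (rule Sob0_scale(1)[OF _ r(1) _ p0(2)]) (simp add: V'_def)
  qed
  have vo: "v y = 0" "H y = 0" if "y \<notin> cube a r" for y
    using out[of "(1/r) *\<^sub>R (y - a)"] that scaled_in_cube(1)[OF r(1), of y a 0 1] by (auto simp: v_def H_def)
  \<comment> \<open>The support fills the closed cube, so Friedrichs' inequality is applied on the
    concentric open cube of twice the side.\<close>
  define a' where "a' = a - (\<chi> i. r/2)"
  have "ccube a r \<subseteq> cube a' (2 * r)"
    using r(1) by (intro ccube_subset_cube) (simp add: a'_def)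
  then have S2: "Sob0 p (cube a' (2 * r)) v H" by (intro sob) auto
  have Fr: "Np p UNIV v \<le> ennreal (4 powr p * (2 * r) powr p) * Np p UNIV H"
    by (rule friedrichs[OF S2 p]) (use r in simp)
  have Km: "Lmeas K" by (rule WkD(2)[OF W])
  have fm: "Lmeas (\<lambda>y. f a (\<xi> + K y))"
  proof -
    have "(\<lambda>y. (a, \<xi> + K y)) \<in> lebesgue \<rightarrow>\<^sub>M lebesgue \<Otimes>\<^sub>M borel"
      using Km by (intro measurable_Pair) auto
    from measurable_compose[OF this meas] show ?thesis by simp
  qed
  have "energy f (cube a r) (\<lambda>x. \<xi> + H x) \<le> (\<integral>\<^sup>+x\<in>cube a r. (\<lambda>y. 1 + 2 * f a (\<xi> + K y)) ((1/r) *\<^sub>R (x - a)) \<partial>lebesgue)"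
  proof (rule nn_integral_mono)
    fix x
    show "f x (\<xi> + H x) * indicator (cube a r) x \<le> (\<lambda>y. 1 + 2 * f a (\<xi> + K y)) ((1/r) *\<^sub>R (x - a)) * indicator (cube a r) x"
    proof (cases "x \<in> cube a r")
      case True
      then have "x \<in> ccube a r" using cube_subset_ccube by blast
      moreover have "a \<in> ccube a r" using r by (simp add: mem_ccube)
      ultimately have "norm (x - a) \<le> s0" using dist_ccube_le[of x a r a] r(2) by (simp add: dist_norm)
      from osc[OF this, of "\<xi> + H x"] show ?thesis using True by (simp add: H_def)
    qed simp
  qed
  also have "\<dots> = ennreal (r ^ CARD('n)) * (\<integral>\<^sup>+y\<in>cube 0 1. (1 + 2 * f a (\<xi> + K y)) \<partial>lebesgue)"
    using nn_integral_cube_scale[OF _ r(1), of "\<lambda>y. 1 + 2 * f a (\<xi> + K y)" a 1] fm by simp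
  also have "(\<integral>\<^sup>+y\<in>cube 0 1. (1 + 2 * f a (\<xi> + K y)) \<partial>lebesgue) = (\<integral>\<^sup>+y. indicator (cube 0 1) y + 2 * (f a (\<xi> + K y) * indicator (cube 0 1) y) \<partial>lebesgue)"
    by (intro nn_integral_cong) (simp add: distrib_right mult.assoc)
  also have "\<dots> = 1 + 2 * (\<integral>\<^sup>+y\<in>cube 0 1. f a (\<xi> + K y) \<partial>lebesgue)"
  proof (subst nn_integral_add)
    show "(\<integral>\<^sup>+y. indicator (cube (0::real^'n) 1) y \<partial>lebesgue) + (\<integral>\<^sup>+y. 2 * (f a (\<xi> + K y) * indicator (cube 0 1) y) \<partial>lebesgue)
      = 1 + 2 * (\<integral>\<^sup>+y\<in>cube 0 1. f a (\<xi> + K y) \<partial>lebesgue)"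
      using fm emeasure_cube(1)[of 1 "0::real^'n"] by (subst nn_integral_cmult) auto
  qed (use fm in auto)
  also have "ennreal (r ^ CARD('n)) * \<dots> \<le> ennreal (r ^ CARD('n)) * (1 + 2 * ennreal (c * (1 + norm \<xi> powr p) + 1))"
    using en by (intro mult_left_mono add_mono) auto
  also have "\<dots> = ennreal (r ^ CARD('n) * (1 + 2 * (c * (1 + norm \<xi> powr p) + 1)))"
  proof -
    have 1: "0 \<le> c * (1 + norm \<xi> powr p) + 1" using c by (intro add_nonneg_nonneg mult_nonneg_nonneg) auto
    have "1 + 2 * ennreal y = ennreal (1 + 2 * y)" if "y \<ge> 0" for y
      using that by (simp add: ennreal_mult')
    note 2 = this[OF 1]
    show ?thesis unfolding 2 using r(1) by (simp add: ennreal_mult' del: ennreal_plus)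
  qed
  also have "\<dots> \<le> ennreal (r ^ CARD('n) * ((3 + 2 * c) * (1 + norm \<xi> powr p)))"
    using r(1) by (intro ennreal_leI mult_left_mono) (auto simp: algebra_simps)
  finally have E: "energy f (cube a r) (\<lambda>x. \<xi> + H x) \<le> ennreal (r ^ CARD('n) * ((3 + 2 * c) * (1 + norm \<xi> powr p)))" .
  show ?thesis by (rule that[OF sob[OF U] vo Fr E])
qed

text \<open>The cell constant \<open>3 + 2 * c\<close> times the loss \<open>2 powr p * 2\<close>
  from replacing the gradient by a piecewise constant one.\<close>

definition C0 :: real where
  "C0 = (3 + 2 * c) * (2 powr p * 2)"

lemma C0_pos: "C0 > 0"
  unfolding C0_def using c by (intro mult_pos_pos add_pos_pos) auto

lemma nn_integral_one_plus_norm: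
  assumes "Lmeas G" "U \<in> sets lebesgue"
  shows "(\<integral>\<^sup>+x\<in>U. ennreal (1 + norm (G x) powr p) \<partial>lebesgue) = emeasure lebesgue U + Np p U (G :: real^'n \<Rightarrow> real^'n^'m)"
proof -
  have "(\<integral>\<^sup>+x\<in>U. ennreal (1 + norm (G x) powr p) \<partial>lebesgue) = (\<integral>\<^sup>+x. indicator U x + ennreal (norm (G x) powr p) * indicator U x \<partial>lebesgue)"
    by (intro nn_integral_cong) (simp add: ennreal_plus distrib_right)
  also have "\<dots> = emeasure lebesgue U + Np p U G"
    unfolding Np_def using assms by (subst nn_integral_add) auto
  finally show ?thesis .
qed

text \<open>Coercivity turns the energy bounds \<open>b i\<close> into bounds on the gradients
  \<open>H i\<close>. These make the series of pieces summable, so that pasting is legitimate, and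
  together with the factor \<open>k\<close> they make the pasted function small in
  \<open>L^p\<close>.\<close>

lemma paste:
  assumes G: "Lmeas G" and cv: "cube_cover U d a r" and aff: "\<And>i x. x \<in> cube (a i) (r i) \<Longrightarrow> G x = \<xi> i"
    and w: "\<And>i. \<exists>v H. Sob0 p U v H \<and> (\<forall>y. y \<notin> cube (a i) (r i) \<longrightarrow> v y = 0 \<and> H y = 0) \<and>
      Np p UNIV v \<le> ennreal k * Np p UNIV H \<and> energy f (cube (a i) (r i)) (\<lambda>x. \<xi> i + H x) \<le> b i"
    and b: "(\<Sum>i. b i) \<le> ennreal \<beta>" "\<beta> \<ge> 0" and fin: "Np p U G \<le> ennreal \<gamma>" "\<gamma> \<ge> 0"
  obtains V E where "Sob0 p U V E" "energy f U (\<lambda>x. G x + E x) \<le> ennreal \<beta>"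
    "Np p UNIV V \<le> ennreal k * ennreal (2 powr p * (\<beta> / C + \<gamma>))"
proof -
  let ?Q = "\<lambda>i. cube (a i) (r i)"
  note cv' = cube_coverD[OF cv] and [measurable] = G
  from choice[OF allI[OF w]] obtain v where "\<forall>i. \<exists>H. Sob0 p U (v i) H \<and> (\<forall>y. y \<notin> ?Q i \<longrightarrow> v i y = 0 \<and> H y = 0) \<and>
      Np p UNIV (v i) \<le> ennreal k * Np p UNIV H \<and> energy f (?Q i) (\<lambda>x. \<xi> i + H x) \<le> b i" ..
  from choice[OF this] obtain H where "\<forall>i. Sob0 p U (v i) (H i) \<and> (\<forall>y. y \<notin> ?Q i \<longrightarrow> v i y = 0 \<and> H i y = 0) \<and>
      Np p UNIV (v i) \<le> ennreal k * Np p UNIV (H i) \<and> energy f (?Q i) (\<lambda>x. \<xi> i + H i x) \<le> b i" ..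
  then have S: "Sob0 p U (v i) (H i)" and out: "y \<notin> ?Q i \<Longrightarrow> v i y = 0 \<and> H i y = 0"
    and Nv: "Np p UNIV (v i) \<le> ennreal k * Np p UNIV (H i)" and en: "energy f (?Q i) (\<lambda>x. \<xi> i + H i x) \<le> b i" for i y by auto
  note [measurable] = Sob0_measurable(2)[OF S]
  have NH: "Np p UNIV (H i) \<le> ennreal (2 powr p) * (ennreal (1 / C) * b i + Np p (?Q i) G)" for i
  proof -
    have "Np p UNIV (H i) = Np p (?Q i) (H i)" by (rule Np_UNIV_supp) (use out p0 in auto)
    also have "\<dots> = Np p (?Q i) (\<lambda>x. (\<xi> i + H i x) - G x)" using aff by (intro Np_cong_AE) auto
    also have "\<dots> \<le> ennreal (2 powr p) * (Np p (?Q i) (\<lambda>x. \<xi> i + H i x) + Np p (?Q i) G)" using p0 by (intro Np_diff) auto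
    also have "Np p (?Q i) (\<lambda>x. \<xi> i + H i x) \<le> ennreal (1 / C) * b i"
    proof -
      have "ennreal C * Np p (?Q i) (\<lambda>x. \<xi> i + H i x) \<le> b i" by (rule order_trans[OF energy_coercive en]) auto
      then have "ennreal (1 / C) * (ennreal C * Np p (?Q i) (\<lambda>x. \<xi> i + H i x)) \<le> ennreal (1 / C) * b i" by (rule mult_left_mono) simp
      then show ?thesis using C by (simp add: mult.assoc[symmetric] ennreal_mult[symmetric])
    qed
    finally show ?thesis by (simp add: mult_left_mono)
  qed
  have sH: "(\<Sum>i. Np p UNIV (H i)) \<le> ennreal (2 powr p * (\<beta> / C + \<gamma>))"
  proof -
    have "(\<Sum>i. Np p UNIV (H i)) \<le> (\<Sum>i. ennreal (2 powr p) * (ennreal (1 / C) * b i + Np p (?Q i) G))" by (intro suminf_le NH) auto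
    also have "\<dots> = ennreal (2 powr p) * (ennreal (1 / C) * (\<Sum>i. b i) + (\<Sum>i. Np p (?Q i) G))" by (simp add: suminf_add[symmetric])
    also have "(\<Sum>i. Np p (?Q i) G) = Np p U G" unfolding Np_def by (rule cover_integral[OF cv, symmetric]) measurable
    also have "ennreal (2 powr p) * (ennreal (1 / C) * (\<Sum>i. b i) + Np p U G) \<le> ennreal (2 powr p) * (ennreal (1 / C) * ennreal \<beta> + ennreal \<gamma>)"
      by (intro mult_left_mono add_mono b fin) auto
    also have "\<dots> = ennreal (2 powr p * (\<beta> / C + \<gamma>))" using b(2) fin(2) C
      by (simp add: ennreal_mult'[symmetric] ennreal_plus[symmetric] del: ennreal_plus)
    finally show ?thesis .
  qed
  have sv: "(\<Sum>i. Np p UNIV (v i)) \<le> ennreal k * ennreal (2 powr p * (\<beta> / C + \<gamma>))"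
  proof -
    have "(\<Sum>i. Np p UNIV (v i)) \<le> (\<Sum>i. ennreal k * Np p UNIV (H i))" by (intro suminf_le Nv) auto
    also have "\<dots> \<le> ennreal k * ennreal (2 powr p * (\<beta> / C + \<gamma>))" using sH by (simp add: mult_left_mono)
    finally show ?thesis .
  qed
  obtain V E where V: "Sob0 p U V E" "\<And>i x. x \<in> ?Q i \<Longrightarrow> E x = H i x" "Np p UNIV V = (\<Sum>i. Np p UNIV (v i))"
    by (rule Sob0_patch[OF S p0(1) cv'(5) cube_basic(5) cv'(4) out])
      (use le_less_trans[OF sv] le_less_trans[OF sH ennreal_less_top] that in \<open>auto simp: ennreal_mult_less_top\<close>)
  note [measurable] = Sob0_measurable(2)[OF V(1)]
  have "energy f U (\<lambda>x. G x + E x) = (\<Sum>i. energy f (?Q i) (\<lambda>x. G x + E x))" by (rule cover_integral[OF cv]) measurable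
  also have "\<dots> = (\<Sum>i. energy f (?Q i) (\<lambda>x. \<xi> i + H i x))"
    using aff V(2) by (intro arg_cong[where f=suminf] ext nn_integral_cong) (auto simp: indicator_def)
  also have "\<dots> \<le> ennreal \<beta>" by (rule order_trans[OF suminf_le[OF en] b(1)]) auto
  finally show thesis using that[OF V(1)] sv V(3) by simp
qed

text \<open>The measure of \<open>U\<close> itself serves as tolerance for the piecewise affine
  approximation, so the perturbation of the gradient is absorbed by the term
  \<open>emeasure lebesgue U\<close>. A null set is treated separately because the tolerance must be
  positive.\<close>

lemma rough_bound:
  assumes W: "Wk p U u G" and U: "open U" "bounded U"
  obtains v H where "Sob0 p U v H"
    "energy f U (\<lambda>x. G x + H x) \<le> ennreal C0 * (emeasure lebesgue U + Np p U G)"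
proof (cases "emeasure lebesgue U = 0")
  case True
  then have "U \<in> null_sets lebesgue" using U(1) by (simp add: null_sets_def)
  then have "energy f U (\<lambda>x. G x + 0) = 0" by (rule nn_integral_null_set)
  then show ?thesis using that[OF Sob0_zero[OF p0(1)]] by simp
next
  case False
  have Us[measurable]: "U \<in> sets lebesgue" using U(1) by simp
  obtain m where m: "emeasure lebesgue U = ennreal m" "m > 0"
    using fmeasurableD2[OF lmeasurable_open[OF U(2,1)]] False by (cases "emeasure lebesgue U") (auto simp: less_le)
  obtain g where g: "Np p U G = ennreal g" "g \<ge> 0" using WkD(4)[OF W] by (cases "Np p U G") auto
  \<comment> \<open>A cube of side \<open>d\<close> has diameter at most
    \<open>CARD('n) * d = s0\<close>, as \<open>cell_on_cube\<close> requires.\<close>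
  define d where "d = s0 / real CARD('n)"
  have d: "d > 0" "real CARD('n) * d = s0" using s0 by (auto simp: d_def)
  obtain v H a r \<xi> where S: "Sob0 p U v H" and NH: "Np p UNIV H \<le> ennreal m" and cov: "cube_cover U d a r"
    and aff: "\<forall>i. \<forall>x\<in>cube (a i) (r i). G x + H x = \<xi> i"
    using piecewise_affine[OF W U p m(2) d(1)] by blast
  note cv = cube_coverD[OF cov]
  let ?Q = "\<lambda>i. cube (a i) (r i)"
  define Z where "Z x = G x + H x" for x
  have Z[measurable]: "Lmeas Z" and aff': "\<And>i x. x \<in> ?Q i \<Longrightarrow> Z x = \<xi> i"
    unfolding Z_def using WkD(2)[OF W] Sob0_measurable(2)[OF S] aff by auto
  have NZ: "Np p U Z \<le> ennreal (2 powr p * (g + m))"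
  proof -
    have "Np p U Z \<le> ennreal (2 powr p) * (Np p U G + Np p U H)"
      unfolding Z_def using WkD(2)[OF W] Sob0_measurable(2)[OF S] p0 by (intro Np_add) auto
    also have "\<dots> \<le> ennreal (2 powr p) * (ennreal g + ennreal m)"
      using order_trans[OF Np_set_mono NH, of U] g by (intro mult_left_mono add_mono) auto
    finally show ?thesis using g m by (simp add: ennreal_mult' ennreal_plus)
  qed
  define b where "b i = ennreal (3 + 2 * c) * (ennreal (r i ^ CARD('n)) * ennreal (1 + norm (\<xi> i) powr p))" for i
  define \<beta> where "\<beta> = C0 * (m + g)"
  have \<beta>: "\<beta> \<ge> 0" using C0_pos m g by (simp add: \<beta>_def)
  have sb: "(\<Sum>i. b i) \<le> ennreal \<beta>"
  proof -
    have "(\<Sum>i. ennreal (r i ^ CARD('n)) * ennreal (1 + norm (\<xi> i) powr p)) = (\<integral>\<^sup>+x\<in>U. ennreal (1 + norm (Z x) powr p) \<partial>lebesgue)"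
      by (rule step_integral[OF cov Z, symmetric]) (use aff' in auto)
    also have "\<dots> = ennreal m + Np p U Z" by (simp only: nn_integral_one_plus_norm[OF Z Us] m(1))
    also have "\<dots> \<le> ennreal (2 powr p * 2 * (m + g))"
    proof -
      have "1 * m \<le> 2 powr p * m" using p0 m by (intro mult_right_mono) (auto simp: ge_one_powr_ge_zero)
      then have "m + 2 powr p * (g + m) \<le> 2 powr p * 2 * (m + g)" using g(2) by (simp add: algebra_simps add_increasing)
      moreover have "ennreal m + Np p U Z \<le> ennreal (m + 2 powr p * (g + m))" using NZ m g by (simp add: add_left_mono)
      ultimately show ?thesis by (meson ennreal_leI order_trans)
    qed
    finally have "(\<Sum>i. b i) \<le> ennreal (3 + 2 * c) * ennreal (2 powr p * 2 * (m + g))" unfolding b_def by (simp add: mult_left_mono)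
    also have "\<dots> = ennreal \<beta>" unfolding \<beta>_def C0_def using c by (simp add: ennreal_mult'[symmetric] mult.assoc del: ennreal_plus)
    finally show ?thesis .
  qed
  have "\<exists>w K. Sob0 p U w K \<and> (\<forall>y. y \<notin> ?Q i \<longrightarrow> w y = 0 \<and> K y = 0) \<and>
    Np p UNIV w \<le> ennreal (4 powr p * (2 * d) powr p) * Np p UNIV K \<and> energy f (?Q i) (\<lambda>x. \<xi> i + K x) \<le> b i" for i
  proof (cases "r i > 0")
    case True
    have s: "real CARD('n) * r i \<le> s0" using cv(2)[of i] d(2) mult_left_mono[of "r i" d "real CARD('n)"] by simp
    obtain w K where w: "Sob0 p U w K" "\<And>y. y \<notin> ?Q i \<Longrightarrow> w y = 0" "\<And>y. y \<notin> ?Q i \<Longrightarrow> K y = 0"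
      "Np p UNIV w \<le> ennreal (4 powr p * (2 * r i) powr p) * Np p UNIV K"
      "energy f (?Q i) (\<lambda>x. \<xi> i + K x) \<le> ennreal (r i ^ CARD('n) * ((3 + 2 * c) * (1 + norm (\<xi> i) powr p)))"
      by (rule cell_on_cube[OF True s U(1) cv(3)[OF True], where \<xi>="\<xi> i"]) (rule that; assumption)
    have "Np p UNIV w \<le> ennreal (4 powr p * (2 * d) powr p) * Np p UNIV K"
      using cv(1,2)[of i] p0 by (intro order_trans[OF w(4)] mult_right_mono ennreal_leI mult_left_mono powr_mono2) auto
    moreover have "ennreal (r i ^ CARD('n) * ((3 + 2 * c) * (1 + norm (\<xi> i) powr p))) = b i"
      unfolding b_def using c True by (simp add: ennreal_mult'[symmetric] mult_ac del: ennreal_plus)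
    ultimately show ?thesis using w by auto
  next
    case False
    then have "?Q i = {}" by (simp add: cube_empty)
    then show ?thesis using Sob0_zero[OF p0(1), of U] p0 by (intro exI[of _ "\<lambda>_. 0"]) (simp add: Np_zero)
  qed
  note cells = this
  have \<gamma>: "2 powr p * (g + m) \<ge> 0" using g(2) m(2) by simp
  obtain V E where V: "Sob0 p U V E" "energy f U (\<lambda>x. Z x + E x) \<le> ennreal \<beta>"
    by (rule paste[OF Z cov aff' cells sb \<beta> NZ \<gamma>]) (assumption, rule that)
  have "ennreal \<beta> = ennreal C0 * (emeasure lebesgue U + Np p U G)" unfolding \<beta>_def m(1) g(1) using C0_pos m g by (simp add: ennreal_mult')
  then show ?thesis using that[OF Sob0_add[OF S V(1) p0(2)]] V(2) by (simp add: Z_def add.assoc)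
qed

text \<open>How rough competitors enter a construction: on the transition set \<open>U\<close> the
  energy of \<open>G\<close>, possibly infinite, is traded for a bound of \<open>p\<close>-growth,
  and nothing changes on \<open>P - U\<close>. The gradient bound, from coercivity, is what
  Friedrichs' inequality needs later.\<close>

lemma rough_fill:
  assumes W: "Wk p P u G" and P: "P \<in> sets lebesgue" and U: "open U" "bounded U" "U \<subseteq> P"
  obtains v H where "Sob0 p U v H"
    "energy f P (\<lambda>x. G x + H x) \<le> energy f (P - U) G + ennreal C0 * (emeasure lebesgue U + Np p U G)"
    "Np p UNIV H \<le> ennreal (2 powr p * (C0 / C + 1)) * (emeasure lebesgue U + Np p U G)"
proof -
  obtain v H where S: "Sob0 p U v H" and E: "energy f U (\<lambda>x. G x + H x) \<le> ennreal C0 * (emeasure lebesgue U + Np p U G)"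
    by (rule rough_bound[OF Wk_mono[OF W U(3)] U(1,2)]) (rule that; assumption)
  let ?X = "emeasure lebesgue U + Np p U G"
  have [measurable]: "U \<in> sets lebesgue" using U(1) by simp
  note [measurable] = WkD(2)[OF W] Sob0_measurable(2)[OF S] P
  have "energy f P (\<lambda>x. G x + H x) = (\<integral>\<^sup>+x. f x (G x) * indicator (P - U) x + f x (G x + H x) * indicator U x \<partial>lebesgue)"
    using U(3) Sob0_outside(2)[OF S] by (intro nn_integral_cong) (auto simp: indicator_def)
  also have "\<dots> = energy f (P - U) G + energy f U (\<lambda>x. G x + H x)"
    by (rule nn_integral_add) measurable
  finally have en: "energy f P (\<lambda>x. G x + H x) \<le> energy f (P - U) G + ennreal C0 * ?X"
    using E by (simp add: add_left_mono)
  have "ennreal C * Np p U (\<lambda>x. G x + H x) \<le> ennreal C0 * ?X" by (rule order_trans[OF energy_coercive E]) auto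
  then have "ennreal (1 / C) * (ennreal C * Np p U (\<lambda>x. G x + H x)) \<le> ennreal (1 / C) * (ennreal C0 * ?X)" by (rule mult_left_mono) simp
  then have N: "Np p U (\<lambda>x. G x + H x) \<le> ennreal (C0 / C) * ?X" using C C0_pos by (simp only: mult.assoc[symmetric] ennreal_mult[symmetric]) (simp add: ennreal_mult[symmetric])
  have "Np p UNIV H = Np p U (\<lambda>x. (G x + H x) - G x)" using Np_UNIV_supp[OF Sob0_outside(2)[OF S] p0(3)] by simp
  also have "\<dots> \<le> ennreal (2 powr p) * (Np p U (\<lambda>x. G x + H x) + Np p U G)" using p0 by (intro Np_diff) auto
  also have "\<dots> \<le> ennreal (2 powr p) * (ennreal (C0 / C) * ?X + 1 * ?X)" using N by (intro mult_left_mono add_mono) (auto simp: add_increasing)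
  also have "\<dots> = ennreal (2 powr p * (C0 / C + 1)) * ?X" using C C0_pos
    by (simp add: ennreal_mult' ennreal_plus distrib_right mult.assoc)
  finally show thesis using that[OF S en] by blast
qed

lemma emeasure_plus_Np_const:
  fixes U :: "(real^'n) set" and \<xi> :: "real^'n^'m"
  assumes "U \<in> sets lebesgue" "emeasure lebesgue U \<le> ennreal \<mu>" "\<mu> \<ge> 0"
  shows "emeasure lebesgue U + Np p U (\<lambda>x. \<xi>) \<le> ennreal (\<mu> * (1 + norm \<xi> powr p))"
proof -
  have "emeasure lebesgue U + Np p U (\<lambda>x. \<xi>) = ennreal (1 + norm \<xi> powr p) * emeasure lebesgue U"
    using assms(1) by (simp add: Np_def nn_integral_cmult_indicator distrib_right)
  also have "\<dots> \<le> ennreal (1 + norm \<xi> powr p) * ennreal \<mu>" by (intro mult_left_mono assms) simp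
  finally show ?thesis using assms(3) by (simp add: ennreal_mult mult.commute)
qed

end

subsection \<open>Gluing with an affine function\<close>

text \<open>\<open>M\<close> nested cutoff functions, all equal to 1 on a cube that fills the unit cube up to a
  fraction \<open>1/M\<close>, whose transition regions are pairwise disjoint.\<close>

definition layers :: "nat \<Rightarrow> real \<Rightarrow> (nat \<Rightarrow> real) \<Rightarrow> (nat \<Rightarrow> real^'n \<Rightarrow> real) \<Rightarrow> bool" where
  "layers M B \<delta> \<theta> \<longleftrightarrow> B > 0 \<and> (\<forall>j. 0 < \<delta> j \<and> \<delta> j < 1/2 \<and> \<delta> (Suc j) < \<delta> j) \<and>
     1 - (1 - 2 * \<delta> 0) ^ CARD('n) \<le> 1 / real M \<and>
     (\<forall>j<M. test_fun (cube (\<chi> i. \<delta> (Suc j)) (1 - 2 * \<delta> (Suc j))) (\<theta> j) \<and> (\<forall>x. 0 \<le> \<theta> j x \<and> \<theta> j x \<le> 1) \<and>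
        (\<forall>x\<in>ccube (\<chi> i. \<delta> j) (1 - 2 * \<delta> j). \<theta> j x = 1) \<and> (\<forall>x. norm (gvec (\<theta> j) x) \<le> B))"

lemma ex_layers:
  assumes M: "M \<ge> 1"
  shows "\<exists>B \<delta> \<theta>. layers M B \<delta> (\<theta> :: nat \<Rightarrow> real^'n \<Rightarrow> real)"
proof -
  have "((\<lambda>d::real. 1 - (1 - 2 * d) ^ CARD('n)) \<longlongrightarrow> 1 - (1 - 2 * 0) ^ CARD('n)) (at_right 0)"
    by (intro tendsto_intros)
  then have "eventually (\<lambda>d::real. 1 - (1 - 2 * d) ^ CARD('n) < 1 / real M) (at_right 0)"
    using M by (intro order_tendstoD) auto
  moreover have "eventually (\<lambda>d::real. d < 1/2) (at_right 0)" by (rule eventually_at_rightI[of 0 "1/2"]) auto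
  moreover have "eventually (\<lambda>d::real. d > 0) (at_right 0)" by (simp add: eventually_at_filter)
  ultimately have "eventually (\<lambda>d::real. 1 - (1 - 2 * d) ^ CARD('n) < 1 / real M \<and> d < 1/2 \<and> d > 0) (at_right 0)"
    by eventually_elim simp
  then obtain d :: real where d: "1 - (1 - 2 * d) ^ CARD('n) < 1 / real M" "d < 1/2" "d > 0"
    using eventually_happens'[OF trivial_limit_at_right_real] by blast
  \<comment> \<open>Strictly decreasing margins: the transition of the cutoff with index
    \<open>j\<close> lies between margin \<open>\<delta> j\<close> inside and
    \<open>\<delta> (Suc j)\<close> outside, so larger indices sit closer to the boundary and all of
    them lie in the frame of width \<open>d\<close>.\<close>
  define \<delta> where "\<delta> j = d / real (Suc j)" for j
  have \<delta>: "0 < \<delta> j" "\<delta> j < 1/2" "\<delta> (Suc j) < \<delta> j" for j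
  proof -
    show "0 < \<delta> j" using d by (simp add: \<delta>_def)
    have "\<delta> j \<le> d" using d by (simp add: \<delta>_def field_simps)
    then show "\<delta> j < 1/2" using d by simp
    show "\<delta> (Suc j) < \<delta> j" using d by (simp add: \<delta>_def field_simps)
  qed
  have "\<exists>\<theta>. test_fun (cube (\<chi> i. \<delta> (Suc j)) (1 - 2 * \<delta> (Suc j)) :: (real^'n) set) \<theta> \<and> (\<forall>x. 0 \<le> \<theta> x \<and> \<theta> x \<le> 1) \<and>
        (\<forall>x\<in>ccube (\<chi> i. \<delta> j) (1 - 2 * \<delta> j). \<theta> x = 1)" for j
  proof -
    have "ccube (\<chi> i. \<delta> j) (1 - 2 * \<delta> j) \<subseteq> cube ((\<chi> i. \<delta> (Suc j)) :: real^'n) (1 - 2 * \<delta> (Suc j))"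
      by (rule ccube_subset_cube) (use \<delta>[of j] in auto)
    from ex_cutoff[OF cube_basic(2) cube_basic(1) this] show ?thesis by metis
  qed
  from choice[OF allI[OF this]] obtain \<theta> where "\<forall>j. test_fun (cube (\<chi> i. \<delta> (Suc j)) (1 - 2 * \<delta> (Suc j)) :: (real^'n) set) (\<theta> j) \<and> (\<forall>x. 0 \<le> \<theta> j x \<and> \<theta> j x \<le> 1) \<and>
        (\<forall>x\<in>ccube (\<chi> i. \<delta> j) (1 - 2 * \<delta> j). \<theta> j x = 1)" ..
  note \<theta> = this[rule_format, THEN conjunct1] this[rule_format, THEN conjunct2]
  have "\<exists>B. B > 0 \<and> (\<forall>x. norm (gvec (\<theta> j) x) \<le> B)" for j using gvec_bounded[OF \<theta>(1)[of j]] by metis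
  then obtain b where b: "\<And>j. b j > 0" "\<And>j x. norm (gvec (\<theta> j) x) \<le> b j" by metis
  define B where "B = (\<Sum>j<M. b j) + 1"
  have B: "B > 0" using b(1) by (simp add: B_def sum_nonneg add_nonneg_pos less_imp_le)
  have "norm (gvec (\<theta> j) x) \<le> B" if "j < M" for j x
  proof -
    have "b j \<le> (\<Sum>j<M. b j)" using that b(1) by (intro member_le_sum) (auto intro: less_imp_le)
    then show ?thesis using b(2)[of j x] by (simp add: B_def)
  qed
  then have "layers M B \<delta> \<theta>"
    unfolding layers_def using B \<delta> d(1) \<theta> by (auto simp: \<delta>_def less_imp_le)
  then show ?thesis by blast
qed

text \<open>The average over \<open>M\<close> disjoint pieces is at most a fraction
  \<open>1/M\<close> of the total. If the total is infinite, so is the bound.\<close>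

lemma ex_small_piece:
  fixes T :: "nat \<Rightarrow> (real^'n) set" and G :: "real^'n \<Rightarrow> 'b::euclidean_space"
  assumes M: "M \<ge> 1" and G: "Lmeas G" and T: "\<And>j. T j \<in> sets lebesgue" "\<And>j. T j \<subseteq> Q"
    and dj: "\<And>i j. i < j \<Longrightarrow> T i \<inter> T j = {}"
  shows "\<exists>j<M. Np p (T j) G \<le> ennreal (1 / real M) * Np p Q G"
proof (rule ccontr)
  assume "\<not> ?thesis"
  then have big: "ennreal (1 / real M) * Np p Q G < Np p (T j) G" if "j < M" for j using that by (auto simp: not_le)
  have "Np p Q G < \<infinity>"
  proof (rule ccontr)
    assume "\<not> Np p Q G < \<infinity>"
    then have "Np p Q G = \<infinity>" by (metis infinity_ennreal_def top.not_eq_extremum)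
    then have "ennreal (1 / real M) * Np p Q G = \<infinity>" using M by (simp add: ennreal_mult_eq_top_iff)
    then show False using big[of 0] M by simp
  qed
  have sum: "(\<Sum>j<M. Np p (T j) G) \<le> Np p Q G"
  proof -
    have "(\<Sum>j<M. Np p (T j) G) = (\<integral>\<^sup>+x. (\<Sum>j<M. ennreal (norm (G x) powr p) * indicator (T j) x) \<partial>lebesgue)"
      unfolding Np_def using G T by (subst nn_integral_sum) auto
    also have "\<dots> \<le> Np p Q G"
      unfolding Np_def
    proof (rule nn_integral_mono)
      fix x
      show "(\<Sum>j<M. ennreal (norm (G x) powr p) * indicator (T j) x) \<le> ennreal (norm (G x) powr p) * indicator Q x"
      proof (cases "\<exists>j<M. x \<in> T j")
        case True
        then obtain j where j: "j < M" "x \<in> T j" by blast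
        have "x \<notin> T i" if "i \<noteq> j" for i using dj[of i j] dj[of j i] j(2) that by (cases "i < j") auto
        then have "(\<Sum>i<M. ennreal (norm (G x) powr p) * indicator (T i) x) = (\<Sum>i<M. if i = j then ennreal (norm (G x) powr p) else 0)"
          using j by (intro sum.cong) auto
        also have "\<dots> = ennreal (norm (G x) powr p)" using j by simp
        finally show ?thesis using j T(2) by (auto simp: indicator_def)
      next
        case False
        then have z: "(\<Sum>j<M. ennreal (norm (G x) powr p) * indicator (T j) x) = 0" by (intro sum.neutral) auto
        show ?thesis unfolding z by simp
      qed
    qed
    finally show ?thesis .
  qed
  then obtain x where x: "Np p Q G = ennreal x" "x \<ge> 0" by (cases "Np p Q G") (use \<open>Np p Q G < \<infinity>\<close> in auto)
  define t where "t j = enn2real (Np p (T j) G)" for j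
  have t: "Np p (T j) G = ennreal (t j)" "t j \<ge> 0" for j
    using le_less_trans[OF Np_set_mono[OF T(2)] \<open>Np p Q G < \<infinity>\<close>, of j] by (auto simp: t_def)
  have "x / real M < t j" if "j < M" for j
    using big[OF that] x t by (simp add: ennreal_mult[symmetric] ennreal_less_iff)
  then have "(\<Sum>j<M. x / real M) < (\<Sum>j<M. t j)" using M by (intro sum_strict_mono) (auto simp: lessThan_empty_iff)
  moreover have "(\<Sum>j<M. t j) \<le> x"
    using sum x t by (simp add: sum_nonneg)
  ultimately show False using M by simp
qed

context integrand
begin

text \<open>The factor \<open>8 powr p\<close> collects the three triangle inequalities that
  separate the gradient of the glued function into \<open>G\<close>, \<xi> and the cutoff
  term.\<close>

definition A1 :: real where
  "A1 = C0 * (2 * 8 powr p + 1)"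

lemma A1_pos: "A1 > 0"
  unfolding A1_def using C0_pos by (intro mult_pos_pos add_pos_pos) auto

text \<open>Interpolating between \<open>u\<close> inside and the affine function outside leaves the
  energy of \<open>G\<close> on the inner cube. On the whole frame around it the interpolation
  serves only as boundary data: its energy, which may be infinite, is replaced by that of a rough
  competitor. Thus only the measure of the frame and the gradient integral of the interpolation
  count, and the last term is the price of the cutoff gradient, of size
  \<open>B / r\<close>.\<close>

lemma glue:
  assumes L: "layers M B \<delta> (\<theta> :: nat \<Rightarrow> real^'n \<Rightarrow> real)" and M: "M \<ge> 1" and r: "r > 0" and W: "Wk p (cube a r) u G"
  obtains v H where "Sob0 p (cube a r) v H"
    "energy f (cube a r) (\<lambda>x. \<xi> + H x) \<le> energy f (cube a r) G
       + ennreal (A1 / real M) * (ennreal (r ^ CARD('n) * (1 + norm \<xi> powr p)) + Np p (cube a r) G)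
       + ennreal (A1 * B powr p * r powr (- p)) * Np p (cube a r) (\<lambda>x. u x - (b + \<xi> *v x))"
proof -
  let ?Q = "cube a r" and ?n = "CARD('n)"
  note l = L[unfolded layers_def]
  have B: "B > 0" using l by blast
  have \<delta>: "0 < \<delta> j" "\<delta> j < 1/2" "\<delta> (Suc j) < \<delta> j" for j using l by blast+
  have \<delta>m: "\<delta> j \<le> \<delta> i" if "i \<le> j" for i j
    using that
  proof (induction rule: dec_induct)
    case (step k)
    then show ?case using \<delta>(3)[of k] by linarith
  qed simp
  have \<delta>0: "1 - (1 - 2 * \<delta> 0) ^ ?n \<le> 1 / real M" using l by blast
  define ca where "ca j = a + (\<chi> i. r * \<delta> j)" for j
  define cr where "cr j = r * (1 - 2 * \<delta> j)" for j
  have sc: "a + r *\<^sub>R (\<chi> i. \<delta> j) = ca j" for j by (simp add: ca_def vec_eq_iff)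
  have cr: "cr j > 0" for j using r \<delta>(2)[of j] by (simp add: cr_def)
  let ?K = "\<lambda>j. ccube (ca j) (cr j)"
  define T where "T j = cube (ca (Suc j)) (cr (Suc j)) - ?K j" for j
  have KQ: "?K j \<subseteq> ?Q" for j
    using r \<delta>(1)[of j] by (intro ccube_subset_cube) (simp add: ca_def cr_def algebra_simps)
  have Kmono: "?K i \<subseteq> ?K j" if "i \<le> j" for i j
    using mult_left_mono[OF \<delta>m[OF that], of r] r by (intro ccube_subset_ccube) (simp add: ca_def cr_def algebra_simps)
  have Ts: "T j \<in> sets lebesgue" for j unfolding T_def by (intro sets.Diff) auto
  have TK: "T j \<subseteq> ?K (Suc j)" for j unfolding T_def using cube_subset_ccube by blast
  have TQ: "T j \<subseteq> ?Q" for j using TK KQ by blast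
  have Td: "T i \<inter> T j = {}" if "i < j" for i j
  proof -
    have "T i \<subseteq> ?K j" using TK[of i] Kmono[of "Suc i" j] that by (metis Suc_leI order_trans)
    moreover have "T j \<inter> ?K j = {}" unfolding T_def by blast
    ultimately show ?thesis by blast
  qed
  note mu[measurable] = WkD(1,2)[OF W]
  \<comment> \<open>The layer is selected by its gradient integral and not by the energy, since the
    energy in the layer is discarded anyway.\<close>
  have "\<exists>j<M. Np p (T j) G \<le> ennreal (1 / real M) * Np p ?Q G"
    by (rule ex_small_piece[OF M mu(2) Ts TQ Td])
  then obtain j where j: "j < M" "Np p (T j) G \<le> ennreal (1 / real M) * Np p ?Q G" by (elim exE conjE)
  have \<theta>: "test_fun (cube (\<chi> i. \<delta> (Suc j)) (1 - 2 * \<delta> (Suc j))) (\<theta> j)" "\<And>x. 0 \<le> \<theta> j x" "\<And>x. \<theta> j x \<le> 1"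
     "\<And>x. x \<in> ccube (\<chi> i. \<delta> j) (1 - 2 * \<delta> j) \<Longrightarrow> \<theta> j x = 1" "\<And>x. norm (gvec (\<theta> j) x) \<le> B"
    using conjunct2[OF conjunct2[OF conjunct2[OF l]], rule_format, OF j(1)] by auto
  have sub01: "cube (\<chi> i. \<delta> (Suc j)) (1 - 2 * \<delta> (Suc j)) \<subseteq> cube (0 :: real^'n) 1"
    by (rule cube_subset_cube) (use \<delta>[of "Suc j"] in auto)
  have \<theta>01: "test_fun (cube 0 1) (\<theta> j)" by (rule test_fun_mono[OF \<theta>(1) sub01])
  define \<Theta> where "\<Theta> x = \<theta> j ((1/r) *\<^sub>R (x - a))" for x
  have \<Theta>t: "test_fun ?Q \<Theta>" unfolding \<Theta>_def by (rule scaled_cutoff(1)[OF \<theta>01 r])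
  have \<Theta>g: "gvec \<Theta> x = (1/r) *\<^sub>R gvec (\<theta> j) ((1/r) *\<^sub>R (x - a))" for x
    unfolding \<Theta>_def by (rule scaled_cutoff(2)[OF \<theta>01 r])
  have \<Theta>b: "\<bar>\<Theta> x\<bar> \<le> 1" for x using \<theta>(2,3) by (simp add: \<Theta>_def)
  have \<Theta>gb: "norm (gvec \<Theta> x) \<le> B / r" for x using \<theta>(5) r by (simp add: \<Theta>g divide_right_mono)
  have \<Theta>1: "\<Theta> x = 1" if x: "x \<in> ?K j" for x
    using x \<theta>(4)[of "(1/r) *\<^sub>R (x - a)"] unfolding scaled_in_cube[OF r] sc by (simp add: \<Theta>_def cr_def)
  have \<Theta>g0: "gvec \<Theta> x = 0" if x: "x \<in> cube (ca j) (cr j)" for x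
    by (rule gvec_eq_0_on_open[OF cube_basic(1) x, of _ 1]) (use \<Theta>1 cube_subset_ccube in blast)
  have \<Theta>out: "\<Theta> x = 0" "gvec \<Theta> x = 0" if x: "x \<notin> cube (ca (Suc j)) (cr (Suc j))" for x
  proof -
    obtain S where S: "compact S" "S \<subseteq> cube (\<chi> i. \<delta> (Suc j)) (1 - 2 * \<delta> (Suc j))" "\<And>x. x \<notin> S \<Longrightarrow> \<theta> j x = 0"
      using test_fun_support[OF \<theta>(1)] by blast
    have n: "(1/r) *\<^sub>R (x - a) \<notin> S"
      using S(2) x scaled_in_cube(1)[OF r, of x a "\<chi> i. \<delta> (Suc j)"] unfolding sc cr_def by blast
    show "\<Theta> x = 0" using S(3)[OF n] by (simp add: \<Theta>_def)
    have "gvec (\<theta> j) ((1/r) *\<^sub>R (x - a)) = 0"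
      unfolding vec_eq_iff gvec_nth using pd_0_outside[OF compact_imp_closed[OF S(1)] S(3) n] by simp
    then show "gvec \<Theta> x = 0" by (simp add: \<Theta>g)
  qed
  define w where "w x = u x - (b + \<xi> *v x)" for x
  have Ww: "Wk p ?Q w (\<lambda>x. G x - \<xi>)" unfolding w_def by (intro Wk_diff W Wk_affine p0 p) auto
  note mw[measurable] = WkD(1)[OF Ww]
  define E where "E x = \<Theta> x *\<^sub>R (G x - \<xi>) + outer (w x) (gvec \<Theta> x)" for x
  have SE: "Sob0 p ?Q (\<lambda>x. \<Theta> x *\<^sub>R w x) E" unfolding E_def by (rule Sob0_mult_test_fun[OF Ww \<Theta>t p]) simp
  note [measurable] = Sob0_measurable(2)[OF SE]
  \<comment> \<open>The set reaches from the inner cube to the boundary of \<open>?Q\<close>.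
    Outside the chosen layer \<open>E\<close> vanishes there, so the gradient is the constant \<xi>
    on a set of measure at most a fraction \<open>1/M\<close>.\<close>
  define Oj where "Oj = ?Q - ?K j"
  have Oj: "open Oj" "bounded Oj" "Oj \<subseteq> ?Q" unfolding Oj_def by (auto simp: open_Diff compact_imp_closed intro: bounded_subset[OF cube_basic(3)])
  have Ojs[measurable]: "Oj \<in> sets lebesgue" using Oj(1) by simp
  have W': "Wk p ?Q (\<lambda>x. (b + \<xi> *v x) + \<Theta> x *\<^sub>R w x) (\<lambda>x. \<xi> + E x)"
    by (intro Wk_add Wk_affine Sob0_Wk[OF SE] p0 p) auto
  obtain v' H' where v': "Sob0 p Oj v' H'"
    "energy f ?Q (\<lambda>x. (\<xi> + E x) + H' x) \<le> energy f (?Q - Oj) (\<lambda>x. \<xi> + E x) + ennreal C0 * (emeasure lebesgue Oj + Np p Oj (\<lambda>x. \<xi> + E x))"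
    by (rule rough_fill[OF W' cube_basic(5) Oj]) (rule that; assumption)
  have E0: "E x = 0" if "x \<in> Oj" "x \<notin> T j" for x
  proof -
    have "x \<notin> cube (ca (Suc j)) (cr (Suc j))" using that unfolding Oj_def T_def by blast
    then show ?thesis using \<Theta>out by (simp add: E_def vec_eq_iff)
  qed
  define y where "y = ennreal (r ^ ?n * (1 + norm \<xi> powr p))"
  define g where "g = Np p ?Q G"
  define q where "q = Np p ?Q w"
  define m where "m = ennreal (1 / real M)"
  have emO: "emeasure lebesgue Oj \<le> ennreal (1 / real M * r ^ ?n)"
  proof -
    have "emeasure lebesgue Oj = emeasure lebesgue ?Q - emeasure lebesgue (?K j)"
      unfolding Oj_def using KQ emeasure_cube(2)[OF less_imp_le[OF cr], of "ca j" j] by (intro emeasure_Diff) auto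
    also have "\<dots> = ennreal (r ^ ?n - cr j ^ ?n)"
      using emeasure_cube(2)[OF less_imp_le[OF cr], of "ca j" j] emeasure_cube(1)[of r a] r cr[of j] by (simp add: ennreal_minus)
    also have "\<dots> \<le> ennreal (1 / real M * r ^ ?n)"
    proof (rule ennreal_leI)
      have "(1 - 2 * \<delta> 0) ^ ?n \<le> (1 - 2 * \<delta> j) ^ ?n" using \<delta>m[of 0 j] \<delta>(2)[of 0] by (intro power_mono) auto
      then have "1 - (1 - 2 * \<delta> j) ^ ?n \<le> 1 / real M" using \<delta>0 by linarith
      then have "(1 - (1 - 2 * \<delta> j) ^ ?n) * r ^ ?n \<le> 1 / real M * r ^ ?n" using r by (intro mult_right_mono) auto
      moreover have "cr j ^ ?n = (1 - 2 * \<delta> j) ^ ?n * r ^ ?n" by (simp only: cr_def power_mult_distrib mult.commute)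
      ultimately show "r ^ ?n - cr j ^ ?n \<le> 1 / real M * r ^ ?n" by (simp add: left_diff_distrib)
    qed
    finally show ?thesis .
  qed
  have TO: "T j \<subseteq> Oj" unfolding Oj_def using TQ[of j] by (auto simp: T_def)
  define c2 where "c2 = ennreal (2 powr p)"
  define e8 where "e8 = ennreal (8 powr p)"
  define R where "R = ennreal ((B / r) powr p) * q"
  have e8: "c2 * (c2 * c2) = e8" "c2 \<le> e8" "c2 * c2 \<le> e8" "1 \<le> e8"
    unfolding c2_def e8_def using p0 by (auto simp: ennreal_mult[symmetric] powr_mult[symmetric] intro!: ennreal_leI powr_mono2 ge_one_powr_ge_zero)
  have X: "emeasure lebesgue Oj + Np p Oj (\<lambda>x. \<xi>) \<le> m * y"
    using emeasure_plus_Np_const[OF Ojs emO, of \<xi>] r by (simp add: m_def y_def ennreal_mult'[symmetric] mult.assoc)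
  \<comment> \<open>\<open>m * g\<close> is the share of \<open>G\<close> in the selected layer, the
    integral of the constant is the contribution of \<xi>, and \<open>R\<close> that of the cutoff
    gradient.\<close>
  have NpE: "Np p Oj E \<le> c2 * (c2 * (m * g + Np p Oj (\<lambda>x. \<xi>)) + R)"
  proof -
    have "Np p Oj E = Np p (T j) E"
      unfolding Np_def using E0 TO p0 by (intro nn_integral_cong) (auto simp: indicator_def)
    also have "\<dots> \<le> c2 * (Np p (T j) (\<lambda>x. \<Theta> x *\<^sub>R (G x - \<xi>)) + Np p (T j) (\<lambda>x. outer (w x) (gvec \<Theta> x)))"
      unfolding E_def c2_def
    proof (rule Np_add[OF _ _ Ts p0(2)])
      have [measurable]: "Lmeas \<Theta>" using test_fun_integrable[OF \<Theta>t] by auto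
      show "Lmeas (\<lambda>x. \<Theta> x *\<^sub>R (G x - \<xi>))" by measurable
      show "Lmeas (\<lambda>x. outer (w x) (gvec \<Theta> x))" by (rule outer_measurable[OF mw \<Theta>t])
    qed
    also have "\<dots> \<le> c2 * (c2 * (m * g + Np p Oj (\<lambda>x. \<xi>)) + R)"
    proof (intro mult_left_mono add_mono)
      have "Np p (T j) (\<lambda>x. \<Theta> x *\<^sub>R (G x - \<xi>)) \<le> Np p (T j) (\<lambda>x. G x - \<xi>)"
        using \<Theta>b mult_right_mono[OF \<Theta>b] p0 by (intro Np_mono) (auto simp: mult_left_le_one_le)
      also have "\<dots> \<le> c2 * (Np p (T j) G + Np p (T j) (\<lambda>x. \<xi>))" unfolding c2_def using Ts p0 by (intro Np_diff) auto
      also have "\<dots> \<le> c2 * (m * g + Np p Oj (\<lambda>x. \<xi>))"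
        using j(2) Np_set_mono[OF TO] by (intro mult_left_mono add_mono) (auto simp: m_def g_def)
      finally show "Np p (T j) (\<lambda>x. \<Theta> x *\<^sub>R (G x - \<xi>)) \<le> c2 * (m * g + Np p Oj (\<lambda>x. \<xi>))" .
      have "Np p (T j) (\<lambda>x. outer (w x) (gvec \<Theta> x)) \<le> Np p ?Q (\<lambda>x. (B / r) *\<^sub>R w x)"
      proof (rule Np_mono)
        show "norm (outer (w x) (gvec \<Theta> x)) \<le> norm ((B / r) *\<^sub>R w x)" for x
          using mult_left_mono[OF \<Theta>gb[of x], of "norm (w x)"] B r by (simp add: norm_outer mult.commute)
      qed (use p0 TQ in auto)
      also have "\<dots> = R" using B r unfolding q_def R_def by (simp add: Np_cmult)
      finally show "Np p (T j) (\<lambda>x. outer (w x) (gvec \<Theta> x)) \<le> R" .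
    qed auto
    finally show ?thesis .
  qed
  have NpO: "Np p Oj (\<lambda>x. \<xi> + E x) \<le> c2 * (Np p Oj (\<lambda>x. \<xi>) + Np p Oj E)"
    unfolding c2_def using p0 by (intro Np_add) auto
  have rough: "ennreal C0 * (emeasure lebesgue Oj + Np p Oj (\<lambda>x. \<xi> + E x))
     \<le> ennreal (A1 / real M) * (y + g) + ennreal (A1 * B powr p * r powr (- p)) * q"
  proof -
    define k where "k = 2 * e8 + 1"
    define N where "N = Np p Oj (\<lambda>x. \<xi>)"
    have "emeasure lebesgue Oj + Np p Oj (\<lambda>x. \<xi> + E x) \<le> emeasure lebesgue Oj + c2 * (N + c2 * (c2 * (m * g + N) + R))"
      unfolding N_def by (intro add_left_mono order_trans[OF NpO] mult_left_mono NpE) simp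
    also have "\<dots> = emeasure lebesgue Oj + (c2 * N + ((c2 * (c2 * c2)) * (m * g) + (c2 * (c2 * c2)) * N) + (c2 * c2) * R)"
      by (simp only: distrib_left mult.assoc add.assoc)
    also have "\<dots> \<le> e8 * emeasure lebesgue Oj + (e8 * N + (e8 * (m * g) + e8 * N) + e8 * R)"
      unfolding e8(1) using mult_right_mono[OF e8(4), of "emeasure lebesgue Oj"] by (intro add_mono mult_right_mono e8) auto
    also have "\<dots> \<le> e8 * (2 * (emeasure lebesgue Oj + N) + m * g + R)"
      by (simp add: distrib_left mult_2 add_ac add_left_mono add_increasing)
    also have "\<dots> \<le> e8 * (2 * (m * y) + 2 * (m * g) + 2 * R)"
      using X unfolding N_def by (intro mult_left_mono add_mono) (auto simp: mult_2)
    also have "\<dots> \<le> k * (m * y + m * g + R)" by (simp add: k_def distrib_left distrib_right mult_ac)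
    finally have "ennreal C0 * (emeasure lebesgue Oj + Np p Oj (\<lambda>x. \<xi> + E x)) \<le> ennreal C0 * (k * (m * y + m * g + R))"
      by (rule mult_left_mono) simp
    also have "\<dots> = (ennreal C0 * k * m) * (y + g) + (ennreal C0 * k * ennreal ((B / r) powr p)) * q"
      by (simp only: R_def distrib_left mult.assoc add.assoc)
    also have "ennreal C0 * k = ennreal A1"
    proof -
      have "k = ennreal (2 * 8 powr p + 1)" by (simp add: k_def e8_def ennreal_mult)
      then show ?thesis using C0_pos unfolding A1_def by (simp add: ennreal_mult' del: ennreal_plus)
    qed
    also have "ennreal A1 * m = ennreal (A1 / real M)" unfolding m_def using A1_pos by (simp add: ennreal_mult[symmetric])
    also have "ennreal A1 * ennreal ((B / r) powr p) = ennreal (A1 * B powr p * r powr (- p))"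
      using A1_pos B r by (simp add: ennreal_mult[symmetric] powr_divide powr_minus field_simps)
    finally show ?thesis .
  qed
  have S: "Sob0 p ?Q (\<lambda>x. \<Theta> x *\<^sub>R w x + v' x) (\<lambda>x. E x + H' x)" by (rule Sob0_add[OF SE Sob0_mono[OF v'(1) Oj(3)] p0(2)])
  have "energy f (?Q - Oj) (\<lambda>x. \<xi> + E x) \<le> energy f ?Q G"
  proof (rule nn_integral_mono_AE)
    show "AE x in lebesgue. f x (\<xi> + E x) * indicator (?Q - Oj) x \<le> f x (G x) * indicator ?Q x"
      using AE_not_in[OF null_ccube_diff_cube[of "ca j" "cr j"]]
    proof eventually_elim
      case (elim x)
      show ?case
      proof (cases "x \<in> ?Q - Oj")
        case True
        then have xK: "x \<in> ?K j" by (simp add: Oj_def)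
        then have xc: "x \<in> cube (ca j) (cr j)" using elim by blast
        have "outer (w x) (gvec \<Theta> x) = 0" using \<Theta>g0[OF xc] by (simp add: vec_eq_iff)
        then show ?thesis using True \<Theta>1[OF xK] by (simp add: E_def)
      qed simp
    qed
  qed
  then have "energy f ?Q (\<lambda>x. \<xi> + (E x + H' x)) \<le> energy f ?Q G
     + ennreal (A1 / real M) * (y + g) + ennreal (A1 * B powr p * r powr (- p)) * q"
    using order_trans[OF v'(2) add_mono[OF _ rough]] by (simp only: add.assoc)
  then show ?thesis by (rule that[OF S, unfolded y_def[symmetric] g_def[symmetric] q_def[symmetric] w_def[abs_def, symmetric]])
qed

end

subsection \<open>The homogenized integrand\<close>

lemma W_hom_le:
  fixes W :: "real^'n \<Rightarrow> real^'n^'m \<Rightarrow> ennreal"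
  assumes S: "Sob0 p (cube 0 (real k)) v H" and k: "k \<ge> 1" and p: "p \<ge> 1"
  shows "W_hom p W \<xi> \<le> ennreal (1 / real k ^ CARD('n)) * energy W (cube 0 (real k)) (\<lambda>x. \<xi> + H x)"
proof -
  let ?Q = "cube (0::real^'n) (real k)"
  note w = Sob0_W1p0[OF S cube_basic(1) p]
  have "(INF \<phi>\<in>{\<phi> :: real^'n \<Rightarrow> real^'m. W1p0 p ?Q \<phi>}. energy W ?Q (\<lambda>x. \<xi> + wgrad ?Q \<phi> x))
     \<le> energy W ?Q (\<lambda>x. \<xi> + wgrad ?Q v x)"
    using w(1) by (intro INF_lower) simp
  also have "\<dots> = energy W ?Q (\<lambda>x. \<xi> + H x)"
    using w(2) by (intro nn_integral_cong_AE) (auto simp: indicator_def elim!: eventually_mono)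
  finally show ?thesis
    unfolding W_hom_def box_eq_cube using k by (intro INF_lower2[of k] mult_left_mono) auto
qed

lemma W_hom_less:
  fixes W :: "real^'n \<Rightarrow> real^'n^'m \<Rightarrow> ennreal"
  assumes t: "W_hom p W \<xi> < t" and p: "p \<ge> 1"
  obtains k v H where "k \<ge> 1" "Sob0 p (cube 0 (real k)) v H"
    "ennreal (1 / real k ^ CARD('n)) * energy W (cube 0 (real k)) (\<lambda>x. \<xi> + H x) < t"
proof -
  let ?Q = "\<lambda>k. cube (0::real^'n) (real k)"
  obtain k where k: "k \<ge> 1" "ennreal (1 / real k ^ CARD('n)) *
      (INF \<phi>\<in>{\<phi> :: real^'n \<Rightarrow> real^'m. W1p0 p (?Q k) \<phi>}. energy W (?Q k) (\<lambda>x. \<xi> + wgrad (?Q k) \<phi> x)) < t"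
    using t unfolding W_hom_def box_eq_cube INF_less_iff by auto
  let ?X = "\<lambda>\<phi> :: real^'n \<Rightarrow> real^'m. energy W (?Q k) (\<lambda>x. \<xi> + wgrad (?Q k) \<phi> x)"
  define c where "c = 1 / real k ^ CARD('n)"
  have c: "c > 0" using k(1) by (simp add: c_def)
  have "\<exists>\<phi>. W1p0 p (?Q k) \<phi> \<and> ennreal c * ?X \<phi> < t"
  proof (rule ccontr)
    assume no: "\<not> ?thesis"
    \<comment> \<open>Dividing by \<open>c\<close> moves the constant out of the infimum, so that a
      lower bound for all competitors contradicts the choice of \<open>k\<close>.\<close>
    have "ennreal (1 / c) * t \<le> ?X \<phi>" if "W1p0 p (?Q k) \<phi>" for \<phi>
    proof -
      have "ennreal (1 / c) * t \<le> ennreal (1 / c) * (ennreal c * ?X \<phi>)" using no that by (intro mult_left_mono) (auto simp: not_less)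
      also have "\<dots> = ?X \<phi>" using c by (simp add: mult.assoc[symmetric] ennreal_mult[symmetric])
      finally show ?thesis .
    qed
    then have "ennreal (1 / c) * t \<le> (INF \<phi>\<in>{\<phi>. W1p0 p (?Q k) \<phi>}. ?X \<phi>)" by (intro INF_greatest) auto
    then have "ennreal c * (ennreal (1 / c) * t) \<le> ennreal c * (INF \<phi>\<in>{\<phi>. W1p0 p (?Q k) \<phi>}. ?X \<phi>)" by (rule mult_left_mono) simp
    moreover have "ennreal c * (ennreal (1 / c) * t) = t" using c by (simp add: mult.assoc[symmetric] ennreal_mult[symmetric])
    ultimately show False using k(2) by (simp add: c_def)
  qed
  then obtain \<phi> :: "real^'n \<Rightarrow> real^'m" where \<phi>: "W1p0 p (?Q k) \<phi>" "ennreal c * ?X \<phi> < t" by blast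
  have "energy W (?Q k) (\<lambda>x. \<xi> + indicator (?Q k) x *\<^sub>R wgrad (?Q k) \<phi> x) = energy W (?Q k) (\<lambda>x. \<xi> + wgrad (?Q k) \<phi> x)"
    by (intro nn_integral_cong) (auto simp: indicator_def)
  then show ?thesis using \<phi>(2) that[OF k(1) W1p0_Sob0[OF \<phi>(1) cube_basic(1) p]] by (simp add: c_def)
qed

section \<open>Periodic integrands, their rescalings, and comparison with the cell formula\<close>

locale hom_integrand = integrand W p C s0 c
  for W :: "real^'n \<Rightarrow> real^'n^'m \<Rightarrow> ennreal" and p C s0 c +
  assumes per: "W (x + axis i 1) \<xi> = W x \<xi>"
begin

abbreviation Wsc :: "real \<Rightarrow> real^'n \<Rightarrow> real^'n^'m \<Rightarrow> ennreal" where
  "Wsc \<epsilon> \<equiv> \<lambda>x. W ((1/\<epsilon>) *\<^sub>R x)"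

lemma per_int: "W (x + (\<chi> i. of_int (z i))) \<xi> = W x \<xi>"
proof -
  have nat: "W (x + real n *\<^sub>R axis i 1) \<xi> = W x \<xi>" for n i x
  proof (induction n)
    case (Suc n)
    have "x + real (Suc n) *\<^sub>R axis i 1 = (x + real n *\<^sub>R axis i 1) + axis i 1" by (simp add: algebra_simps)
    then show ?case by (simp only: per Suc)
  qed simp
  have int: "W (x + of_int m *\<^sub>R axis i 1) \<xi> = W x \<xi>" for m i x
  proof (cases "m \<ge> 0")
    case True
    then show ?thesis using nat[of x "nat m" i] by simp
  next
    case False
    have "(x + of_int m *\<^sub>R axis i 1) + real (nat (- m)) *\<^sub>R axis i 1 = x" using False by (simp add: scaleR_left_distrib[symmetric])
    then show ?thesis using nat[of "x + of_int m *\<^sub>R axis i 1" "nat (- m)" i] by (simp only:)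
  qed
  have "W (x + (\<Sum>i\<in>F. of_int (z i) *\<^sub>R axis i 1)) \<xi> = W x \<xi>" if "finite F" for F :: "'n set"
    using that
  proof (induction F)
    case (insert j F)
    then show ?case using int[of "x + (\<Sum>i\<in>F. of_int (z i) *\<^sub>R axis i 1)" "z j" j] by (simp add: ac_simps)
  qed simp
  moreover have "(\<Sum>i\<in>UNIV. of_int (z i) *\<^sub>R axis i 1) = ((\<chi> i. of_int (z i)) :: real^'n)"
    using basis_expansion[of "(\<chi> i. of_int (z i)) :: real^'n"] by (simp add: scalar_mult_eq_scaleR)
  ultimately show ?thesis by (metis finite)
qed

text \<open>The relaxation \<open>ZW\<close> freezes the point, so its bound is unaffected; only the
  comparison distance shrinks, to \<open>\<epsilon> * s0\<close>. As \<open>C0\<close> and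
  \<open>A1\<close> depend on \<open>p\<close>, \<open>C\<close> and \<open>c\<close> alone, all
  estimates for rough competitors and gluing hold with constants independent of \<epsilon>.\<close>

lemma scaled: assumes e: "\<epsilon> > 0" shows "integrand (Wsc \<epsilon>) p C (\<epsilon> * s0) c"
proof
  show "(\<lambda>(x, \<xi>). W ((1/\<epsilon>) *\<^sub>R x) \<xi>) \<in> borel_measurable (lebesgue \<Otimes>\<^sub>M borel)"
  proof -
    have "(\<lambda>x :: real^'n. (1/\<epsilon>) *\<^sub>R x) \<in> lebesgue \<rightarrow>\<^sub>M lebesgue" by (rule lebesgue_measurable_scaling)
    then have "(\<lambda>z :: (real^'n) \<times> (real^'n^'m). ((1/\<epsilon>) *\<^sub>R fst z, snd z)) \<in> lebesgue \<Otimes>\<^sub>M borel \<rightarrow>\<^sub>M lebesgue \<Otimes>\<^sub>M borel"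
      by (intro measurable_Pair measurable_compose[OF measurable_fst] measurable_snd)
    from measurable_compose[OF this meas] show ?thesis by (simp add: case_prod_beta)
  qed
  show "ZW (Wsc \<epsilon>) x \<xi> \<le> ennreal (c * (1 + norm \<xi> powr p))" for x \<xi>
    using ZW_le[of "(1/\<epsilon>) *\<^sub>R x" \<xi>] by (simp add: ZW_def)
  show "W ((1/\<epsilon>) *\<^sub>R x1) \<xi> \<le> 1 + 2 * W ((1/\<epsilon>) *\<^sub>R x2) \<xi>" if "norm (x1 - x2) \<le> \<epsilon> * s0" for x1 x2 \<xi>
  proof (rule osc)
    have "norm ((1/\<epsilon>) *\<^sub>R x1 - (1/\<epsilon>) *\<^sub>R x2) = norm (x1 - x2) / \<epsilon>" using e by (simp flip: scaleR_diff_right)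
    also have "\<dots> \<le> s0" using that e by (simp add: field_simps)
    finally show "norm ((1/\<epsilon>) *\<^sub>R x1 - (1/\<epsilon>) *\<^sub>R x2) \<le> s0" .
  qed
qed (use p C s0 c coercive e in auto)

text \<open>A rough competitor on the unit cube, the case \<open>k = 1\<close> of the cell formula,
  gives \<open>p\<close>-growth even where \<open>W\<close> itself is infinite on affine
  functions.\<close>

lemma W_hom_bound: "W_hom p W \<xi> \<le> ennreal (C0 * (1 + norm \<xi> powr p))"
proof -
  have Wk: "Wk p (cube 0 1) (\<lambda>x. 0 + \<xi> *v x) (\<lambda>x. \<xi>)" by (rule Wk_affine[OF cube_basic(3) p0(2)])
  obtain v H where v: "Sob0 p (cube 0 1) v H"
    "energy W (cube 0 1) (\<lambda>x. \<xi> + H x) \<le> ennreal C0 * (emeasure lebesgue (cube (0::real^'n) 1) + Np p (cube (0::real^'n) 1) (\<lambda>x. \<xi>))"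
    by (rule rough_bound[OF Wk cube_basic(1) cube_basic(3)]) (rule that; assumption)
  have "W_hom p W \<xi> \<le> ennreal (1 / real 1 ^ CARD('n)) * energy W (cube 0 (real 1)) (\<lambda>x. \<xi> + H x)"
    by (rule W_hom_le) (use v p in auto)
  also have "\<dots> \<le> ennreal C0 * (emeasure lebesgue (cube (0::real^'n) 1) + Np p (cube (0::real^'n) 1) (\<lambda>x. \<xi>))" using v(2) by simp
  also have "\<dots> = ennreal (C0 * (1 + norm \<xi> powr p))"
    using emeasure_cube(1)[of 1 "0::real^'n"] C0_pos by (simp add: Np_def nn_integral_cmult_indicator ennreal_mult')
  finally show ?thesis .
qed

lemma rough_const:
  assumes e: "\<epsilon> > 0" and U: "open U" "bounded U" and m: "emeasure lebesgue U \<le> ennreal \<mu>" "\<mu> \<ge> 0"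
  obtains v H where "Sob0 p U v H"
    "energy (Wsc \<epsilon>) U (\<lambda>x. \<xi> + H x) \<le> ennreal (C0 * \<mu> * (1 + norm \<xi> powr p))"
proof -
  interpret S: integrand "Wsc \<epsilon>" p C "\<epsilon> * s0" c by (rule scaled[OF e])
  have Wk: "Wk p U (\<lambda>x. 0 + \<xi> *v x) (\<lambda>x. \<xi>)" by (rule Wk_affine[OF U(2) p0(2)])
  obtain v H where v: "Sob0 p U v H"
    "energy (Wsc \<epsilon>) U (\<lambda>x. \<xi> + H x) \<le> ennreal C0 * (emeasure lebesgue U + Np p U (\<lambda>x. \<xi>))"
    by (rule S.rough_bound[OF Wk U]) (rule that; assumption)
  have "ennreal C0 * (emeasure lebesgue U + Np p U (\<lambda>x. \<xi>)) \<le> ennreal C0 * ennreal (\<mu> * (1 + norm \<xi> powr p))"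
    using U(1) by (intro mult_left_mono emeasure_plus_Np_const m) auto
  also have "\<dots> = ennreal (C0 * \<mu> * (1 + norm \<xi> powr p))"
    using C0_pos by (simp add: ennreal_mult'[symmetric] mult.assoc)
  finally show ?thesis using that[OF v(1)] v(2) order_trans by blast
qed

text \<open>The cube is enlarged to one whose corner lies on the lattice of spacing \<epsilon> and
  whose side is an integer multiple of \<epsilon>. Periodicity and rescaling make the enlarged cube
  a competitor set in the cell formula; the frame in between is filled roughly, and its volume gives
  the error term.\<close>

lemma cell_lower:
  assumes e: "\<epsilon> > 0" and r: "r > 0" and S: "Sob0 p (cube a r) v H"
  shows "ennreal (r ^ CARD('n)) * W_hom p W \<xi> \<le> energy (Wsc \<epsilon>) (cube a r) (\<lambda>x. \<xi> + H x)
    + ennreal (C0 * ((r + 2 * \<epsilon>) ^ CARD('n) - r ^ CARD('n)) * (1 + norm \<xi> powr p))"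
proof -
  interpret S: integrand "Wsc \<epsilon>" p C "\<epsilon> * s0" c by (rule scaled[OF e])
  let ?n = "CARD('n)" and ?Q = "cube a r"
  define z where "z i = \<lfloor>a $ i / \<epsilon>\<rfloor>" for i
  define zv where "zv = ((\<chi> i. of_int (z i)) :: real^'n)"
  define A where "A = \<epsilon> *\<^sub>R zv"
  \<comment> \<open>One cell more than needed to cover the side \<open>r\<close>, because the
    lattice corner may lie up to \<epsilon> below \<open>a\<close>. Rounding up and the extra cell
    together add at most \<open>2 * \<epsilon>\<close>.\<close>
  define k where "k = nat \<lceil>r / \<epsilon>\<rceil> + 1"
  have rk: "r \<le> \<epsilon> * (real k - 1)" "\<epsilon> * real k \<le> r + 2 * \<epsilon>" "k \<ge> 1"
  proof -
    have re: "r / \<epsilon> > 0" using r e by simp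
    then have "real k - 1 = of_int \<lceil>r / \<epsilon>\<rceil>" by (simp add: k_def)
    then have "r / \<epsilon> \<le> real k - 1" "real k - 1 \<le> r / \<epsilon> + 1" by linarith+
    then show "r \<le> \<epsilon> * (real k - 1)" "\<epsilon> * real k \<le> r + 2 * \<epsilon>" using e by (simp_all add: field_simps)
    show "k \<ge> 1" by (simp add: k_def)
  qed
  have az: "A $ i \<le> a $ i" "a $ i < A $ i + \<epsilon>" for i
  proof -
    have "of_int (z i) \<le> a $ i / \<epsilon>" "a $ i / \<epsilon> < of_int (z i) + 1" unfolding z_def by linarith+
    then show "A $ i \<le> a $ i" "a $ i < A $ i + \<epsilon>" using e by (simp_all add: A_def zv_def field_simps)
  qed
  let ?P = "cube A (\<epsilon> * real k)"
  have QP: "?Q \<subseteq> ?P"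
  proof (rule cube_subset_cube)
    show "A $ i \<le> a $ i \<and> a $ i + r \<le> A $ i + \<epsilon> * real k" for i using az[of i] rk(1) by (auto simp: algebra_simps)
  qed
  have ek: "\<epsilon> * real k \<ge> r" "\<epsilon> * real k \<ge> 0" using rk(1) e r by (auto simp: algebra_simps)
  \<comment> \<open>Removing the closed cube makes the frame open. On it \<open>H\<close> vanishes,
    so the datum for the rough competitor is the constant \<xi>.\<close>
  define Oj where "Oj = ?P - ccube a r"
  have Oj: "open Oj" "bounded Oj" unfolding Oj_def by (auto simp: open_Diff compact_imp_closed intro: bounded_subset[OF cube_basic(3)])
  define \<mu> where "\<mu> = (r + 2 * \<epsilon>) ^ ?n - r ^ ?n"
  have \<mu>: "\<mu> \<ge> 0" using e r by (simp add: \<mu>_def power_mono)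
  have emO: "emeasure lebesgue Oj \<le> ennreal \<mu>"
  proof -
    have "emeasure lebesgue Oj \<le> emeasure lebesgue (?P - ?Q)"
      unfolding Oj_def using cube_subset_ccube by (intro emeasure_mono sets.Diff) auto
    also have "\<dots> = emeasure lebesgue ?P - emeasure lebesgue ?Q"
      using QP emeasure_cube(1)[of r a] r by (intro emeasure_Diff) auto
    also have "\<dots> = ennreal ((\<epsilon> * real k) ^ ?n - r ^ ?n)"
      using emeasure_cube(1)[OF ek(2), of A] emeasure_cube(1)[of r a] r by (simp add: ennreal_minus)
    also have "\<dots> \<le> ennreal \<mu>"
      unfolding \<mu>_def using rk(2) ek by (intro ennreal_leI diff_right_mono power_mono) auto
    finally show ?thesis .
  qed
  note [measurable] = Sob0_measurable(2)[OF S]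
  have Os[measurable]: "Oj \<in> sets lebesgue" using Oj(1) by simp
  have W': "Wk p ?P (\<lambda>x. (0 + \<xi> *v x) + v x) (\<lambda>x. \<xi> + H x)"
    by (intro Wk_add[OF Wk_affine[OF cube_basic(3) p0(2)] Sob0_Wk[OF S p] p]) simp
  obtain v' H' where v': "Sob0 p Oj v' H'" and en: "energy (Wsc \<epsilon>) ?P (\<lambda>x. (\<xi> + H x) + H' x) \<le>
      energy (Wsc \<epsilon>) (?P - Oj) (\<lambda>x. \<xi> + H x) + ennreal C0 * (emeasure lebesgue Oj + Np p Oj (\<lambda>x. \<xi> + H x))"
    by (rule S.rough_fill[OF W' cube_basic(5) Oj]) (auto simp: Oj_def intro: that)
  define vt where "vt x = v x + v' x" for x
  define Ht where "Ht x = H x + H' x" for x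
  have St: "Sob0 p ?P vt Ht"
    unfolding vt_def Ht_def
    by (intro Sob0_add Sob0_mono[OF S QP] Sob0_mono[OF v'] p0) (auto simp: Oj_def)
  have "Np p Oj (\<lambda>x. \<xi> + H x) = Np p Oj (\<lambda>x. \<xi>)"
    using Sob0_outside(2)[OF S] cube_subset_ccube by (intro Np_cong_AE AE_I2) (force simp: Oj_def)
  then have "ennreal C0 * (emeasure lebesgue Oj + Np p Oj (\<lambda>x. \<xi> + H x)) \<le> ennreal C0 * ennreal (\<mu> * (1 + norm \<xi> powr p))"
    using emeasure_plus_Np_const[OF Os emO \<mu>] by (intro mult_left_mono) auto
  moreover have "energy (Wsc \<epsilon>) (?P - Oj) (\<lambda>x. \<xi> + H x) \<le> energy (Wsc \<epsilon>) ?Q (\<lambda>x. \<xi> + H x)"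
    using AE_not_in[OF null_ccube_diff_cube[of a r]]
    by (intro nn_integral_mono_AE) (auto simp: Oj_def indicator_def elim!: eventually_mono)
  ultimately have en: "energy (Wsc \<epsilon>) ?P (\<lambda>x. \<xi> + Ht x) \<le> energy (Wsc \<epsilon>) ?Q (\<lambda>x. \<xi> + H x) + ennreal (C0 * \<mu> * (1 + norm \<xi> powr p))"
    unfolding Ht_def add.assoc[symmetric] using C0_pos by (intro order_trans[OF en] add_mono) (auto simp: ennreal_mult' mult.assoc)
  define K where "K y = Ht (\<epsilon> *\<^sub>R (y + zv))" for y
  have aff: "(1 / (1/\<epsilon>)) *\<^sub>R (y - (- zv)) = \<epsilon> *\<^sub>R (y + zv)" for y by simp
  have SK: "Sob0 p (cube 0 (real k)) (\<lambda>y. (1/\<epsilon>) *\<^sub>R vt (\<epsilon> *\<^sub>R (y + zv))) K"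
    unfolding K_def
  proof (rule Sob0_scale(1)[OF St, of "1/\<epsilon>" "- zv" "cube 0 (real k)", unfolded aff])
    fix x assume x: "x \<in> ?P"
    show "- zv + (1/\<epsilon>) *\<^sub>R x \<in> cube 0 (real k)" unfolding mem_cube
    proof
      fix i
      have "\<epsilon> * zv $ i < x $ i" "x $ i < \<epsilon> * zv $ i + \<epsilon> * real k" using x by (auto simp: mem_cube A_def)
      then show "0 $ i < (- zv + (1/\<epsilon>) *\<^sub>R x) $ i \<and> (- zv + (1/\<epsilon>) *\<^sub>R x) $ i < 0 $ i + real k" using e by (auto simp: field_simps)
    qed
  qed (use e p0 in auto)
  have KW: "Lmeas (\<lambda>y. W y (\<xi> + K y))" using Sob0_measurable(2)[OF SK] by measurable
  have "energy (Wsc \<epsilon>) ?P (\<lambda>x. \<xi> + Ht x) = (\<integral>\<^sup>+x\<in>?P. (\<lambda>y. W y (\<xi> + K y)) ((1/\<epsilon>) *\<^sub>R (x - A)) \<partial>lebesgue)"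
  proof (intro nn_integral_cong)
    fix x
    have "(1/\<epsilon>) *\<^sub>R x = (1/\<epsilon>) *\<^sub>R (x - A) + zv" using e by (simp add: A_def scaleR_diff_right)
    then have "W ((1/\<epsilon>) *\<^sub>R x) \<zeta> = W ((1/\<epsilon>) *\<^sub>R (x - A)) \<zeta>" for \<zeta> using per_int[of "(1/\<epsilon>) *\<^sub>R (x - A)" z] by (simp add: zv_def)
    moreover have "K ((1/\<epsilon>) *\<^sub>R (x - A)) = Ht x" using e by (simp add: K_def A_def scaleR_add_right scaleR_diff_right)
    ultimately show "W ((1/\<epsilon>) *\<^sub>R x) (\<xi> + Ht x) * indicator ?P x = (\<lambda>y. W y (\<xi> + K y)) ((1/\<epsilon>) *\<^sub>R (x - A)) * indicator ?P x" by simp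
  qed
  also have "\<dots> = ennreal (\<epsilon> ^ ?n) * (\<integral>\<^sup>+y\<in>cube 0 (real k). W y (\<xi> + K y) \<partial>lebesgue)"
    by (rule nn_integral_cube_scale[OF KW e])
  finally have sc: "energy (Wsc \<epsilon>) ?P (\<lambda>x. \<xi> + Ht x) = ennreal (\<epsilon> ^ ?n) * (\<integral>\<^sup>+y\<in>cube 0 (real k). W y (\<xi> + K y) \<partial>lebesgue)" .
  \<comment> \<open>Passing to the larger volume is in the right direction, as the homogenized
    integrand is nonnegative.\<close>
  have "ennreal (r ^ ?n) * W_hom p W \<xi> \<le> ennreal ((\<epsilon> * real k) ^ ?n) * W_hom p W \<xi>"
    using ek r by (intro mult_right_mono ennreal_leI power_mono) auto
  also have "\<dots> \<le> ennreal ((\<epsilon> * real k) ^ ?n) * (ennreal (1 / real k ^ ?n) * (\<integral>\<^sup>+y\<in>cube 0 (real k). W y (\<xi> + K y) \<partial>lebesgue))"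
    by (intro mult_left_mono W_hom_le[OF SK rk(3) p]) simp
  also have "\<dots> = ennreal ((\<epsilon> * real k) ^ ?n * (1 / real k ^ ?n)) * (\<integral>\<^sup>+y\<in>cube 0 (real k). W y (\<xi> + K y) \<partial>lebesgue)"
    using e by (subst ennreal_mult) (auto simp: mult.assoc)
  also have "(\<epsilon> * real k) ^ ?n * (1 / real k ^ ?n) = \<epsilon> ^ ?n" using rk(3) by (simp add: power_mult_distrib)
  finally show ?thesis using en unfolding sc[symmetric] \<mu>_def by (rule order_trans)
qed

end

section \<open>Filling a cube with periodic copies of a cell function\<close>

context hom_integrand
begin

text \<open>Copies of the cell function, of side \<open>L\<close>, occupy all lattice cells
  contained in the cube; each has energy at most \<open>t\<close> per unit of volume by periodicity.
  The frame left over, of width at most \<open>L\<close>, gets a rough competitor. In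
  \<open>L^p\<close> the copies are small by scaling, with the factor
  \<open>\<epsilon> powr p\<close>, and the rough part by Friedrichs' inequality and the small
  volume of the frame.\<close>

lemma packing:
  fixes a :: "real^'n"
  assumes e: "\<epsilon> > 0" and k: "k \<ge> 1" and S: "Sob0 p (cube 0 (real k)) w K"
    and E: "ennreal (1 / real k ^ CARD('n)) * energy W (cube 0 (real k)) (\<lambda>x. \<xi> + K x) \<le> t"
    and L: "L = \<epsilon> * real k" "2 * L \<le> r"
  shows "\<exists>v H. Sob0 p (cube a r) v H \<and> energy (Wsc \<epsilon>) (cube a r) (\<lambda>x. \<xi> + H x) \<le>
    ennreal (r ^ CARD('n)) * t + ennreal (C0 * (r ^ CARD('n) - (r - 2 * L) ^ CARD('n)) * (1 + norm \<xi> powr p)) \<and>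
    Np p UNIV v \<le> ennreal (2 powr p) * (ennreal (\<epsilon> powr p * (r ^ CARD('n) / real k ^ CARD('n))) * Np p UNIV w +
      ennreal (4 powr p * r powr p * (2 powr p * ((C0 / C + 1) * ((r ^ CARD('n) - (r - 2 * L) ^ CARD('n)) * (1 + norm \<xi> powr p))))))"
proof -
  interpret S: integrand "Wsc \<epsilon>" p C "\<epsilon> * s0" c by (rule scaled[OF e])
  let ?n = "CARD('n)" and ?Q = "cube a r"
  have L0: "L > 0" using e k L(1) by simp
  have r: "r > 0" using L0 L(2) by simp
  define A where "A z = ((\<chi> i. L * of_int (z i)) :: real^'n)" for z
  define ok where "ok z \<longleftrightarrow> (\<forall>i. a $ i \<le> L * of_int (z i) \<and> L * (of_int (z i) + 1) \<le> a $ i + r)" for z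
  \<comment> \<open>Lattice points form a countable type and are coded by natural numbers. Decoding
    need not be injective, so \<open>valid\<close> admits only the canonical code of a point; every
    other index gets an empty cell.\<close>
  define dec where "dec j = (from_nat j :: 'n \<Rightarrow> int)" for j
  define valid where "valid j \<longleftrightarrow> to_nat (dec j) = j \<and> ok (dec j)" for j
  define Q where "Q j = (if valid j then cube (A (dec j)) L else {})" for j
  have cell: "z i = \<lfloor>x $ i / L\<rfloor>" if "x \<in> cube (A z) L" for x z i
  proof -
    have "L * of_int (z i) < x $ i" "x $ i < L * of_int (z i) + L" using that by (auto simp: mem_cube A_def)
    then have "of_int (z i) \<le> x $ i / L" "x $ i / L < of_int (z i) + 1" using L0 by (auto simp: field_simps)
    then show ?thesis by linarith
  qed
  have dj: "disjoint_family Q"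
    unfolding disjoint_family_on_def
  proof (intro ballI impI)
    fix i j :: nat assume "i \<noteq> j"
    have False if x: "x \<in> Q i" "x \<in> Q j" for x
    proof -
      have v: "valid i" "valid j" using x by (auto simp: Q_def split: if_splits)
      then have "dec i = dec j" using x cell[of x "dec i"] cell[of x "dec j"] by (intro ext) (simp add: Q_def)
      then show False using v \<open>i \<noteq> j\<close> unfolding valid_def by metis
    qed
    then show "Q i \<inter> Q j = {}" by blast
  qed
  have Qs[measurable]: "Q j \<in> sets lebesgue" for j by (simp add: Q_def)
  have QU: "Q j \<subseteq> ?Q" for j
    unfolding Q_def by (auto simp only: valid_def ok_def split: if_splits) (rule subsetD[OF cube_subset_cube], auto simp: A_def distrib_left)
  \<comment> \<open>The indices \<open>lo\<close> and \<open>hi\<close> delimit the lattice cells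
    inside the cube in each coordinate; \<open>B\<close> is the closed box they fill, so that its
    complement in the cube is open.\<close>
  define lo where "lo i = \<lceil>a $ i / L\<rceil>" for i
  define hi where "hi i = \<lfloor>(a $ i + r) / L\<rfloor>" for i
  define B where "B = cbox ((\<chi> i. L * of_int (lo i)) :: real^'n) (\<chi> i. L * of_int (hi i))"
  have memB: "x \<in> B \<longleftrightarrow> (\<forall>i. L * of_int (lo i) \<le> x $ i \<and> x $ i \<le> L * of_int (hi i))" for x
    by (simp add: B_def mem_box_cart)
  have lohi: "a $ i \<le> L * of_int (lo i)" "L * of_int (lo i) < a $ i + L" "L * of_int (hi i) \<le> a $ i + r" "a $ i + r < L * of_int (hi i) + L" for i
  proof -
    have "a $ i / L \<le> of_int (lo i)" "of_int (lo i) < a $ i / L + 1" "of_int (hi i) \<le> (a $ i + r) / L" "(a $ i + r) / L < of_int (hi i) + 1"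
      unfolding lo_def hi_def by linarith+
    then show "a $ i \<le> L * of_int (lo i)" "L * of_int (lo i) < a $ i + L" "L * of_int (hi i) \<le> a $ i + r" "a $ i + r < L * of_int (hi i) + L"
      using L0 by (auto simp: field_simps)
  qed
  define Oj where "Oj = ?Q - B"
  have Oj: "open Oj" "bounded Oj" unfolding Oj_def B_def by (auto intro: bounded_subset[OF cube_basic(3)])
  have Ojs[measurable]: "Oj \<in> sets lebesgue" using Oj(1) by simp
  define \<mu> where "\<mu> = r ^ ?n - (r - 2 * L) ^ ?n"
  have \<mu>: "\<mu> \<ge> 0" using L0 L(2) by (simp add: \<mu>_def power_mono)
  have emO: "emeasure lebesgue Oj \<le> ennreal \<mu>"
  proof -
    \<comment> \<open>The cube with margin \<open>L\<close> on every side lies in \<open>B\<close>,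
      which bounds the volume of the frame.\<close>
    let ?q = "cube (a + (\<chi> i. L)) (r - 2 * L)"
    have qB: "?q \<subseteq> B"
    proof
      fix x assume x: "x \<in> ?q"
      show "x \<in> B" unfolding memB
      proof
        fix i
        have "a $ i + L < x $ i" "x $ i < a $ i + L + (r - 2 * L)" using x by (auto simp: mem_cube)
        then show "L * of_int (lo i) \<le> x $ i \<and> x $ i \<le> L * of_int (hi i)" using lohi[of i] by linarith
      qed
    qed
    have qQ: "?q \<subseteq> ?Q" using L0 by (intro cube_subset_cube) simp
    have "emeasure lebesgue Oj \<le> emeasure lebesgue (?Q - ?q)"
      unfolding Oj_def using qB by (intro emeasure_mono) auto
    also have "\<dots> = emeasure lebesgue ?Q - emeasure lebesgue ?q"
      using qQ emeasure_cube(1)[of "r - 2 * L" "a + (\<chi> i. L)"] L(2) by (intro emeasure_Diff) auto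
    also have "\<dots> = ennreal \<mu>"
      using emeasure_cube(1)[of "r - 2 * L" "a + (\<chi> i. L)"] emeasure_cube(1)[of r a] r L(2) by (simp add: ennreal_minus \<mu>_def)
    finally show ?thesis .
  qed
  have QB: "x \<in> B" if "x \<in> Q j" for x j
    unfolding memB
  proof
    fix i
    have v: "valid j" "x \<in> cube (A (dec j)) L" using that by (auto simp: Q_def split: if_splits)
    have x: "L * of_int (dec j i) < x $ i" "x $ i < L * of_int (dec j i) + L" using v(2) by (auto simp: mem_cube A_def)
    have o: "a $ i \<le> L * of_int (dec j i)" "L * (of_int (dec j i) + 1) \<le> a $ i + r" using v(1) by (auto simp: valid_def ok_def)
    have "lo i \<le> dec j i" unfolding lo_def ceiling_le_iff using o L0 by (simp add: field_simps)
    then have 1: "L * of_int (lo i) \<le> L * of_int (dec j i)" using L0 by simp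
    have "dec j i + 1 \<le> hi i" unfolding hi_def le_floor_iff using o L0 by (simp add: field_simps)
    then have "L * of_int (dec j i + 1) \<le> L * of_int (hi i)" using L0 by (simp only: mult_le_cancel_left_pos of_int_le_iff)
    then have "L * of_int (dec j i) + L \<le> L * of_int (hi i)" by (simp add: distrib_left)
    then show "L * of_int (lo i) \<le> x $ i \<and> x $ i \<le> L * of_int (hi i)" using 1 x by linarith
  qed
  have AEQ: "AE x in lebesgue. x \<in> ?Q \<longrightarrow> x \<in> Oj \<or> x \<in> (\<Union>j. Q j)"
  proof -
    have "AE x in lebesgue. \<forall>z. x \<notin> ccube (A z) L - cube (A z) L"
      unfolding AE_all_countable using AE_not_in[OF null_ccube_diff_cube] by blast
    then show ?thesis
    proof eventually_elim
      case (elim x)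
      show ?case
      proof (intro impI, cases "x \<in> B")
        case True
        define z where "z i = \<lfloor>x $ i / L\<rfloor>" for i
        have "of_int (z i) \<le> x $ i / L" "x $ i / L \<le> of_int (z i) + 1" for i unfolding z_def by linarith+
        then have "x \<in> ccube (A z) L" using L0 by (auto simp: mem_ccube A_def field_simps)
        then have x: "x \<in> cube (A z) L" using elim by blast
        have "ok z" unfolding ok_def
        proof
          fix i
          have x': "L * of_int (z i) < x $ i" "x $ i < L * of_int (z i) + L" using x by (auto simp: mem_cube A_def)
          have b: "L * of_int (lo i) \<le> x $ i" "x $ i \<le> L * of_int (hi i)" using True by (auto simp: memB)
          have "L * of_int (z i) < L * of_int (hi i)" using b x' by linarith
          moreover have "L * of_int (lo i) < L * of_int (z i + 1)" unfolding of_int_add distrib_left using b x' by simp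
          ultimately have "z i < hi i" "lo i < z i + 1" using L0 by (auto simp only: mult_less_cancel_left_pos of_int_less_iff)
          then have "z i + 1 \<le> hi i" "lo i \<le> z i" by simp_all
          then have "L * of_int (z i + 1) \<le> L * of_int (hi i)" "L * of_int (lo i) \<le> L * of_int (z i)" using L0 by (simp_all only: mult_le_cancel_left_pos of_int_le_iff)
          then show "a $ i \<le> L * of_int (z i) \<and> L * (of_int (z i) + 1) \<le> a $ i + r" using lohi[of i] unfolding of_int_add of_int_1 by linarith
        qed
        then have "x \<in> Q (to_nat z)" using x by (simp add: Q_def valid_def dec_def)
        then show "x \<in> Oj \<or> x \<in> (\<Union>j. Q j)" by blast
      qed (simp add: Oj_def)
    qed
  qed
  define v where "v j x = (if valid j then \<epsilon> *\<^sub>R w ((1/\<epsilon>) *\<^sub>R (x - A (dec j))) else 0)" for j x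
  define H where "H j x = (if valid j then K ((1/\<epsilon>) *\<^sub>R (x - A (dec j))) else 0)" for j x
  have emQ: "emeasure lebesgue (Q j) = (if valid j then ennreal (L ^ ?n) else 0)" for j
    using emeasure_cube(1)[of L "A (dec j)"] L0 by (simp add: Q_def)
  have Sj: "Sob0 p (Q j) (v j) (H j) \<and> Np p UNIV (v j) = ennreal (\<epsilon> powr p / real k ^ ?n) * Np p UNIV w * emeasure lebesgue (Q j) \<and>
     Np p UNIV (H j) = ennreal (1 / real k ^ ?n) * Np p UNIV K * emeasure lebesgue (Q j)" for j
  proof (cases "valid j")
    case True
    have in_cell: "A (dec j) + \<epsilon> *\<^sub>R y \<in> cube (A (dec j)) L" if "y \<in> cube 0 (real k)" for y
      using that e by (auto simp: mem_cube L(1))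
    note sc = Sob0_scale[OF S e in_cell p0(2)]
    have c: "ennreal x = ennreal (x / (\<epsilon> ^ ?n * real k ^ ?n)) * ennreal (L ^ ?n)" if "x \<ge> 0" for x
      using that e k L0 by (simp add: ennreal_mult'[symmetric] L(1) power_mult_distrib)
    have "ennreal (\<epsilon> powr p * \<epsilon> ^ ?n) = ennreal (\<epsilon> powr p / real k ^ ?n) * ennreal (L ^ ?n)"
      "ennreal (\<epsilon> ^ ?n) = ennreal (1 / real k ^ ?n) * ennreal (L ^ ?n)"
      using c[of "\<epsilon> powr p * \<epsilon> ^ ?n"] c[of "\<epsilon> ^ ?n"] e by simp_all
    then show ?thesis unfolding emQ using sc True by (simp add: v_def[abs_def] H_def[abs_def] Q_def mult_ac)
  next
    case False
    then show ?thesis using Sob0_zero[OF p0(1)] p0 by (simp add: v_def[abs_def] H_def[abs_def] Q_def Np_zero)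
  qed
  have UQ: "(\<Sum>j. emeasure lebesgue (Q j)) \<le> ennreal (r ^ ?n)"
  proof -
    have "(\<Sum>j. emeasure lebesgue (Q j)) = emeasure lebesgue (\<Union>j. Q j)" by (rule suminf_emeasure) (use dj in auto)
    also have "\<dots> \<le> emeasure lebesgue ?Q" using QU by (intro emeasure_mono) auto
    finally show ?thesis using emeasure_cube(1)[of r a] r by simp
  qed
  have fin: "(\<Sum>j. Np p UNIV (v j)) < \<infinity>" "(\<Sum>j. Np p UNIV (H j)) < \<infinity>"
    using Sob0_finite[OF S p0(2)] UQ Sj by (auto simp: ennreal_mult_less_top intro: le_less_trans)
  have out: "x \<notin> Q j \<Longrightarrow> v j x = 0 \<and> H j x = 0" for j x using Sob0_outside Sj by blast
  obtain V G where VG: "Sob0 p ?Q V G" "\<And>j x. x \<in> Q j \<Longrightarrow> G x = H j x" "\<And>x. x \<notin> (\<Union>j. Q j) \<Longrightarrow> G x = 0" "Np p UNIV V = (\<Sum>j. Np p UNIV (v j))"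
    by (rule Sob0_patch[OF Sob0_mono[OF Sj[THEN conjunct1] QU] p0(1) dj Qs QU out fin]) (assumption, rule that)
  note [measurable] = Sob0_measurable(2)[OF VG(1)]
  have W': "Wk p ?Q (\<lambda>x. (0 + \<xi> *v x) + V x) (\<lambda>x. \<xi> + G x)"
    by (intro Wk_add[OF Wk_affine[OF cube_basic(3) p0(2)] Sob0_Wk[OF VG(1) p] p]) simp
  obtain v' H' where v': "Sob0 p Oj v' H'" "energy (Wsc \<epsilon>) ?Q (\<lambda>x. (\<xi> + G x) + H' x) \<le>
      energy (Wsc \<epsilon>) (?Q - Oj) (\<lambda>x. \<xi> + G x) + ennreal C0 * (emeasure lebesgue Oj + Np p Oj (\<lambda>x. \<xi> + G x))"
    "Np p UNIV H' \<le> ennreal (2 powr p * (C0 / C + 1)) * (emeasure lebesgue Oj + Np p Oj (\<lambda>x. \<xi> + G x))"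
    by (rule S.rough_fill[OF W' cube_basic(5) Oj]) (auto simp: Oj_def intro: that)
  have X: "emeasure lebesgue Oj + Np p Oj (\<lambda>x. \<xi> + G x) \<le> ennreal (\<mu> * (1 + norm \<xi> powr p))"
  proof -
    have "Np p Oj (\<lambda>x. \<xi> + G x) = Np p Oj (\<lambda>x. \<xi>)"
      using VG(3) QB by (intro Np_cong_AE AE_I2) (force simp: Oj_def)
    then show ?thesis using emeasure_plus_Np_const[OF Ojs emO \<mu>] by simp
  qed
  have KW: "Lmeas (\<lambda>y. W y (\<xi> + K y))" using Sob0_measurable(2)[OF S] by measurable
  have en: "energy (Wsc \<epsilon>) (Q j) (\<lambda>x. \<xi> + G x) \<le> t * emeasure lebesgue (Q j)" for j
  proof (cases "valid j")
    case True
    have "energy (Wsc \<epsilon>) (Q j) (\<lambda>x. \<xi> + G x) = (\<integral>\<^sup>+x\<in>cube (A (dec j)) (\<epsilon> * real k). (\<lambda>y. W y (\<xi> + K y)) ((1/\<epsilon>) *\<^sub>R (x - A (dec j))) \<partial>lebesgue)"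
    proof (intro nn_integral_cong)
      fix x
      \<comment> \<open>In the rescaled variable the corners of the cells are integer multiples of
        \<open>k\<close>, so periodicity identifies every cell with the cube at the origin.\<close>
      have "(1/\<epsilon>) *\<^sub>R x = (1/\<epsilon>) *\<^sub>R (x - A (dec j)) + (\<chi> i. of_int (int k * dec j i))"
        using e by (simp add: A_def L(1) vec_eq_iff right_diff_distrib)
      then have "W ((1/\<epsilon>) *\<^sub>R x) \<zeta> = W ((1/\<epsilon>) *\<^sub>R (x - A (dec j))) \<zeta>" for \<zeta>
        using per_int[of "(1/\<epsilon>) *\<^sub>R (x - A (dec j))" "\<lambda>i. int k * dec j i"] by simp
      then show "W ((1/\<epsilon>) *\<^sub>R x) (\<xi> + G x) * indicator (Q j) x =
          (\<lambda>y. W y (\<xi> + K y)) ((1/\<epsilon>) *\<^sub>R (x - A (dec j))) * indicator (cube (A (dec j)) (\<epsilon> * real k)) x"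
        using VG(2)[of x j] True by (simp add: Q_def H_def L(1) indicator_def)
    qed
    also have "\<dots> = ennreal (\<epsilon> ^ ?n) * (\<integral>\<^sup>+y\<in>cube 0 (real k). W y (\<xi> + K y) \<partial>lebesgue)"
      by (rule nn_integral_cube_scale[OF KW e])
    also have "ennreal (\<epsilon> ^ ?n) = ennreal (L ^ ?n) * ennreal (1 / real k ^ ?n)"
      using e k L0 by (simp add: ennreal_mult'[symmetric] L(1) power_mult_distrib)
    also have "\<dots> * (\<integral>\<^sup>+y\<in>cube 0 (real k). W y (\<xi> + K y) \<partial>lebesgue) \<le> ennreal (L ^ ?n) * t"
      unfolding mult.assoc by (intro mult_left_mono E) simp
    finally show ?thesis unfolding emQ using True by (simp add: mult.commute)
  qed (simp add: Q_def)
  have "energy (Wsc \<epsilon>) (?Q - Oj) (\<lambda>x. \<xi> + G x) \<le> energy (Wsc \<epsilon>) ((\<Union>j. Q j)) (\<lambda>x. \<xi> + G x)"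
    using AEQ by (intro nn_integral_mono_AE) (auto simp: indicator_def elim!: eventually_mono)
  also have "\<dots> = (\<Sum>j. energy (Wsc \<epsilon>) (Q j) (\<lambda>x. \<xi> + G x))"
    by (rule nn_integral_disjoint_family) (use dj in auto)
  also have "\<dots> \<le> (\<Sum>j. t * emeasure lebesgue (Q j))" by (intro suminf_le en) auto
  also have "\<dots> \<le> ennreal (r ^ ?n) * t" using mult_left_mono[OF UQ, of t] by (simp add: mult.commute)
  finally have "energy (Wsc \<epsilon>) ?Q (\<lambda>x. (\<xi> + G x) + H' x) \<le> ennreal (r ^ ?n) * t + ennreal C0 * ennreal (\<mu> * (1 + norm \<xi> powr p))"
    by (intro order_trans[OF v'(2)] add_mono mult_left_mono X) auto
  then have fin: "energy (Wsc \<epsilon>) ?Q (\<lambda>x. \<xi> + (G x + H' x)) \<le> ennreal (r ^ ?n) * t + ennreal (C0 * \<mu> * (1 + norm \<xi> powr p))"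
    using C0_pos by (simp add: ennreal_mult' mult.assoc add.assoc)
  have "Sob0 p ?Q (\<lambda>x. V x + v' x) (\<lambda>x. G x + H' x)"
    by (intro Sob0_add VG(1) Sob0_mono[OF v'(1)] p0) (auto simp: Oj_def)
  moreover have "Np p UNIV (\<lambda>x. V x + v' x) \<le> ennreal (2 powr p) * (Np p UNIV V + Np p UNIV v')"
    by (rule Np_add[OF Sob0_measurable(1)[OF VG(1)] Sob0_measurable(1)[OF v'(1)] _ p0(2)]) simp
  moreover have "Np p UNIV V \<le> ennreal (\<epsilon> powr p * (r ^ ?n / real k ^ ?n)) * Np p UNIV w"
  proof -
    have "Np p UNIV V = ennreal (\<epsilon> powr p / real k ^ ?n) * Np p UNIV w * (\<Sum>j. emeasure lebesgue (Q j))" using VG(4) Sj by simp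
    also have "\<dots> \<le> ennreal (\<epsilon> powr p / real k ^ ?n) * Np p UNIV w * ennreal (r ^ ?n)" by (intro mult_left_mono UQ) simp
    also have "\<dots> = (ennreal (\<epsilon> powr p / real k ^ ?n) * ennreal (r ^ ?n)) * Np p UNIV w" by (simp only: mult_ac)
    also have "ennreal (\<epsilon> powr p / real k ^ ?n) * ennreal (r ^ ?n) = ennreal (\<epsilon> powr p * (r ^ ?n / real k ^ ?n))"
      using r by (simp add: ennreal_mult'[symmetric])
    finally show ?thesis .
  qed
  moreover have "Np p UNIV v' \<le> ennreal (4 powr p * r powr p * (2 powr p * ((C0 / C + 1) * (\<mu> * (1 + norm \<xi> powr p)))))"
  proof -
    have "Np p UNIV v' \<le> ennreal (4 powr p * r powr p) * Np p UNIV H'"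
      by (rule friedrichs[OF Sob0_mono[OF v'(1)] p r]) (auto simp: Oj_def)
    also have "\<dots> \<le> ennreal (4 powr p * r powr p) * (ennreal (2 powr p * (C0 / C + 1)) * ennreal (\<mu> * (1 + norm \<xi> powr p)))"
      by (intro mult_left_mono order_trans[OF v'(3)] X) auto
    also have "\<dots> = ennreal (4 powr p * r powr p * (2 powr p * ((C0 / C + 1) * (\<mu> * (1 + norm \<xi> powr p)))))"
      using C0_pos C by (simp add: ennreal_mult'[symmetric] mult.assoc)
    finally show ?thesis .
  qed
  ultimately show ?thesis using fin unfolding \<mu>_def[symmetric]
    by (intro exI conjI) (assumption, assumption, meson order_trans mult_left_mono add_mono zero_le)
qed

text \<open>One nearly optimal cell function, with its \<open>k\<close>, is fixed first; only then
  does \<epsilon> tend to 0, and all errors of \<open>packing\<close> vanish. Smallness of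
  \<open>v\<close> in \<open>L^p\<close> is what allows such a filling to be glued to another affine
  function in \<open>W_hom_modulus\<close>.\<close>

lemma cell_upper:
  fixes a :: "real^'n"
  assumes t: "W_hom p W \<xi> < t" and r: "r > 0" and e: "e > 0"
  shows "\<forall>\<^sub>F \<epsilon> in at_right 0. \<exists>v H. Sob0 p (cube a r) v H \<and>
    energy (Wsc \<epsilon>) (cube a r) (\<lambda>x. \<xi> + H x) \<le> ennreal (r ^ CARD('n)) * t + ennreal e \<and>
    Np p UNIV v \<le> ennreal e"
proof -
  obtain k w K where k: "k \<ge> 1" "Sob0 p (cube 0 (real k)) w K"
    and E: "ennreal (1 / real k ^ CARD('n)) * energy W (cube 0 (real k)) (\<lambda>x. \<xi> + K x) < t"
    by (rule W_hom_less[OF t p])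
  let ?g = "\<lambda>\<epsilon>. C0 * (r ^ CARD('n) - (r - 2 * (\<epsilon> * real k)) ^ CARD('n)) * (1 + norm \<xi> powr p)"
  have "(?g \<longlongrightarrow> C0 * (r ^ CARD('n) - (r - 2 * (0 * real k)) ^ CARD('n)) * (1 + norm \<xi> powr p)) (at_right 0)"
    by (intro tendsto_intros)
  then have g: "\<forall>\<^sub>F \<epsilon> in at_right 0. ?g \<epsilon> < e" using e by (intro order_tendstoD) auto
  have "((\<lambda>\<epsilon>. 2 * (\<epsilon> * real k)) \<longlongrightarrow> 2 * (0 * real k)) (at_right 0)" by (intro tendsto_intros)
  then have "\<forall>\<^sub>F \<epsilon> in at_right 0. 2 * (\<epsilon> * real k) < r" using r by (intro order_tendstoD) auto
  moreover
  obtain nw where nw: "Np p UNIV w = ennreal nw" "nw \<ge> 0" using Sob0_finite(1)[OF k(2) p0(2)] by (cases "Np p UNIV w") auto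
  let ?h = "\<lambda>\<epsilon>. 2 powr p * (\<epsilon> powr p * (r ^ CARD('n) / real k ^ CARD('n)) * nw +
      4 powr p * r powr p * (2 powr p * ((C0 / C + 1) * ((r ^ CARD('n) - (r - 2 * (\<epsilon> * real k)) ^ CARD('n)) * (1 + norm \<xi> powr p)))))"
  have pw: "((\<lambda>\<epsilon>::real. \<epsilon> powr p) \<longlongrightarrow> 0 powr p) (at_right 0)"
    using p0 eventually_at_right_less[of "0::real"] by (intro tendsto_powr' tendsto_intros) (auto elim: eventually_mono)
  have "(?h \<longlongrightarrow> 2 powr p * (0 powr p * (r ^ CARD('n) / real k ^ CARD('n)) * nw +
      4 powr p * r powr p * (2 powr p * ((C0 / C + 1) * ((r ^ CARD('n) - (r - 2 * (0 * real k)) ^ CARD('n)) * (1 + norm \<xi> powr p)))))) (at_right 0)"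
    by (intro pw tendsto_mult tendsto_add tendsto_diff tendsto_power tendsto_const tendsto_ident_at)
  then have "\<forall>\<^sub>F \<epsilon> in at_right 0. ?h \<epsilon> < e" using e p0 by (intro order_tendstoD) auto
  ultimately show ?thesis using g eventually_at_right_less[of 0]
  proof eventually_elim
    case (elim \<epsilon>)
    obtain v H where v: "Sob0 p (cube a r) v H" "energy (Wsc \<epsilon>) (cube a r) (\<lambda>x. \<xi> + H x) \<le>
        ennreal (r ^ CARD('n)) * t + ennreal (?g \<epsilon>)"
      and Nv: "Np p UNIV v \<le> ennreal (2 powr p) * (ennreal (\<epsilon> powr p * (r ^ CARD('n) / real k ^ CARD('n))) * Np p UNIV w +
      ennreal (4 powr p * r powr p * (2 powr p * ((C0 / C + 1) * ((r ^ CARD('n) - (r - 2 * (\<epsilon> * real k)) ^ CARD('n)) * (1 + norm \<xi> powr p))))))"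
      using packing[OF elim(4) k less_imp_le[OF E] refl less_imp_le[OF elim(1)], of a] by blast
    have "ennreal (?g \<epsilon>) \<le> ennreal e" using elim(3) by (intro ennreal_leI) simp
    note v(2)[THEN order_trans, OF add_left_mono[OF this]]
    moreover have "r - 2 * (\<epsilon> * real k) \<ge> 0" "r - 2 * (\<epsilon> * real k) \<le> r" using elim by auto
    then have "r ^ CARD('n) - (r - 2 * (\<epsilon> * real k)) ^ CARD('n) \<ge> 0" by (simp add: power_mono)
    then have "Np p UNIV v \<le> ennreal (?h \<epsilon>)"
      using Nv r nw(2) C0_pos C unfolding nw(1)
      by (simp only: ennreal_mult'[symmetric] ennreal_plus[symmetric] ennreal_mult[symmetric] mult_nonneg_nonneg powr_ge_zero divide_nonneg_nonneg zero_le_power of_nat_0_le_iff less_imp_le add_nonneg_nonneg zero_le_one norm_ge_zero)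
    then have "Np p UNIV v \<le> ennreal e" by (rule order_trans) (use elim(2) in \<open>auto intro: ennreal_leI\<close>)
    ultimately show ?case using v(1) by blast
  qed
qed

end

section \<open>Modulus of continuity of the homogenized integrand\<close>

context hom_integrand
begin

text \<open>\<open>glue\<close> produces zero boundary values relative to the affine function of
  slope \<zeta>, which is what \<open>cell_lower\<close> asks for.\<close>

lemma cell_glue:
  fixes u :: "real^'n \<Rightarrow> real^'m"
  assumes L: "layers M B \<delta> (\<theta> :: nat \<Rightarrow> real^'n \<Rightarrow> real)" and M: "M \<ge> 1" and e: "\<epsilon> > 0" and r: "r > 0" and W: "Wk p (cube a r) u G"
  shows "ennreal (r ^ CARD('n)) * W_hom p W \<zeta> \<le> energy (Wsc \<epsilon>) (cube a r) G
    + ennreal (A1 / real M) * (ennreal (r ^ CARD('n) * (1 + norm \<zeta> powr p)) + Np p (cube a r) G)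
    + ennreal (A1 * B powr p * r powr (- p)) * Np p (cube a r) (\<lambda>x. u x - (b + \<zeta> *v x))
    + ennreal (C0 * ((r + 2 * \<epsilon>) ^ CARD('n) - r ^ CARD('n)) * (1 + norm \<zeta> powr p))"
proof -
  interpret S: integrand "Wsc \<epsilon>" p C "\<epsilon> * s0" c by (rule scaled[OF e])
  obtain v H where v: "Sob0 p (cube a r) v H"
    "energy (Wsc \<epsilon>) (cube a r) (\<lambda>x. \<zeta> + H x) \<le> energy (Wsc \<epsilon>) (cube a r) G
    + ennreal (A1 / real M) * (ennreal (r ^ CARD('n) * (1 + norm \<zeta> powr p)) + Np p (cube a r) G)
    + ennreal (A1 * B powr p * r powr (- p)) * Np p (cube a r) (\<lambda>x. u x - (b + \<zeta> *v x))"
    by (rule S.glue[OF L M r W]) (rule that; assumption)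
  show ?thesis using cell_lower[OF e r v(1), of \<zeta>] add_right_mono[OF v(2)] by (rule order_trans)
qed

text \<open>The gluing constant, with the gradient integral of the filling replaced by
  \<open>C0 / C\<close> times the growth bound, by coercivity.\<close>

definition A2 :: real where
  "A2 = A1 * (1 + C0 / C)"

lemma A2_nonneg: "A2 \<ge> 0"
  using A1_pos C0_pos C by (simp add: A2_def)

lemma W_hom_real: "W_hom p W \<xi> = ennreal (enn2real (W_hom p W \<xi>))"
  using le_less_trans[OF W_hom_bound ennreal_less_top, of \<xi>] by simp

text \<open>A nearly optimal filling of the unit cube for slope \<xi> is glued to the affine
  function of slope \<zeta>. The layer costs a multiple of \<open>1/M\<close>; the distance between
  the two functions is essentially that of the affine parts and enters with a factor that grows with
  the gradient bound \<open>B\<close> of the layers. The number \<open>M\<close> stays free: it is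
  fixed large before \<zeta> approaches \<xi>.\<close>

lemma W_hom_modulus:
  assumes M: "M \<ge> 1"
  shows "\<exists>D\<ge>0. \<forall>\<xi> \<zeta>. W_hom p W \<zeta> \<le> W_hom p W \<xi> + ennreal (A2 / real M * (1 + norm \<xi> powr p + norm \<zeta> powr p) + D * norm (\<xi> - \<zeta>) powr p)"
proof -
  let ?n = "CARD('n)" and ?Q = "cube (0::real^'n) 1"
  obtain B \<delta> and \<theta> :: "nat \<Rightarrow> real^'n \<Rightarrow> real" where L: "layers M B \<delta> \<theta>" using ex_layers[OF M] by blast
  \<comment> \<open>\<open>B powr p\<close> is the cutoff cost and \<open>2 powr p\<close> separates
    the filling \<open>v\<close> from the affine difference. In \<open>D\<close> the further factor
    bounds the norm of a point of the unit cube by \<open>CARD('n)\<close>.\<close>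
  define D1 where "D1 = A1 * B powr p * 2 powr p"
  have D1: "D1 \<ge> 0" using A1_pos by (simp add: D1_def)
  define D where "D = D1 * real ?n powr p"
  show ?thesis
  proof (intro exI[of _ D] conjI allI)
    show "D \<ge> 0" using D1 by (simp add: D_def)
    fix \<xi> \<zeta> :: "real^'n^'m"
    define w where "w = enn2real (W_hom p W \<xi>)"
    have w: "W_hom p W \<xi> = ennreal w" "w \<ge> 0" unfolding w_def using W_hom_real by auto
    have wC: "w \<le> C0 * (1 + norm \<xi> powr p)" using W_hom_bound[of \<xi>] C0_pos unfolding w(1) by (subst (asm) ennreal_le_iff) auto
    define X where "X = w + A1 / real M * (1 + norm \<zeta> powr p + w / C) + D * norm (\<xi> - \<zeta>) powr p"
    define Y where "Y = 3 + A1 / real M * (2 / C) + D1"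
    have XY: "X \<ge> 0" "Y \<ge> 0" using w(2) A1_pos C D1 \<open>D \<ge> 0\<close> by (auto simp: X_def Y_def)
    have main: "W_hom p W \<zeta> \<le> ennreal (X + \<tau> * Y)" if \<tau>: "\<tau> > 0" for \<tau>
    proof -
      have "W_hom p W \<xi> < ennreal (w + \<tau>)" using w \<tau> by (simp add: ennreal_less_iff)
      note cu = cell_upper[OF this zero_less_one \<tau>, of 0]
      have "((\<lambda>\<epsilon>. C0 * ((1 + 2 * \<epsilon>) ^ ?n - 1 ^ ?n) * (1 + norm \<zeta> powr p)) \<longlongrightarrow> C0 * ((1 + 2 * 0) ^ ?n - 1 ^ ?n) * (1 + norm \<zeta> powr p)) (at_right 0)"
        by (intro tendsto_intros)
      then have "\<forall>\<^sub>F \<epsilon> in at_right 0. C0 * ((1 + 2 * \<epsilon>) ^ ?n - 1 ^ ?n) * (1 + norm \<zeta> powr p) < \<tau>" using \<tau> by (intro order_tendstoD) auto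
      from eventually_happens'[OF trivial_limit_at_right_real eventually_conj[OF eventually_conj[OF cu this] eventually_at_right_less[of 0]]]
      obtain \<epsilon> v H where e: "\<epsilon> > 0" "C0 * ((1 + 2 * \<epsilon>) ^ ?n - 1 ^ ?n) * (1 + norm \<zeta> powr p) < \<tau>"
        and v: "Sob0 p ?Q v H" "energy (Wsc \<epsilon>) ?Q (\<lambda>x. \<xi> + H x) \<le> ennreal (1 ^ ?n) * ennreal (w + \<tau>) + ennreal \<tau>" "Np p UNIV v \<le> ennreal \<tau>"
        by blast
      interpret S: integrand "Wsc \<epsilon>" p C "\<epsilon> * s0" c by (rule scaled[OF e(1)])
      note [measurable] = Sob0_measurable[OF v(1)]
      have E: "energy (Wsc \<epsilon>) ?Q (\<lambda>x. \<xi> + H x) \<le> ennreal (w + 2 * \<tau>)"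
        using v(2) w(2) \<tau> by (simp add: ennreal_plus[symmetric] add_ac del: ennreal_plus)
      have Wk: "Wk p ?Q (\<lambda>x. (0 + \<xi> *v x) + v x) (\<lambda>x. \<xi> + H x)"
        by (intro Wk_add[OF Wk_affine[OF cube_basic(3) p0(2)] Sob0_Wk[OF v(1) p] p]) simp
      have NG: "Np p ?Q (\<lambda>x. \<xi> + H x) \<le> ennreal ((w + 2 * \<tau>) / C)"
      proof -
        have "ennreal C * Np p ?Q (\<lambda>x. \<xi> + H x) \<le> ennreal (w + 2 * \<tau>)" by (rule order_trans[OF S.energy_coercive E]) auto
        then have "ennreal (1 / C) * (ennreal C * Np p ?Q (\<lambda>x. \<xi> + H x)) \<le> ennreal (1 / C) * ennreal (w + 2 * \<tau>)" by (rule mult_left_mono) simp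
        then show ?thesis using C w(2) \<tau> by (simp add: mult.assoc[symmetric] ennreal_mult'[symmetric] del: ennreal_plus)
      qed
      have Nu: "Np p ?Q (\<lambda>x. ((0 + \<xi> *v x) + v x) - (0 + \<zeta> *v x)) \<le> ennreal (2 powr p * (real ?n powr p * norm (\<xi> - \<zeta>) powr p + \<tau>))"
      proof -
        have "Np p ?Q (\<lambda>x. ((0 + \<xi> *v x) + v x) - (0 + \<zeta> *v x)) = Np p ?Q (\<lambda>x. (\<xi> - \<zeta>) *v x + v x)"
          by (simp add: matrix_vector_mult_diff_rdistrib algebra_simps)
        also have "\<dots> \<le> ennreal (2 powr p) * (Np p ?Q (\<lambda>x. (\<xi> - \<zeta>) *v x) + Np p ?Q v)"
          using WkD(1)[OF Wk_affine[OF cube_basic(3) p0(2), of "0::real^'n" 1 0 "\<xi> - \<zeta>"]] by (intro Np_add) (auto simp: p0)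
        also have "\<dots> \<le> ennreal (2 powr p) * (ennreal (real ?n powr p * norm (\<xi> - \<zeta>) powr p) + ennreal \<tau>)"
        proof (intro mult_left_mono add_mono)
          have "Np p ?Q (\<lambda>x. (\<xi> - \<zeta>) *v x) \<le> Np p ?Q (\<lambda>x. real ?n *\<^sub>R (\<xi> - \<zeta>))"
          proof (rule Np_mono)
            fix x assume "x \<in> ?Q"
            then have "norm x \<le> real ?n * 1" by (intro norm_le_card) (auto simp: mem_cube abs_le_iff less_imp_le intro: order_trans[of _ 0])
            then have "norm (\<xi> - \<zeta>) * norm x \<le> norm (\<xi> - \<zeta>) * real ?n" by (intro mult_left_mono) auto
            then show "norm ((\<xi> - \<zeta>) *v x) \<le> norm (real ?n *\<^sub>R (\<xi> - \<zeta>))" using norm_matrix_vector_le[of "\<xi> - \<zeta>" x] by (simp add: mult.commute)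
          qed (use p0 in auto)
          also have "\<dots> = ennreal (real ?n powr p * norm (\<xi> - \<zeta>) powr p)"
            using emeasure_cube(1)[of 1 "0::real^'n"] by (simp add: Np_def nn_integral_cmult_indicator powr_mult)
          finally show "Np p ?Q (\<lambda>x. (\<xi> - \<zeta>) *v x) \<le> ennreal (real ?n powr p * norm (\<xi> - \<zeta>) powr p)" .
          show "Np p ?Q v \<le> ennreal \<tau>" using Np_set_mono[of ?Q UNIV p v] v(3) by simp
        qed auto
        finally show ?thesis using \<tau> by (simp add: ennreal_mult'[symmetric] ennreal_plus[symmetric] del: ennreal_plus)
      qed
      have "ennreal (1 ^ ?n) * W_hom p W \<zeta> \<le> ennreal (w + 2 * \<tau>)
          + ennreal (A1 / real M) * (ennreal (1 ^ ?n * (1 + norm \<zeta> powr p)) + ennreal ((w + 2 * \<tau>) / C))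
          + ennreal (A1 * B powr p * 1 powr (- p)) * ennreal (2 powr p * (real ?n powr p * norm (\<xi> - \<zeta>) powr p + \<tau>))
          + ennreal \<tau>"
        using e(2) by (intro order_trans[OF cell_glue[OF L M e(1) zero_less_one Wk, where b=0]] add_mono mult_left_mono E NG Nu ennreal_leI) auto
      also have "\<dots> = ennreal (X + \<tau> * Y)"
        using w(2) \<tau> A1_pos C M unfolding X_def Y_def D_def D1_def
        by (simp add: ennreal_mult'[symmetric] ennreal_plus[symmetric] del: ennreal_plus) (simp add: field_simps)
      finally show ?thesis by simp
    qed
    have "W_hom p W \<zeta> \<le> ennreal X"
    proof (rule ennreal_le_epsilon)
      fix e :: real assume e: "e > 0"
      have "e / (Y + 1) * Y \<le> e" using e XY(2) by (simp add: field_simps)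
      then have "ennreal (X + e / (Y + 1) * Y) \<le> ennreal (X + e)" by (intro ennreal_leI) simp
      also have "\<dots> = ennreal X + ennreal e" using e XY(1) by simp
      finally have "ennreal (X + e / (Y + 1) * Y) \<le> ennreal X + ennreal e" .
      moreover have "e / (Y + 1) > 0" using e XY by simp
      ultimately show "W_hom p W \<zeta> \<le> ennreal X + ennreal e" using main order_trans by blast
    qed
    also have "X \<le> w + (A2 / real M * (1 + norm \<xi> powr p + norm \<zeta> powr p) + D * norm (\<xi> - \<zeta>) powr p)"
    proof -
      have "w / C \<le> C0 / C * (1 + norm \<xi> powr p)" using wC C by (simp add: field_simps)
      also have "\<dots> \<le> C0 / C * (1 + norm \<xi> powr p + norm \<zeta> powr p)" using C0_pos C by (intro mult_left_mono) auto
      finally have "1 + norm \<zeta> powr p + w / C \<le> (1 + norm \<xi> powr p + norm \<zeta> powr p) + C0 / C * (1 + norm \<xi> powr p + norm \<zeta> powr p)"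
        by (intro add_mono) simp_all
      then have "A1 / real M * (1 + norm \<zeta> powr p + w / C) \<le> A1 / real M * ((1 + C0 / C) * (1 + norm \<xi> powr p + norm \<zeta> powr p))"
        using A1_pos by (intro mult_left_mono) (auto simp: algebra_simps)
      then show ?thesis by (simp add: X_def A2_def)
    qed
    finally show "W_hom p W \<zeta> \<le> W_hom p W \<xi> + ennreal (A2 / real M * (1 + norm \<xi> powr p + norm \<zeta> powr p) + D * norm (\<xi> - \<zeta>) powr p)"
      unfolding w(1) using w(2) A2_nonneg \<open>D \<ge> 0\<close> by (subst ennreal_plus[symmetric]) (auto intro: ennreal_leI)
  qed
qed

text \<open>By continuity: \<open>M\<close> is chosen so that the \<open>1/M\<close> part of the
  modulus is below the tolerance, and the remaining part vanishes as \<zeta> tends to \<xi>.\<close>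

lemma W_hom_measurable [measurable]: "W_hom p W \<in> borel_measurable borel"
proof -
  define w where "w \<xi> = enn2real (W_hom p W \<xi>)" for \<xi>
  have wr: "W_hom p W \<xi> = ennreal (w \<xi>)" and w0: "w \<xi> \<ge> 0" for \<xi> unfolding w_def by (rule W_hom_real) simp
  have "(w \<longlongrightarrow> w \<xi>) (at \<xi>)" for \<xi>
  proof (rule tendstoI)
    fix e :: real assume e: "e > 0"
    define N where "N = 1 + norm \<xi> powr p + norm \<xi> powr p"
    obtain M :: nat where M: "M \<ge> 1" "A2 / real M * N < e"
    proof -
      have N: "N > 0" unfolding N_def by (intro add_pos_nonneg) auto
      obtain k :: nat where k: "A2 * N / e < real k" using reals_Archimedean2 by blast
      have "A2 / real (Suc k) * N < e" using k e by (simp add: field_simps)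
      then show thesis using that[of "Suc k"] by simp
    qed
    obtain D where D: "D \<ge> 0" "\<And>\<xi> \<zeta>. W_hom p W \<zeta> \<le> W_hom p W \<xi> + ennreal (A2 / real M * (1 + norm \<xi> powr p + norm \<zeta> powr p) + D * norm (\<xi> - \<zeta>) powr p)"
      using W_hom_modulus[OF M(1)] by blast
    have lim: "((\<lambda>\<zeta>. A2 / real M * (1 + norm \<xi> powr p + norm \<zeta> powr p) + D * norm (\<xi> - \<zeta>) powr p) \<longlongrightarrow>
       A2 / real M * (1 + norm \<xi> powr p + norm \<xi> powr p) + D * norm (\<xi> - \<xi>) powr p) (at \<xi>)"
      by (intro tendsto_add tendsto_mult tendsto_powr' tendsto_norm tendsto_diff tendsto_const tendsto_ident_at) (use p0 in auto)
    then have "\<forall>\<^sub>F \<zeta> in at \<xi>. A2 / real M * (1 + norm \<xi> powr p + norm \<zeta> powr p) + D * norm (\<xi> - \<zeta>) powr p < e"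
      by (rule order_tendstoD(2)) (use M(2) p0 in \<open>simp add: N_def\<close>)
    then show "\<forall>\<^sub>F \<zeta> in at \<xi>. dist (w \<zeta>) (w \<xi>) < e"
    proof eventually_elim
      case (elim \<zeta>)
      let ?d = "A2 / real M * (1 + norm \<xi> powr p + norm \<zeta> powr p) + D * norm (\<xi> - \<zeta>) powr p"
      have d: "?d \<ge> 0" using A2_nonneg D(1) by simp
      have le: "w y \<le> w x + ?d" if "W_hom p W y \<le> W_hom p W x + ennreal ?d" for x y
        using that d unfolding wr by (simp add: ennreal_plus[symmetric] w0 del: ennreal_plus)
      have "w \<zeta> \<le> w \<xi> + ?d" using D(2) by (rule le)
      moreover have "w \<xi> \<le> w \<zeta> + ?d" using D(2)[of \<xi> \<zeta>] by (intro le) (simp add: add_ac norm_minus_commute)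
      ultimately show ?case using elim by (simp add: dist_real_def abs_less_iff)
    qed
  qed
  then have "continuous_on UNIV w" by (simp add: continuous_on_def)
  then have "(\<lambda>\<xi>. ennreal (w \<xi>)) \<in> borel_measurable borel" by (intro measurable_compose[OF borel_measurable_continuous_onI measurable_ennreal])
  then show ?thesis by (simp only: wr[abs_def, symmetric])
qed

end

subsection \<open>The lower bound\<close>

context hom_integrand
begin

text \<open>The integrated modulus. It is used in both directions: from the step function to the
  given gradient in the lower bound, and back in the construction of recovery sequences.\<close>

lemma W_hom_integral_le:
  assumes D: "D \<ge> 0" "\<And>\<xi> \<zeta>. W_hom p W \<zeta> \<le> W_hom p W \<xi> + ennreal (A2 / real M * (1 + norm \<xi> powr p + norm \<zeta> powr p) + D * norm (\<xi> - \<zeta>) powr p)"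
    and m[measurable]: "Lmeas G" "Lmeas Z" "U \<in> sets lebesgue"
  shows "(\<integral>\<^sup>+x\<in>U. W_hom p W (Z x) \<partial>lebesgue) \<le> (\<integral>\<^sup>+x\<in>U. W_hom p W (G x) \<partial>lebesgue) +
    (ennreal (A2 / real M) * (emeasure lebesgue U + Np p U G + Np p U Z) + ennreal D * Np p U (\<lambda>x. G x - Z x))"
proof -
  have [measurable]: "Lmeas (\<lambda>x. W_hom p W (F x))" if "Lmeas F" for F
    by (rule measurable_compose[OF that W_hom_measurable])
  have "(\<integral>\<^sup>+x\<in>U. W_hom p W (Z x) \<partial>lebesgue) \<le> (\<integral>\<^sup>+x. W_hom p W (G x) * indicator U x +
    (ennreal (A2 / real M) * (indicator U x + ennreal (norm (G x) powr p) * indicator U x + ennreal (norm (Z x) powr p) * indicator U x)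
     + ennreal D * (ennreal (norm (G x - Z x) powr p) * indicator U x)) \<partial>lebesgue)"
  proof (rule nn_integral_mono)
    fix x
    have "ennreal (A2 / real M * (1 + norm (G x) powr p + norm (Z x) powr p) + D * norm (G x - Z x) powr p) =
      ennreal (A2 / real M) * (1 + ennreal (norm (G x) powr p) + ennreal (norm (Z x) powr p)) + ennreal D * ennreal (norm (G x - Z x) powr p)"
    proof -
      have "ennreal (A2 / real M * (1 + norm (G x) powr p + norm (Z x) powr p)) = ennreal (A2 / real M) * ennreal (1 + norm (G x) powr p + norm (Z x) powr p)"
        using A2_nonneg by (intro ennreal_mult) auto
      then show ?thesis using A2_nonneg D(1) by (simp add: ennreal_mult'')
    qed
    then show "W_hom p W (Z x) * indicator U x \<le> W_hom p W (G x) * indicator U x +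
      (ennreal (A2 / real M) * (indicator U x + ennreal (norm (G x) powr p) * indicator U x + ennreal (norm (Z x) powr p) * indicator U x)
       + ennreal D * (ennreal (norm (G x - Z x) powr p) * indicator U x))"
      using D(2)[of "Z x" "G x"] by (cases "x \<in> U") simp_all
  qed
  also have "\<dots> = (\<integral>\<^sup>+x\<in>U. W_hom p W (G x) \<partial>lebesgue) +
    (ennreal (A2 / real M) * (emeasure lebesgue U + Np p U G + Np p U Z) + ennreal D * Np p U (\<lambda>x. G x - Z x))"
    unfolding Np_def by (simp add: nn_integral_add nn_integral_cmult)
  finally show ?thesis .
qed

text \<open>Only finitely many cubes are summed: the weights \<open>r i powr (- p)\<close>, which
  multiply the distance of \<open>u'\<close> to \<open>u\<close>, may have a divergent sum, and the
  frame errors vanish with \<epsilon> for each cube separately.\<close>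

lemma lower_sum:
  fixes u u' :: "real^'n \<Rightarrow> real^'m"
  assumes L: "layers M B \<delta> (\<theta> :: nat \<Rightarrow> real^'n \<Rightarrow> real)" and M: "M \<ge> 1" and e: "\<epsilon> > 0"
    and cv: "cube_cover U d a r" and U: "U \<in> sets lebesgue" and Wk: "Wk p U u' G'" and u: "Lmeas u"
    and aff: "(\<Sum>i. ennreal (r i powr (- p)) * Np p (cube (a i) (r i)) (\<lambda>x. u x - (b i + \<xi> i *v x))) \<le> ennreal \<eta>"
    and Z: "Lmeas Z" "\<And>i x. x \<in> cube (a i) (r i) \<Longrightarrow> Z x = \<xi> i"
  shows "(\<Sum>i<n. ennreal (r i ^ CARD('n)) * W_hom p W (\<xi> i)) \<le> energy (Wsc \<epsilon>) U G'
    + ennreal (A1 / real M) * ((emeasure lebesgue U + Np p U Z) + Np p U G')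
    + ennreal (A1 * B powr p * 2 powr p) * ((\<Sum>i<n. ennreal (r i powr (- p))) * Np p U (\<lambda>x. u' x - u x) + ennreal \<eta>)
    + (\<Sum>i<n. ennreal (C0 * ((r i + 2 * \<epsilon>) ^ CARD('n) - r i ^ CARD('n)) * (1 + norm (\<xi> i) powr p)))"
proof -
  interpret S: integrand "Wsc \<epsilon>" p C "\<epsilon> * s0" c by (rule scaled[OF e])
  note [measurable] = WkD(1,2)[OF Wk] u Z(1) U
  let ?Q = "\<lambda>i. cube (a i) (r i)"
  let ?T1 = "\<lambda>i. energy (Wsc \<epsilon>) (?Q i) G'"
  let ?T2 = "\<lambda>i. ennreal (r i ^ CARD('n) * (1 + norm (\<xi> i) powr p)) + Np p (?Q i) G'"
  let ?T3 = "\<lambda>i. ennreal (r i powr (- p)) * Np p U (\<lambda>x. u' x - u x) + ennreal (r i powr (- p)) * Np p (?Q i) (\<lambda>x. u x - (b i + \<xi> i *v x))"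
  let ?T4 = "\<lambda>i. ennreal (C0 * ((r i + 2 * \<epsilon>) ^ CARD('n) - r i ^ CARD('n)) * (1 + norm (\<xi> i) powr p))"
  have cell: "ennreal (r i ^ CARD('n)) * W_hom p W (\<xi> i) \<le> ?T1 i + ennreal (A1 / real M) * ?T2 i + ennreal (A1 * B powr p * 2 powr p) * ?T3 i + ?T4 i" for i
  proof (cases "r i > 0")
    case True
    have "Np p (?Q i) (\<lambda>x. u' x - (b i + \<xi> i *v x)) \<le> ennreal (2 powr p) * (Np p (?Q i) (\<lambda>x. u' x - u x) + Np p (?Q i) (\<lambda>x. u x - (b i + \<xi> i *v x)))"
      using WkD(1)[OF Wk_affine[OF cube_basic(3) p0(2), of "a i" "r i" "b i" "\<xi> i"]] by (intro Np_triangle p0) auto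
    also have "\<dots> \<le> ennreal (2 powr p) * (Np p U (\<lambda>x. u' x - u x) + Np p (?Q i) (\<lambda>x. u x - (b i + \<xi> i *v x)))"
      by (intro mult_left_mono add_right_mono Np_set_mono cube_coverD(4)[OF cv]) simp
    finally have "ennreal (A1 * B powr p * r i powr (- p)) * Np p (?Q i) (\<lambda>x. u' x - (b i + \<xi> i *v x)) \<le>
      ennreal (A1 * B powr p * r i powr (- p)) * (ennreal (2 powr p) * (Np p U (\<lambda>x. u' x - u x) + Np p (?Q i) (\<lambda>x. u x - (b i + \<xi> i *v x))))"
      by (rule mult_left_mono) simp
    also have "\<dots> = (ennreal (A1 * B powr p * r i powr (- p)) * ennreal (2 powr p)) * (Np p U (\<lambda>x. u' x - u x) + Np p (?Q i) (\<lambda>x. u x - (b i + \<xi> i *v x)))"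
      by (simp only: mult.assoc)
    also have "ennreal (A1 * B powr p * r i powr (- p)) * ennreal (2 powr p) = ennreal (A1 * B powr p * 2 powr p) * ennreal (r i powr (- p))"
      using A1_pos by (simp add: ennreal_mult'[symmetric] mult_ac)
    also have "ennreal (A1 * B powr p * 2 powr p) * ennreal (r i powr (- p)) * (Np p U (\<lambda>x. u' x - u x) + Np p (?Q i) (\<lambda>x. u x - (b i + \<xi> i *v x)))
        = ennreal (A1 * B powr p * 2 powr p) * ?T3 i" by (simp only: mult.assoc distrib_left)
    finally show ?thesis
      by (intro order_trans[OF cell_glue[OF L M e True Wk_mono[OF Wk cube_coverD(4)[OF cv]], where b="b i" and \<zeta>="\<xi> i"]] add_right_mono add_left_mono)
  next
    case False
    then have "r i = 0" using cube_coverD(1)[OF cv, of i] by simp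
    then show ?thesis by (simp add: zero_power)
  qed
  have "(\<Sum>i<n. ennreal (r i ^ CARD('n)) * W_hom p W (\<xi> i)) \<le> (\<Sum>i<n. ?T1 i) + ennreal (A1 / real M) * (\<Sum>i<n. ?T2 i)
     + ennreal (A1 * B powr p * 2 powr p) * (\<Sum>i<n. ?T3 i) + (\<Sum>i<n. ?T4 i)"
    unfolding sum_distrib_left sum.distrib[symmetric] by (intro sum_mono cell)
  also have "\<dots> \<le> energy (Wsc \<epsilon>) U G' + ennreal (A1 / real M) * ((emeasure lebesgue U + Np p U Z) + Np p U G')
    + ennreal (A1 * B powr p * 2 powr p) * ((\<Sum>i<n. ennreal (r i powr (- p))) * Np p U (\<lambda>x. u' x - u x) + ennreal \<eta>) + (\<Sum>i<n. ?T4 i)"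
  proof (intro add_right_mono add_mono mult_left_mono)
    show "(\<Sum>i<n. ?T1 i) \<le> energy (Wsc \<epsilon>) U G'"
      by (subst cover_integral[OF cv]) (auto intro!: sum_le_suminf)
    have "(\<Sum>i<n. ennreal (r i ^ CARD('n) * (1 + norm (\<xi> i) powr p))) \<le> emeasure lebesgue U + Np p U Z"
    proof -
      have "(\<Sum>i<n. ennreal (r i ^ CARD('n) * (1 + norm (\<xi> i) powr p))) \<le> (\<Sum>i. ennreal (r i ^ CARD('n) * (1 + norm (\<xi> i) powr p)))"
        by (intro sum_le_suminf) auto
      also have "\<dots> = (\<integral>\<^sup>+x\<in>U. ennreal (1 + norm (Z x) powr p) \<partial>lebesgue)"
        using cube_coverD(1)[OF cv] by (subst step_integral[OF cv Z, where g="\<lambda>\<xi>. ennreal (1 + norm \<xi> powr p)"]) (auto simp: ennreal_mult)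
      finally show ?thesis using nn_integral_one_plus_norm[OF Z(1) U] by simp
    qed
    moreover have "(\<Sum>i<n. Np p (?Q i) G') \<le> Np p U G'"
      unfolding Np_def by (subst cover_integral[OF cv]) (auto intro!: sum_le_suminf)
    ultimately show "(\<Sum>i<n. ?T2 i) \<le> (emeasure lebesgue U + Np p U Z) + Np p U G'" unfolding sum.distrib by (rule add_mono)
    have "(\<Sum>i<n. ennreal (r i powr (- p)) * Np p (?Q i) (\<lambda>x. u x - (b i + \<xi> i *v x))) \<le> ennreal \<eta>"
      by (rule order_trans[OF sum_le_suminf aff]) auto
    then show "(\<Sum>i<n. ?T3 i) \<le> (\<Sum>i<n. ennreal (r i powr (- p))) * Np p U (\<lambda>x. u' x - u x) + ennreal \<eta>"
      unfolding sum.distrib sum_distrib_right[symmetric] by (rule add_left_mono)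
  qed auto
  finally show ?thesis .
qed

lemma W1p_setup:
  fixes \<phi> :: "real^'n \<Rightarrow> real^'m"
  assumes U: "open U" "bounded U" and \<phi>: "W1p p U \<phi>"
  obtains u G m g where "Wk p U u G" "\<And>x. x \<in> U \<Longrightarrow> u x = \<phi> x" "I_hom p U W \<phi> = (\<integral>\<^sup>+x\<in>U. W_hom p W (G x) \<partial>lebesgue)"
    "emeasure lebesgue U = ennreal m" "m \<ge> 0" "Np p U G = ennreal g" "g \<ge> 0"
proof -
  note Wk = W1p_Wk[OF \<phi> U(1) p]
  obtain m where m: "emeasure lebesgue U = ennreal m" "m \<ge> 0"
    using fmeasurableD2[OF lmeasurable_open[OF U(2,1)]] by (cases "emeasure lebesgue U") blast+
  obtain g where g: "Np p U (\<lambda>x. indicator U x *\<^sub>R wgrad U \<phi> x) = ennreal g" "g \<ge> 0"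
    using WkD(4)[OF Wk] by (cases "Np p U (\<lambda>x. indicator U x *\<^sub>R wgrad U \<phi> x)") auto
  have hom: "I_hom p U W \<phi> = (\<integral>\<^sup>+x\<in>U. W_hom p W (indicator U x *\<^sub>R wgrad U \<phi> x) \<partial>lebesgue)"
    unfolding I_hom_def by (intro nn_integral_cong) (auto simp: indicator_def)
  show thesis by (rule that[OF Wk _ hom m g]) simp
qed

text \<open>Order of choices: first \<open>M\<close> with its layers and \<open>D\<close>, then the
  tolerance \<eta> and the cover, then the number \<open>n\<close> of cubes, and last \<epsilon>.
  The limits are undone in reverse: errors in \<epsilon> vanish for fixed \<open>n\<close>, then
  \<open>n\<close> and finally \<open>M\<close> tend to infinity.\<close>

lemma liminf_aux:
  fixes \<phi> :: "real^'n \<Rightarrow> real^'m"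
  assumes U: "open U" "bounded U" and \<phi>: "W1p p U \<phi>" and lim: "((\<lambda>\<epsilon>. Lp_dist p U (\<phi>s \<epsilon>) \<phi>) \<longlongrightarrow> 0) (at_right 0)"
    and t: "t \<ge> 0" "\<exists>\<^sub>F \<epsilon> in at_right 0. I_eps p U W \<epsilon> (\<phi>s \<epsilon>) < ennreal t"
  shows "I_hom p U W \<phi> \<le> ennreal t"
proof -
  obtain u G m g where Wk: "Wk p U u G" and u: "\<And>x. x \<in> U \<Longrightarrow> u x = \<phi> x" and hom: "I_hom p U W \<phi> = (\<integral>\<^sup>+x\<in>U. W_hom p W (G x) \<partial>lebesgue)"
    and m: "emeasure lebesgue U = ennreal m" "m \<ge> 0" and g: "Np p U G = ennreal g" "g \<ge> 0"
    by (rule W1p_setup[OF U \<phi>]) (rule that; assumption)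
  note [measurable] = WkD(1,2)[OF Wk]
  have Us[measurable]: "U \<in> sets lebesgue" using U(1) by simp
  define z where "z = 2 powr p * (g + 1)"
  have z: "z \<ge> 0" using g(2) by (simp add: z_def)
  define K where "K = A1 * ((m + z) + t / C) + A2 * (m + g + z) + 1"
  have K: "K \<ge> 0" unfolding K_def using A1_pos A2_nonneg m g z t C by (intro add_nonneg_nonneg mult_nonneg_nonneg) auto
  have main: "I_hom p U W \<phi> \<le> ennreal (t + K / real M)" if M: "M \<ge> 1" for M :: nat
  proof -
    obtain B \<delta> and \<theta> :: "nat \<Rightarrow> real^'n \<Rightarrow> real" where L: "layers M B \<delta> \<theta>" using ex_layers[OF M] by blast
    obtain D where D: "D \<ge> 0" "\<And>\<xi> \<zeta>. W_hom p W \<zeta> \<le> W_hom p W \<xi> + ennreal (A2 / real M * (1 + norm \<xi> powr p + norm \<zeta> powr p) + D * norm (\<xi> - \<zeta>) powr p)"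
      using W_hom_modulus[OF M] by blast
    define B1 where "B1 = A1 * B powr p * 2 powr p"
    have B1: "B1 \<ge> 0" using A1_pos by (simp add: B1_def)
    \<comment> \<open>The factors \<open>B1\<close> and \<open>D\<close> depend on \<open>M\<close>
      and may be large, so \<eta> is chosen after them; its total contribution is
      \<open>1 / real M\<close>, the summand 1 in \<open>K\<close>.\<close>
    obtain \<eta> where \<eta>: "\<eta> > 0" "\<eta> \<le> 1" "(B1 + D) * \<eta> \<le> 1 / real M"
      using ex_small_factor[of "B1 + D" "1 / real M"] B1 D(1) M by auto
    from affine_cover[OF Wk U p zero_less_one \<eta>(1)] obtain a r \<xi> b where cv: "cube_cover U 1 a r"
      and A: "(\<Sum>i. Np p (cube (a i) (r i)) (\<lambda>x. G x - \<xi> i)) \<le> ennreal \<eta>"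
        "(\<Sum>i. ennreal (r i powr (- p)) * Np p (cube (a i) (r i)) (\<lambda>x. u x - (b i + \<xi> i *v x))) \<le> ennreal \<eta>" by blast
    obtain Z where Z: "Lmeas Z" "\<And>i x. x \<in> cube (a i) (r i) \<Longrightarrow> Z x = \<xi> i"
      by (rule ex_step[OF cv]) (rule that; assumption)
    note [measurable] = Z(1)
    have NGZ: "Np p U (\<lambda>x. Z x - G x) \<le> ennreal \<eta>"
    proof -
      have "Np p U (\<lambda>x. Z x - G x) = (\<Sum>i. Np p (cube (a i) (r i)) (\<lambda>x. Z x - G x))"
        unfolding Np_def by (rule cover_integral[OF cv]) auto
      also have "\<dots> = (\<Sum>i. Np p (cube (a i) (r i)) (\<lambda>x. G x - \<xi> i))"
        using Z(2) by (intro arg_cong[where f=suminf] ext) (auto simp: Np_def indicator_def norm_minus_commute intro!: nn_integral_cong)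
      finally show ?thesis using A(1) by simp
    qed
    have NZ: "Np p U Z \<le> ennreal z"
    proof -
      have "Np p U (\<lambda>x. (Z x - G x) + G x) \<le> ennreal (2 powr p) * (Np p U (\<lambda>x. Z x - G x) + Np p U G)" using p0 by (intro Np_add) auto
      also have "\<dots> \<le> ennreal (2 powr p) * (ennreal 1 + ennreal g)"
        using g(1) \<eta>(2) by (intro mult_left_mono add_mono order_trans[OF NGZ] ennreal_leI) auto
      also have "\<dots> = ennreal z" unfolding z_def using g(2) by (simp add: ennreal_mult' add.commute ennreal_plus)
      finally show ?thesis by simp
    qed
    have head: "(\<Sum>i<n. ennreal (r i ^ CARD('n)) * W_hom p W (\<xi> i)) \<le> ennreal (t + A1 / real M * ((m + z) + t / C) + B1 * \<eta>)" for n
    proof (rule ennreal_le_epsilon)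
      fix e :: real assume e: "e > 0"
      let ?R1 = "\<lambda>\<epsilon>. ennreal B1 * (\<Sum>i<n. ennreal (r i powr (- p))) * Lp_dist p U (\<phi>s \<epsilon>) \<phi>"
      let ?R2 = "\<lambda>\<epsilon>. \<Sum>i<n. ennreal (C0 * ((r i + 2 * \<epsilon>) ^ CARD('n) - r i ^ CARD('n)) * (1 + norm (\<xi> i) powr p))"
      have "(?R1 \<longlongrightarrow> ennreal B1 * (\<Sum>i<n. ennreal (r i powr (- p))) * 0) (at_right 0)"
        by (intro ennreal_tendsto_cmult lim) (auto simp: ennreal_mult_less_top)
      moreover have "(?R2 \<longlongrightarrow> (\<Sum>i<n. ennreal (C0 * ((r i + 2 * 0) ^ CARD('n) - r i ^ CARD('n)) * (1 + norm (\<xi> i) powr p)))) (at_right 0)"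
        by (intro tendsto_intros)
      ultimately have "((\<lambda>\<epsilon>. ?R1 \<epsilon> + ?R2 \<epsilon>) \<longlongrightarrow> 0) (at_right 0)" using tendsto_add by fastforce
      then have "\<forall>\<^sub>F \<epsilon> in at_right 0. ?R1 \<epsilon> + ?R2 \<epsilon> < ennreal e" using e by (intro order_tendstoD) auto
      \<comment> \<open>One single \<epsilon> with energy below \<open>t\<close> and small errors is
        enough; no subsequence is extracted.\<close>
      from frequently_ex[OF frequently_eventually_conj[OF t(2) eventually_conj[OF this eventually_at_right_less[of 0]]]]
      obtain \<epsilon> where \<epsilon>: "\<epsilon> > 0" "I_eps p U W \<epsilon> (\<phi>s \<epsilon>) < ennreal t" "?R1 \<epsilon> + ?R2 \<epsilon> < ennreal e" by blast
      interpret S: integrand "Wsc \<epsilon>" p C "\<epsilon> * s0" c by (rule scaled[OF \<epsilon>(1)])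
      define u' where "u' x = indicator U x *\<^sub>R \<phi>s \<epsilon> x" for x
      define G' where "G' x = indicator U x *\<^sub>R wgrad U (\<phi>s \<epsilon>) x" for x
      \<comment> \<open>The functional is infinite off the Sobolev space, so finite energy yields
        membership.\<close>
      have W1: "W1p p U (\<phi>s \<epsilon>)" using \<epsilon>(2) by (auto simp: I_eps_def split: if_splits)
      have Wk': "Wk p U u' G'" unfolding u'_def[abs_def] G'_def[abs_def] by (rule W1p_Wk[OF W1 U(1) p])
      note [measurable] = WkD(2)[OF Wk']
      have E: "energy (Wsc \<epsilon>) U G' \<le> ennreal t"
      proof -
        have "energy (Wsc \<epsilon>) U G' = I_eps p U W \<epsilon> (\<phi>s \<epsilon>)"
          using W1 unfolding I_eps_def by (auto simp: G'_def indicator_def intro!: nn_integral_cong)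
        then show ?thesis using \<epsilon>(2) by simp
      qed
      have NG': "Np p U G' \<le> ennreal (t / C)"
      proof -
        have "ennreal C * Np p U G' \<le> ennreal t" by (rule order_trans[OF S.energy_coercive E]) auto
        then have "ennreal (1 / C) * (ennreal C * Np p U G') \<le> ennreal (1 / C) * ennreal t" by (rule mult_left_mono) simp
        then show ?thesis using C t(1) by (simp add: mult.assoc[symmetric] ennreal_mult'[symmetric])
      qed
      have d: "Np p U (\<lambda>x. u' x - u x) = Lp_dist p U (\<phi>s \<epsilon>) \<phi>"
        unfolding Lp_dist_Np by (auto simp: Np_def u'_def u indicator_def intro!: nn_integral_cong)
      have "(\<Sum>i<n. ennreal (r i ^ CARD('n)) * W_hom p W (\<xi> i)) \<le> ennreal t + ennreal (A1 / real M) * ((ennreal m + ennreal z) + ennreal (t / C))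
          + ennreal B1 * ((\<Sum>i<n. ennreal (r i powr (- p))) * Lp_dist p U (\<phi>s \<epsilon>) \<phi> + ennreal \<eta>) + ?R2 \<epsilon>"
        using lower_sum[OF L M \<epsilon>(1) cv Us Wk' WkD(1)[OF Wk] A(2) Z, of n] unfolding d m(1) B1_def[symmetric]
        by (rule order_trans) (assumption, intro add_right_mono add_mono mult_left_mono E NG' NZ order_refl zero_le)
      also have "\<dots> = (ennreal t + ennreal (A1 / real M) * ((ennreal m + ennreal z) + ennreal (t / C)) + ennreal B1 * ennreal \<eta>) + (?R1 \<epsilon> + ?R2 \<epsilon>)"
        by (simp only: distrib_left mult.assoc add_ac)
      also have "\<dots> \<le> ennreal (t + A1 / real M * ((m + z) + t / C) + B1 * \<eta>) + ennreal e"
      proof (rule add_mono)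
        show "ennreal t + ennreal (A1 / real M) * ((ennreal m + ennreal z) + ennreal (t / C)) + ennreal B1 * ennreal \<eta>
            \<le> ennreal (t + A1 / real M * ((m + z) + t / C) + B1 * \<eta>)"
          using t(1) m z C A1_pos B1 \<eta>(1) by (simp add: ennreal_mult'[symmetric] ennreal_plus[symmetric] del: ennreal_plus)
        show "?R1 \<epsilon> + ?R2 \<epsilon> \<le> ennreal e" using \<epsilon>(3) by simp
      qed
      finally show "(\<Sum>i<n. ennreal (r i ^ CARD('n)) * W_hom p W (\<xi> i)) \<le> ennreal (t + A1 / real M * ((m + z) + t / C) + B1 * \<eta>) + ennreal e" .
    qed
    have "(\<integral>\<^sup>+x\<in>U. W_hom p W (Z x) \<partial>lebesgue) \<le> ennreal (t + A1 / real M * ((m + z) + t / C) + B1 * \<eta>)"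
    proof -
      have "(\<integral>\<^sup>+x\<in>U. W_hom p W (Z x) \<partial>lebesgue) = (\<Sum>i. ennreal (r i ^ CARD('n)) * W_hom p W (\<xi> i))"
        by (rule step_integral[OF cv Z W_hom_measurable])
      also have "\<dots> \<le> ennreal (t + A1 / real M * ((m + z) + t / C) + B1 * \<eta>)" by (rule suminf_le_const) (use head in auto)
      finally show ?thesis .
    qed
    then have "I_hom p U W \<phi> \<le> ennreal (t + A1 / real M * ((m + z) + t / C) + B1 * \<eta>)
        + (ennreal (A2 / real M) * (ennreal m + ennreal z + ennreal g) + ennreal D * ennreal \<eta>)"
      unfolding hom using m(1) g(1)
      by (intro order_trans[OF W_hom_integral_le[OF D Z(1) WkD(2)[OF Wk] Us]] add_mono mult_left_mono NGZ NZ) auto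
    also have "\<dots> = ennreal ((t + A1 / real M * ((m + z) + t / C) + B1 * \<eta>) + (A2 / real M * (m + z + g) + D * \<eta>))"
      using t(1) m z g C A1_pos A2_nonneg B1 D(1) \<eta>(1) by (simp add: ennreal_mult'[symmetric] ennreal_plus[symmetric] del: ennreal_plus)
    also have "\<dots> \<le> ennreal (t + K / real M)"
      using \<eta>(3) by (intro ennreal_leI) (simp add: K_def add_divide_distrib algebra_simps)
    finally show ?thesis .
  qed
  show ?thesis
  proof (rule ennreal_le_epsilon)
    fix e :: real assume e: "e > 0"
    obtain k :: nat where k: "K / e < real k" using reals_Archimedean2 by blast
    have "K / real (Suc k) \<le> e" using k e by (simp add: field_simps)
    then have "ennreal (t + K / real (Suc k)) \<le> ennreal (t + e)" by (intro ennreal_leI) simp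
    then show "I_hom p U W \<phi> \<le> ennreal t + ennreal e" using main[of "Suc k"] t(1) e by simp
  qed
qed

lemma liminf_inequality:
  fixes \<phi> :: "real^'n \<Rightarrow> real^'m"
  assumes U: "open U" "bounded U" and \<phi>: "W1p p U \<phi>" and lim: "((\<lambda>\<epsilon>. Lp_dist p U (\<phi>s \<epsilon>) \<phi>) \<longlongrightarrow> 0) (at_right 0)"
  shows "I_hom p U W \<phi> \<le> Liminf (at_right 0) (\<lambda>\<epsilon>. I_eps p U W \<epsilon> (\<phi>s \<epsilon>))" (is "_ \<le> ?l")
proof (rule ennreal_le_epsilon)
  fix e :: real assume e: "e > 0" and "?l < top"
  then obtain l where l: "?l = ennreal l" "l \<ge> 0" by (cases ?l) auto
  have "\<exists>\<^sub>F \<epsilon> in at_right 0. I_eps p U W \<epsilon> (\<phi>s \<epsilon>) < ennreal (l + e)"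
  proof (rule ccontr)
    assume "\<not> ?thesis"
    then have "\<forall>\<^sub>F \<epsilon> in at_right 0. ennreal (l + e) \<le> I_eps p U W \<epsilon> (\<phi>s \<epsilon>)" by (simp add: not_frequently not_less)
    then have "ennreal (l + e) \<le> ?l" by (rule Liminf_bounded)
    then show False using l e by (simp del: ennreal_plus)
  qed
  from liminf_aux[OF U \<phi> lim _ this] show "I_hom p U W \<phi> \<le> ?l + ennreal e" using l e by simp
qed

end

subsection \<open>Recovery sequences\<close>

text \<open>The tail is written as a series with masked terms so that it can be added to other
  series term by term.\<close>

lemma ennreal_small_tail:
  fixes f :: "nat \<Rightarrow> ennreal"
  assumes s: "(\<Sum>i. f i) < \<infinity>" and e: "e > 0"
  shows "\<exists>n. (\<Sum>i. if i < n then 0 else f i) \<le> ennreal e"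
proof -
  have "(\<Sum>i. f i) < (\<Sum>i. f i) + ennreal e" using s e by (simp add: ennreal_zero_less_top)
  have "\<exists>n. (\<Sum>i. f i) \<le> (\<Sum>i<n. f i) + ennreal e"
  proof -
    have "(\<lambda>n. (\<Sum>i<n. f i) + ennreal e) \<longlonglongrightarrow> (\<Sum>i. f i) + ennreal e"
      by (intro tendsto_add summable_LIMSEQ tendsto_const) simp
    then have "\<forall>\<^sub>F n in sequentially. (\<Sum>i. f i) < (\<Sum>i<n. f i) + ennreal e"
      by (rule order_tendstoD(1)) fact
    then show ?thesis by (auto simp: eventually_sequentially intro: less_imp_le)
  qed
  then obtain n where n: "(\<Sum>i. f i) \<le> (\<Sum>i<n. f i) + ennreal e" ..
  have "(\<Sum>i. f i) = (\<Sum>i. (if i < n then f i else 0) + (if i < n then 0 else f i))"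
    by (intro arg_cong[where f=suminf] ext) simp
  also have "\<dots> = (\<Sum>i. if i < n then f i else 0) + (\<Sum>i. if i < n then 0 else f i)"
    by (rule suminf_add[symmetric]) auto
  also have "(\<Sum>i. if i < n then f i else 0) = (\<Sum>i<n. f i)"
    by (subst suminf_finite[of "{..<n}"]) auto
  finally have "(\<Sum>i<n. f i) + (\<Sum>i. if i < n then 0 else f i) \<le> (\<Sum>i<n. f i) + ennreal e" using n by simp
  moreover have "(\<Sum>i<n. f i) < \<infinity>" by (rule le_less_trans[OF sum_le_suminf s]) auto
  ultimately show ?thesis unfolding ennreal_add_left_cancel_le by (metis less_irrefl)
qed

lemma ennreal_tendsto_0I:
  fixes f :: "'a \<Rightarrow> ennreal"
  assumes "\<And>e. e > 0 \<Longrightarrow> \<forall>\<^sub>F x in F. f x \<le> ennreal e"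
  shows "(f \<longlongrightarrow> 0) F"
proof (rule order_tendstoI)
  fix a :: ennreal assume "0 < a"
  then obtain y where y: "0 < y" "y < a" using dense by blast
  then obtain e where e: "y = ennreal e" by (cases y) auto
  then have "e > 0" using y(1) by simp
  from assms[OF this] show "\<forall>\<^sub>F x in F. f x < a"
    by (rule eventually_mono) (use y(2) e in auto)
qed simp

text \<open>For each \<epsilon> a nearly optimal element for the worse of the two errors is taken,
  within \<epsilon> of the infimum. This one choice serves all tolerances \<open>e\<close> at once,
  so no sequence of thresholds for the continuous parameter has to be managed.\<close>

lemma ex_diagonal_family:
  fixes A :: "'a \<Rightarrow> ennreal" and B :: "real \<Rightarrow> 'a \<Rightarrow> ennreal"
  assumes P: "P \<psi>0" and b: "b < \<infinity>"
    and ex: "\<And>e. e > 0 \<Longrightarrow> \<forall>\<^sub>F \<epsilon> in at_right 0. \<exists>\<psi>. P \<psi> \<and> A \<psi> \<le> ennreal e \<and> B \<epsilon> \<psi> \<le> b + ennreal e"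
  obtains \<phi>s where "\<And>\<epsilon>. \<epsilon> > 0 \<Longrightarrow> P (\<phi>s \<epsilon>)" "((\<lambda>\<epsilon>. A (\<phi>s \<epsilon>)) \<longlongrightarrow> 0) (at_right 0)" "Limsup (at_right 0) (\<lambda>\<epsilon>. B \<epsilon> (\<phi>s \<epsilon>)) \<le> b"
proof -
  \<comment> \<open>Subtraction is truncated, so the second entry is the excess of \<open>B\<close>
    over \<open>b\<close> and is 0 when there is none.\<close>
  define err where "err \<epsilon> \<psi> = max (A \<psi>) (B \<epsilon> \<psi> - b)" for \<epsilon> \<psi>
  define m where "m \<epsilon> = (INF \<psi>\<in>Collect P. err \<epsilon> \<psi>)" for \<epsilon>
  have "\<exists>\<psi>. P \<psi> \<and> (\<epsilon> > 0 \<longrightarrow> err \<epsilon> \<psi> \<le> m \<epsilon> + ennreal \<epsilon>)" for \<epsilon>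
  proof (cases "m \<epsilon> < \<infinity> \<and> \<epsilon> > 0")
    case True
    then have "m \<epsilon> < m \<epsilon> + ennreal \<epsilon>" by (simp add: less_top)
    then obtain \<psi> where "P \<psi>" "err \<epsilon> \<psi> < m \<epsilon> + ennreal \<epsilon>" unfolding m_def INF_less_iff by auto
    then show ?thesis by (auto intro: less_imp_le)
  next
    case False
    then have "\<epsilon> > 0 \<Longrightarrow> m \<epsilon> = \<infinity>" by (metis infinity_ennreal_def top.not_eq_extremum)
    then show ?thesis using P by (intro exI[of _ \<psi>0]) auto
  qed
  then have "\<forall>\<epsilon>. \<exists>\<psi>. P \<psi> \<and> (\<epsilon> > 0 \<longrightarrow> err \<epsilon> \<psi> \<le> m \<epsilon> + ennreal \<epsilon>)" ..
  from choice[OF this] obtain \<phi>s where \<phi>s: "\<forall>\<epsilon>. P (\<phi>s \<epsilon>) \<and> (\<epsilon> > 0 \<longrightarrow> err \<epsilon> (\<phi>s \<epsilon>) \<le> m \<epsilon> + ennreal \<epsilon>)" ..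
  have small: "\<forall>\<^sub>F \<epsilon> in at_right 0. A (\<phi>s \<epsilon>) \<le> ennreal e \<and> B \<epsilon> (\<phi>s \<epsilon>) \<le> b + ennreal e" if e: "e > 0" for e
  proof -
    have e2: "e / 2 > 0" using e by simp
    have "\<forall>\<^sub>F \<epsilon> in at_right 0. \<epsilon> < e / 2" using e2 by (intro order_tendstoD(2)[OF tendsto_ident_at])
    then show ?thesis using ex[OF e2] eventually_at_right_less[of 0]
    proof eventually_elim
      case (elim \<epsilon>)
      obtain \<psi> where \<psi>: "P \<psi>" "A \<psi> \<le> ennreal (e / 2)" "B \<epsilon> \<psi> \<le> b + ennreal (e / 2)" using elim(2) by blast
      have "m \<epsilon> \<le> err \<epsilon> \<psi>" unfolding m_def using \<psi>(1) by (intro INF_lower) simp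
      also have "\<dots> \<le> ennreal (e / 2)" using \<psi>(2,3) b by (simp add: err_def ennreal_minus_le_iff less_top)
      finally have "err \<epsilon> (\<phi>s \<epsilon>) \<le> ennreal (e / 2) + ennreal (e / 2)"
        using \<phi>s[rule_format, THEN conjunct2, rule_format, OF elim(3)] elim(1) by (meson add_mono ennreal_leI less_imp_le order_trans)
      also have "\<dots> = ennreal e" using e by (subst ennreal_plus[symmetric]) auto
      finally have "err \<epsilon> (\<phi>s \<epsilon>) \<le> ennreal e" .
      then show ?case using b by (simp add: err_def ennreal_minus_le_iff less_top)
    qed
  qed
  show thesis
  proof
    show "P (\<phi>s \<epsilon>)" for \<epsilon> using \<phi>s by blast
    show "((\<lambda>\<epsilon>. A (\<phi>s \<epsilon>)) \<longlongrightarrow> 0) (at_right 0)"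
      by (rule ennreal_tendsto_0I) (rule eventually_mono[OF small], auto)
    show "Limsup (at_right 0) (\<lambda>\<epsilon>. B \<epsilon> (\<phi>s \<epsilon>)) \<le> b"
      by (rule ennreal_le_epsilon, rule Limsup_bounded, rule eventually_mono[OF small]) auto
  qed
qed

context hom_integrand
begin

lemma W_hom_integral_finite:
  assumes "Wk p U u G" "open U" "bounded U"
  shows "(\<integral>\<^sup>+x\<in>U. W_hom p W (G x) \<partial>lebesgue) < \<infinity>"
proof -
  have [measurable]: "U \<in> sets lebesgue" using assms(2) by simp
  note [measurable] = WkD(2)[OF assms(1)]
  have "(\<integral>\<^sup>+x\<in>U. W_hom p W (G x) \<partial>lebesgue) \<le> (\<integral>\<^sup>+x. ennreal C0 * (ennreal (1 + norm (G x) powr p) * indicator U x) \<partial>lebesgue)"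
    using W_hom_bound C0_pos by (intro nn_integral_mono) (auto simp: indicator_def ennreal_mult'[symmetric] simp del: ennreal_plus)
  also have "\<dots> = ennreal C0 * (\<integral>\<^sup>+x\<in>U. ennreal (1 + norm (G x) powr p) \<partial>lebesgue)" by (rule nn_integral_cmult) measurable
  also have "\<dots> = ennreal C0 * (emeasure lebesgue U + Np p U G)" by (subst nn_integral_one_plus_norm) auto
  also have "\<dots> < \<infinity>" using WkD(4)[OF assms(1)] fmeasurableD2[OF lmeasurable_open[OF assms(3,2)]]
    by (auto simp: ennreal_mult_less_top top.not_eq_extremum)
  finally show ?thesis .
qed

text \<open>\<open>cell_upper\<close> holds for small \<epsilon> on each cube separately, with no
  uniformity over infinitely many cubes. Hence finitely many cubes receive periodic fillings, and
  the others, which carry little of the growth bound, receive rough competitors available for every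
  \<epsilon>.\<close>

lemma recovery:
  fixes \<phi> :: "real^'n \<Rightarrow> real^'m"
  assumes U: "open U" "bounded U" and \<phi>: "W1p p U \<phi>" and e: "e > 0"
  shows "\<forall>\<^sub>F \<epsilon> in at_right 0. \<exists>\<psi>. Lp p U \<psi> \<and> Lp_dist p U \<psi> \<phi> \<le> ennreal e \<and> I_eps p U W \<epsilon> \<psi> \<le> I_hom p U W \<phi> + ennreal e"
proof -
  let ?n = "CARD('n)"
  obtain u G m g where Wk: "Wk p U u G" and u: "\<And>x. x \<in> U \<Longrightarrow> u x = \<phi> x" and hom: "I_hom p U W \<phi> = (\<integral>\<^sup>+x\<in>U. W_hom p W (G x) \<partial>lebesgue)"
    and m: "emeasure lebesgue U = ennreal m" "m \<ge> 0" and g: "Np p U G = ennreal g" "g \<ge> 0"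
    by (rule W1p_setup[OF U \<phi>]) (rule that; assumption)
  note [measurable] = WkD(1,2)[OF Wk]
  have Us[measurable]: "U \<in> sets lebesgue" using U(1) by simp
  define z where "z = 2 powr p * (g + 1)"
  have z: "z \<ge> 0" using g(2) by (simp add: z_def)
  obtain h where h: "I_hom p U W \<phi> = ennreal h" "h \<ge> 0"
    using W_hom_integral_finite[OF Wk U] unfolding hom[symmetric] by (cases "I_hom p U W \<phi>") auto
  obtain M :: nat where M: "M \<ge> 1" "A2 / real M * (m + g + z) \<le> e / 4"
  proof -
    obtain k :: nat where k: "A2 * (m + g + z) * 4 / e < real k" using reals_Archimedean2 by blast
    have "A2 / real (Suc k) * (m + g + z) \<le> e / 4" using k e by (simp add: field_simps)
    then show thesis using that[of "Suc k"] by simp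
  qed
  obtain D where D: "D \<ge> 0" "\<And>\<xi> \<zeta>. W_hom p W \<zeta> \<le> W_hom p W \<xi> + ennreal (A2 / real M * (1 + norm \<xi> powr p + norm \<zeta> powr p) + D * norm (\<xi> - \<zeta>) powr p)"
    using W_hom_modulus[OF M(1)] by blast
  \<comment> \<open>The bound that \<open>paste\<close> will give for the gradient of the
    correction, with total energy \<open>h + e\<close> and \<open>Np p U Z\<close> at most
    \<open>z\<close>.\<close>
  define K where "K = 2 powr p * ((h + e) / C + z)"
  have K: "K \<ge> 0" using h e C z by (simp add: K_def)
  obtain \<eta> where \<eta>: "\<eta> > 0" "\<eta> \<le> 1" "D * \<eta> \<le> e / 4" "2 powr p * \<eta> \<le> e / 2"
  proof -
    obtain \<eta> where \<eta>: "\<eta> > 0" "\<eta> \<le> 1" "(D + 2 powr p) * \<eta> \<le> e / 4" using ex_small_factor[of "D + 2 powr p" "e / 4"] D(1) e by auto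
    then have "D * \<eta> + 2 powr p * \<eta> \<le> e / 4" "0 \<le> D * \<eta>" "0 \<le> 2 powr p * \<eta>" using D(1) by (simp_all add: distrib_right)
    then show thesis using e by (intro that[OF \<eta>(1,2)]) linarith+
  qed
  \<comment> \<open>An upper bound for the sides of the cubes: by Friedrichs' inequality on each
    cube, corrections with gradient integral at most \<open>K\<close> are then small in
    \<open>L^p\<close>.\<close>
  obtain s where s: "s > 0" "2 powr p * (4 powr p * s powr p * K) < e / 2"
  proof -
    have "((\<lambda>s. s powr p) \<longlongrightarrow> 0 powr p) (at_right 0)"
      using p0 eventually_at_right_less[of "0::real"] by (intro tendsto_powr' tendsto_intros) (auto elim: eventually_mono)
    then have "((\<lambda>s. 2 powr p * (4 powr p * s powr p * K)) \<longlongrightarrow> 2 powr p * (4 powr p * 0 powr p * K)) (at_right 0)"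
      by (intro tendsto_mult tendsto_const)
    then have "\<forall>\<^sub>F s in at_right 0. 2 powr p * (4 powr p * s powr p * K) < e / 2" using e p0 by (intro order_tendstoD) auto
    from eventually_happens'[OF trivial_limit_at_right_real eventually_conj[OF eventually_at_right_less this]] show thesis using that by blast
  qed
  from piecewise_affine[OF Wk U p \<eta>(1) s(1)] obtain v H a r \<xi> where v: "Sob0 p U v H" "Np p UNIV v \<le> ennreal \<eta>" "Np p UNIV H \<le> ennreal \<eta>"
    and cv: "cube_cover U s a r" and aff: "\<forall>i. \<forall>x\<in>cube (a i) (r i). G x + H x = \<xi> i" by blast
  note [measurable] = Sob0_measurable[OF v(1)]
  let ?Q = "\<lambda>i. cube (a i) (r i)"
  define Z where "Z x = G x + H x" for x
  have Z: "Lmeas Z" "\<And>i x. x \<in> ?Q i \<Longrightarrow> Z x = \<xi> i" unfolding Z_def using aff by auto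
  note [measurable] = Z(1)
  have si: "(\<integral>\<^sup>+x\<in>U. q (Z x) \<partial>lebesgue) = (\<Sum>i. ennreal (r i ^ ?n) * q (\<xi> i))" if "q \<in> borel_measurable borel" for q
    by (rule step_integral[OF cv Z that])
  have NH: "Np p U H \<le> ennreal \<eta>" using Np_set_mono[of U UNIV p H] v(3) by simp
  have NZ: "Np p U Z \<le> ennreal z"
  proof -
    have "Np p U Z \<le> ennreal (2 powr p) * (Np p U G + Np p U H)" unfolding Z_def using p0 by (intro Np_add) auto
    also have "\<dots> \<le> ennreal (2 powr p) * (ennreal g + ennreal 1)"
      using g(1) \<eta>(2) by (intro mult_left_mono add_mono order_trans[OF NH] ennreal_leI) auto
    also have "\<dots> = ennreal z" unfolding z_def using g(2) by (simp add: ennreal_mult' ennreal_plus)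
    finally show ?thesis .
  qed
  have WZ: "(\<Sum>i. ennreal (r i ^ ?n) * W_hom p W (\<xi> i)) \<le> ennreal (h + e / 2)"
  proof -
    have "Np p U (\<lambda>x. G x - Z x) \<le> ennreal \<eta>" using NH by (simp add: Z_def Np_def)
    then have "(\<integral>\<^sup>+x\<in>U. W_hom p W (Z x) \<partial>lebesgue) \<le> ennreal h + (ennreal (A2 / real M) * (ennreal m + ennreal g + ennreal z) + ennreal D * ennreal \<eta>)"
      using W_hom_integral_le[OF D WkD(2)[OF Wk] Z(1) Us] unfolding hom[symmetric] h(1) m(1) g(1)
      by (rule_tac order_trans) (assumption, intro add_left_mono add_mono mult_left_mono NZ order_refl zero_le)
    also have "\<dots> = ennreal (h + (A2 / real M * (m + g + z) + D * \<eta>))"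
      using h m g z D(1) \<eta>(1) A2_nonneg by (simp add: ennreal_mult'[symmetric] ennreal_plus[symmetric] del: ennreal_plus)
    also have "\<dots> \<le> ennreal (h + e / 2)" using M(2) \<eta>(3) by (intro ennreal_leI) linarith
    finally show ?thesis unfolding si[OF W_hom_measurable] .
  qed
  define f where "f i = ennreal (C0 * r i ^ ?n * (1 + norm (\<xi> i) powr p))" for i
  have "(\<Sum>i. f i) < \<infinity>"
  proof -
    have "(\<Sum>i. f i) = (\<Sum>i. ennreal C0 * (ennreal (r i ^ ?n) * ennreal (1 + norm (\<xi> i) powr p)))"
      unfolding f_def using C0_pos cube_coverD(1)[OF cv] by (simp add: ennreal_mult'[symmetric] mult.assoc del: ennreal_plus)
    also have "\<dots> = ennreal C0 * (\<integral>\<^sup>+x\<in>U. ennreal (1 + norm (Z x) powr p) \<partial>lebesgue)"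
      by (subst si[of "\<lambda>\<xi>. ennreal (1 + norm \<xi> powr p)"]) auto
    also have "\<dots> = ennreal C0 * (ennreal m + Np p U Z)" using nn_integral_one_plus_norm[OF Z(1) Us] m(1) by simp
    also have "\<dots> < \<infinity>" using NZ by (auto simp: ennreal_mult_less_top intro: le_less_trans)
    finally show ?thesis .
  qed
  from ennreal_small_tail[OF this, of "e / 4"] e obtain n where n: "(\<Sum>i. if i < n then 0 else f i) \<le> ennreal (e / 4)" by auto
  \<comment> \<open>Summed over the cover, \<open>2 * \<tau>\<close> per unit of volume amounts to
    at most \<open>e / 4\<close>; \<open>m + 1\<close> avoids division by 0.\<close>
  define \<tau> where "\<tau> = e / (8 * (m + 1))"
  have \<tau>: "\<tau> > 0" "2 * \<tau> * m \<le> e / 4" using e m(2) by (auto simp: \<tau>_def field_simps)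
  \<comment> \<open>Of the \<open>2 * \<tau>\<close> per unit of volume, one \<tau> is for near
    optimality in the cell formula and one for the filling error. Tail cubes are allowed the rough
    bound \<open>f i\<close> in addition.\<close>
  define b where "b i = ennreal (r i ^ ?n) * (W_hom p W (\<xi> i) + ennreal (2 * \<tau>)) + (if i < n then 0 else f i)" for i
  have sb: "(\<Sum>i. b i) \<le> ennreal (h + e)"
  proof -
    have "(\<Sum>i. ennreal (r i ^ ?n) * ennreal (2 * \<tau>)) = ennreal (2 * \<tau> * m)"
      using si[of "\<lambda>_. ennreal (2 * \<tau>)"] m \<tau>(1) by (simp add: nn_integral_cmult_indicator ennreal_mult'[symmetric])
    then have "(\<Sum>i. b i) = (\<Sum>i. ennreal (r i ^ ?n) * W_hom p W (\<xi> i)) + ennreal (2 * \<tau> * m) + (\<Sum>i. if i < n then 0 else f i)"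
      unfolding b_def distrib_left by (subst suminf_add[symmetric], simp, simp)+ simp
    also have "\<dots> \<le> ennreal (h + e / 2) + ennreal (e / 4) + ennreal (e / 4)" using \<tau>(2) by (intro add_mono WZ n ennreal_leI)
    also have "\<dots> = ennreal (h + e)" using h(2) e by (simp add: ennreal_plus[symmetric] del: ennreal_plus)
    finally show ?thesis .
  qed
  let ?cell = "\<lambda>\<epsilon> i. \<exists>w K. Sob0 p (?Q i) w K \<and> energy (Wsc \<epsilon>) (?Q i) (\<lambda>x. \<xi> i + K x) \<le> b i"
  have triv: "?cell \<epsilon> i" if "\<not> r i > 0" for \<epsilon> i
    using Sob0_zero[OF p0(1), of "?Q i"] that by (intro exI[of _ "\<lambda>_. 0"]) (simp add: cube_empty not_less)
  have head: "\<forall>\<^sub>F \<epsilon> in at_right 0. ?cell \<epsilon> i" if i: "i < n" for i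
  proof (cases "r i > 0")
    case True
    have "W_hom p W (\<xi> i) < W_hom p W (\<xi> i) + ennreal \<tau>" using \<tau>(1) le_less_trans[OF W_hom_bound ennreal_less_top, of "\<xi> i"] by simp
    from cell_upper[OF this True, of "\<tau> * r i ^ ?n" "a i"] True \<tau>(1)
    have "\<forall>\<^sub>F \<epsilon> in at_right 0. \<exists>v H. Sob0 p (?Q i) v H \<and> energy (Wsc \<epsilon>) (?Q i) (\<lambda>x. \<xi> i + H x) \<le>
       ennreal (r i ^ ?n) * (W_hom p W (\<xi> i) + ennreal \<tau>) + ennreal (\<tau> * r i ^ ?n) \<and> Np p UNIV v \<le> ennreal (\<tau> * r i ^ ?n)" by simp
    moreover have "ennreal (r i ^ ?n) * (W_hom p W (\<xi> i) + ennreal \<tau>) + ennreal (\<tau> * r i ^ ?n) = b i"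
    proof -
      have "ennreal (2 * \<tau>) = ennreal \<tau> + ennreal \<tau>" using \<tau>(1) by (simp add: ennreal_plus[symmetric] del: ennreal_plus)
      moreover have "ennreal (\<tau> * r i ^ ?n) = ennreal (r i ^ ?n) * ennreal \<tau>" using True \<tau>(1) by (simp add: ennreal_mult'[symmetric] mult.commute)
      ultimately show ?thesis using i by (simp add: b_def distrib_left add.assoc)
    qed
    ultimately show ?thesis by (auto elim!: eventually_mono)
  qed (use triv in simp)
  have tail: "?cell \<epsilon> i" if i: "\<not> i < n" and \<epsilon>: "\<epsilon> > 0" for \<epsilon> i
  proof -
    have "emeasure lebesgue (?Q i) \<le> ennreal (r i ^ ?n)" using emeasure_cube(1)[OF cube_coverD(1)[OF cv], of "a i" i] by simp
    then obtain v' H' where v': "Sob0 p (?Q i) v' H'"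
      "energy (Wsc \<epsilon>) (?Q i) (\<lambda>x. \<xi> i + H' x) \<le> ennreal (C0 * r i ^ ?n * (1 + norm (\<xi> i) powr p))"
      by (rule rough_const[OF \<epsilon> cube_basic(1,3), of "a i" "r i" _ "\<xi> i"]) (use cube_coverD(1)[OF cv] that in auto)
    have "f i \<le> b i" using i by (simp add: b_def)
    then show ?thesis using v' unfolding f_def by (blast intro: order_trans)
  qed
  have "\<forall>\<^sub>F \<epsilon> in at_right 0. \<forall>i\<in>{..<n}. ?cell \<epsilon> i" using head by (intro eventually_ball_finite) auto
  then show ?thesis using eventually_at_right_less[of 0]
  proof eventually_elim
    case (elim \<epsilon>)
    interpret S: integrand "Wsc \<epsilon>" p C "\<epsilon> * s0" c by (rule scaled[OF elim(2)])
    have "\<exists>w K. Sob0 p U w K \<and> (\<forall>y. y \<notin> ?Q i \<longrightarrow> w y = 0 \<and> K y = 0) \<and> Np p UNIV w \<le> ennreal (4 powr p * s powr p) * Np p UNIV K \<and>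
      energy (Wsc \<epsilon>) (?Q i) (\<lambda>x. \<xi> i + K x) \<le> b i" for i
    proof -
      have "?cell \<epsilon> i" using elim tail[of i \<epsilon>] by (cases "i < n") auto
      then obtain w K where w: "Sob0 p (?Q i) w K" "energy (Wsc \<epsilon>) (?Q i) (\<lambda>x. \<xi> i + K x) \<le> b i" by blast
      have "Np p UNIV w \<le> ennreal (4 powr p * s powr p) * Np p UNIV K"
      proof (cases "r i > 0")
        case True
        have "Np p UNIV w \<le> ennreal (4 powr p * r i powr p) * Np p UNIV K" by (rule friedrichs[OF w(1) p True])
        also have "\<dots> \<le> ennreal (4 powr p * s powr p) * Np p UNIV K"
          using cube_coverD(1,2)[OF cv] p0 by (intro mult_right_mono ennreal_leI mult_left_mono powr_mono2) auto
        finally show ?thesis .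
      next
        case False
        then have "w x = 0" for x using Sob0_outside(1)[OF w(1), of x] by (simp add: cube_empty)
        then show ?thesis using Np_zero[OF p0(3), of UNIV] by (simp add: Np_def)
      qed
      then show ?thesis using w Sob0_mono[OF w(1) cube_coverD(4)[OF cv]] Sob0_outside[OF w(1)] by blast
    qed
    note cells = this
    have he: "h + e \<ge> 0" using h e by simp
    obtain V E where V: "Sob0 p U V E" and EV: "energy (Wsc \<epsilon>) U (\<lambda>x. Z x + E x) \<le> ennreal (h + e)"
      and NV: "Np p UNIV V \<le> ennreal (4 powr p * s powr p) * ennreal (2 powr p * ((h + e) / C + z))"
      by (rule S.paste[OF Z(1) cv Z(2) cells sb he NZ z]) (assumption, rule that)
    note [measurable] = Sob0_measurable[OF V]
    define \<psi> where "\<psi> x = (u x + v x) + V x" for x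
    have W\<psi>: "Wk p U \<psi> (\<lambda>x. (G x + H x) + E x)"
      unfolding \<psi>_def by (intro Wk_add[OF Wk_add[OF Wk Sob0_Wk[OF v(1) p] p Us] Sob0_Wk[OF V p] p Us])
    show ?case
    proof (intro exI[of _ \<psi>] conjI)
      show "Lp p U \<psi>" by (rule Np_LpI[OF WkD(1,3)[OF W\<psi>]])
      have "Lp_dist p U \<psi> \<phi> = Np p U (\<lambda>x. v x + V x)"
        unfolding Lp_dist_Np by (auto simp: Np_def \<psi>_def u indicator_def algebra_simps intro!: nn_integral_cong)
      also have "\<dots> \<le> ennreal (2 powr p) * (Np p U v + Np p U V)" using p0 by (intro Np_add) auto
      also have "\<dots> \<le> ennreal (2 powr p) * (ennreal \<eta> + ennreal (4 powr p * s powr p * K))"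
        using v(2) NV unfolding K_def by (intro mult_left_mono add_mono order_trans[OF Np_set_mono[of U UNIV]]) (auto simp: ennreal_mult')
      also have "\<dots> = ennreal (2 powr p * \<eta> + 2 powr p * (4 powr p * s powr p * K))"
        using \<eta>(1) K by (simp add: ennreal_mult'[symmetric] ennreal_plus[symmetric] distrib_left del: ennreal_plus)
      also have "\<dots> \<le> ennreal e" using \<eta>(4) s(2) by (intro ennreal_leI) simp
      finally show "Lp_dist p U \<psi> \<phi> \<le> ennreal e" .
      have "I_eps p U W \<epsilon> \<psi> = energy (Wsc \<epsilon>) U (\<lambda>x. wgrad U \<psi> x)"
        using Wk_W1p(1)[OF W\<psi> U(1) p] by (simp add: I_eps_def)
      also have "\<dots> = energy (Wsc \<epsilon>) U (\<lambda>x. Z x + E x)"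
        using Wk_W1p(2)[OF W\<psi> U(1) p] by (intro nn_integral_cong_AE) (auto simp: indicator_def Z_def elim!: eventually_mono)
      also have "\<dots> \<le> I_hom p U W \<phi> + ennreal e" using EV h e by simp
      finally show "I_eps p U W \<epsilon> \<psi> \<le> I_hom p U W \<phi> + ennreal e" .
    qed
  qed
qed

end

section \<open>From the class of the statement to the theorem\<close>

lemma class_A_per_hom_integrand:
  assumes A: "class_A_per p W" and p: "p \<ge> 1"
  obtains C s0 c where "hom_integrand W p C s0 c"
proof -
  note A' = A[unfolded class_A_per_def class_A_def normal_integrand_def]
  obtain C where C: "C > 0" "\<And>x \<xi>. ennreal C * ennreal (norm \<xi> powr p) \<le> W x \<xi>" using A' by blast
  obtain c where c: "c > 0" "\<And>x \<xi>. ZW W x \<xi> \<le> ennreal (c * (1 + norm \<xi> powr p))" using A' by blast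
  obtain \<omega> :: "real \<Rightarrow> real" where \<omega>: "\<omega> 0 = 0" "continuous (at_right 0) \<omega>"
    "\<And>x1 x2 \<xi>. W x1 \<xi> \<le> ennreal (\<omega> (norm (x1 - x2))) * (1 + W x2 \<xi>) + W x2 \<xi>" using A' by blast
  have "(\<omega> \<longlongrightarrow> 0) (at_right 0)" using \<omega>(1,2) by (simp add: continuous_within)
  then have "\<forall>\<^sub>F t in at_right 0. \<omega> t < 1" by (intro order_tendstoD) auto
  then obtain b where b: "b > 0" "\<And>t. 0 < t \<Longrightarrow> t < b \<Longrightarrow> \<omega> t < 1" unfolding eventually_at_right_field by auto
  have "hom_integrand W p C (b / 2) c"
  proof
    \<comment> \<open>The modulus is below 1 only on the open interval from 0 to \<open>b\<close>,
      so the closed condition uses \<open>b / 2\<close>; equal points are covered by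
      \<open>\<omega> 0 = 0\<close>.\<close>
    show "W x1 \<xi> \<le> 1 + 2 * W x2 \<xi>" if "norm (x1 - x2) \<le> b / 2" for x1 x2 \<xi>
    proof -
      have "\<omega> (norm (x1 - x2)) \<le> 1" using b(2)[of "norm (x1 - x2)"] b(1) that \<omega>(1) by (cases "x1 = x2") auto
      then have "ennreal (\<omega> (norm (x1 - x2))) * (1 + W x2 \<xi>) \<le> 1 * (1 + W x2 \<xi>)" by (intro mult_right_mono) (auto simp: ennreal_le_1)
      then show ?thesis using \<omega>(3)[of x1 \<xi> x2] by (auto simp: mult_2 add.assoc[symmetric] intro: order_trans add_right_mono)
    qed
  qed (use A' p b(1) C c in auto)
  then show thesis by (rule that)
qed

theorem theorem3p4:
  fixes \<Omega> :: "(real^'n) set" and W :: "real^'n \<Rightarrow> real^'n^'m \<Rightarrow> ennreal" and p :: real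
  assumes "p \<ge> 1"
    and "bounded \<Omega>" and "open \<Omega>" and "emeasure lebesgue (frontier \<Omega>) = 0"
    and "class_A_per p W"
  shows "Gamma_conv_Lp p \<Omega> (\<lambda>\<epsilon>. I_eps p \<Omega> W \<epsilon>) (I_hom p \<Omega> W)"
proof -
  obtain C s0 c where "hom_integrand W p C s0 c" by (rule class_A_per_hom_integrand[OF assms(5,1)])
  then interpret hom_integrand W p C s0 c .
  show ?thesis
    unfolding Gamma_conv_Lp_def Let_def
  proof (intro allI impI)
    fix \<phi> :: "real^'n \<Rightarrow> real^'m" assume \<phi>: "W1p p \<Omega> \<phi>"
    let ?R = "{\<phi>s :: real \<Rightarrow> real^'n \<Rightarrow> real^'m. (\<forall>\<epsilon>>0. Lp p \<Omega> (\<phi>s \<epsilon>)) \<and> ((\<lambda>\<epsilon>. Lp_dist p \<Omega> (\<phi>s \<epsilon>) \<phi>) \<longlongrightarrow> 0) (at_right 0)}"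
    let ?li = "INF \<phi>s\<in>?R. Liminf (at_right 0) (\<lambda>\<epsilon>. I_eps p \<Omega> W \<epsilon> (\<phi>s \<epsilon>))"
    let ?ls = "INF \<phi>s\<in>?R. Limsup (at_right 0) (\<lambda>\<epsilon>. I_eps p \<Omega> W \<epsilon> (\<phi>s \<epsilon>))"
    have "I_hom p \<Omega> W \<phi> \<le> ?li" using liminf_inequality[OF assms(3,2) \<phi>] by (intro INF_greatest) auto
    moreover have "?li \<le> ?ls" by (intro INF_mono') (simp add: Liminf_le_Limsup)
    moreover have "?ls \<le> I_hom p \<Omega> W \<phi>"
    proof -
      have "I_hom p \<Omega> W \<phi> = (\<integral>\<^sup>+x\<in>\<Omega>. W_hom p W (indicator \<Omega> x *\<^sub>R wgrad \<Omega> \<phi> x) \<partial>lebesgue)"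
        unfolding I_hom_def by (intro nn_integral_cong) (auto simp: indicator_def)
      \<comment> \<open>Finiteness of the limit energy is needed because the diagonal choice
        measures the excess over it.\<close>
      then have "I_hom p \<Omega> W \<phi> < \<infinity>" using W_hom_integral_finite[OF W1p_Wk[OF \<phi> assms(3,1)] assms(3,2)] by simp
      moreover have "Lp p \<Omega> \<phi>" using \<phi> by (simp add: W1p_def)
      ultimately obtain \<phi>s where "\<And>\<epsilon>. \<epsilon> > 0 \<Longrightarrow> Lp p \<Omega> (\<phi>s \<epsilon>)" "((\<lambda>\<epsilon>. Lp_dist p \<Omega> (\<phi>s \<epsilon>) \<phi>) \<longlongrightarrow> 0) (at_right 0)"
        "Limsup (at_right 0) (\<lambda>\<epsilon>. I_eps p \<Omega> W \<epsilon> (\<phi>s \<epsilon>)) \<le> I_hom p \<Omega> W \<phi>"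
        using ex_diagonal_family[of "Lp p \<Omega>" \<phi> "I_hom p \<Omega> W \<phi>" "\<lambda>\<psi>. Lp_dist p \<Omega> \<psi> \<phi>" "I_eps p \<Omega> W", OF _ _ recovery[OF assms(3,2) \<phi>]] by blast
      then show ?thesis by (intro INF_lower2[of \<phi>s]) auto
    qed
    ultimately show "?li = I_hom p \<Omega> W \<phi> \<and> ?ls = I_hom p \<Omega> W \<phi>" by (auto intro: antisym order_trans)
  qed
qed

end
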